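(* For every $a\in\mathbb{C}$ with $a^2\neq 4$, the singularity $f_0^a:(\mathbb{C}^2,0)\to(\mathbb{C},0)$, $f_0^a(x,y)=x^4+y^4+ax^2y^2$, satisfies $\lambda(f_0^a)=2$. Moreover, for every singularity $f$ of type $X_9$ one has $\lambda(f)=2$.
   Context: A germ $f_0:(\mathbb{C}^n,0)\to(\mathbb{C},0)$ of a holomorphic function is an (isolated) singularity if it has an isolated critical point at $0$, i.e. some holomorphic representative on an open neighbourhood $U$ of $0$ satisfies $f_0(0)=0$, $\nabla f_0(0)=0$ and $\nabla f_0(z)\neq 0$ for $z\in U\setminus\{0\}$. Let $\mathcal{O}^n$ be the ring of germs at $0$ of holomorphic functions on $\mathbb{C}^n$. The Milnor number of a germ $g$ is $\mu(g)=\dim_{\mathbb{C}}\mathcal{O}^n/(\nabla g)$, where $(\nabla g)$ is the ideal generated by $\partial g/\partial z_1,\dots,\partial g/\partial z_n$ (so $\mu(g)=0$ if $\nabla g(0)\neq 0$). A deformation of a singularity $f_0$ is the germ of a holomorphic function $f=f(s,z):(\mathbb{C}\times\mathbb{C}^n,0)\to(\mathbb{C},0)$ such that: (1) $f(0,z)=f_0(z)$; (2) $f(s,0)=0$; (3) for each sufficiently small $|s|$, $\nabla_z f(s,z)\neq 0$ for $z\neq 0$ in a small neighbourhood of $0\in\mathbb{C}^n$. Write $f_s(z)=f(s,z)$; germs $f_s$ with $\nabla f_s(0)\ne 0$ are allowed. By upper semicontinuity, $\mu(f_s)$ is constant for all sufficiently small $s\neq 0$ and is at most $\mu(f_0)$.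 The jump of the deformation is $\lambda((f_s)):=\mu(f_0)-\mu(f_s)$ for small $s\neq0$. The jump of the Milnor number of $f_0$, denoted $\lambda(f_0)$, is the smallest nonzero value among the jumps of all deformations of $f_0$. Two germs $f:(\mathbb{C}^n,0)\to(\mathbb{C},0)$ and $g:(\mathbb{C}^m,0)\to(\mathbb{C},0)$ are stably equivalent if there exist $p\geq\max(m,n)$ and a biholomorphism $\Phi:(\mathbb{C}^p,0)\to(\mathbb{C}^p,0)$ with $\widetilde f\circ\Phi=\widetilde g$, where $\widetilde f=f(z_1,\dots,z_n)+z_{n+1}^2+\dots+z_p^2$ and $\widetilde g=g(w_1,\dots,w_m)+w_{m+1}^2+\dots+w_p^2$. A singularity (in any number of variables) is of type $X_9$ if it is stably equivalent to $x^4+y^4+ax^2y^2$ for some $a\in\mathbb{C}$ with $a^2\neq 4$. *)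

theory Defs
  imports "HOL-Analysis.Analysis" "HOL-Algebra.QuotRing" "HOL-Algebra.Embedded_Algebras" "HOL-Library.Extended_Nat"
begin

text \<open>
  All dimensions occur as terms, because stable equivalence quantifies over them. Thus \<open>\<complex>\<^sup>n\<close> is
  the set of complex sequences supported on the indices \<open>0, \<dots>, n - 1\<close>; the product topology
  induces the usual topology on it. A germ on \<open>\<complex>\<^sup>n\<close> is represented by a function on sequences, of
  which only the values at points of \<open>\<complex>\<^sup>n\<close> near the origin matter.
\<close>

type_synonym cvec = "nat \<Rightarrow> complex"

definition Cn :: "nat \<Rightarrow> cvec set" where
  "Cn n = {z. \<forall>i\<ge>n. z i = 0}"

abbreviation origin :: cvec where
  "origin \<equiv> (\<lambda>_. 0)"

definition near_origin :: "nat \<Rightarrow> cvec filter" where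
  "near_origin n = inf (nhds origin) (principal (Cn n))"


subsection \<open>Holomorphic functions of several variables\<close>

text \<open>Holomorphic on an open subset of \<open>\<complex>\<^sup>n\<close>: continuous and holomorphic in each variable.\<close>

definition holomorphic_Cn :: "nat \<Rightarrow> (cvec \<Rightarrow> complex) \<Rightarrow> cvec set \<Rightarrow> bool" where
  "holomorphic_Cn n f U \<longleftrightarrow> openin (top_of_set (Cn n)) U \<and> continuous_on U f \<and>
     (\<forall>z\<in>U. \<forall>i<n. (\<lambda>w. f (z(i := w))) field_differentiable (at (z i)))"

definition holomorphic_germ :: "nat \<Rightarrow> (cvec \<Rightarrow> complex) \<Rightarrow> bool" where
  "holomorphic_germ n f \<longleftrightarrow> (\<exists>U. origin \<in> U \<and> holomorphic_Cn n f U)"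

definition partial_deriv :: "nat \<Rightarrow> (cvec \<Rightarrow> complex) \<Rightarrow> cvec \<Rightarrow> complex" where
  "partial_deriv i f z = deriv (\<lambda>w. f (z(i := w))) (z i)"

definition grad_zero :: "nat \<Rightarrow> (cvec \<Rightarrow> complex) \<Rightarrow> cvec \<Rightarrow> bool" where
  "grad_zero n f z \<longleftrightarrow> (\<forall>i<n. partial_deriv i f z = 0)"

definition isolated_singularity :: "nat \<Rightarrow> (cvec \<Rightarrow> complex) \<Rightarrow> bool" where
  "isolated_singularity n f \<longleftrightarrow> holomorphic_germ n f \<and> f origin = 0 \<and> grad_zero n f origin \<and>
     (\<forall>\<^sub>F z in near_origin n. z \<noteq> origin \<longrightarrow> \<not> grad_zero n f z)"


subsection \<open>The ring of germs and the Milnor number\<close>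

text \<open>
  \<open>\<O>\<^sup>n\<close> is the ring of functions that are holomorphic near the origin, modulo the ideal of those
  that vanish near the origin.
\<close>

definition hol_fun_ring :: "nat \<Rightarrow> (cvec \<Rightarrow> complex) ring" where
  "hol_fun_ring n =
     \<lparr>carrier = {f. holomorphic_germ n f},
      mult = (\<lambda>f g z. f z * g z), one = (\<lambda>_. 1),
      zero = (\<lambda>_. 0), add = (\<lambda>f g z. f z + g z)\<rparr>"

definition null_germs :: "nat \<Rightarrow> (cvec \<Rightarrow> complex) set" where
  "null_germs n = {f. holomorphic_germ n f \<and> (\<forall>\<^sub>F z in near_origin n. f z = 0)}"

definition germ_ring :: "nat \<Rightarrow> (cvec \<Rightarrow> complex) set ring" where
  "germ_ring n = hol_fun_ring n Quot null_germs n"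

definition germ :: "nat \<Rightarrow> (cvec \<Rightarrow> complex) \<Rightarrow> (cvec \<Rightarrow> complex) set" where
  "germ n f = null_germs n +>\<^bsub>hol_fun_ring n\<^esub> f"

definition jacobian_ideal :: "nat \<Rightarrow> (cvec \<Rightarrow> complex) \<Rightarrow> (cvec \<Rightarrow> complex) set set" where
  "jacobian_ideal n g = Idl\<^bsub>germ_ring n\<^esub> {germ n (partial_deriv i g) | i. i < n}"

definition milnor_algebra :: "nat \<Rightarrow> (cvec \<Rightarrow> complex) \<Rightarrow> (cvec \<Rightarrow> complex) set set ring" where
  "milnor_algebra n g = germ_ring n Quot jacobian_ideal n g"

text \<open>The copy of the scalar field \<open>\<complex>\<close> inside the Milnor algebra.\<close>

definition milnor_scalars :: "nat \<Rightarrow> (cvec \<Rightarrow> complex) \<Rightarrow> (cvec \<Rightarrow> complex) set set set" where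
  "milnor_scalars n g = range (\<lambda>c. jacobian_ideal n g +>\<^bsub>germ_ring n\<^esub> germ n (\<lambda>_. c))"

text \<open>
  If the gradient of \<open>g\<close> does not vanish at the origin, the Milnor algebra is the zero ring and its
  scalars are not a subfield, but the dimension of \<open>{\<zero>}\<close> is still 0.
\<close>

definition milnor_number :: "nat \<Rightarrow> (cvec \<Rightarrow> complex) \<Rightarrow> enat" where
  "milnor_number n g =
     (let A = milnor_algebra n g; K = milnor_scalars n g
      in if ring.finite_dimension A K (carrier A)
         then enat (ring.dim A K (carrier A)) else \<infinity>)"


subsection \<open>Deformations and the jump of the Milnor number\<close>

text \<open>
  \<open>F s z\<close> is holomorphic as a function of the \<open>n + 1\<close> variables \<open>(s, z)\<close>. The neighbourhood of the
  origin on which the gradient of \<open>F s\<close> does not vanish may depend on \<open>s\<close>.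
\<close>

definition deformation :: "nat \<Rightarrow> (cvec \<Rightarrow> complex) \<Rightarrow> (complex \<Rightarrow> cvec \<Rightarrow> complex) \<Rightarrow> bool" where
  "deformation n f0 F \<longleftrightarrow>
     holomorphic_germ (Suc n) (\<lambda>w. F (w 0) (\<lambda>i. w (Suc i))) \<and>
     (\<forall>\<^sub>F z in near_origin n. F 0 z = f0 z) \<and>
     (\<forall>\<^sub>F s in nhds 0. F s origin = 0) \<and>
     (\<forall>\<^sub>F s in nhds 0. \<forall>\<^sub>F z in near_origin n. z \<noteq> origin \<longrightarrow> \<not> grad_zero n (F s) z)"

text \<open>
  \<open>k\<close> is the jump of the deformation: \<open>\<mu>(f\<^sub>0) - \<mu>(f\<^sub>s) = k\<close> for all small \<open>s \<noteq> 0\<close>. It is written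
  additively because subtraction on \<^typ>\<open>enat\<close> truncates.
\<close>

definition has_jump ::
    "nat \<Rightarrow> (cvec \<Rightarrow> complex) \<Rightarrow> (complex \<Rightarrow> cvec \<Rightarrow> complex) \<Rightarrow> nat \<Rightarrow> bool" where
  "has_jump n f0 F k \<longleftrightarrow>
     (\<forall>\<^sub>F s in at 0. milnor_number n (F s) + enat k = milnor_number n f0)"

text \<open>With values in \<^typ>\<open>enat\<close>, a nonempty infimum is a minimum and the empty infimum is \<open>\<infinity>\<close>.\<close>

definition milnor_jump :: "nat \<Rightarrow> (cvec \<Rightarrow> complex) \<Rightarrow> enat" where
  "milnor_jump n f0 = Inf {enat k | k. k \<noteq> 0 \<and> (\<exists>F. deformation n f0 F \<and> has_jump n f0 F k)}"


subsection \<open>Stable equivalence and the class \<open>X\<^sub>9\<close>\<close>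

definition holomorphic_self_germ :: "nat \<Rightarrow> (cvec \<Rightarrow> cvec) \<Rightarrow> bool" where
  "holomorphic_self_germ p \<Phi> \<longleftrightarrow> \<Phi> origin = origin \<and>
     (\<forall>\<^sub>F z in near_origin p. \<Phi> z \<in> Cn p) \<and> (\<forall>i<p. holomorphic_germ p (\<lambda>z. \<Phi> z i))"

definition biholomorphic_germ :: "nat \<Rightarrow> (cvec \<Rightarrow> cvec) \<Rightarrow> bool" where
  "biholomorphic_germ p \<Phi> \<longleftrightarrow> holomorphic_self_germ p \<Phi> \<and>
     (\<exists>\<Psi>. holomorphic_self_germ p \<Psi> \<and>
          (\<forall>\<^sub>F z in near_origin p. \<Psi> (\<Phi> z) = z) \<and> (\<forall>\<^sub>F z in near_origin p. \<Phi> (\<Psi> z) = z))"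

definition add_squares :: "nat \<Rightarrow> nat \<Rightarrow> (cvec \<Rightarrow> complex) \<Rightarrow> cvec \<Rightarrow> complex" where
  "add_squares n p f z = f (\<lambda>i. if i < n then z i else 0) + (\<Sum>i\<in>{n..<p}. (z i)\<^sup>2)"

definition stably_equivalent ::
    "nat \<Rightarrow> (cvec \<Rightarrow> complex) \<Rightarrow> nat \<Rightarrow> (cvec \<Rightarrow> complex) \<Rightarrow> bool" where
  "stably_equivalent n f m g \<longleftrightarrow>
     (\<exists>p \<Phi>. max m n \<le> p \<and> biholomorphic_germ p \<Phi> \<and>
        (\<forall>\<^sub>F z in near_origin p. add_squares n p f (\<Phi> z) = add_squares m p g z))"

definition X9_poly :: "complex \<Rightarrow> cvec \<Rightarrow> complex" where
  "X9_poly a z = z 0 ^ 4 + z 1 ^ 4 + a * (z 0)\<^sup>2 * (z 1)\<^sup>2"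

definition type_X9 :: "nat \<Rightarrow> (cvec \<Rightarrow> complex) \<Rightarrow> bool" where
  "type_X9 n f \<longleftrightarrow> isolated_singularity n f \<and>
     (\<exists>a. a\<^sup>2 \<noteq> 4 \<and> stably_equivalent n f 2 (X9_poly a))"

end

theory Submission
  imports Defs "HOL-Complex_Analysis.Complex_Analysis" "HOL-Library.Function_Algebras"
    "HOL-Computational_Algebra.Fundamental_Theorem_Algebra"
begin

text \<open>
  A linear change of coordinates turns \<open>x\<^sup>4 + y\<^sup>4 + a x\<^sup>2 y\<^sup>2\<close> into a quartic form divisible by \<open>x\<close> but not
  by \<open>x\<^sup>2\<close>. Adding \<open>s x\<^sup>3\<close> gives a singularity of type \<open>E\<^sub>7\<close>, so the Milnor number drops from 9 to 7.

  Conversely, suppose that a deformation has Milnor number 8 for all small \<open>s \<noteq> 0\<close>. The squares of a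
  stable equivalence are split off with parameter \<open>s\<close>, which leaves a family \<open>g\<^sub>s(x, y)\<close> with a critical
  point at the origin and \<open>g\<^sub>0 = x\<^sup>4 + y\<^sup>4 + a x\<^sup>2 y\<^sup>2\<close>. Rescale \<open>g\<^sub>s\<close> to \<open>g\<^sub>s(\<mu> x, \<mu> y) / \<mu>\<^sup>4\<close> with \<open>\<mu> \<rightarrow> 0\<close>
  chosen so that the terms of degree 2 and 3 stay bounded and do not all tend to 0. A subsequence
  converges to a polynomial \<open>Q\<close> with quartic part \<open>g\<^sub>0\<close> and some term of degree 2 or 3. Milnor number 8 means
  that for any seven monomials there is a nonzero functional on the local algebra that kills them, and
  after normalisation such functionals pass to the limit. Hence it suffices to find, for every \<open>Q\<close>, seven
  monomials and coordinates for which no such functional exists. The critical case is a quadratic part of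
  rank one: there the functional forces the quartic part of \<open>Q\<close> to be a square, which \<open>a\<^sup>2 \<noteq> 4\<close> excludes.
\<close>

text \<open>Letting s tend to 0 without rescaling yields only \<open>X9_poly a\<close>, whose
  algebra of dimension 9 carries functionals that kill any seven monomials. The rescaling makes a
  term of degree 2 or 3 survive, and with such a term the Milnor number at the origin is at most 7;
  seven is also the largest number of linear conditions that must leave a nonzero functional on an
  algebra of dimension 8. Functionals make the limit controllable: Milnor number 8 puts the eighth
  powers of both variables into the Jacobian ideal, so a functional is an array of 64 numbers, and
  arrays of norm 1 form a compact set.

  For the jump 2 the obstacle is stable equivalence. The variable x lives on the stabilised space,
  but a deformation may use only the n variables of the given germ. The inverse coordinate change
  supplies x as a function on the larger space; restricting it to the given variables alters it by
  an element of the Jacobian ideal. The computation for E7 is therefore made for a class of germs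
  that is closed under this ambiguity and under splitting off squares.\<close>

definition polydisc :: "nat \<Rightarrow> real \<Rightarrow> cvec set" where
  "polydisc n r = {z \<in> Cn n. \<forall>i<n. cmod (z i) < r}"

abbreviation hol :: "nat \<Rightarrow> real \<Rightarrow> (cvec \<Rightarrow> complex) \<Rightarrow> bool" where
  "hol n r f \<equiv> holomorphic_Cn n f (polydisc n r)"

lemma origin_Cn [simp]: "origin \<in> Cn n"
  by (simp add: Cn_def)

lemma origin_polydisc [simp]: "0 < r \<Longrightarrow> origin \<in> polydisc n r"
  by (simp add: polydisc_def)

lemma polydisc_mono: "s \<le> r \<Longrightarrow> polydisc n s \<subseteq> polydisc n r"
  by (force simp: polydisc_def)

lemma polydisc_Cn: "z \<in> polydisc n r \<Longrightarrow> z \<in> Cn n"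
  by (simp add: polydisc_def)

lemma upd_Cn: "z \<in> Cn n \<Longrightarrow> i < n \<Longrightarrow> z(i := w) \<in> Cn n"
  by (simp add: Cn_def)

lemma polydisc_upd: "z \<in> polydisc n r \<Longrightarrow> i < n \<Longrightarrow> cmod w < r \<Longrightarrow> z(i := w) \<in> polydisc n r"
  by (auto simp: polydisc_def upd_Cn)

lemma polydisc_cmod: "z \<in> polydisc n r \<Longrightarrow> 0 < r \<Longrightarrow> cmod (z i) < r"
  by (cases "i < n") (auto simp: polydisc_def Cn_def)

lemma polydisc_shrink:
  assumes "z \<in> polydisc n r" "0 < r"
  obtains s where "0 < s" "s < r" "z \<in> polydisc n s"
proof -
  define m where "m = Max (insert 0 ((\<lambda>i. cmod (z i)) ` {..<n}))"
  have "m < r" unfolding m_def using assms by (subst Max_less_iff) (auto simp: polydisc_def)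
  have "0 \<le> m" unfolding m_def by (intro Max_ge) auto
  have "cmod (z i) \<le> m" if "i < n" for i
    unfolding m_def using that by (intro Max_ge) auto
  with \<open>m < r\<close> \<open>0 \<le> m\<close> show ?thesis
    using assms by (intro that[of "(m + r) / 2"]) (force simp: polydisc_def)+
qed

lemma continuous_on_coord: "continuous_on S g \<Longrightarrow> continuous_on S (\<lambda>x. g x i)"
  for g :: "'a::topological_space \<Rightarrow> 'b \<Rightarrow> 'c::topological_space"
  by (rule continuous_on_product_then_coordinatewise)

lemma continuous_on_coords [continuous_intros]:
  "continuous_on S (\<lambda>x::cvec. x i)" "continuous_on T (\<lambda>x::cvec \<times> 'a::topological_space. fst x i)"
proof -
  show "continuous_on S (\<lambda>x::cvec. x i)"
    by (rule continuous_on_product_then_coordinatewise[OF continuous_on_id])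
  show "continuous_on T (\<lambda>x::cvec \<times> 'a. fst x i)"
    by (rule continuous_on_product_then_coordinatewise[OF continuous_on_fst[OF continuous_on_id]])
qed

lemma continuous_on_upd [continuous_intros]:
  fixes g :: "'a::topological_space \<Rightarrow> 'b \<Rightarrow> 'c::topological_space"
  assumes "continuous_on S g" "continuous_on S c"
  shows "continuous_on S (\<lambda>x. (g x)(i := c x))"
proof (rule continuous_on_coordinatewise_then_product)
  fix j show "continuous_on S (\<lambda>x. ((g x)(i := c x)) j)"
    using assms by (cases "j = i") (auto intro: continuous_on_coord)
qed

lemma continuous_on_upd_coord [continuous_intros]:
  fixes g :: "'a::topological_space \<Rightarrow> 'b \<Rightarrow> 'c::topological_space"
  assumes "continuous_on S (\<lambda>x. g x j)" "continuous_on S c"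
  shows "continuous_on S (\<lambda>x. ((g x)(i := c x)) j)"
  using assms by (cases "j = i") auto

lemma openin_polydisc: "openin (top_of_set (Cn n)) (polydisc n r)"
proof -
  have "open {z::cvec. cmod (z i) < r}" for i
    by (intro open_Collect_less continuous_intros)
  hence "open (\<Inter>i\<in>{..<n}. {z::cvec. cmod (z i) < r})"
    by (intro open_INT) auto
  moreover have "polydisc n r = Cn n \<inter> (\<Inter>i\<in>{..<n}. {z::cvec. cmod (z i) < r})"
    by (auto simp: polydisc_def)
  ultimately show ?thesis by (metis openin_open)
qed

lemma openin_polydisc_openin: "s \<le> r \<Longrightarrow> openin (top_of_set (polydisc n r)) (polydisc n s)"
  by (rule openin_subset_trans[OF openin_polydisc]) (auto simp: polydisc_mono polydisc_Cn)

text \<open>A basic open set restricts finitely many coordinates, and some of these may lie beyond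
  \<open>n\<close>. On \<open>Cn n\<close> such coordinates vanish, so the smallest of the first
  \<open>n\<close> radii suffices; the inserted 1 keeps the minimum defined for
  \<open>n = 0\<close>.\<close>

lemma openin_Cn_contains_polydisc:
  assumes "openin (top_of_set (Cn n)) U" "origin \<in> U"
  obtains r where "0 < r" "polydisc n r \<subseteq> U"
proof -
  obtain T where T: "open T" "U = Cn n \<inter> T" using assms(1) by (auto simp: openin_open)
  have "openin (product_topology (\<lambda>i. euclidean::complex topology) UNIV) T"
    using T(1) by (simp add: euclidean_product_topology)
  from product_topology_open_contains_basis[OF this, of origin] assms T(2)
  obtain X where X: "origin \<in> (\<Pi>\<^sub>E i\<in>UNIV. X i)" "\<And>i. open (X i)" "(\<Pi>\<^sub>E i\<in>UNIV. X i) \<subseteq> T"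
    by auto
  have "\<exists>e>0. ball 0 e \<subseteq> X i" for i
    using X(1,2) by (metis PiE_E UNIV_I open_contains_ball)
  then obtain e where e: "\<And>i. e i > 0" "\<And>i. ball 0 (e i) \<subseteq> X i" by metis
  define r where "r = Min (insert 1 (e ` {..<n}))"
  have r: "r > 0" unfolding r_def using e by (subst Min_gr_iff) auto
  have re: "r \<le> e i" if "i < n" for i unfolding r_def using that by (intro Min_le) auto
  show ?thesis
  proof (rule that[OF r])
    show "polydisc n r \<subseteq> U"
    proof
      fix z assume z: "z \<in> polydisc n r"
      have "z i \<in> X i" for i
      proof (cases "i < n")
        case True
        hence "cmod (z i) < e i" using z re[of i] by (auto simp: polydisc_def intro: less_le_trans)
        thus ?thesis using e(2)[of i] by (auto simp: subset_iff)
      next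
        case False
        hence "z i = 0" using z by (auto simp: polydisc_def Cn_def)
        thus ?thesis using X(1) by (simp add: PiE_iff)
      qed
      thus "z \<in> U" using X(3) T(2) z polydisc_Cn by (auto simp: PiE_iff)
    qed
  qed
qed

section \<open>Germs at the origin and holomorphy on polydiscs\<close>

lemma eventually_near_origin:
  "eventually P (near_origin n) \<longleftrightarrow> (\<exists>r>0. \<forall>z\<in>polydisc n r. P z)"
proof
  assume "eventually P (near_origin n)"
  then obtain S where S: "open S" "origin \<in> S" "\<forall>z\<in>S. z \<in> Cn n \<longrightarrow> P z"
    unfolding near_origin_def eventually_inf_principal eventually_nhds by auto
  obtain r where "0 < r" "polydisc n r \<subseteq> Cn n \<inter> S"
    using openin_Cn_contains_polydisc[of n "Cn n \<inter> S"] S by (auto simp: openin_open_Int)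
  thus "\<exists>r>0. \<forall>z\<in>polydisc n r. P z" using S(3) by blast
next
  assume "\<exists>r>0. \<forall>z\<in>polydisc n r. P z"
  then obtain r where r: "0 < r" "\<forall>z\<in>polydisc n r. P z" by blast
  obtain T where "open T" "polydisc n r = Cn n \<inter> T"
    using openin_polydisc[of n r] by (auto simp: openin_open)
  thus "eventually P (near_origin n)"
    unfolding near_origin_def eventually_inf_principal eventually_nhds
    using r origin_polydisc[of r n] by blast
qed

text \<open>The definition asks for differentiability in each variable at the point itself. In a
  polydisc a coordinate may be moved through the whole disc, so each slice is holomorphic there and
  the theory of one variable applies to it.\<close>

lemma hol_iff:
  "hol n r f \<longleftrightarrow> continuous_on (polydisc n r) f \<and>
     (\<forall>z\<in>polydisc n r. \<forall>i<n. (\<lambda>w. f (z(i := w))) holomorphic_on ball 0 r)"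
proof
  assume L: "hol n r f"
  have "(\<lambda>w. f (z(i := w))) field_differentiable at w"
    if "z \<in> polydisc n r" "i < n" "w \<in> ball 0 r" for z i w
  proof -
    have "z(i := w) \<in> polydisc n r" using that polydisc_upd by auto
    hence "(\<lambda>u. f ((z(i := w))(i := u))) field_differentiable at ((z(i := w)) i)"
      using L that unfolding holomorphic_Cn_def by blast
    thus ?thesis by simp
  qed
  thus "continuous_on (polydisc n r) f \<and>
     (\<forall>z\<in>polydisc n r. \<forall>i<n. (\<lambda>w. f (z(i := w))) holomorphic_on ball 0 r)"
    using L by (auto simp: holomorphic_Cn_def holomorphic_on_def intro: field_differentiable_at_within)
next
  assume R: "continuous_on (polydisc n r) f \<and>
     (\<forall>z\<in>polydisc n r. \<forall>i<n. (\<lambda>w. f (z(i := w))) holomorphic_on ball 0 r)"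
  have "(\<lambda>w. f (z(i := w))) field_differentiable at (z i)" if "z \<in> polydisc n r" "i < n" for z i
  proof -
    have "z i \<in> ball 0 r" using that by (auto simp: polydisc_def)
    thus ?thesis using R that holomorphic_on_imp_differentiable_at[OF _ open_ball] by blast
  qed
  thus "hol n r f" using R by (auto simp: holomorphic_Cn_def openin_polydisc)
qed

lemma hol_mono: "hol n r f \<Longrightarrow> s \<le> r \<Longrightarrow> hol n s f"
  using polydisc_mono[of s r n] openin_polydisc[of n s] unfolding holomorphic_Cn_def
  by (blast intro: continuous_on_subset)

lemma hol_cong:
  assumes "\<And>z. z \<in> polydisc n r \<Longrightarrow> f z = g z"
  shows "hol n r f \<longleftrightarrow> hol n r g"
proof -
  have "(\<lambda>w. f (z(i := w))) holomorphic_on ball 0 r \<longleftrightarrow> (\<lambda>w. g (z(i := w))) holomorphic_on ball 0 r"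
    if "z \<in> polydisc n r" "i < n" for z i
    using that assms by (intro holomorphic_cong refl) (simp add: polydisc_upd)
  moreover have "continuous_on (polydisc n r) f \<longleftrightarrow> continuous_on (polydisc n r) g"
    using assms by (intro continuous_on_cong refl) auto
  ultimately show ?thesis unfolding hol_iff by blast
qed

lemma holomorphic_germ_iff: "holomorphic_germ n f \<longleftrightarrow> (\<exists>r>0. hol n r f)"
proof
  assume "holomorphic_germ n f"
  then obtain U where U: "origin \<in> U" "holomorphic_Cn n f U" by (auto simp: holomorphic_germ_def)
  then obtain r where "0 < r" "polydisc n r \<subseteq> U"
    using openin_Cn_contains_polydisc[of n U] by (auto simp: holomorphic_Cn_def)
  moreover from this have "hol n r f" using U openin_polydisc unfolding holomorphic_Cn_def
    by (blast intro: continuous_on_subset)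
  ultimately show "\<exists>r>0. hol n r f" by blast
qed (use origin_polydisc in \<open>unfold holomorphic_germ_def, blast\<close>)

lemma hol_continuous: "hol n r f \<Longrightarrow> continuous_on (polydisc n r) f"
  by (simp add: hol_iff)

lemma hol_slice: "hol n r f \<Longrightarrow> z \<in> polydisc n r \<Longrightarrow> i < n \<Longrightarrow> (\<lambda>w. f (z(i := w))) holomorphic_on ball 0 r"
  by (simp add: hol_iff)

lemma hol_const: "hol n r (\<lambda>_. c)"
  by (auto simp: hol_iff)

lemma hol_coord: "hol n r (\<lambda>z. z i)"
proof -
  have "(\<lambda>w. (z(j := w)) i) holomorphic_on ball 0 r" for z :: cvec and j
    by (cases "i = j") (auto intro!: holomorphic_intros)
  thus ?thesis by (auto simp: hol_iff intro!: continuous_intros)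
qed

lemma hol_add: "hol n r f \<Longrightarrow> hol n r g \<Longrightarrow> hol n r (\<lambda>z. f z + g z)"
  and hol_diff: "hol n r f \<Longrightarrow> hol n r g \<Longrightarrow> hol n r (\<lambda>z. f z - g z)"
  and hol_mult: "hol n r f \<Longrightarrow> hol n r g \<Longrightarrow> hol n r (\<lambda>z. f z * g z)"
  unfolding hol_iff by (simp_all add: continuous_on_add continuous_on_diff continuous_on_mult
      holomorphic_on_add holomorphic_on_diff holomorphic_on_mult)

lemma hol_inverse:
  assumes "hol n r f" "\<And>z. z \<in> polydisc n r \<Longrightarrow> f z \<noteq> 0"
  shows "hol n r (\<lambda>z. inverse (f z))"
  using assms(1) unfolding hol_iff
  by (auto intro!: continuous_on_inverse holomorphic_on_inverse simp: assms(2) polydisc_upd)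

subsection \<open>Partial derivatives\<close>

lemma hol_has_partial:
  assumes "hol n r f" "z \<in> polydisc n r" "i < n" "cmod w < r"
  shows "((\<lambda>w. f (z(i := w))) has_field_derivative partial_deriv i f (z(i := w))) (at w)"
  using holomorphic_derivI[OF hol_slice[OF assms(1-3)] open_ball, of w] assms(4)
  by (simp add: partial_deriv_def)

text \<open>The circle of radius \<open>\<rho>\<close> traversed over the unit interval: contour
  integrals become integrals over a fixed compact interval, ready for theorems on parameter
  integrals.\<close>

definition circ :: "real \<Rightarrow> real \<Rightarrow> complex" where
  "circ \<rho> t = of_real \<rho> * exp (2 * of_real pi * \<i> * of_real t)"

lemma cmod_circ: "0 \<le> \<rho> \<Longrightarrow> cmod (circ \<rho> t) = \<rho>"
  by (simp add: circ_def norm_mult)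

lemma continuous_on_circ [continuous_intros]:
  "continuous_on S f \<Longrightarrow> continuous_on S (\<lambda>x. circ \<rho> (f x))"
  unfolding circ_def by (intro continuous_intros)

text \<open>Cauchy's formula for the derivative. One radius \<open>\<rho>\<close> between
  \<open>s\<close> and \<open>r\<close> serves all points of the smaller polydisc, so the integrand
  is jointly continuous in \<open>z\<close> and \<open>t\<close>.\<close>

lemma partial_deriv_cauchy:
  assumes f: "hol n r f" and i: "i < n" and z: "z \<in> polydisc n s" and s: "0 < s" "s < \<rho>" "\<rho> < r"
  shows "partial_deriv i f z =
     integral (cbox 0 1) (\<lambda>t. f (z(i := circ \<rho> t)) * circ \<rho> t / (circ \<rho> t - z i)\<^sup>2)"
proof -
  have zr: "z \<in> polydisc n r" using z s polydisc_mono[of s r n] by auto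
  have H: "(\<lambda>w. f (z(i := w))) holomorphic_on ball 0 r" by (rule hol_slice[OF f zr i])
  have sub: "cball 0 \<rho> \<subseteq> ball (0::complex) r" using s by auto
  have C: "continuous_on (cball 0 \<rho>) (\<lambda>w. f (z(i := w)))"
    by (rule continuous_on_subset[OF holomorphic_on_imp_continuous_on[OF H] sub])
  have H': "(\<lambda>w. f (z(i := w))) holomorphic_on ball 0 \<rho>"
    by (rule holomorphic_on_subset[OF H]) (use s in auto)
  have zi: "z i \<in> ball 0 \<rho>" using z i s by (force simp: polydisc_def)
  have "partial_deriv i f z = 1 / (2 * of_real pi * \<i>) *
      contour_integral (circlepath 0 \<rho>) (\<lambda>u. f (z(i := u)) / (u - z i)\<^sup>2)"
    unfolding partial_deriv_def by (rule DERIV_imp_deriv, rule Cauchy_derivative_integral_circlepath(2)[OF C H' zi])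
  also have "contour_integral (circlepath 0 \<rho>) (\<lambda>u. f (z(i := u)) / (u - z i)\<^sup>2) =
     integral (cbox 0 1) (\<lambda>t. (2 * of_real pi * \<i>) * (f (z(i := circ \<rho> t)) * circ \<rho> t / (circ \<rho> t - z i)\<^sup>2))"
    unfolding contour_integral_integral box_real
  proof (rule integral_cong)
    fix t :: real
    have "circlepath 0 \<rho> t = circ \<rho> t" by (simp add: circlepath circ_def)
    moreover have "vector_derivative (circlepath 0 \<rho>) (at t) = 2 * of_real pi * \<i> * circ \<rho> t"
      by (simp add: vector_derivative_circlepath circ_def algebra_simps)
    ultimately show "f (z(i := circlepath 0 \<rho> t)) / (circlepath 0 \<rho> t - z i)\<^sup>2 * vector_derivative (circlepath 0 \<rho>) (at t) =
       (2 * of_real pi * \<i>) * (f (z(i := circ \<rho> t)) * circ \<rho> t / (circ \<rho> t - z i)\<^sup>2)"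
      by (simp only:) (simp add: field_simps)
  qed
  also have "\<dots> = (2 * of_real pi * \<i>) * integral (cbox 0 1) (\<lambda>t. f (z(i := circ \<rho> t)) * circ \<rho> t / (circ \<rho> t - z i)\<^sup>2)"
    by (rule integral_mult_right)
  finally show ?thesis by (simp del: integral_mult_right)
qed

lemma continuous_on_polydisc_upd:
  assumes "continuous_on (polydisc n r) f" "continuous_on S g" "continuous_on S c"
    and "\<And>x. x \<in> S \<Longrightarrow> (g x)(i := c x) \<in> polydisc n r"
  shows "continuous_on S (\<lambda>x. f ((g x)(i := c x)))"
  by (rule continuous_on_compose2[OF assms(1) continuous_on_upd[OF assms(2,3)]]) (use assms(4) in auto)

text \<open>On smaller polydiscs the Cauchy integral depends continuously on its parameter; each
  point lies in such a polydisc, which is open in the larger one.\<close>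

lemma hol_partial_continuous:
  assumes f: "hol n r f" and i: "i < n"
  shows "continuous_on (polydisc n r) (partial_deriv i f)"
proof -
  have *: "continuous_on (polydisc n s) (partial_deriv i f)" if s: "0 < s" "s < r" for s
  proof -
    define \<rho> where "\<rho> = (s + r) / 2"
    have \<rho>: "s < \<rho>" "\<rho> < r" "0 < \<rho>" using s by (auto simp: \<rho>_def)
    have "continuous_on (polydisc n s \<times> cbox 0 1)
       (\<lambda>(z,t). f (z(i := circ \<rho> t)) * circ \<rho> t / (circ \<rho> t - z i)\<^sup>2)"
      unfolding split_beta
    proof (intro continuous_intros continuous_on_polydisc_upd[OF hol_continuous[OF f]])
      show "(fst x)(i := circ \<rho> (snd x)) \<in> polydisc n r" if "x \<in> polydisc n s \<times> cbox 0 1" for x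
        using that \<rho> s i polydisc_mono[of s r n] by (intro polydisc_upd) (auto simp: cmod_circ)
      show "\<forall>x\<in>polydisc n s \<times> cbox 0 1. (circ \<rho> (snd x) - fst x i)\<^sup>2 \<noteq> 0"
      proof
        fix x assume "x \<in> polydisc n s \<times> cbox (0::real) 1"
        hence "cmod (fst x i) < \<rho>" using \<rho> s i by (force simp: polydisc_def)
        thus "(circ \<rho> (snd x) - fst x i)\<^sup>2 \<noteq> 0" using cmod_circ[of \<rho> "snd x"] \<rho> by auto
      qed
    qed
    hence "continuous_on (polydisc n s)
        (\<lambda>z. integral (cbox 0 1) (\<lambda>t. f (z(i := circ \<rho> t)) * circ \<rho> t / (circ \<rho> t - z i)\<^sup>2))"
      by (rule integral_continuous_on_param)
    thus ?thesis
      by (rule continuous_on_eq) (use partial_deriv_cauchy[OF f i _ s(1) \<rho>(1,2)] in auto)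
  qed
  show ?thesis
  proof (cases "0 < r")
    case True
    show ?thesis unfolding continuous_on_eq_continuous_within
    proof
      fix z assume z: "z \<in> polydisc n r"
      obtain s where s: "0 < s" "s < r" "z \<in> polydisc n s" using polydisc_shrink[OF z True] by blast
      have "continuous (at z within polydisc n s) (partial_deriv i f)"
        using *[OF s(1,2)] s(3) by (simp add: continuous_on_eq_continuous_within)
      moreover have "at z within polydisc n s = at z within polydisc n r"
      proof -
        obtain T where T: "open T" "polydisc n s = polydisc n r \<inter> T"
          using openin_polydisc_openin[of s r n] s by (auto simp: openin_open)
        thus ?thesis using s(3) by (intro at_within_nhd[of _ T]) auto
      qed
      ultimately show "continuous (at z within polydisc n r) (partial_deriv i f)" by simp
    qed
  next
    case False
    hence "polydisc n r = {}" if "n > 0" using that by (force simp: polydisc_def not_less intro: order.trans)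
    thus ?thesis using i by auto
  qed
qed

text \<open>The Cauchy kernel in the variable \<open>i\<close> does not involve the variable
  \<open>j\<close>, so differentiation passes under the integral to \<open>f\<close> itself. This
  yields holomorphy of the partial derivative and, through the explicit value, the symmetry of
  second derivatives.\<close>

lemma partial_deriv_leibniz:
  assumes f: "hol n r f" and i: "i < n" and j: "j < n" "i \<noteq> j" and z: "z \<in> polydisc n s"
    and s: "0 < s" "s < \<rho>" "\<rho> < r" and \<zeta>: "cmod \<zeta> < s"
  shows "((\<lambda>w. partial_deriv i f (z(j := w))) has_field_derivative
     integral (cbox 0 1) (\<lambda>t. partial_deriv j f (z(j := \<zeta>, i := circ \<rho> t)) * circ \<rho> t / (circ \<rho> t - z i)\<^sup>2)) (at \<zeta>)"
proof -
  have zr: "z \<in> polydisc n r" using z s polydisc_mono[of s r n] by auto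
  have zi: "cmod (z i) < \<rho>" using z i s by (force simp: polydisc_def)
  have nz: "circ \<rho> t - z i \<noteq> 0" for t using cmod_circ[of \<rho> t] zi s by auto
  have mem: "z(j := w, i := circ \<rho> t) \<in> polydisc n r" if "cmod w < s" for w t
    using that zr i j s by (intro polydisc_upd) (auto simp: cmod_circ)
  have cont: "continuous_on (ball 0 s \<times> cbox 0 1)
      (\<lambda>(w,t). g (z(j := w, i := circ \<rho> t)) * circ \<rho> t / (circ \<rho> t - z i)\<^sup>2)"
    if "continuous_on (polydisc n r) g" for g
    unfolding split_beta
  proof (intro continuous_intros continuous_on_polydisc_upd[OF that])
    show "(z(j := fst x))(i := circ \<rho> (snd x)) \<in> polydisc n r" if "x \<in> ball 0 s \<times> cbox 0 1" for x
      using mem that by auto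
    show "\<forall>x\<in>ball (0::complex) s \<times> cbox 0 1. (circ \<rho> (snd x) - z i)\<^sup>2 \<noteq> 0" using nz by simp
  qed
  have L: "((\<lambda>w. integral (cbox 0 1) (\<lambda>t. f (z(j := w, i := circ \<rho> t)) * circ \<rho> t / (circ \<rho> t - z i)\<^sup>2))
     has_field_derivative
     integral (cbox 0 1) (\<lambda>t. partial_deriv j f (z(j := \<zeta>, i := circ \<rho> t)) * circ \<rho> t / (circ \<rho> t - z i)\<^sup>2))
     (at \<zeta> within ball 0 s)"
  proof (rule leibniz_rule_field_derivative[where fx = "\<lambda>w t. partial_deriv j f (z(j := w, i := circ \<rho> t)) * circ \<rho> t / (circ \<rho> t - z i)\<^sup>2"])
    fix w t assume w: "w \<in> ball (0::complex) s"
    have "z(i := circ \<rho> t) \<in> polydisc n r" using zr i s by (intro polydisc_upd) (auto simp: cmod_circ)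
    from hol_has_partial[OF f this j(1), of w] w s
    have "((\<lambda>w. f (z(i := circ \<rho> t, j := w))) has_field_derivative partial_deriv j f (z(i := circ \<rho> t, j := w))) (at w)"
      by auto
    hence D: "((\<lambda>w. f (z(j := w, i := circ \<rho> t))) has_field_derivative partial_deriv j f (z(j := w, i := circ \<rho> t))) (at w)"
      using j by (simp add: fun_upd_twist)
    show "((\<lambda>x. f (z(j := x, i := circ \<rho> t)) * circ \<rho> t / (circ \<rho> t - z i)\<^sup>2) has_field_derivative
            partial_deriv j f (z(j := w, i := circ \<rho> t)) * circ \<rho> t / (circ \<rho> t - z i)\<^sup>2) (at w within ball 0 s)"
      by (rule has_field_derivative_at_within) (intro DERIV_cdivide DERIV_cmult_right D)
  next
    fix w assume w: "w \<in> ball (0::complex) s"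
    have "continuous_on (cbox 0 1) (\<lambda>t. f (z(j := w, i := circ \<rho> t)) * circ \<rho> t / (circ \<rho> t - z i)\<^sup>2)"
      by (rule continuous_on_compose2[OF cont[OF hol_continuous[OF f]], of _ "\<lambda>t. (w,t)", simplified])
         (use w in \<open>auto intro!: continuous_intros\<close>)
    thus "(\<lambda>t. f (z(j := w, i := circ \<rho> t)) * circ \<rho> t / (circ \<rho> t - z i)\<^sup>2) integrable_on cbox 0 1"
      by (rule integrable_continuous)
  qed (use cont[OF hol_partial_continuous[OF f j(1)]] \<zeta> in auto)
  hence "((\<lambda>w. integral (cbox 0 1) (\<lambda>t. f (z(j := w, i := circ \<rho> t)) * circ \<rho> t / (circ \<rho> t - z i)\<^sup>2))
     has_field_derivative
     integral (cbox 0 1) (\<lambda>t. partial_deriv j f (z(j := \<zeta>, i := circ \<rho> t)) * circ \<rho> t / (circ \<rho> t - z i)\<^sup>2))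
     (at \<zeta>)"
    using \<zeta> by (simp add: at_within_open[OF _ open_ball])
  thus ?thesis
  proof (rule has_field_derivative_transform_within_open[OF _ open_ball[of 0 s]])
    fix w assume w: "w \<in> ball (0::complex) s"
    have "z(j := w) \<in> polydisc n s" using z j w by (intro polydisc_upd) auto
    from partial_deriv_cauchy[OF f i this s]
    show "integral (cbox 0 1) (\<lambda>t. f (z(j := w, i := circ \<rho> t)) * circ \<rho> t / (circ \<rho> t - z i)\<^sup>2) =
         partial_deriv i f (z(j := w))" using j by simp
  qed (use \<zeta> in auto)
qed

lemma polydisc_empty: "r \<le> 0 \<Longrightarrow> i < n \<Longrightarrow> polydisc n r = {}"
  by (force simp: polydisc_def not_less intro: order.trans)

lemma hol_partial_deriv:
  assumes f: "hol n r f" and i: "i < n"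
  shows "hol n r (partial_deriv i f)"
proof (cases "0 < r")
  case True
  have "(\<lambda>w. partial_deriv i f (z(j := w))) holomorphic_on ball 0 r"
    if z: "z \<in> polydisc n r" and j: "j < n" for z j
  proof (cases "i = j")
    case True
    have "deriv (\<lambda>w. f (z(i := w))) holomorphic_on ball 0 r"
      by (rule holomorphic_deriv[OF hol_slice[OF f z i] open_ball])
    thus ?thesis using True by (simp add: partial_deriv_def)
  next
    case False
    have "(\<lambda>w. partial_deriv i f (z(j := w))) field_differentiable at \<zeta>" if "\<zeta> \<in> ball 0 r" for \<zeta>
    proof -
      have "z(j := \<zeta>) \<in> polydisc n r" using z j that by (intro polydisc_upd) auto
      then obtain s where s: "0 < s" "s < r" "z(j := \<zeta>) \<in> polydisc n s"
        using polydisc_shrink True by blast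
      have "cmod \<zeta> < s" using polydisc_cmod[OF s(3,1), of j] by simp
      moreover have "s < (s + r) / 2" "(s + r) / 2 < r" using s by auto
      ultimately show ?thesis
        using partial_deriv_leibniz[OF f i j False s(3,1), of "(s + r) / 2" \<zeta>]
        by (auto simp: field_differentiable_def)
    qed
    thus ?thesis by (auto simp: holomorphic_on_def intro: field_differentiable_at_within)
  qed
  thus ?thesis using hol_partial_continuous[OF f i] by (auto simp: hol_iff)
qed (use polydisc_empty[OF _ i] openin_polydisc in \<open>auto simp: holomorphic_Cn_def not_less\<close>)

text \<open>The value computed by \<open>partial_deriv_leibniz\<close> is Cauchy's formula in the
  variable \<open>i\<close>, applied to \<open>partial_deriv j f\<close>.\<close>

lemma partial_deriv_commute:
  assumes f: "hol n r f" and i: "i < n" and j: "j < n" and z: "z \<in> polydisc n r" and r: "0 < r"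
  shows "partial_deriv j (partial_deriv i f) z = partial_deriv i (partial_deriv j f) z"
proof (cases "i = j")
  case False
  obtain s where s: "0 < s" "s < r" "z \<in> polydisc n s"
    using polydisc_shrink[OF z r] by blast
  define \<rho> where "\<rho> = (s + r) / 2"
  have \<rho>: "s < \<rho>" "\<rho> < r" using s by (auto simp: \<rho>_def)
  have "partial_deriv j (partial_deriv i f) z = 
     integral (cbox 0 1) (\<lambda>t. partial_deriv j f (z(j := z j, i := circ \<rho> t)) * circ \<rho> t / (circ \<rho> t - z i)\<^sup>2)"
    unfolding partial_deriv_def[of j "partial_deriv i f"]
    by (rule DERIV_imp_deriv, rule partial_deriv_leibniz[OF f i j False s(3,1) \<rho>]) (rule polydisc_cmod[OF s(3,1)])
  also have "\<dots> = partial_deriv i (partial_deriv j f) z"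
    using partial_deriv_cauchy[OF hol_partial_deriv[OF f j] i s(3,1) \<rho>] by simp
  finally show ?thesis .
qed simp

lemma partial_deriv_cong:
  assumes "\<And>z. z \<in> polydisc n r \<Longrightarrow> f z = g z" "z \<in> polydisc n r" "i < n" "0 < r"
  shows "partial_deriv i f z = partial_deriv i g z"
  unfolding partial_deriv_def
proof (rule deriv_cong_ev[OF _ refl])
  have "\<forall>\<^sub>F w in nhds (z i). w \<in> ball 0 r"
    using polydisc_cmod[OF assms(2,4), of i] by (intro eventually_nhds_in_open) auto
  thus "\<forall>\<^sub>F w in nhds (z i). f (z(i := w)) = g (z(i := w))"
    by eventually_elim (use assms polydisc_upd in auto)
qed

subsection \<open>Division by a coordinate\<close>

text \<open>Fundamental theorem of calculus along a segment in one coordinate. It serves twice: from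
  0 to \<open>z i\<close> for division by a coordinate, and between two values of a coordinate for
  the chain rule.\<close>

lemma hol_segment:
  assumes f: "hol n r f" and i: "i < n" and z: "z \<in> polydisc n r" and ab: "cmod a < r" "cmod b < r"
  shows "f (z(i := b)) - f (z(i := a)) =
     (b - a) * integral (cbox 0 1) (\<lambda>t. partial_deriv i f (z(i := a + of_real t * (b - a))))"
proof -
  have seg: "a + of_real t * (b - a) \<in> ball 0 r" if "t \<in> {0..1}" for t
  proof -
    have "(1 - t) *\<^sub>R a + t *\<^sub>R b \<in> ball 0 r"
      using that ab by (intro convexD[OF convex_ball]) auto
    thus ?thesis by (simp add: algebra_simps scaleR_conv_of_real)
  qed
  have "((\<lambda>t. (b - a) * partial_deriv i f (z(i := a + of_real t * (b - a)))) has_integral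
     f (z(i := a + of_real 1 * (b - a))) - f (z(i := a + of_real 0 * (b - a)))) {0..1}"
  proof (rule fundamental_theorem_of_calculus)
    fix t :: real assume t: "t \<in> {0..1}"
    have 1: "((\<lambda>t. a + of_real t * (b - a)) has_vector_derivative (b - a)) (at t within {0..1})"
      by (auto intro!: derivative_eq_intros)
    have 2: "((\<lambda>w. f (z(i := w))) has_field_derivative partial_deriv i f (z(i := a + of_real t * (b - a))))
       (at (a + of_real t * (b - a)))"
      using hol_has_partial[OF f z i] seg[OF t] by auto
    from field_vector_diff_chain_within[OF 1 has_field_derivative_at_within[OF 2]]
    show "((\<lambda>t. f (z(i := a + of_real t * (b - a)))) has_vector_derivative
            (b - a) * partial_deriv i f (z(i := a + of_real t * (b - a)))) (at t within {0..1})"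
      by (simp add: o_def)
  qed simp
  hence "integral {0..1} (\<lambda>t. (b - a) * partial_deriv i f (z(i := a + of_real t * (b - a)))) = f (z(i := b)) - f (z(i := a))"
    by (simp add: integral_unique del: integral_mult_right)
  thus ?thesis by simp
qed

text \<open>Hadamard's lemma: the quotient is the mean of \<open>partial_deriv i f\<close> over the
  segment from 0 to \<open>z i\<close>. It is holomorphic by differentiation under the
  integral.\<close>

lemma hol_divide_coord:
  assumes f: "hol n r f" and i: "i < n"
  obtains Q where "hol n r Q" "\<And>z. z \<in> polydisc n r \<Longrightarrow> f z = f (z(i := 0)) + z i * Q z"
proof -
  define Q where "Q z = integral (cbox 0 1) (\<lambda>t. partial_deriv i f (z(i := of_real t * z i)))" for z
  have tm: "cmod (of_real t * w) < r" if "cmod w < r" "t \<in> cbox 0 (1::real)" for t w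
    using that mult_right_mono[of t 1 "cmod w"] by (auto simp: norm_mult)
  have D: "hol n r (partial_deriv i f)" by (rule hol_partial_deriv[OF f i])
  have "continuous_on (polydisc n r) Q" unfolding Q_def
    by (rule integral_continuous_on_param, unfold split_beta)
       (auto intro!: continuous_on_polydisc_upd[OF hol_continuous[OF D]] continuous_intros
          polydisc_upd i tm simp: polydisc_def i)
  moreover have "(\<lambda>w. Q (z(j := w))) holomorphic_on ball 0 r" if z: "z \<in> polydisc n r" and j: "j < n" for z j
  proof -
    have r: "0 < r" using z j polydisc_empty[of r j n] by (cases "0 < r") auto
    \<comment> \<open>\<open>k t\<close> is the inner derivative of the path \<open>p\<close>:
      differentiating in the scaled variable itself gives the factor \<open>t\<close>, in any other
      variable the factor 1.\<close>
    define k where "k t = (if j = i then of_real t else 1 :: complex)" for t :: real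
    define p where "p w t = z(j := w, i := of_real t * (z(j := w)) i)" for w and t :: real
    have p: "p w t \<in> polydisc n r" if "cmod w < r" "t \<in> cbox 0 1" for w t
      unfolding p_def using that z i j
      by (cases "j = i") (auto intro!: polydisc_upd tm polydisc_cmod[OF z r])
    have contp: "continuous_on (ball 0 r \<times> cbox 0 1) (\<lambda>(w,t). g (p w t))"
      if "continuous_on (polydisc n r) g" for g :: "cvec \<Rightarrow> complex"
      unfolding split_beta
    proof (rule continuous_on_compose2[OF that])
      show "continuous_on (ball 0 r \<times> cbox 0 1) (\<lambda>x. p (fst x) (snd x))"
        unfolding p_def by (intro continuous_intros)
    qed (auto intro!: p)
    have "(\<lambda>w. integral (cbox 0 1) (\<lambda>t. partial_deriv i f (p w t))) field_differentiable (at w within ball 0 r)"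
      if "w \<in> ball 0 r" for w
    proof (rule leibniz_rule_field_differentiable[where
          fx = "\<lambda>w t. k t * partial_deriv j (partial_deriv i f) (p w t)"])
      fix w t assume w: "w \<in> ball (0::complex) r" and t: "t \<in> cbox (0::real) 1"
      have "((\<lambda>w. partial_deriv i f (p w t)) has_field_derivative k t * partial_deriv j (partial_deriv i f) (p w t)) (at w)"
      proof (cases "j = i")
        case True
        have "cmod (of_real t * w) < r" using w t tm by auto
        from hol_has_partial[OF D z i this] 
        have *: "((\<lambda>w. partial_deriv i f (z(i := w))) has_field_derivative partial_deriv i (partial_deriv i f) (z(i := of_real t * w))) (at (of_real t * w))" .
        have "((\<lambda>w. of_real t * w) has_field_derivative of_real t) (at w)"
          by (auto intro!: derivative_eq_intros)
        from DERIV_chain2[OF * this] show ?thesis using True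
          by (simp add: p_def k_def mult.commute)
      next
        case False
        have "z(i := of_real t * z i) \<in> polydisc n r" using z i t by (intro polydisc_upd tm polydisc_cmod[OF z r]) auto
        from hol_has_partial[OF D this j, of w] w False show ?thesis
          by (simp add: p_def k_def fun_upd_twist)
      qed
      thus "((\<lambda>w. partial_deriv i f (p w t)) has_field_derivative k t * partial_deriv j (partial_deriv i f) (p w t)) (at w within ball 0 r)"
        by (rule has_field_derivative_at_within)
    next
      fix w assume w: "w \<in> ball (0::complex) r"
      have "continuous_on (cbox 0 1) (\<lambda>t. partial_deriv i f (p w t))"
        by (rule continuous_on_compose2[OF contp[OF hol_continuous[OF D]], of _ "\<lambda>t. (w,t)", simplified])
           (use w in \<open>auto intro!: continuous_intros\<close>)
      thus "(\<lambda>t. partial_deriv i f (p w t)) integrable_on cbox 0 1" by (rule integrable_continuous)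
    next
      have "continuous_on (ball 0 r \<times> cbox 0 1) (\<lambda>x. k (snd x))"
        unfolding k_def by (cases "j = i") (auto intro!: continuous_intros)
      thus "continuous_on (ball 0 r \<times> cbox 0 1) (\<lambda>(w, t). k t * partial_deriv j (partial_deriv i f) (p w t))"
        using contp[OF hol_continuous[OF hol_partial_deriv[OF D j]]]
        unfolding split_beta by (intro continuous_intros)
    qed (use that in auto)
    thus ?thesis by (auto simp: holomorphic_on_def Q_def p_def)
  qed
  ultimately have "hol n r Q" by (auto simp: hol_iff)
  moreover have "f z = f (z(i := 0)) + z i * Q z" if z: "z \<in> polydisc n r" for z
  proof -
    have "0 < r" using z i polydisc_empty[of r i n] by (cases "0 < r") auto
    thus ?thesis using hol_segment[OF f i z, of 0 "z i"] polydisc_cmod[OF z, of i] by (simp add: Q_def algebra_simps)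
  qed
  ultimately show ?thesis by (rule that)
qed

subsection \<open>Composition\<close>

text \<open>Coordinates are exchanged one at a time; each exchange changes \<open>f\<close> by an
  increment times a mean of a partial derivative. These means are continuous, which gives the chain
  rule from the partial derivatives alone.\<close>

lemma hol_chain_slice:
  assumes f: "hol p R f" and R: "0 < R"
    and \<phi>: "\<And>k. k < p \<Longrightarrow> \<phi> k holomorphic_on ball 0 r"
    and b: "\<And>k t. k < p \<Longrightarrow> t \<in> ball 0 r \<Longrightarrow> cmod (\<phi> k t) < R" and t0: "t0 \<in> ball 0 r"
  shows "((\<lambda>t. f (\<lambda>k. if k < p then \<phi> k t else 0)) has_field_derivative
     (\<Sum>k<p. partial_deriv k f (\<lambda>k. if k < p then \<phi> k t0 else 0) * deriv (\<phi> k) t0)) (at t0)"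
proof -
  define w where "w t = (\<lambda>k. if k < p then \<phi> k t else 0)" for t
  \<comment> \<open>\<open>m k t\<close> interpolates between \<open>w t\<close> at
    \<open>k = 0\<close> and \<open>w t0\<close> at \<open>k = p\<close>; the step from
    \<open>k\<close> to \<open>Suc k\<close> changes only coordinate \<open>k\<close>, and
    \<open>G k t\<close> is the mean of the partial derivative along it.\<close>
  define m where "m k t = (\<lambda>l. if l < k then w t0 l else w t l)" for k t
  define G where "G k t = integral (cbox 0 1) (\<lambda>\<tau>. partial_deriv k f ((m k t)(k := \<phi> k t0 + of_real \<tau> * (\<phi> k t - \<phi> k t0))))" for k t
  have m: "m k t \<in> polydisc p R" if "t \<in> ball 0 r" for k t
    using that t0 b by (auto simp: m_def w_def polydisc_def Cn_def)
  have step: "f (m k t) - f (m (Suc k) t) = (\<phi> k t - \<phi> k t0) * G k t" if t: "t \<in> ball 0 r" and k: "k < p" for k t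
  proof -
    have 1: "(m k t)(k := \<phi> k t) = m k t" using k by (auto simp: m_def w_def)
    have 2: "(m k t)(k := \<phi> k t0) = m (Suc k) t" using k by (auto simp: m_def w_def)
    show ?thesis using hol_segment[OF f k m[OF t] b[OF k t0] b[OF k t], of k] by (simp only: 1 2 G_def)
  qed
  have diff: "f (w t) - f (w t0) = (\<Sum>k<p. (\<phi> k t - \<phi> k t0) * G k t)" if t: "t \<in> ball 0 r" for t
  proof -
    have "(\<Sum>k<p. (\<phi> k t - \<phi> k t0) * G k t) = (\<Sum>k<p. f (m k t) - f (m (Suc k) t))"
      using step[OF t] by simp
    also have "\<dots> = f (m 0 t) - f (m p t)" by (rule sum_lessThan_telescope')
    also have "m 0 t = w t" by (simp add: m_def)
    also have "m p t = w t0" by (auto simp: m_def w_def)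
    finally show ?thesis by simp
  qed
  have cont\<phi>: "continuous_on (ball 0 r) (\<phi> k)" if "k < p" for k
    using \<phi>[OF that] by (rule holomorphic_on_imp_continuous_on)
  have contw: "continuous_on (ball 0 r) w"
    unfolding w_def by (rule continuous_on_coordinatewise_then_product, case_tac "i < p") (auto intro!: cont\<phi>)
  have Glim: "(G k \<longlongrightarrow> partial_deriv k f (w t0)) (at t0)" if k: "k < p" for k
  proof -
    have "continuous_on (ball 0 r) (G k)" unfolding G_def
    proof (rule integral_continuous_on_param, unfold split_beta)
      have *: "\<phi> k t0 + of_real \<tau> * (\<phi> k t - \<phi> k t0) \<in> ball 0 R" if "\<tau> \<in> cbox 0 1" "t \<in> ball 0 r" for \<tau> t
      proof -
        have "(1 - \<tau>) *\<^sub>R \<phi> k t0 + \<tau> *\<^sub>R \<phi> k t \<in> ball 0 R"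
          using that b[OF k] t0 by (intro convexD[OF convex_ball]) auto
        thus ?thesis by (simp add: algebra_simps scaleR_conv_of_real)
      qed
      have "continuous_on (ball 0 r) (m k)"
        unfolding m_def
        by (rule continuous_on_coordinatewise_then_product)
           (case_tac "i < k", simp_all add: continuous_on_product_then_coordinatewise[OF contw])
      hence "continuous_on (ball 0 r \<times> cbox (0::real) 1) (\<lambda>x. m k (fst x))"
        by (rule continuous_on_compose2) (auto intro!: continuous_intros)
      moreover have "continuous_on (ball 0 r \<times> cbox (0::real) 1) (\<lambda>x. \<phi> k (fst x))"
        by (rule continuous_on_compose2[OF cont\<phi>[OF k]]) (auto intro!: continuous_intros)
      ultimately have "continuous_on (ball 0 r \<times> cbox 0 1)
         (\<lambda>x. (m k (fst x))(k := \<phi> k t0 + of_real (snd x) * (\<phi> k (fst x) - \<phi> k t0)))"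
        by (intro continuous_on_upd continuous_on_add continuous_on_mult continuous_on_diff continuous_on_const
            continuous_on_of_real continuous_on_snd continuous_on_id)
      thus "continuous_on (ball 0 r \<times> cbox 0 1)
         (\<lambda>x. partial_deriv k f ((m k (fst x))(k := \<phi> k t0 + of_real (snd x) * (\<phi> k (fst x) - \<phi> k t0))))"
        by (rule continuous_on_compose2[OF hol_continuous[OF hol_partial_deriv[OF f k]]])
           (use * k m in \<open>auto intro!: polydisc_upd simp del: fun_upd_apply\<close>)
    qed
    hence "(G k \<longlongrightarrow> G k t0) (at t0)"
      using t0 by (simp add: continuous_on_eq_continuous_at isCont_def)
    moreover have "(m k t0)(k := \<phi> k t0) = w t0" using k by (auto simp: m_def w_def)
    hence "G k t0 = partial_deriv k f (w t0)" by (simp add: G_def)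
    ultimately show ?thesis by simp
  qed
  have "((\<lambda>t. \<Sum>k<p. G k t * ((\<phi> k t - \<phi> k t0) / (t - t0))) \<longlongrightarrow>
      (\<Sum>k<p. partial_deriv k f (w t0) * deriv (\<phi> k) t0)) (at t0)"
  proof (intro tendsto_sum tendsto_mult Glim)
    fix k assume "k \<in> {..<p}"
    hence "(\<phi> k has_field_derivative deriv (\<phi> k) t0) (at t0)"
      using holomorphic_derivI[OF \<phi> open_ball t0] by auto
    thus "((\<lambda>t. (\<phi> k t - \<phi> k t0) / (t - t0)) \<longlongrightarrow> deriv (\<phi> k) t0) (at t0)"
      by (simp add: has_field_derivative_iff)
  qed auto
  hence "((\<lambda>t. (f (w t) - f (w t0)) / (t - t0)) \<longlongrightarrow>
      (\<Sum>k<p. partial_deriv k f (w t0) * deriv (\<phi> k) t0)) (at t0)"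
  proof (rule Lim_transform_eventually)
    have "\<forall>\<^sub>F t in at t0. t \<in> ball 0 r" using t0 by (intro eventually_at_in_open') auto
    thus "\<forall>\<^sub>F t in at t0. (\<Sum>k<p. G k t * ((\<phi> k t - \<phi> k t0) / (t - t0))) = (f (w t) - f (w t0)) / (t - t0)"
      by eventually_elim (simp add: diff sum_divide_distrib mult_ac)
  qed
  thus ?thesis by (simp add: has_field_derivative_iff w_def)
qed

lemma
  assumes f: "hol p R f" and R: "0 < R" and \<phi>: "\<And>k. k < p \<Longrightarrow> hol n r (\<phi> k)"
    and b: "\<And>k z. k < p \<Longrightarrow> z \<in> polydisc n r \<Longrightarrow> cmod (\<phi> k z) < R"
  shows hol_compose: "hol n r (\<lambda>z. f (\<lambda>k. if k < p then \<phi> k z else 0))" (is ?A)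
    and partial_deriv_compose: "\<And>z i. z \<in> polydisc n r \<Longrightarrow> i < n \<Longrightarrow>
      partial_deriv i (\<lambda>z. f (\<lambda>k. if k < p then \<phi> k z else 0)) z =
        (\<Sum>k<p. partial_deriv k f (\<lambda>k. if k < p then \<phi> k z else 0) * partial_deriv i (\<phi> k) z)"
proof -
  have D: "((\<lambda>t. f (\<lambda>k. if k < p then \<phi> k (z(i := t)) else 0)) has_field_derivative
     (\<Sum>k<p. partial_deriv k f (\<lambda>k. if k < p then \<phi> k (z(i := t0)) else 0) * deriv (\<lambda>t. \<phi> k (z(i := t))) t0)) (at t0)"
    if "z \<in> polydisc n r" "i < n" "t0 \<in> ball 0 r" for z i t0
    by (rule hol_chain_slice[where \<phi> = "\<lambda>k t. \<phi> k (z(i := t))", OF f R])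
       (use that in \<open>auto intro: hol_slice[OF \<phi>] b polydisc_upd\<close>)
  have "continuous_on (polydisc n r) (\<lambda>z k. if k < p then \<phi> k z else 0)"
    by (rule continuous_on_coordinatewise_then_product, case_tac "i < p") (auto intro!: hol_continuous[OF \<phi>])
  hence "continuous_on (polydisc n r) (\<lambda>z. f (\<lambda>k. if k < p then \<phi> k z else 0))"
    by (rule continuous_on_compose2[OF hol_continuous[OF f]]) (use b in \<open>auto simp: polydisc_def[of p] Cn_def\<close>)
  moreover have "(\<lambda>t. f (\<lambda>k. if k < p then \<phi> k (z(i := t)) else 0)) holomorphic_on ball 0 r"
    if "z \<in> polydisc n r" "i < n" for z i
    unfolding holomorphic_on_def field_differentiable_def
    using has_field_derivative_at_within[OF D[OF that]] by blast
  ultimately show ?A unfolding hol_iff by blast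
  show "partial_deriv i (\<lambda>z. f (\<lambda>k. if k < p then \<phi> k z else 0)) z =
        (\<Sum>k<p. partial_deriv k f (\<lambda>k. if k < p then \<phi> k z else 0) * partial_deriv i (\<phi> k) z)"
    if "z \<in> polydisc n r" "i < n" for z i
  proof -
    have "0 < r" using that polydisc_empty[of r i n] by (cases "0 < r") auto
    hence "z i \<in> ball 0 r" using polydisc_cmod[OF that(1)] by simp
    from DERIV_imp_deriv[OF D[OF that this]] show ?thesis
      unfolding partial_deriv_def[of i] by (simp only: fun_upd_triv)
  qed
qed

lemma
  assumes g: "hol (Suc n) R g" and W: "hol n r W" and b: "\<And>z. z \<in> polydisc n r \<Longrightarrow> cmod (W z) < R"
    and r: "0 < r" "r \<le> R"
  shows hol_subst_last: "hol n r (\<lambda>z. g (z(n := W z)))"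
    and partial_deriv_subst_last: "\<And>z i. z \<in> polydisc n r \<Longrightarrow> i < n \<Longrightarrow>
      partial_deriv i (\<lambda>z. g (z(n := W z))) z =
        partial_deriv i g (z(n := W z)) + partial_deriv n g (z(n := W z)) * partial_deriv i W z"
proof -
  define \<phi> where "\<phi> k = (if k = n then W else (\<lambda>z. z k))" for k
  have eq: "(\<lambda>k. if k < Suc n then \<phi> k z else 0) = z(n := W z)" if "z \<in> polydisc n r" for z
    using that by (auto simp: \<phi>_def polydisc_def Cn_def)
  have \<phi>: "hol n r (\<phi> k)" for k using W by (auto simp: \<phi>_def hol_coord)
  have b': "cmod (\<phi> k z) < R" if "z \<in> polydisc n r" for k z
    using polydisc_cmod[OF that r(1), of k] r(2) b[OF that] by (auto simp: \<phi>_def)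
  have R: "0 < R" using r by simp
  have eq2: "(\<lambda>z. g (z(n := W z))) z = g (\<lambda>k. if k < Suc n then \<phi> k z else 0)" if "z \<in> polydisc n r" for z
    using eq[OF that] by simp
  show "hol n r (\<lambda>z. g (z(n := W z)))"
    by (subst hol_cong[OF eq2]) (auto intro!: hol_compose[OF g R] \<phi> b')
  show "partial_deriv i (\<lambda>z. g (z(n := W z))) z =
        partial_deriv i g (z(n := W z)) + partial_deriv n g (z(n := W z)) * partial_deriv i W z"
    if z: "z \<in> polydisc n r" and i: "i < n" for z i
  proof -
    have "partial_deriv i (\<lambda>z. g (z(n := W z))) z = partial_deriv i (\<lambda>z. g (\<lambda>k. if k < Suc n then \<phi> k z else 0)) z"
      by (rule partial_deriv_cong[OF eq2 z i r(1)])
    also have "\<dots> = (\<Sum>k<Suc n. partial_deriv k g (\<lambda>k. if k < Suc n then \<phi> k z else 0) * partial_deriv i (\<phi> k) z)"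
      by (rule partial_deriv_compose[OF g R]) (use \<phi> b' z i in auto)
    also have "\<dots> = (\<Sum>k<n. partial_deriv k g (z(n := W z)) * partial_deriv i (\<phi> k) z) + partial_deriv n g (z(n := W z)) * partial_deriv i W z"
      unfolding eq[OF z] by (simp add: \<phi>_def)
    also have "(\<Sum>k<n. partial_deriv k g (z(n := W z)) * partial_deriv i (\<phi> k) z) =
        (\<Sum>k<n. if k = i then partial_deriv i g (z(n := W z)) else 0)"
    proof (rule sum.cong[OF refl])
      fix k assume "k \<in> {..<n}"
      hence "\<phi> k = (\<lambda>z. z k)" by (simp add: \<phi>_def)
      moreover have "partial_deriv i (\<lambda>z. z k) z = (if k = i then 1 else 0)"
        by (simp add: partial_deriv_def)
      ultimately show "partial_deriv k g (z(n := W z)) * partial_deriv i (\<phi> k) z =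
         (if k = i then partial_deriv i g (z(n := W z)) else 0)" by simp
    qed
    also have "(\<Sum>k<n. if k = i then partial_deriv i g (z(n := W z)) else 0) = partial_deriv i g (z(n := W z))"
      using i by (simp del: fun_upd_apply)
    finally show ?thesis .
  qed
qed

subsection \<open>The implicit function theorem\<close>

lemma hol_small_near_origin:
  assumes f: "hol n R f" and R: "0 < R" and "f origin = 0" and e: "0 < e"
  obtains r where "0 < r" "r \<le> R" "\<And>z. z \<in> polydisc n r \<Longrightarrow> cmod (f z) < e"
proof -
  have "open (ball (0::complex) e)" by simp
  from continuous_openin_preimage_gen[OF hol_continuous[OF f] this]
  have "openin (top_of_set (Cn n)) (polydisc n R \<inter> f -` ball 0 e)"
    using openin_polydisc openin_trans by blast
  moreover have "origin \<in> polydisc n R \<inter> f -` ball 0 e" using assms by auto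
  ultimately obtain r where "0 < r" "polydisc n r \<subseteq> polydisc n R \<inter> f -` ball 0 e"
    by (rule openin_Cn_contains_polydisc)
  thus ?thesis using polydisc_mono[of "min r R" r n] by (intro that[of "min r R"]) (use R in auto)
qed

lemma hol_uniform_limit:
  assumes W: "\<And>k. hol n r (W k)" and l: "uniform_limit (polydisc n r) W L sequentially"
  shows "hol n r L"
proof -
  have "(\<lambda>w. L (z(i := w))) holomorphic_on ball 0 r" if "z \<in> polydisc n r" "i < n" for z i
  proof (rule holomorphic_uniform_sequence[OF open_ball])
    show "(\<lambda>w. W k (z(i := w))) holomorphic_on ball 0 r" for k by (rule hol_slice[OF W that])
    fix x assume "x \<in> ball (0::complex) r"
    then obtain d where d: "d > 0" "cball x d \<subseteq> ball 0 r" using open_contains_cball[of "ball (0::complex) r"] open_ball by blast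
    have "uniform_limit (cball x d) (\<lambda>k w. W k (z(i := w))) (\<lambda>w. L (z(i := w))) sequentially"
      by (rule uniform_limit_compose'[OF l]) (use that d in \<open>auto intro!: polydisc_upd\<close>)
    with d show "\<exists>d>0. cball x d \<subseteq> ball 0 r \<and> uniform_limit (cball x d) (\<lambda>k w. W k (z(i := w))) (\<lambda>w. L (z(i := w))) sequentially"
      by blast
  qed
  moreover have "continuous_on (polydisc n r) L"
    by (rule uniform_limit_theorem[OF _ l]) (auto intro!: always_eventually hol_continuous[OF W])
  ultimately show ?thesis by (auto simp: hol_iff)
qed

text \<open>Fixed-point iteration with \<open>z\<close> as a parameter: the iterates are holomorphic
  and converge uniformly, so the limit is holomorphic. Uniqueness on the full disc of radius
  \<open>\<rho>\<close> matters later, where \<open>\<zeta>\<close> is identified at points at which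
  a zero is known beforehand.\<close>

lemma implicit_function:
  assumes g: "hol (Suc n) R g" and R: "0 < R" and g0: "g origin = 0" and c0: "partial_deriv n g origin \<noteq> 0"
  obtains r \<rho> \<zeta> where "0 < r" "r \<le> \<rho>" "\<rho> \<le> R" "hol n r \<zeta>"
    "\<And>z. z \<in> polydisc n r \<Longrightarrow> cmod (\<zeta> z) < \<rho>"
    "\<And>z w. z \<in> polydisc n r \<Longrightarrow> cmod w < \<rho> \<Longrightarrow> g (z(n := w)) = 0 \<longleftrightarrow> w = \<zeta> z"
proof -
  define c where "c = partial_deriv n g origin"
  have c: "cmod c > 0" using c0 by (simp add: c_def)
  have "hol (Suc n) R (\<lambda>z. partial_deriv n g z - c)" by (intro hol_diff hol_const hol_partial_deriv g) auto
  from hol_small_near_origin[OF this R, of "cmod c / 2"] c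
  obtain \<rho> where \<rho>: "0 < \<rho>" "\<rho> \<le> R" "\<And>z. z \<in> polydisc (Suc n) \<rho> \<Longrightarrow> cmod (partial_deriv n g z - c) < cmod c / 2"
    by (auto simp: c_def)
  from hol_small_near_origin[OF g R g0, of "cmod c * \<rho> / 8"] c \<rho>
  obtain r0 where r0: "0 < r0" "r0 \<le> R" "\<And>z. z \<in> polydisc (Suc n) r0 \<Longrightarrow> cmod (g z) < cmod c * \<rho> / 8"
    by auto
  define r where "r = min r0 \<rho>"
  have r: "0 < r" "r \<le> r0" "r \<le> \<rho>" using r0 \<rho> by (auto simp: r_def)
  have emb: "z \<in> polydisc (Suc n) r" if "z \<in> polydisc n r" for z
    using that polydisc_cmod[OF that r(1)] by (auto simp: polydisc_def Cn_def)
  \<comment> \<open>Newton's method with the derivative frozen at \<open>c\<close>. The bound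
    \<open>cmod c / 2\<close> makes \<open>T z\<close> a contraction with factor 1/2, and the bound
    \<open>cmod c * \<rho> / 8\<close> keeps the iterates within \<open>\<rho> / 4\<close>, since
    half of \<open>\<rho> / 4\<close> plus \<open>\<rho> / 8\<close> is
    \<open>\<rho> / 4\<close>.\<close>
  define T where "T z w = w - g (z(n := w)) / c" for z w
  have contr: "cmod (T z w - T z w') \<le> cmod (w - w') / 2"
    if z: "z \<in> polydisc n r" and "cmod w < \<rho>" "cmod w' < \<rho>" for z w w'
  proof -
    have z\<rho>: "z \<in> polydisc (Suc n) \<rho>" using emb[OF z] polydisc_mono[OF r(3)] by auto
    have zR: "z \<in> polydisc (Suc n) R" using z\<rho> polydisc_mono[OF \<rho>(2)] by auto
    have "norm (T z w' - T z w) \<le> 1/2 * norm (w' - w)"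
    proof (rule field_differentiable_bound[where S = "ball 0 \<rho>" and f' = "\<lambda>w. 1 - partial_deriv n g (z(n := w)) / c"])
      fix u assume u: "u \<in> ball (0::complex) \<rho>"
      have D: "((\<lambda>w. g (z(n := w))) has_field_derivative partial_deriv n g (z(n := u))) (at u)"
        by (rule hol_has_partial[OF g zR]) (use u \<rho> in auto)
      show "(T z has_field_derivative 1 - partial_deriv n g (z(n := u)) / c) (at u within ball 0 \<rho>)"
        unfolding T_def by (rule has_field_derivative_at_within[OF DERIV_diff[OF DERIV_ident DERIV_cdivide[OF D]]])
      have "z(n := u) \<in> polydisc (Suc n) \<rho>" using z\<rho> u by (intro polydisc_upd) auto
      from \<rho>(3)[OF this] have "cmod ((c - partial_deriv n g (z(n := u))) / c) \<le> 1/2"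
        using c by (simp add: norm_divide field_simps norm_minus_commute)
      thus "norm (1 - partial_deriv n g (z(n := u)) / c) \<le> 1/2" using c by (simp add: diff_divide_distrib)
    qed (use that in auto)
    thus ?thesis by (simp add: norm_minus_commute)
  qed
  have T0: "cmod (T z 0) \<le> \<rho> / 8" if z: "z \<in> polydisc n r" for z
  proof -
    have "z(n := 0) = z" using z by (auto simp: polydisc_def Cn_def)
    moreover have "z \<in> polydisc (Suc n) r0" using emb[OF z] polydisc_mono[OF r(2)] by auto
    ultimately show ?thesis using r0(3)[of z] c by (simp add: T_def norm_divide field_simps less_imp_le)
  qed
  define W where "W k z = (T z ^^ k) 0" for k z
  have W_Suc: "W (Suc k) z = T z (W k z)" for k z by (simp add: W_def)
  have Wb: "cmod (W k z) \<le> \<rho> / 4" if z: "z \<in> polydisc n r" for k z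
  proof (induction k)
    case 0 thus ?case using \<rho> by (simp add: W_def)
  next
    case (Suc k)
    have "cmod (W (Suc k) z) \<le> cmod (T z (W k z) - T z 0) + cmod (T z 0)"
      unfolding W_Suc by (metis add.commute diff_add_cancel norm_triangle_ineq)
    also have "\<dots> \<le> cmod (W k z - 0) / 2 + \<rho> / 8"
      using Suc \<rho> by (intro add_mono contr T0 z) auto
    finally show ?case using Suc by simp
  qed
  have Wd: "cmod (W (Suc k) z - W k z) \<le> \<rho> / 8 * (1/2) ^ k" if z: "z \<in> polydisc n r" for k z
  proof (induction k)
    case 0 thus ?case using T0[OF z] by (simp add: W_def)
  next
    case (Suc k)
    have "cmod (W (Suc (Suc k)) z - W (Suc k) z) \<le> cmod (W (Suc k) z - W k z) / 2"
      unfolding W_Suc[of "Suc k"] W_Suc[of k] using Wb[OF z, of k] Wb[OF z, of "Suc k"] \<rho> unfolding W_Suc[of k]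
      by (intro contr z) auto
    thus ?case using Suc by simp
  qed
  have Wh: "hol n r (W k)" for k
  proof (induction k)
    case 0 thus ?case by (simp add: W_def hol_const)
  next
    case (Suc k)
    have "hol n r (\<lambda>z. g (z(n := W k z)))"
    proof (rule hol_subst_last[OF g Suc _ r(1)])
      show "cmod (W k z) < R" if "z \<in> polydisc n r" for z using Wb[OF that, of k] \<rho> by linarith
      show "r \<le> R" using r \<rho> by linarith
    qed
    from hol_diff[OF Suc hol_mult[OF this hol_const[where c = "inverse c"]]]
    show ?case by (simp add: W_Suc[abs_def] T_def divide_inverse)
  qed
  \<comment> \<open>The limit is written as a telescoping series, so that the M-test gives uniform
    convergence.\<close>
  define \<zeta> where "\<zeta> z = (\<Sum>k. W (Suc k) z - W k z)" for z
  have "uniform_limit (polydisc n r) (\<lambda>N z. \<Sum>k<N. W (Suc k) z - W k z) \<zeta> sequentially"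
    unfolding \<zeta>_def by (rule Weierstrass_m_test[where M = "\<lambda>k. \<rho> / 8 * (1/2) ^ k"])
      (rule Wd, assumption, intro summable_mult summable_geometric, simp)
  moreover have "(\<Sum>k<N. W (Suc k) z - W k z) = W N z" for N z
    using sum_lessThan_telescope[of "\<lambda>k. W k z" N] by (simp add: W_def[of 0])
  ultimately have L: "uniform_limit (polydisc n r) W \<zeta> sequentially" by simp
  have \<zeta>h: "hol n r \<zeta>" by (rule hol_uniform_limit[OF Wh L])
  have lim: "(\<lambda>k. W k z) \<longlonglongrightarrow> \<zeta> z" if "z \<in> polydisc n r" for z
    by (rule tendsto_uniform_limitI[OF L that])
  have \<zeta>b: "cmod (\<zeta> z) \<le> \<rho> / 4" if z: "z \<in> polydisc n r" for z
    by (rule tendsto_upperbound[OF tendsto_norm[OF lim[OF z]]]) (use Wb[OF z] in auto)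
  have fixp: "T z (\<zeta> z) = \<zeta> z" if z: "z \<in> polydisc n r" for z
  proof -
    have "(\<lambda>k. W (Suc k) z - T z (\<zeta> z)) \<longlonglongrightarrow> 0"
    proof (rule Lim_null_comparison[where g = "\<lambda>k. cmod (W k z - \<zeta> z) / 2"])
      show "\<forall>\<^sub>F k in sequentially. norm (W (Suc k) z - T z (\<zeta> z)) \<le> cmod (W k z - \<zeta> z) / 2"
      proof (intro always_eventually allI)
        fix k show "norm (W (Suc k) z - T z (\<zeta> z)) \<le> cmod (W k z - \<zeta> z) / 2"
          unfolding W_Suc using Wb[OF z, of k] \<zeta>b[OF z] \<rho> by (intro contr z) linarith+
      qed
      show "(\<lambda>k. cmod (W k z - \<zeta> z) / 2) \<longlonglongrightarrow> 0"
        using lim[OF z] by (auto intro!: tendsto_eq_intros)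
    qed
    moreover have "(\<lambda>k. W (Suc k) z - T z (\<zeta> z)) \<longlonglongrightarrow> \<zeta> z - T z (\<zeta> z)"
      using LIMSEQ_Suc[OF lim[OF z]] by (intro tendsto_intros)
    ultimately show ?thesis using LIMSEQ_unique by force
  qed
  show ?thesis
  proof (rule that[OF r(1,3) \<rho>(2) \<zeta>h])
    show "cmod (\<zeta> z) < \<rho>" if "z \<in> polydisc n r" for z using \<zeta>b[OF that] \<rho> by simp
    show "g (z(n := w)) = 0 \<longleftrightarrow> w = \<zeta> z" if z: "z \<in> polydisc n r" and w: "cmod w < \<rho>" for z w
    proof
      assume "g (z(n := w)) = 0"
      hence "T z w = w" by (simp add: T_def)
      thus "w = \<zeta> z" using contr[OF z w, of "\<zeta> z"] fixp[OF z] \<zeta>b[OF z] \<rho> by auto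
    next
      assume "w = \<zeta> z"
      thus "g (z(n := w)) = 0" using fixp[OF z] c by (simp add: T_def)
    qed
  qed
qed

subsection \<open>Germs\<close>

lemma hg_I: "0 < r \<Longrightarrow> hol n r f \<Longrightarrow> holomorphic_germ n f"
  by (auto simp: holomorphic_germ_iff)

lemma hg2:
  assumes "holomorphic_germ n f" "holomorphic_germ n g"
  obtains r where "0 < r" "hol n r f" "hol n r g"
proof -
  obtain r s where "0 < r" "hol n r f" "0 < s" "hol n s g" using assms by (auto simp: holomorphic_germ_iff)
  thus ?thesis by (intro that[of "min r s"]) (auto intro: hol_mono)
qed

lemma hg_const [intro]: "holomorphic_germ n (\<lambda>_. c)"
  by (rule hg_I[OF zero_less_one hol_const])

lemma hg_coord [intro]: "holomorphic_germ n (\<lambda>z. z i)"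
  by (rule hg_I[OF zero_less_one hol_coord])

lemma hg_add [intro]: "holomorphic_germ n f \<Longrightarrow> holomorphic_germ n g \<Longrightarrow> holomorphic_germ n (\<lambda>z. f z + g z)"
  by (erule (1) hg2) (rule hg_I, auto intro: hol_add)

lemma hg_diff [intro]: "holomorphic_germ n f \<Longrightarrow> holomorphic_germ n g \<Longrightarrow> holomorphic_germ n (\<lambda>z. f z - g z)"
  by (erule (1) hg2) (rule hg_I, auto intro: hol_diff)

lemma hg_mult [intro]: "holomorphic_germ n f \<Longrightarrow> holomorphic_germ n g \<Longrightarrow> holomorphic_germ n (\<lambda>z. f z * g z)"
  by (erule (1) hg2) (rule hg_I, auto intro: hol_mult)

lemma hg_uminus [intro]: "holomorphic_germ n f \<Longrightarrow> holomorphic_germ n (\<lambda>z. - f z)"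
  using hg_diff[OF hg_const[of n 0]] by simp

lemma hg_sum [intro]: "(\<And>i. i \<in> I \<Longrightarrow> holomorphic_germ n (f i)) \<Longrightarrow> holomorphic_germ n (\<lambda>z. \<Sum>i\<in>I. f i z)"
  by (induction I rule: infinite_finite_induct) auto

lemma hg_power [intro]: "holomorphic_germ n f \<Longrightarrow> holomorphic_germ n (\<lambda>z. f z ^ k)"
  by (induction k) auto

lemma hg_partial [intro]: "holomorphic_germ n f \<Longrightarrow> i < n \<Longrightarrow> holomorphic_germ n (partial_deriv i f)"
  by (auto simp: holomorphic_germ_iff intro: hol_partial_deriv)

lemma hg_inverse:
  assumes "holomorphic_germ n f" "f origin \<noteq> 0"
  obtains g where "holomorphic_germ n g" "g origin = inverse (f origin)"
    "\<forall>\<^sub>F z in near_origin n. f z \<noteq> 0 \<and> g z = inverse (f z)"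
proof -
  obtain R where R: "0 < R" "hol n R f" using assms by (auto simp: holomorphic_germ_iff)
  have "hol n R (\<lambda>z. f z - f origin)" by (rule hol_diff[OF R(2) hol_const])
  from hol_small_near_origin[OF this R(1), of "cmod (f origin)"] assms(2)
  obtain r where r: "0 < r" "r \<le> R" "\<And>z. z \<in> polydisc n r \<Longrightarrow> cmod (f z - f origin) < cmod (f origin)" by auto
  have nz: "f z \<noteq> 0" if "z \<in> polydisc n r" for z using r(3)[OF that] by auto
  have "hol n r (\<lambda>z. inverse (f z))" by (rule hol_inverse[OF hol_mono[OF R(2) r(2)] nz])
  thus ?thesis using r nz by (intro that[of "\<lambda>z. inverse (f z)"]) (auto simp: eventually_near_origin intro: hg_I)
qed

lemma hg_cong:
  assumes "\<forall>\<^sub>F z in near_origin n. f z = g z" "holomorphic_germ n f"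
  shows "holomorphic_germ n g"
proof -
  obtain r s where r: "0 < r" "\<And>z. z \<in> polydisc n r \<Longrightarrow> f z = g z" and s: "0 < s" "hol n s f"
    using assms by (auto simp: eventually_near_origin holomorphic_germ_iff)
  have "hol n (min r s) f" using hol_mono[OF s(2)] by simp
  hence "hol n (min r s) g"
    using r(2) polydisc_mono[of "min r s" r n] by (subst hol_cong[where g = f]) auto
  thus ?thesis using r s by (intro hg_I[of "min r s"]) auto
qed

lemma eventually_near_origin_at: "eventually P (near_origin n) \<Longrightarrow> P origin"
  by (auto simp: eventually_near_origin)

lemma partial_deriv_cong_germ:
  assumes "\<forall>\<^sub>F z in near_origin n. f z = g z" "i < n"
  shows "\<forall>\<^sub>F z in near_origin n. partial_deriv i f z = partial_deriv i g z"
proof -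
  obtain r where r: "0 < r" "\<And>z. z \<in> polydisc n r \<Longrightarrow> f z = g z" using assms(1) by (auto simp: eventually_near_origin)
  from partial_deriv_cong[OF r(2) _ assms(2) r(1)] r(1) show ?thesis by (auto simp: eventually_near_origin)
qed

lemma partial_deriv_commute_germ:
  assumes "holomorphic_germ n f" "i < n" "j < n"
  shows "\<forall>\<^sub>F z in near_origin n. partial_deriv j (partial_deriv i f) z = partial_deriv i (partial_deriv j f) z"
proof -
  obtain r where "0 < r" "hol n r f" using assms by (auto simp: holomorphic_germ_iff)
  thus ?thesis using partial_deriv_commute[of n f _ i j] assms by (auto simp: eventually_near_origin)
qed

subsection \<open>The Jacobian ideal on the level of functions\<close>

text \<open>The Jacobian ideal pulled back to functions, with explicit coefficients, so that
  membership can be shown by identities between functions instead of cosets.\<close>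

definition jac :: "nat \<Rightarrow> (cvec \<Rightarrow> complex) \<Rightarrow> (cvec \<Rightarrow> complex) set" where
  "jac n g = {h. holomorphic_germ n h \<and> (\<exists>a. (\<forall>i<n. holomorphic_germ n (a i)) \<and>
     (\<forall>\<^sub>F z in near_origin n. h z = (\<Sum>i<n. a i z * partial_deriv i g z)))}"

lemma jac_hg: "h \<in> jac n g \<Longrightarrow> holomorphic_germ n h"
  by (simp add: jac_def)

lemma jac_partial:
  assumes "holomorphic_germ n g" "i < n"
  shows "partial_deriv i g \<in> jac n g"
  unfolding jac_def
proof (intro CollectI conjI exI[of _ "\<lambda>j _. if j = i then 1 else 0"] allI impI)
  show "\<forall>\<^sub>F z in near_origin n. partial_deriv i g z = (\<Sum>j<n. (if j = i then 1 else 0) * partial_deriv j g z)"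
    using assms(2) by (simp add: if_distrib[of "\<lambda>x. x * _"] cong: if_cong)
qed (use assms in auto)

lemma jac_add:
  assumes "h \<in> jac n g" "k \<in> jac n g"
  shows "(\<lambda>z. h z + k z) \<in> jac n g"
proof -
  obtain a b where a: "\<forall>i<n. holomorphic_germ n (a i)" "\<forall>\<^sub>F z in near_origin n. h z = (\<Sum>i<n. a i z * partial_deriv i g z)"
    and b: "\<forall>i<n. holomorphic_germ n (b i)" "\<forall>\<^sub>F z in near_origin n. k z = (\<Sum>i<n. b i z * partial_deriv i g z)"
    using assms by (auto simp: jac_def)
  show ?thesis unfolding jac_def
  proof (intro CollectI conjI exI[of _ "\<lambda>i z. a i z + b i z"] allI impI)
    show "\<forall>\<^sub>F z in near_origin n. h z + k z = (\<Sum>i<n. (a i z + b i z) * partial_deriv i g z)"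
      using a(2) b(2) by eventually_elim (simp add: sum.distrib ring_distribs)
  qed (use assms jac_hg a b in auto)
qed

lemma jac_mult:
  assumes "h \<in> jac n g" "holomorphic_germ n k"
  shows "(\<lambda>z. k z * h z) \<in> jac n g"
proof -
  obtain a where a: "\<forall>i<n. holomorphic_germ n (a i)" "\<forall>\<^sub>F z in near_origin n. h z = (\<Sum>i<n. a i z * partial_deriv i g z)"
    using assms by (auto simp: jac_def)
  show ?thesis unfolding jac_def
  proof (intro CollectI conjI exI[of _ "\<lambda>i z. k z * a i z"] allI impI)
    show "\<forall>\<^sub>F z in near_origin n. k z * h z = (\<Sum>i<n. (k z * a i z) * partial_deriv i g z)"
      using a(2) by eventually_elim (simp add: sum_distrib_left mult.assoc)
  qed (use assms jac_hg a in auto)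
qed

lemma jac_cmult: "h \<in> jac n g \<Longrightarrow> (\<lambda>z. c * h z) \<in> jac n g"
  by (rule jac_mult) auto

lemma jac_diff: "h \<in> jac n g \<Longrightarrow> k \<in> jac n g \<Longrightarrow> (\<lambda>z. h z - k z) \<in> jac n g"
  using jac_add[OF _ jac_cmult[of k n g "-1"], of h] by simp

lemma jac_cong:
  assumes "h \<in> jac n g" "\<forall>\<^sub>F z in near_origin n. h z = k z"
  shows "k \<in> jac n g"
proof -
  obtain a where a: "\<forall>i<n. holomorphic_germ n (a i)" "\<forall>\<^sub>F z in near_origin n. h z = (\<Sum>i<n. a i z * partial_deriv i g z)"
    using assms by (auto simp: jac_def)
  have "\<forall>\<^sub>F z in near_origin n. k z = (\<Sum>i<n. a i z * partial_deriv i g z)"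
    using a(2) assms(2) by eventually_elim simp
  thus ?thesis using a hg_cong[OF assms(2) jac_hg[OF assms(1)]] by (auto simp: jac_def)
qed

lemma jac_zero: "(\<lambda>_. 0) \<in> jac n g"
  unfolding jac_def by (auto intro!: exI[of _ "\<lambda>_ _. 0"])

lemma jac_sum: "(\<And>i. i \<in> I \<Longrightarrow> h i \<in> jac n g) \<Longrightarrow> (\<lambda>z. \<Sum>i\<in>I. h i z) \<in> jac n g"
  by (induction I rule: infinite_finite_induct) (auto intro: jac_zero jac_add)

lemma jac_unit:
  assumes u: "u \<in> jac n g" "u origin \<noteq> 0" and h: "holomorphic_germ n h"
  shows "h \<in> jac n g"
proof -
  obtain v where v: "holomorphic_germ n v" "\<forall>\<^sub>F z in near_origin n. u z \<noteq> 0 \<and> v z = inverse (u z)"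
    using hg_inverse[OF jac_hg[OF u(1)] u(2)] by blast
  have "(\<lambda>z. (h z * v z) * u z) \<in> jac n g" by (rule jac_mult[OF u(1)]) (use h v in auto)
  moreover have "\<forall>\<^sub>F z in near_origin n. (h z * v z) * u z = h z" using v(2) by eventually_elim simp
  ultimately show ?thesis by (rule jac_cong)
qed

subsection \<open>The Milnor algebra\<close>

lemma cring_hol_fun_ring: "cring (hol_fun_ring n)"
proof (intro cringI abelian_groupI comm_monoidI)
  fix f assume "f \<in> carrier (hol_fun_ring n)"
  thus "\<exists>h\<in>carrier (hol_fun_ring n). h \<oplus>\<^bsub>hol_fun_ring n\<^esub> f = \<zero>\<^bsub>hol_fun_ring n\<^esub>"
    by (intro bexI[of _ "\<lambda>z. - f z"]) (auto simp: hol_fun_ring_def)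
qed (auto simp: hol_fun_ring_def algebra_simps)

lemma a_inv_hol_fun_ring:
  assumes "holomorphic_germ n f"
  shows "\<ominus>\<^bsub>hol_fun_ring n\<^esub> f = (\<lambda>z. - f z)"
proof -
  interpret R: cring "hol_fun_ring n" by (rule cring_hol_fun_ring)
  show ?thesis by (rule R.minus_equality) (use assms in \<open>auto simp: hol_fun_ring_def\<close>)
qed

lemma ideal_null_germs: "ideal (null_germs n) (hol_fun_ring n)"
proof -
  interpret R: cring "hol_fun_ring n" by (rule cring_hol_fun_ring)
  show ?thesis
  proof (rule idealI)
    show "ring (hol_fun_ring n)" by (rule R.ring_axioms)
    show "subgroup (null_germs n) (add_monoid (hol_fun_ring n))"
    proof (rule R.add.subgroupI)
      show "null_germs n \<subseteq> carrier (hol_fun_ring n)" by (auto simp: null_germs_def hol_fun_ring_def)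
      have "(\<lambda>_. 0) \<in> null_germs n" by (auto simp: null_germs_def)
      thus "null_germs n \<noteq> {}" by blast
      show "\<ominus>\<^bsub>hol_fun_ring n\<^esub> a \<in> null_germs n" if "a \<in> null_germs n" for a
        using that by (auto simp: null_germs_def a_inv_hol_fun_ring)
      show "a \<oplus>\<^bsub>hol_fun_ring n\<^esub> b \<in> null_germs n" if "a \<in> null_germs n" "b \<in> null_germs n" for a b
        using that by (auto simp: null_germs_def hol_fun_ring_def elim: eventually_elim2)
    qed
    show "x \<otimes>\<^bsub>hol_fun_ring n\<^esub> a \<in> null_germs n" "a \<otimes>\<^bsub>hol_fun_ring n\<^esub> x \<in> null_germs n"
      if "a \<in> null_germs n" "x \<in> carrier (hol_fun_ring n)" for a x
      using that by (auto simp: null_germs_def hol_fun_ring_def elim: eventually_mono)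
  qed
qed

lemma cring_germ_ring: "cring (germ_ring n)"
  unfolding germ_ring_def by (rule ideal.quotient_is_cring[OF ideal_null_germs cring_hol_fun_ring])

lemma germ_hom: "germ n \<in> ring_hom (hol_fun_ring n) (germ_ring n)"
  using ideal.rcos_ring_hom[OF ideal_null_germs[of n]] unfolding germ_ring_def germ_def[abs_def] .

lemma germ_closed: "holomorphic_germ n f \<Longrightarrow> germ n f \<in> carrier (germ_ring n)"
  using ring_hom_closed[OF germ_hom] by (simp add: hol_fun_ring_def)

lemma germ_mult: "holomorphic_germ n f \<Longrightarrow> holomorphic_germ n g \<Longrightarrow>
    germ n f \<otimes>\<^bsub>germ_ring n\<^esub> germ n g = germ n (\<lambda>z. f z * g z)"
  using ring_hom_mult[OF germ_hom, of f n g] by (simp add: hol_fun_ring_def)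

lemma germ_add: "holomorphic_germ n f \<Longrightarrow> holomorphic_germ n g \<Longrightarrow>
    germ n f \<oplus>\<^bsub>germ_ring n\<^esub> germ n g = germ n (\<lambda>z. f z + g z)"
  using ring_hom_add[OF germ_hom, of f n g] by (simp add: hol_fun_ring_def)

lemma germ_one: "germ n (\<lambda>_. 1) = \<one>\<^bsub>germ_ring n\<^esub>"
  using ring_hom_one[OF germ_hom, of n] by (simp add: hol_fun_ring_def)

lemma germ_surj:
  assumes "x \<in> carrier (germ_ring n)"
  obtains f where "holomorphic_germ n f" "x = germ n f"
  using assms by (auto simp: germ_ring_def FactRing_def A_RCOSETS_def' germ_def hol_fun_ring_def)

lemma germ_eqD:
  assumes "germ n f = germ n g" "holomorphic_germ n f" "holomorphic_germ n g"
  shows "\<forall>\<^sub>F z in near_origin n. f z = g z"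
proof -
  interpret I: ideal "null_germs n" "hol_fun_ring n" by (rule ideal_null_germs)
  have "f \<in> null_germs n +>\<^bsub>hol_fun_ring n\<^esub> f" by (rule I.a_rcos_self) (use assms in \<open>simp add: hol_fun_ring_def\<close>)
  hence "f \<in> null_germs n +>\<^bsub>hol_fun_ring n\<^esub> g" using assms(1) by (simp add: germ_def)
  then obtain h where "h \<in> null_germs n" "f = (\<lambda>z. h z + g z)"
    by (auto simp: a_r_coset_def' hol_fun_ring_def)
  thus ?thesis by (auto simp: null_germs_def elim: eventually_mono)
qed

lemma germ_zero: "germ n (\<lambda>_. 0) = \<zero>\<^bsub>germ_ring n\<^esub>"
proof -
  interpret G: cring "germ_ring n" by (rule cring_germ_ring)
  have "germ n (\<lambda>_. 0) \<oplus>\<^bsub>germ_ring n\<^esub> germ n (\<lambda>_. 0) = germ n (\<lambda>_. 0)"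
    by (simp add: germ_add hg_const)
  thus ?thesis using germ_closed[OF hg_const[of n 0]] by (metis G.add.l_cancel_one')
qed

lemma germ_uminus: "holomorphic_germ n f \<Longrightarrow> \<ominus>\<^bsub>germ_ring n\<^esub> germ n f = germ n (\<lambda>z. - f z)"
proof -
  interpret G: cring "germ_ring n" by (rule cring_germ_ring)
  assume f: "holomorphic_germ n f"
  have "germ n (\<lambda>z. - f z) \<oplus>\<^bsub>germ_ring n\<^esub> germ n f = \<zero>\<^bsub>germ_ring n\<^esub>"
    using germ_add[OF hg_uminus[OF f] f] by (simp add: germ_zero)
  thus ?thesis by (rule G.minus_equality) (use f in \<open>auto intro: germ_closed\<close>)
qed

lemma jac_gens: "{germ n (partial_deriv i g) | i. i < n} \<subseteq> carrier (germ_ring n)" if "holomorphic_germ n g"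
  using that by (auto intro: germ_closed)

lemma jacobian_ideal: "holomorphic_germ n g \<Longrightarrow> ideal (jacobian_ideal n g) (germ_ring n)"
  unfolding jacobian_ideal_def
  by (rule ring.genideal_ideal[OF cring.axioms(1)[OF cring_germ_ring] jac_gens])

text \<open>In one direction, the germs of members of \<open>jac\<close> form an ideal that contains
  the generators, hence the generated ideal. In the other, the sum is built up generator by
  generator, and a function that agrees with it near the origin has the same germ.\<close>

lemma germ_in_jacobian_ideal:
  assumes g: "holomorphic_germ n g" and f: "holomorphic_germ n f"
  shows "germ n f \<in> jacobian_ideal n g \<longleftrightarrow> f \<in> jac n g"
proof
  interpret G: cring "germ_ring n" by (rule cring_germ_ring)
  have "ideal (germ n ` jac n g) (germ_ring n)"
  proof (rule idealI[OF G.ring_axioms])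
    show "subgroup (germ n ` jac n g) (add_monoid (germ_ring n))"
    proof (rule G.add.subgroupI)
      show "germ n ` jac n g \<subseteq> carrier (germ_ring n)" using jac_hg germ_closed by blast
      show "germ n ` jac n g \<noteq> {}" using jac_zero by blast
      show "\<ominus>\<^bsub>germ_ring n\<^esub> a \<in> germ n ` jac n g" if "a \<in> germ n ` jac n g" for a
      proof -
        from that obtain h where h: "h \<in> jac n g" "a = germ n h" by blast
        thus ?thesis using germ_uminus[OF jac_hg[OF h(1)]] jac_cmult[OF h(1), of "-1"] by auto
      qed
      show "a \<oplus>\<^bsub>germ_ring n\<^esub> b \<in> germ n ` jac n g" if "a \<in> germ n ` jac n g" "b \<in> germ n ` jac n g" for a b
        using that germ_add jac_hg jac_add by (smt (verit) image_iff)
    qed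
    have *: "x \<otimes>\<^bsub>germ_ring n\<^esub> a \<in> germ n ` jac n g" if "a \<in> germ n ` jac n g" "x \<in> carrier (germ_ring n)" for a x
    proof -
      obtain h where h: "h \<in> jac n g" "a = germ n h" using \<open>a \<in> germ n ` jac n g\<close> by blast
      obtain k where k: "holomorphic_germ n k" "x = germ n k" using germ_surj[OF \<open>x \<in> carrier (germ_ring n)\<close>] by blast
      show ?thesis using jac_mult[OF h(1) k(1)] germ_mult[OF k(1) jac_hg[OF h(1)]] k(2) h(2) by auto
    qed
    show "x \<otimes>\<^bsub>germ_ring n\<^esub> a \<in> germ n ` jac n g" if "a \<in> germ n ` jac n g" "x \<in> carrier (germ_ring n)" for a x
      by (rule *[OF that])
    show "a \<otimes>\<^bsub>germ_ring n\<^esub> x \<in> germ n ` jac n g" if "a \<in> germ n ` jac n g" "x \<in> carrier (germ_ring n)" for a x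
      using *[OF that] that germ_closed jac_hg by (subst G.m_comm) auto
  qed
  hence sub: "jacobian_ideal n g \<subseteq> germ n ` jac n g"
    unfolding jacobian_ideal_def by (rule G.genideal_minimal) (use jac_partial[OF g] in blast)
  assume "germ n f \<in> jacobian_ideal n g"
  then obtain h where h: "h \<in> jac n g" "germ n f = germ n h" using sub by blast
  from germ_eqD[OF h(2) f jac_hg[OF h(1)]]
  have "\<forall>\<^sub>F z in near_origin n. h z = f z" by (rule eventually_mono) simp
  with h(1) show "f \<in> jac n g" by (rule jac_cong)
next
  interpret G: cring "germ_ring n" by (rule cring_germ_ring)
  interpret I: ideal "jacobian_ideal n g" "germ_ring n" by (rule jacobian_ideal[OF g])
  assume "f \<in> jac n g"
  then obtain a where a: "\<forall>i<n. holomorphic_germ n (a i)"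
      "\<forall>\<^sub>F z in near_origin n. f z = (\<Sum>i<n. a i z * partial_deriv i g z)"
    by (auto simp: jac_def)
  have gen: "germ n (partial_deriv i g) \<in> jacobian_ideal n g" if "i < n" for i
    unfolding jacobian_ideal_def using G.genideal_self[OF jac_gens[OF g]] that by blast
  have *: "germ n (\<lambda>z. \<Sum>i<m. a i z * partial_deriv i g z) \<in> jacobian_ideal n g" if "m \<le> n" for m
    using that
  proof (induction m)
    case 0 thus ?case by (simp add: germ_zero)
  next
    case (Suc m)
    have hg: "holomorphic_germ n (\<lambda>z. a m z * partial_deriv m g z)" using Suc a g by (intro hg_mult hg_partial) auto
    have "germ n (a m) \<otimes>\<^bsub>germ_ring n\<^esub> germ n (partial_deriv m g) \<in> jacobian_ideal n g"
      using Suc a by (intro I.I_l_closed gen germ_closed) auto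
    hence "germ n (\<lambda>z. a m z * partial_deriv m g z) \<in> jacobian_ideal n g"
      using Suc a g by (subst (asm) germ_mult) auto
    with Suc have "germ n (\<lambda>z. \<Sum>i<m. a i z * partial_deriv i g z) \<oplus>\<^bsub>germ_ring n\<^esub> germ n (\<lambda>z. a m z * partial_deriv m g z) \<in> jacobian_ideal n g"
      by (intro I.a_closed) auto
    moreover have "holomorphic_germ n (\<lambda>z. \<Sum>i<m. a i z * partial_deriv i g z)"
      using Suc a g by (intro hg_sum hg_mult hg_partial) auto
    ultimately show ?case using hg by (simp add: germ_add)
  qed
  have hs: "holomorphic_germ n (\<lambda>z. \<Sum>i<n. a i z * partial_deriv i g z)"
    using a g by (intro hg_sum hg_mult hg_partial) auto
  have "(\<lambda>z. f z - (\<Sum>i<n. a i z * partial_deriv i g z)) \<in> null_germs n"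
    using a(2) f hs by (auto simp: null_germs_def elim: eventually_mono)
  hence "germ n (\<lambda>z. f z - (\<Sum>i<n. a i z * partial_deriv i g z)) = \<zero>\<^bsub>germ_ring n\<^esub>"
    unfolding germ_def using ideal.Icarr[OF ideal_null_germs]
    by (simp add: germ_ring_def FactRing_def abelian_subgroup.a_rcos_const[OF abelian_subgroupI3[OF ideal.axioms(1)[OF ideal_null_germs] ring.is_abelian_group[OF cring.axioms(1)[OF cring_hol_fun_ring]]]])
  hence "germ n (\<lambda>z. f z - (\<Sum>i<n. a i z * partial_deriv i g z)) \<in> jacobian_ideal n g" by simp
  from I.a_closed[OF this *[OF order_refl]]
  show "germ n f \<in> jacobian_ideal n g" using hs f by (subst (asm) germ_add) auto
qed

text \<open>Spanning sets of the Milnor algebra described by functions. The index set is arbitrary,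
  so that monomials can be indexed by exponent pairs and abstract bases by numbers.\<close>

definition spans_mod :: "nat \<Rightarrow> (cvec \<Rightarrow> complex) \<Rightarrow> 'i set \<Rightarrow> ('i \<Rightarrow> cvec \<Rightarrow> complex) \<Rightarrow> bool" where
  "spans_mod n g I e \<longleftrightarrow> finite I \<and> (\<forall>i\<in>I. holomorphic_germ n (e i)) \<and>
     (\<forall>f. holomorphic_germ n f \<longrightarrow> (\<exists>c. (\<lambda>z. f z - (\<Sum>i\<in>I. c i * e i z)) \<in> jac n g))"

definition indep_mod :: "nat \<Rightarrow> (cvec \<Rightarrow> complex) \<Rightarrow> 'i set \<Rightarrow> ('i \<Rightarrow> cvec \<Rightarrow> complex) \<Rightarrow> bool" where
  "indep_mod n g I e \<longleftrightarrow> finite I \<and> (\<forall>i\<in>I. holomorphic_germ n (e i)) \<and>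
     (\<forall>c. (\<lambda>z. \<Sum>i\<in>I. c i * e i z) \<in> jac n g \<longrightarrow> (\<forall>i\<in>I. c i = 0))"

lemma spans_mod_reindex:
  assumes "bij_betw b K I" "spans_mod n g I e"
  shows "spans_mod n g K (e \<circ> b)"
proof -
  have b: "b ` K = I" using assms by (auto simp: bij_betw_def)
  have 1: "(\<Sum>i\<in>I. c i * e i z) = (\<Sum>k\<in>K. (c \<circ> b) k * (e \<circ> b) k z)" for c z
    using sum.reindex_bij_betw[OF assms(1), of "\<lambda>i. c i * e i z"] by simp
  have "\<exists>c. (\<lambda>z. f z - (\<Sum>k\<in>K. c k * (e \<circ> b) k z)) \<in> jac n g" if f: "holomorphic_germ n f" for f
  proof -
    obtain c where "(\<lambda>z. f z - (\<Sum>i\<in>I. c i * e i z)) \<in> jac n g" using assms(2) f unfolding spans_mod_def by blast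
    thus ?thesis unfolding 1 by blast
  qed
  moreover have "finite K" using assms bij_betw_finite by (auto simp: spans_mod_def)
  moreover have "\<forall>k\<in>K. holomorphic_germ n ((e \<circ> b) k)" using assms(2) b by (auto simp: spans_mod_def)
  ultimately show ?thesis unfolding spans_mod_def by blast
qed

lemma indep_mod_reindex:
  assumes "bij_betw b K I" "indep_mod n g I e"
  shows "indep_mod n g K (e \<circ> b)"
proof -
  have b: "inj_on b K" "b ` K = I" using assms by (auto simp: bij_betw_def)
  have 2: "(\<Sum>k\<in>K. c k * (e \<circ> b) k z) = (\<Sum>i\<in>I. (c \<circ> the_inv_into K b) i * e i z)" for c z
    unfolding b(2)[symmetric] using b by (subst sum.reindex) (auto simp: the_inv_into_f_f)
  have "\<forall>k\<in>K. c k = 0" if "(\<lambda>z. \<Sum>k\<in>K. c k * (e \<circ> b) k z) \<in> jac n g" for c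
  proof -
    have "\<forall>i\<in>I. (c \<circ> the_inv_into K b) i = 0" using that assms(2) unfolding 2 indep_mod_def by blast
    thus ?thesis using b by (auto simp: the_inv_into_f_f)
  qed
  thus ?thesis using assms(2) b bij_betw_finite[OF assms(1)] unfolding indep_mod_def by (auto simp: comp_def)
qed

text \<open>In the zero ring the scalars do not form a subfield, so the dimension has to be read off
  its inductive definition: a space that contains zero is already everything, and no vector is left
  to extend it.\<close>

lemma (in ring) dimension_of_zero:
  assumes "dimension n K {\<zero>}" "\<zero> \<in> K" "carrier R = {\<zero>}"
  shows "n = 0"
proof -
  have z: "\<zero> \<in> E" if "dimension m K' E" "\<zero> \<in> K'" for m K' E using that
  proof (induction rule: dimension.induct)
    case (Suc_dim v E n K')
    thus ?case using assms(3) by (auto simp: line_extension_mem_iff intro!: bexI[of _ \<zero>])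
  qed simp
  show ?thesis using assms(1)
  proof cases
    case (Suc_dim v E m)
    have "v = \<zero>" using Suc_dim(3) assms(3) by blast
    thus ?thesis using z[OF Suc_dim(5) assms(2)] Suc_dim(4) by blast
  qed simp
qed

context
  fixes n g assumes g: "holomorphic_germ n g"
begin

definition mproj :: "(cvec \<Rightarrow> complex) \<Rightarrow> (cvec \<Rightarrow> complex) set set" where
  "mproj f = jacobian_ideal n g +>\<^bsub>germ_ring n\<^esub> germ n f"

abbreviation "MA \<equiv> milnor_algebra n g"
abbreviation "MK \<equiv> milnor_scalars n g"

lemma cring_MA: "cring MA"
  unfolding milnor_algebra_def by (rule ideal.quotient_is_cring[OF jacobian_ideal[OF g] cring_germ_ring])

lemma mproj_hom: "(+>\<^bsub>germ_ring n\<^esub>) (jacobian_ideal n g) \<in> ring_hom (germ_ring n) MA"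
  unfolding milnor_algebra_def by (rule ideal.rcos_ring_hom[OF jacobian_ideal[OF g]])

lemma mproj_closed: "holomorphic_germ n f \<Longrightarrow> mproj f \<in> carrier MA"
  unfolding mproj_def by (rule ring_hom_closed[OF mproj_hom germ_closed])

lemma mproj_mult: "holomorphic_germ n f \<Longrightarrow> holomorphic_germ n h \<Longrightarrow> mproj f \<otimes>\<^bsub>MA\<^esub> mproj h = mproj (\<lambda>z. f z * h z)"
  unfolding mproj_def using ring_hom_mult[OF mproj_hom germ_closed germ_closed, of f h] by (simp add: germ_mult)

lemma mproj_add: "holomorphic_germ n f \<Longrightarrow> holomorphic_germ n h \<Longrightarrow> mproj f \<oplus>\<^bsub>MA\<^esub> mproj h = mproj (\<lambda>z. f z + h z)"
  unfolding mproj_def using ring_hom_add[OF mproj_hom germ_closed germ_closed, of f h] by (simp add: germ_add)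

lemma mproj_one: "mproj (\<lambda>_. 1) = \<one>\<^bsub>MA\<^esub>"
  unfolding mproj_def using ring_hom_one[OF mproj_hom] by (simp add: germ_one)

lemma mproj_surj:
  assumes "x \<in> carrier MA"
  obtains f where "holomorphic_germ n f" "x = mproj f"
proof -
  obtain y where y: "y \<in> carrier (germ_ring n)" "x = jacobian_ideal n g +>\<^bsub>germ_ring n\<^esub> y"
    using assms by (auto simp: milnor_algebra_def FactRing_def A_RCOSETS_def')
  obtain f where "holomorphic_germ n f" "y = germ n f" by (rule germ_surj[OF y(1)])
  with y(2) show ?thesis by (intro that) (auto simp: mproj_def)
qed

lemma mproj_zero_iff:
  assumes "holomorphic_germ n f"
  shows "mproj f = \<zero>\<^bsub>MA\<^esub> \<longleftrightarrow> f \<in> jac n g"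
proof -
  interpret I: ideal "jacobian_ideal n g" "germ_ring n" by (rule jacobian_ideal[OF g])
  have "mproj f = jacobian_ideal n g \<longleftrightarrow> germ n f \<in> jacobian_ideal n g"
    unfolding mproj_def using I.a_rcos_const I.a_rcos_self[OF germ_closed[OF assms]] by metis
  thus ?thesis using germ_in_jacobian_ideal[OF g assms] by (simp add: milnor_algebra_def FactRing_def)
qed

lemma mproj_eq_iff:
  assumes "holomorphic_germ n f" "holomorphic_germ n h"
  shows "mproj f = mproj h \<longleftrightarrow> (\<lambda>z. f z - h z) \<in> jac n g"
proof -
  interpret A: cring MA by (rule cring_MA)
  have e: "mproj (\<lambda>z. f z - h z) \<oplus>\<^bsub>MA\<^esub> mproj h = mproj f"
    using assms by (subst mproj_add) auto
  have "mproj (\<lambda>z. f z - h z) = \<zero>\<^bsub>MA\<^esub> \<longleftrightarrow> mproj f = mproj h"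
    using A.add.r_cancel_one[OF mproj_closed[OF assms(2)] mproj_closed[OF hg_diff[OF assms]]] e by auto
  thus ?thesis using mproj_zero_iff[OF hg_diff[OF assms]] by simp
qed

lemma MK_eq: "MK = range (\<lambda>c. mproj (\<lambda>_. c))"
  by (simp add: milnor_scalars_def mproj_def)

lemma mproj_const_zero: "mproj (\<lambda>_. 0) = \<zero>\<^bsub>MA\<^esub>"
  using mproj_zero_iff[OF hg_const] jac_zero by simp

lemma subfield_MK:
  assumes "(\<lambda>_. 1) \<notin> jac n g"
  shows "subfield MK MA"
proof -
  interpret A: cring MA by (rule cring_MA)
  have one: "\<one>\<^bsub>MA\<^esub> \<noteq> \<zero>\<^bsub>MA\<^esub>" using mproj_zero_iff[OF hg_const, of 1] assms mproj_one by simp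
  have sub: "subring MK MA"
  proof (rule A.subringI)
    show "MK \<subseteq> carrier MA" using mproj_closed by (auto simp: MK_eq)
    show "\<one>\<^bsub>MA\<^esub> \<in> MK" by (auto simp: MK_eq mproj_one[symmetric])
    fix h assume "h \<in> MK"
    then obtain c where c: "h = mproj (\<lambda>_. c)" by (auto simp: MK_eq)
    have "mproj (\<lambda>_. - c) \<oplus>\<^bsub>MA\<^esub> h = \<zero>\<^bsub>MA\<^esub>" using c by (simp add: mproj_add hg_const mproj_const_zero)
    hence "\<ominus>\<^bsub>MA\<^esub> h = mproj (\<lambda>_. - c)" by (rule A.minus_equality) (auto simp: c intro: mproj_closed)
    thus "\<ominus>\<^bsub>MA\<^esub> h \<in> MK" by (auto simp: MK_eq)
  next
    fix h1 h2 assume "h1 \<in> MK" "h2 \<in> MK"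
    then obtain c d where c: "h1 = mproj (\<lambda>_. c)" "h2 = mproj (\<lambda>_. d)" by (auto simp: MK_eq)
    show "h1 \<otimes>\<^bsub>MA\<^esub> h2 \<in> MK" "h1 \<oplus>\<^bsub>MA\<^esub> h2 \<in> MK" 
      unfolding c by (auto simp: mproj_mult mproj_add hg_const MK_eq)
  qed
  show ?thesis
  proof (rule A.subfieldI[OF A.subcringI[OF sub]])
    show "h1 \<otimes>\<^bsub>MA\<^esub> h2 = h2 \<otimes>\<^bsub>MA\<^esub> h1" if "h1 \<in> MK" "h2 \<in> MK" for h1 h2
      using that subringE(1)[OF sub] by (intro A.m_comm) auto
    show "Units (MA \<lparr>carrier := MK\<rparr>) = MK - {\<zero>\<^bsub>MA\<^esub>}"
    proof
      show "Units (MA \<lparr>carrier := MK\<rparr>) \<subseteq> MK - {\<zero>\<^bsub>MA\<^esub>}"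
        using one subringE(1)[OF sub] by (auto simp: Units_def)
      show "MK - {\<zero>\<^bsub>MA\<^esub>} \<subseteq> Units (MA \<lparr>carrier := MK\<rparr>)"
      proof
        fix k assume k: "k \<in> MK - {\<zero>\<^bsub>MA\<^esub>}"
        then obtain c where c: "k = mproj (\<lambda>_. c)" by (auto simp: MK_eq)
        have c0: "c \<noteq> 0" using k c mproj_const_zero by auto
        have "mproj (\<lambda>_. inverse c) \<otimes>\<^bsub>MA\<^esub> k = \<one>\<^bsub>MA\<^esub>" "k \<otimes>\<^bsub>MA\<^esub> mproj (\<lambda>_. inverse c) = \<one>\<^bsub>MA\<^esub>"
          using c0 unfolding c by (simp_all add: mproj_mult hg_const mproj_one)
        thus "k \<in> Units (MA \<lparr>carrier := MK\<rparr>)" using k by (auto simp: Units_def MK_eq)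
      qed
    qed
  qed
qed

lemma combine_mproj:
  assumes "\<forall>i<k. holomorphic_germ n (e i)" "length cs = k"
  shows "ring.combine MA (map (\<lambda>c. mproj (\<lambda>_. c)) cs) (map (\<lambda>i. mproj (e i)) [0..<k]) =
     mproj (\<lambda>z. \<Sum>i<k. cs ! i * e i z)"
  using assms
proof (induction cs arbitrary: k e)
  interpret A: cring MA by (rule cring_MA)
  case Nil thus ?case by (simp add: mproj_const_zero)
next
  interpret A: cring MA by (rule cring_MA)
  case (Cons c cs)
  then obtain m where m: "k = Suc m" "length cs = m" by (cases k) auto
  have l: "[0..<k] = 0 # map Suc [0..<m]" using m by (simp add: map_Suc_upt upt_conv_Cons)
  have hg: "holomorphic_germ n (e 0)" "\<forall>i<m. holomorphic_germ n (e (Suc i))" using Cons.prems m by auto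
  have "map (\<lambda>i. mproj (e i)) (map Suc [0..<m]) = map (\<lambda>i. mproj ((e \<circ> Suc) i)) [0..<m]" by simp
  hence "A.combine (map (\<lambda>c. mproj (\<lambda>_. c)) (c # cs)) (map (\<lambda>i. mproj (e i)) [0..<k])
      = mproj (\<lambda>_. c) \<otimes>\<^bsub>MA\<^esub> mproj (e 0) \<oplus>\<^bsub>MA\<^esub> mproj (\<lambda>z. \<Sum>i<m. cs ! i * e (Suc i) z)"
    using Cons.IH[of m "e \<circ> Suc"] hg m unfolding l by (simp add: comp_def)
  also have "\<dots> = mproj (\<lambda>z. c * e 0 z + (\<Sum>i<m. cs ! i * e (Suc i) z))"
    using hg by (subst mproj_mult, blast, blast, subst mproj_add) (auto intro!: hg_sum)
  also have "(\<lambda>z. c * e 0 z + (\<Sum>i<m. cs ! i * e (Suc i) z)) = (\<lambda>z. \<Sum>i<k. (c # cs) ! i * e i z)"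
    unfolding m(1) by (subst sum.lessThan_Suc_shift) simp
  finally show ?case .
qed

lemma MK_list:
  assumes "set Ks \<subseteq> MK"
  obtains cs where "length cs = length Ks" "Ks = map (\<lambda>c. mproj (\<lambda>_. c)) cs"
  using assms
proof (induction Ks arbitrary: thesis)
  case (Cons k Ks)
  then obtain cs where "length cs = length Ks" "Ks = map (\<lambda>c. mproj (\<lambda>_. c)) cs" by auto
  moreover obtain c where "k = mproj (\<lambda>_. c)" using Cons by (auto simp: MK_eq)
  ultimately show ?case by (intro Cons.prems(1)[of "c # cs"]) auto
qed auto

lemma independent_mproj:
  assumes "subfield MK MA" and e: "\<forall>i<k. holomorphic_germ n (e i)"
  shows "ring.independent MA MK (map (\<lambda>i. mproj (e i)) [0..<k]) \<longleftrightarrow> indep_mod n g {..<k} e"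
proof
  interpret A: cring MA by (rule cring_MA)
  assume L: "A.independent MK (map (\<lambda>i. mproj (e i)) [0..<k])"
  have "\<forall>i<k. c i = 0" if "(\<lambda>z. \<Sum>i<k. c i * e i z) \<in> jac n g" for c
  proof -
    let ?Ks = "map (\<lambda>c. mproj (\<lambda>_. c)) (map c [0..<k])"
    have "A.combine ?Ks (map (\<lambda>i. mproj (e i)) [0..<k]) = mproj (\<lambda>z. \<Sum>i<k. map c [0..<k] ! i * e i z)"
      by (rule combine_mproj[OF e]) simp
    also have "(\<lambda>z. \<Sum>i<k. map c [0..<k] ! i * e i z) = (\<lambda>z. \<Sum>i<k. c i * e i z)" by simp
    also have "mproj \<dots> = \<zero>\<^bsub>MA\<^esub>" using that jac_hg[OF that] mproj_zero_iff by blast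
    finally have "set (take k ?Ks) \<subseteq> {\<zero>\<^bsub>MA\<^esub>}"
      using A.independent_imp_trivial_combine[OF assms(1) L, of ?Ks] by (force simp: MK_eq)
    moreover have "mproj (\<lambda>_. c i) \<in> set (take k ?Ks)" if "i < k" for i using that by simp
    ultimately have "mproj (\<lambda>_. c i) = \<zero>\<^bsub>MA\<^esub>" if "i < k" for i using that by blast
    moreover have "mproj (\<lambda>_. x) \<noteq> \<zero>\<^bsub>MA\<^esub>" if "x \<noteq> 0" for x
    proof
      assume "mproj (\<lambda>_. x) = \<zero>\<^bsub>MA\<^esub>"
      hence "(\<lambda>_. x) \<in> jac n g" using mproj_zero_iff[OF hg_const] by simp
      from jac_unit[OF this that hg_const] have "mproj (\<lambda>_. 1) = \<zero>\<^bsub>MA\<^esub>" using mproj_zero_iff[OF hg_const] by simp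
      thus False using mproj_one subfieldE(6)[OF assms(1)] by simp
    qed
    ultimately show ?thesis by blast
  qed
  thus "indep_mod n g {..<k} e" using e by (simp add: indep_mod_def)
next
  interpret A: cring MA by (rule cring_MA)
  assume R: "indep_mod n g {..<k} e"
  show "A.independent MK (map (\<lambda>i. mproj (e i)) [0..<k])"
  proof (rule A.trivial_combine_imp_independent[OF assms(1)])
    show "set (map (\<lambda>i. mproj (e i)) [0..<k]) \<subseteq> carrier MA" using e mproj_closed by auto
    fix Ks assume Ks: "set Ks \<subseteq> MK" "A.combine Ks (map (\<lambda>i. mproj (e i)) [0..<k]) = \<zero>\<^bsub>MA\<^esub>"
    obtain cs where cs: "length cs = length Ks" "Ks = map (\<lambda>c. mproj (\<lambda>_. c)) cs" using MK_list[OF Ks(1)] .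
    \<comment> \<open>A coefficient list may have any length; it is cut down or padded with zeros to
      length \<open>k\<close>, which does not change the combination.\<close>
    define ds where "ds = take k cs @ replicate (k - length cs) 0"
    have ds: "length ds = k" by (auto simp: ds_def)
    have "map (\<lambda>c. mproj (\<lambda>_. c)) ds = take k Ks @ replicate (k - length cs) \<zero>\<^bsub>MA\<^esub>"
      by (simp add: ds_def cs(2) take_map mproj_const_zero)
    hence "A.combine (map (\<lambda>c. mproj (\<lambda>_. c)) ds) (map (\<lambda>i. mproj (e i)) [0..<k]) = \<zero>\<^bsub>MA\<^esub>"
      using Ks(2) A.combine_take[of "map (\<lambda>i. mproj (e i)) [0..<k]" Ks] e mproj_closed
        A.combine_append_replicate[of "map (\<lambda>i. mproj (e i)) [0..<k]" "take k Ks" "k - length cs"]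
      by (simp add: image_subset_iff)
    hence "mproj (\<lambda>z. \<Sum>i<k. ds ! i * e i z) = \<zero>\<^bsub>MA\<^esub>" using combine_mproj[OF e ds] by simp
    hence "(\<lambda>z. \<Sum>i<k. ds ! i * e i z) \<in> jac n g"
      by (subst (asm) mproj_zero_iff) (use e in \<open>auto intro!: hg_sum hg_mult\<close>)
    hence "\<forall>i<k. ds ! i = 0" using R by (auto simp: indep_mod_def)
    hence "\<forall>c\<in>set ds. c = 0" using ds by (auto simp: in_set_conv_nth)
    hence "\<forall>c\<in>set (take k cs). c = 0" by (auto simp: ds_def)
    thus "set (take (length (map (\<lambda>i. mproj (e i)) [0..<k])) Ks) \<subseteq> {\<zero>\<^bsub>MA\<^esub>}"
      by (auto simp: cs(2) take_map mproj_const_zero)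
  qed
qed

lemma Span_mproj:
  assumes "subfield MK MA" and e: "\<forall>i<k. holomorphic_germ n (e i)"
  shows "ring.Span MA MK (map (\<lambda>i. mproj (e i)) [0..<k]) = carrier MA \<longleftrightarrow> spans_mod n g {..<k} e"
proof -
  interpret A: cring MA by (rule cring_MA)
  let ?U = "map (\<lambda>i. mproj (e i)) [0..<k]"
  have U: "set ?U \<subseteq> carrier MA" using e mproj_closed by auto
  have mem: "mproj f \<in> A.Span MK ?U \<longleftrightarrow> (\<exists>c. (\<lambda>z. f z - (\<Sum>i<k. c i * e i z)) \<in> jac n g)"
    if f: "holomorphic_germ n f" for f
  proof
    assume "mproj f \<in> A.Span MK ?U"
    then obtain Ks where Ks: "set Ks \<subseteq> MK" "length Ks = k" "mproj f = A.combine Ks ?U"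
      using A.Span_mem_iff_length_version[OF assms(1) U] by auto
    obtain cs where cs: "length cs = length Ks" "Ks = map (\<lambda>c. mproj (\<lambda>_. c)) cs" using MK_list[OF Ks(1)] .
    have "mproj f = mproj (\<lambda>z. \<Sum>i<k. cs ! i * e i z)" 
      unfolding Ks(3) cs(2) by (rule combine_mproj[OF e]) (simp add: cs(1) Ks(2))
    hence "(\<lambda>z. f z - (\<Sum>i<k. cs ! i * e i z)) \<in> jac n g" 
      by (subst (asm) mproj_eq_iff[OF f]) (use e in \<open>auto intro!: hg_sum hg_mult\<close>)
    thus "\<exists>c. (\<lambda>z. f z - (\<Sum>i<k. c i * e i z)) \<in> jac n g" by (rule exI[of _ "\<lambda>i. cs ! i"])
  next
    assume "\<exists>c. (\<lambda>z. f z - (\<Sum>i<k. c i * e i z)) \<in> jac n g"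
    then obtain c where "(\<lambda>z. f z - (\<Sum>i<k. c i * e i z)) \<in> jac n g" by blast
    hence "mproj f = mproj (\<lambda>z. \<Sum>i<k. c i * e i z)" 
      by (subst mproj_eq_iff[OF f]) (use e in \<open>auto intro!: hg_sum hg_mult\<close>)
    also have "\<dots> = A.combine (map (\<lambda>c. mproj (\<lambda>_. c)) (map c [0..<k])) ?U"
      by (subst combine_mproj[OF e]) auto
    finally have "mproj f = A.combine (map (\<lambda>c. mproj (\<lambda>_. c)) (map c [0..<k])) ?U" .
    moreover have "set (map (\<lambda>c. mproj (\<lambda>_. c)) (map c [0..<k])) \<subseteq> MK" by (auto simp: MK_eq)
    moreover have "length (map (\<lambda>c. mproj (\<lambda>_. c)) (map c [0..<k])) = length ?U" by simp
    ultimately show "mproj f \<in> A.Span MK ?U"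
      using A.Span_mem_iff_length_version[OF assms(1) U] by blast
  qed
  have "A.Span MK ?U = carrier MA \<longleftrightarrow> (\<forall>f. holomorphic_germ n f \<longrightarrow> mproj f \<in> A.Span MK ?U)"
  proof
    assume *: "\<forall>f. holomorphic_germ n f \<longrightarrow> mproj f \<in> A.Span MK ?U"
    have "x \<in> A.Span MK ?U" if x: "x \<in> carrier MA" for x
    proof -
      obtain f where "holomorphic_germ n f" "x = mproj f" using mproj_surj[OF x] .
      thus ?thesis using * by blast
    qed
    thus "A.Span MK ?U = carrier MA" using A.Span_in_carrier[OF subfieldE(3)[OF assms(1)] U] by blast
  qed (use mproj_closed in blast)
  thus ?thesis using mem e by (auto simp: spans_mod_def)
qed

text \<open>Independent spanning lists in the quotient ring correspond to families of functions. If
  1 lies in the Jacobian ideal, then every germ does, and both sides say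
  \<open>k = 0\<close>.\<close>

lemma milnor_number_iff:
  "milnor_number n g = enat k \<longleftrightarrow> (\<exists>e::nat \<Rightarrow> _. spans_mod n g {..<k} e \<and> indep_mod n g {..<k} e)"
proof (cases "(\<lambda>_. 1) \<in> jac n g")
  case True
  interpret A: cring MA by (rule cring_MA)
  have all: "f \<in> jac n g" if "holomorphic_germ n f" for f by (rule jac_unit[OF True _ that]) simp
  have c: "carrier MA = {\<zero>\<^bsub>MA\<^esub>}"
  proof (intro equalityI subsetI)
    fix x assume "x \<in> carrier MA"
    then obtain f where "holomorphic_germ n f" "x = mproj f" by (rule mproj_surj)
    thus "x \<in> {\<zero>\<^bsub>MA\<^esub>}" using all mproj_zero_iff by simp
  qed simp
  have z: "\<zero>\<^bsub>MA\<^esub> \<in> MK" by (auto simp: MK_eq mproj_const_zero[symmetric])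
  have d: "A.dimension 0 MK {\<zero>\<^bsub>MA\<^esub>}" by simp
  have "A.dim MK {\<zero>\<^bsub>MA\<^esub>} = 0"
    unfolding A.dim_def using d A.dimension_of_zero[OF _ z c] by (intro the_equality) auto
  hence m: "milnor_number n g = 0"
    using d unfolding milnor_number_def Let_def c A.finite_dimension_def zero_enat_def by auto
  show ?thesis
  proof
    assume "milnor_number n g = enat k"
    hence "k = 0" using m by (simp add: zero_enat_def)
    thus "\<exists>e::nat \<Rightarrow> _. spans_mod n g {..<k} e \<and> indep_mod n g {..<k} e"
      using all by (auto simp: spans_mod_def indep_mod_def)
  next
    assume "\<exists>e::nat \<Rightarrow> _. spans_mod n g {..<k} e \<and> indep_mod n g {..<k} e"
    then obtain e :: "nat \<Rightarrow> _" where e: "indep_mod n g {..<k} e" by blast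
    hence "(\<lambda>z. \<Sum>i<k. (\<lambda>_. 1) i * e i z) \<in> jac n g"
      by (intro all hg_sum hg_mult) (auto simp: indep_mod_def)
    hence "\<forall>i<k. (1::complex) = 0" using e unfolding indep_mod_def
      by (elim conjE allE[of _ "\<lambda>_. 1"]) auto
    hence "k = 0" by auto
    thus "milnor_number n g = enat k" using m by (simp add: zero_enat_def)
  qed
next
  case False
  interpret A: cring MA by (rule cring_MA)
  note K = subfield_MK[OF False]
  have "milnor_number n g = enat k \<longleftrightarrow> A.dimension k MK (carrier MA)"
    using A.dimI[OF K] by (auto simp: milnor_number_def Let_def over_def intro: A.finite_dimensionI
      elim!: A.finite_dimensionE')
  also have "\<dots> \<longleftrightarrow> (\<exists>e::nat \<Rightarrow> _. spans_mod n g {..<k} e \<and> indep_mod n g {..<k} e)"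
  proof
    assume "A.dimension k MK (carrier MA)"
    then obtain Vs where Vs: "set Vs \<subseteq> carrier MA" "A.independent MK Vs" "length Vs = k" "A.Span MK Vs = carrier MA"
      using A.exists_base[OF K] by blast
    have "\<forall>i. \<exists>f. i < k \<longrightarrow> holomorphic_germ n f \<and> Vs ! i = mproj f"
      using Vs mproj_surj by (metis nth_mem subsetD)
    then obtain e where e: "\<And>i. i < k \<Longrightarrow> holomorphic_germ n (e i)" "\<And>i. i < k \<Longrightarrow> Vs ! i = mproj (e i)" by metis
    have "Vs = map (\<lambda>i. mproj (e i)) [0..<k]" using Vs(3) e(2) by (intro nth_equalityI) auto
    thus "\<exists>e::nat \<Rightarrow> _. spans_mod n g {..<k} e \<and> indep_mod n g {..<k} e"
      using Vs(2,4) Span_mproj[OF K, of k e] independent_mproj[OF K, of k e] e(1) by blast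
  next
    assume "\<exists>e::nat \<Rightarrow> _. spans_mod n g {..<k} e \<and> indep_mod n g {..<k} e"
    then obtain e :: "nat \<Rightarrow> _" where e: "spans_mod n g {..<k} e" "indep_mod n g {..<k} e" by blast
    hence hg: "\<forall>i<k. holomorphic_germ n (e i)" by (auto simp: spans_mod_def)
    show "A.dimension k MK (carrier MA)"
      using A.dimensionI[of MK "map (\<lambda>i. mproj (e i)) [0..<k]" "carrier MA", OF K]
        Span_mproj[OF K hg] independent_mproj[OF K hg] e by simp
  qed
  finally show ?thesis .
qed

lemma indep_mod_card_le:
  assumes m: "milnor_number n g = enat k" and e: "indep_mod n g I e"
  shows "card I \<le> k"
proof (cases "(\<lambda>_. 1) \<in> jac n g")
  case True
  have all: "f \<in> jac n g" if "holomorphic_germ n f" for f by (rule jac_unit[OF True _ that]) simp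
  have "(\<lambda>z. \<Sum>i\<in>I. (\<lambda>_. 1) i * e i z) \<in> jac n g"
    using e by (intro all hg_sum hg_mult) (auto simp: indep_mod_def)
  hence "\<forall>i\<in>I. (1::complex) = 0" using e unfolding indep_mod_def
    by (elim conjE allE[of _ "\<lambda>_. 1"]) auto
  hence "I = {}" by auto
  thus ?thesis by simp
next
  case False
  interpret A: cring MA by (rule cring_MA)
  note K = subfield_MK[OF False]
  have fin: "finite I" using e by (simp add: indep_mod_def)
  obtain b where "bij_betw b {0..<card I} I" using ex_bij_betw_nat_finite[OF fin] by blast
  hence b: "bij_betw b {..<card I} I" by (simp add: lessThan_atLeast0)
  have ib: "indep_mod n g {..<card I} (e \<circ> b)" by (rule indep_mod_reindex[OF b e])
  hence hg: "\<forall>i<card I. holomorphic_germ n ((e \<circ> b) i)" by (auto simp: indep_mod_def)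
  have "A.dimension k MK (carrier MA)"
    using m A.dimI[OF K] A.finite_dimensionE[OF K] by (auto simp: milnor_number_def Let_def over_def split: if_splits)
  moreover have "A.independent MK (map (\<lambda>i. mproj ((e \<circ> b) i)) [0..<card I])"
    using independent_mproj[OF K hg] ib by blast
  moreover have "set (map (\<lambda>i. mproj ((e \<circ> b) i)) [0..<card I]) \<subseteq> carrier MA"
    using hg mproj_closed by auto
  ultimately have "length (map (\<lambda>i. mproj ((e \<circ> b) i)) [0..<card I]) \<le> k"
    by (rule A.independent_length_le_dimension[OF K])
  thus ?thesis by simp
qed

text \<open>A spanning subfamily of least size is independent, because a relation would express one
  member through the others. This also shows that the Milnor number is finite.\<close>

lemma spans_mod_milnor_le:
  assumes "spans_mod n g I e"
  obtains k where "k \<le> card I" "milnor_number n g = enat k"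
proof -
  define P where "P S \<longleftrightarrow> S \<subseteq> I \<and> spans_mod n g S e" for S
  have "P I" using assms by (simp add: P_def)
  then obtain S where S: "P S" "\<And>S'. P S' \<Longrightarrow> card S \<le> card S'"
    using ex_has_least_nat[of P I card] by blast
  have fin: "finite S" and hg: "\<And>i. i \<in> S \<Longrightarrow> holomorphic_germ n (e i)" using S(1) by (auto simp: P_def spans_mod_def)
  have "indep_mod n g S e" unfolding indep_mod_def
  proof (intro conjI allI impI ballI fin hg; assumption?)
    fix c j assume c: "(\<lambda>z. \<Sum>i\<in>S. c i * e i z) \<in> jac n g" and j: "j \<in> S"
    show "c j = 0"
    proof (rule ccontr)
      assume cj: "c j \<noteq> 0"
      have "P (S - {j})" unfolding P_def spans_mod_def
      proof (intro conjI allI impI)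
        fix f assume "holomorphic_germ n f"
        then obtain d where d: "(\<lambda>z. f z - (\<Sum>i\<in>S. d i * e i z)) \<in> jac n g"
          using S(1) by (auto simp: P_def spans_mod_def)
        \<comment> \<open>The multiple \<open>d j / c j\<close> of the relation removes the term
          with index \<open>j\<close>.\<close>
        have "(\<lambda>z. (f z - (\<Sum>i\<in>S. d i * e i z)) + d j / c j * (\<Sum>i\<in>S. c i * e i z)) \<in> jac n g"
          by (intro jac_add d jac_cmult c)
        also have "(\<lambda>z. (f z - (\<Sum>i\<in>S. d i * e i z)) + d j / c j * (\<Sum>i\<in>S. c i * e i z)) =
           (\<lambda>z. f z - (\<Sum>i\<in>S - {j}. (d i - d j / c j * c i) * e i z))"
        proof
          fix z
          have "(\<Sum>i\<in>S. (d i - d j / c j * c i) * e i z) = (\<Sum>i\<in>S - {j}. (d i - d j / c j * c i) * e i z)"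
            using fin j cj by (subst sum.remove[OF fin j]) simp
          moreover have "(\<Sum>i\<in>S. (d i - d j / c j * c i) * e i z) = (\<Sum>i\<in>S. d i * e i z) - d j / c j * (\<Sum>i\<in>S. c i * e i z)"
            by (simp add: sum_distrib_left sum_subtractf algebra_simps)
          ultimately show "(f z - (\<Sum>i\<in>S. d i * e i z)) + d j / c j * (\<Sum>i\<in>S. c i * e i z) =
            f z - (\<Sum>i\<in>S - {j}. (d i - d j / c j * c i) * e i z)" by simp
        qed
        finally show "\<exists>c. (\<lambda>z. f z - (\<Sum>i\<in>S - {j}. c i * e i z)) \<in> jac n g"
          by (rule exI[of _ "\<lambda>i. d i - d j / c j * c i"])
      qed (use S(1) fin hg in \<open>auto simp: P_def\<close>)
      from S(2)[OF this] show False using card_Diff1_less[OF fin j] by simp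
    qed
  qed
  obtain b where "bij_betw b {0..<card S} S" using ex_bij_betw_nat_finite[OF fin] by blast
  hence b: "bij_betw b {..<card S} S" by (simp add: lessThan_atLeast0)
  have "milnor_number n g = enat (card S)"
    unfolding milnor_number_iff
    using indep_mod_reindex[OF b \<open>indep_mod n g S e\<close>] spans_mod_reindex[OF b] S(1) unfolding P_def by blast
  moreover have "card S \<le> card I" using S(2)[OF \<open>P I\<close>] .
  ultimately show ?thesis by (rule that[rotated])
qed

lemma milnor_number_zero:
  assumes "\<not> grad_zero n g origin"
  shows "milnor_number n g = 0"
proof -
  obtain i where i: "i < n" "partial_deriv i g origin \<noteq> 0" using assms by (auto simp: grad_zero_def)
  have "spans_mod n g ({}::nat set) (\<lambda>_ _. 0)"
    using jac_unit[OF jac_partial[OF g i(1)] i(2)] by (simp add: spans_mod_def)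
  then obtain k where "k \<le> card ({}::nat set)" "milnor_number n g = enat k" by (rule spans_mod_milnor_le)
  thus ?thesis by (simp add: zero_enat_def)
qed

end

subsection \<open>Invariance of the Milnor number\<close>

text \<open>Substituting \<open>\<sigma>\<close> or \<open>\<tau>\<close> induces maps between the
  two Milnor algebras. It suffices that these are inverse to each other modulo the Jacobian ideals,
  which allows spaces of different dimension.\<close>

lemma milnor_transfer_aux:
  assumes g: "holomorphic_germ N g" and h: "holomorphic_germ n h"
    and s: "\<And>f. holomorphic_germ N f \<Longrightarrow> holomorphic_germ n (\<lambda>z. f (\<sigma> z))"
    and t: "\<And>f. holomorphic_germ n f \<Longrightarrow> holomorphic_germ N (\<lambda>z. f (\<tau> z))"
    and js: "\<And>f. f \<in> jac N g \<Longrightarrow> (\<lambda>z. f (\<sigma> z)) \<in> jac n h"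
    and jt: "\<And>f. f \<in> jac n h \<Longrightarrow> (\<lambda>z. f (\<tau> z)) \<in> jac N g"
    and st: "\<And>f. holomorphic_germ n f \<Longrightarrow> (\<lambda>z. f z - f (\<tau> (\<sigma> z))) \<in> jac n h"
    and ts: "\<And>f. holomorphic_germ N f \<Longrightarrow> (\<lambda>z. f z - f (\<sigma> (\<tau> z))) \<in> jac N g"
    and m: "milnor_number N g = enat k"
  shows "milnor_number n h = enat k"
proof -
  obtain e :: "nat \<Rightarrow> _" where e: "spans_mod N g {..<k} e" "indep_mod N g {..<k} e"
    using m milnor_number_iff[OF g] by blast
  have hg: "\<And>i. i < k \<Longrightarrow> holomorphic_germ N (e i)" using e(1) by (auto simp: spans_mod_def)
  define e' where "e' i z = e i (\<sigma> z)" for i z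
  have "spans_mod n h {..<k} e'" unfolding spans_mod_def
  proof (intro conjI allI impI ballI)
    fix f assume f: "holomorphic_germ n f"
    then obtain c where c: "(\<lambda>z. f (\<tau> z) - (\<Sum>i<k. c i * e i z)) \<in> jac N g"
      using e(1) t[OF f] unfolding spans_mod_def by blast
    from jac_add[OF st[OF f] js[OF this]]
    show "\<exists>c. (\<lambda>z. f z - (\<Sum>i<k. c i * e' i z)) \<in> jac n h" by (auto simp: e'_def)
  qed (auto simp: e'_def[abs_def] intro: s hg)
  moreover have "indep_mod n h {..<k} e'" unfolding indep_mod_def
  proof (intro conjI allI impI)
    fix c assume "(\<lambda>z. \<Sum>i<k. c i * e' i z) \<in> jac n h"
    from jt[OF this] have 1: "(\<lambda>z. \<Sum>i<k. c i * e i (\<sigma> (\<tau> z))) \<in> jac N g" by (simp add: e'_def)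
    have "holomorphic_germ N (\<lambda>z. \<Sum>i<k. c i * e i z)"
      by (intro hg_sum hg_mult hg_const) (use hg in auto)
    from jac_add[OF ts[OF this] 1] have "(\<lambda>z. \<Sum>i<k. c i * e i z) \<in> jac N g" by simp
    thus "\<forall>i\<in>{..<k}. c i = 0" using e(2) by (simp add: indep_mod_def)
  qed (auto simp: e'_def[abs_def] intro: s hg)
  ultimately show ?thesis unfolding milnor_number_iff[OF h] by blast
qed

text \<open>The hypotheses are symmetric in the two sides, so an infinite Milnor number on one side
  forces the same on the other.\<close>

lemma milnor_transfer:
  assumes g: "holomorphic_germ N g" and h: "holomorphic_germ n h"
    and s: "\<And>f. holomorphic_germ N f \<Longrightarrow> holomorphic_germ n (\<lambda>z. f (\<sigma> z))"
    and t: "\<And>f. holomorphic_germ n f \<Longrightarrow> holomorphic_germ N (\<lambda>z. f (\<tau> z))"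
    and js: "\<And>f. f \<in> jac N g \<Longrightarrow> (\<lambda>z. f (\<sigma> z)) \<in> jac n h"
    and jt: "\<And>f. f \<in> jac n h \<Longrightarrow> (\<lambda>z. f (\<tau> z)) \<in> jac N g"
    and st: "\<And>f. holomorphic_germ n f \<Longrightarrow> (\<lambda>z. f z - f (\<tau> (\<sigma> z))) \<in> jac n h"
    and ts: "\<And>f. holomorphic_germ N f \<Longrightarrow> (\<lambda>z. f z - f (\<sigma> (\<tau> z))) \<in> jac N g"
  shows "milnor_number N g = milnor_number n h"
proof (cases "milnor_number N g")
  case (enat k)
  from milnor_transfer_aux[OF assms this] enat show ?thesis by simp
next
  case infinity
  show ?thesis
  proof (cases "milnor_number n h")
    case (enat k)
    from milnor_transfer_aux[OF h g t s jt js ts st this] infinity show ?thesis by simp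
  qed (use infinity in simp)
qed

lemmas hg_intros = hg_const hg_coord hg_add hg_diff hg_mult hg_uminus hg_sum hg_power
text \<open>As standing introduction rules these higher-order patterns make the classical reasoner diverge.\<close>
declare hg_intros [rule del] hg_partial [rule del]

text \<open>A map germ is given by its component functions; components from \<open>p\<close> on are
  set to 0, so that values lie in \<open>Cn p\<close> by construction.\<close>

definition cmap :: "nat \<Rightarrow> (nat \<Rightarrow> cvec \<Rightarrow> complex) \<Rightarrow> cvec \<Rightarrow> cvec" where
  "cmap p \<phi> z = (\<lambda>k. if k < p then \<phi> k z else 0)"

definition cgerm :: "nat \<Rightarrow> nat \<Rightarrow> (nat \<Rightarrow> cvec \<Rightarrow> complex) \<Rightarrow> bool" where
  "cgerm n p \<phi> \<longleftrightarrow> (\<forall>k<p. holomorphic_germ n (\<phi> k) \<and> \<phi> k origin = 0)"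

lemma near_origin_Cn: "\<forall>\<^sub>F z in near_origin n. z \<in> Cn n"
  by (auto simp: eventually_near_origin polydisc_Cn intro: exI[of _ 1])

lemma cgerm_small:
  assumes "cgerm n p \<phi>" "0 < R"
  shows "\<exists>r>0. \<forall>k<p. hol n r (\<phi> k) \<and> (\<forall>z\<in>polydisc n r. cmod (\<phi> k z) < R)"
proof -
  have "\<exists>r>0. hol n r (\<phi> k) \<and> (\<forall>z\<in>polydisc n r. cmod (\<phi> k z) < R)" if "k < p" for k
  proof -
    have "holomorphic_germ n (\<phi> k)" and 0: "\<phi> k origin = 0" using assms(1) that by (simp_all add: cgerm_def)
    then obtain r where r: "0 < r" "hol n r (\<phi> k)" by (auto simp: holomorphic_germ_iff)
    obtain s where "0 < s" "s \<le> r" "\<And>z. z \<in> polydisc n s \<Longrightarrow> cmod (\<phi> k z) < R"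
      using hol_small_near_origin[OF r(2,1) 0 assms(2)] by metis
    thus ?thesis using hol_mono[OF r(2), of s] by auto
  qed
  then obtain f where f: "\<And>k. k < p \<Longrightarrow> f k > 0 \<and> hol n (f k) (\<phi> k) \<and> (\<forall>z\<in>polydisc n (f k). cmod (\<phi> k z) < R)"
    by metis
  define r where "r = Min (insert 1 (f ` {..<p}))"
  have r: "r > 0" unfolding r_def using f by (subst Min_gr_iff) auto
  have rf: "r \<le> f k" if "k < p" for k unfolding r_def using that by (intro Min_le) auto
  have "hol n r (\<phi> k) \<and> (\<forall>z\<in>polydisc n r. cmod (\<phi> k z) < R)" if "k < p" for k
    using f[OF that] polydisc_mono[OF rf[OF that], of n] hol_mono[OF _ rf[OF that]] by blast
  thus ?thesis using r by blast
qed

lemma eventually_cmap: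
  assumes "cgerm n p \<phi>" "eventually P (near_origin p)"
  shows "\<forall>\<^sub>F z in near_origin n. P (cmap p \<phi> z)"
proof -
  obtain R where R: "0 < R" "\<And>z. z \<in> polydisc p R \<Longrightarrow> P z" using assms(2) by (auto simp: eventually_near_origin)
  obtain r where r0: "0 < r" "\<forall>k<p. hol n r (\<phi> k) \<and> (\<forall>z\<in>polydisc n r. cmod (\<phi> k z) < R)"
    using cgerm_small[OF assms(1) R(1)] by blast
  have r: "0 < r" "\<And>k. k < p \<Longrightarrow> hol n r (\<phi> k)" "\<And>k z. k < p \<Longrightarrow> z \<in> polydisc n r \<Longrightarrow> cmod (\<phi> k z) < R"
    using r0 by auto
  show ?thesis unfolding eventually_near_origin
    using r by (intro exI[of _ r] conjI ballI R(2)) (auto simp: cmap_def polydisc_def Cn_def)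
qed

lemma hg_cmap:
  assumes "cgerm n p \<phi>" "holomorphic_germ p f"
  shows "holomorphic_germ n (\<lambda>z. f (cmap p \<phi> z))"
proof -
  obtain R where R: "0 < R" "hol p R f" using assms(2) by (auto simp: holomorphic_germ_iff)
  obtain r where r0: "0 < r" "\<forall>k<p. hol n r (\<phi> k) \<and> (\<forall>z\<in>polydisc n r. cmod (\<phi> k z) < R)"
    using cgerm_small[OF assms(1) R(1)] by blast
  have r: "0 < r" "\<And>k. k < p \<Longrightarrow> hol n r (\<phi> k)" "\<And>k z. k < p \<Longrightarrow> z \<in> polydisc n r \<Longrightarrow> cmod (\<phi> k z) < R"
    using r0 by auto
  show ?thesis unfolding cmap_def by (rule hg_I[OF r(1) hol_compose[OF R(2,1) r(2,3)]])
qed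

lemma partial_deriv_cmap:
  assumes "cgerm n p \<phi>" "holomorphic_germ p f" "i < n"
  shows "\<forall>\<^sub>F z in near_origin n. partial_deriv i (\<lambda>z. f (cmap p \<phi> z)) z =
     (\<Sum>k<p. partial_deriv k f (cmap p \<phi> z) * partial_deriv i (\<phi> k) z)"
proof -
  obtain R where R: "0 < R" "hol p R f" using assms(2) by (auto simp: holomorphic_germ_iff)
  obtain r where r0: "0 < r" "\<forall>k<p. hol n r (\<phi> k) \<and> (\<forall>z\<in>polydisc n r. cmod (\<phi> k z) < R)"
    using cgerm_small[OF assms(1) R(1)] by blast
  have r: "0 < r" "\<And>k. k < p \<Longrightarrow> hol n r (\<phi> k)" "\<And>k z. k < p \<Longrightarrow> z \<in> polydisc n r \<Longrightarrow> cmod (\<phi> k z) < R"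
    using r0 by auto
  show ?thesis unfolding cmap_def eventually_near_origin
    by (intro exI[of _ r] conjI ballI r(1) partial_deriv_compose[OF R(2,1) r(2,3) _ assms(3)])
qed

lemma cmap_origin: "cgerm n p \<phi> \<Longrightarrow> cmap p \<phi> origin = origin"
  by (auto simp: cmap_def cgerm_def)

lemma cgerm_coord: "cgerm n p (\<lambda>k z. z k)"
  by (auto simp: cgerm_def hg_coord)

lemma cmap_coord: "z \<in> Cn n \<Longrightarrow> n \<le> p \<Longrightarrow> cmap p (\<lambda>k z. z k) z = z"
  by (auto simp: cmap_def Cn_def)

subsection \<open>Biholomorphic coordinate changes\<close>

text \<open>The chain rule is applied to \<open>g = h \<circ> \<psi>\<close> rather than to
  \<open>h = g \<circ> \<phi>\<close>: this writes the derivatives of \<open>g\<close> through those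
  of \<open>h\<close>, with derivatives of \<open>\<psi>\<close> as coefficients, and pulling back
  along \<open>\<phi>\<close> gives the claim.\<close>

lemma jac_cmap:
  assumes \<phi>: "cgerm p p \<phi>" and \<psi>: "cgerm p p \<psi>"
    and i1: "\<forall>\<^sub>F z in near_origin p. cmap p \<phi> (cmap p \<psi> z) = z"
    and i2: "\<forall>\<^sub>F z in near_origin p. cmap p \<psi> (cmap p \<phi> z) = z"
    and g: "holomorphic_germ p g" and h: "holomorphic_germ p h"
    and gh: "\<forall>\<^sub>F z in near_origin p. h z = g (cmap p \<phi> z)"
    and f: "f \<in> jac p g"
  shows "(\<lambda>z. f (cmap p \<phi> z)) \<in> jac p h"
proof -
  obtain a where a: "\<forall>i<p. holomorphic_germ p (a i)" "\<forall>\<^sub>F z in near_origin p. f z = (\<Sum>i<p. a i z * partial_deriv i g z)"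
    using f by (auto simp: jac_def)
  have hg: "\<forall>\<^sub>F z in near_origin p. g z = h (cmap p \<psi> z)"
    using eventually_cmap[OF \<psi> gh] i1 by eventually_elim simp
  have dg: "(\<lambda>z. partial_deriv k g (cmap p \<phi> z)) \<in> jac p h" if k: "k < p" for k
  proof -
    have "\<forall>\<^sub>F z in near_origin p. partial_deriv k g z =
       (\<Sum>i<p. partial_deriv i h (cmap p \<psi> z) * partial_deriv k (\<psi> i) z)"
      using partial_deriv_cong_germ[OF hg k] partial_deriv_cmap[OF \<psi> h k] by eventually_elim simp
    from eventually_cmap[OF \<phi> this] i2
    have "\<forall>\<^sub>F z in near_origin p. (\<Sum>i<p. partial_deriv k (\<psi> i) (cmap p \<phi> z) * partial_deriv i h z) = partial_deriv k g (cmap p \<phi> z)"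
      by eventually_elim (simp add: mult.commute)
    moreover have "(\<lambda>z. \<Sum>i<p. partial_deriv k (\<psi> i) (cmap p \<phi> z) * partial_deriv i h z) \<in> jac p h"
    proof (intro jac_sum)
      fix i assume i: "i \<in> {..<p}"
      hence "holomorphic_germ p (partial_deriv k (\<psi> i))" using \<psi> k by (simp add: cgerm_def hg_partial)
      from jac_mult[OF jac_partial[OF h] hg_cmap[OF \<phi> this]] i
      show "(\<lambda>z. partial_deriv k (\<psi> i) (cmap p \<phi> z) * partial_deriv i h z) \<in> jac p h" by simp
    qed
    ultimately show ?thesis by (rule jac_cong[rotated])
  qed
  have "(\<lambda>z. \<Sum>i<p. a i (cmap p \<phi> z) * partial_deriv i g (cmap p \<phi> z)) \<in> jac p h"
  proof (intro jac_sum)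
    fix i assume i: "i \<in> {..<p}"
    from jac_mult[OF dg hg_cmap[OF \<phi>]] i a(1)
    show "(\<lambda>z. a i (cmap p \<phi> z) * partial_deriv i g (cmap p \<phi> z)) \<in> jac p h" by simp
  qed
  moreover have "\<forall>\<^sub>F z in near_origin p. (\<Sum>i<p. a i (cmap p \<phi> z) * partial_deriv i g (cmap p \<phi> z)) = f (cmap p \<phi> z)"
    using eventually_cmap[OF \<phi> a(2)] by eventually_elim simp
  ultimately show ?thesis by (rule jac_cong)
qed

lemma jac_near_zero: "\<forall>\<^sub>F z in near_origin n. h z = 0 \<Longrightarrow> h \<in> jac n g"
  by (rule jac_cong[OF jac_zero]) (erule eventually_mono, simp)

lemma milnor_cmap:
  assumes \<phi>: "cgerm p p \<phi>" and \<psi>: "cgerm p p \<psi>"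
    and i1: "\<forall>\<^sub>F z in near_origin p. cmap p \<phi> (cmap p \<psi> z) = z"
    and i2: "\<forall>\<^sub>F z in near_origin p. cmap p \<psi> (cmap p \<phi> z) = z"
    and g: "holomorphic_germ p g"
    and gh: "\<forall>\<^sub>F z in near_origin p. h z = g (cmap p \<phi> z)"
  shows "milnor_number p g = milnor_number p h"
proof -
  have "\<forall>\<^sub>F z in near_origin p. g (cmap p \<phi> z) = h z" using gh by eventually_elim simp
  hence h: "holomorphic_germ p h" by (rule hg_cong[OF _ hg_cmap[OF \<phi> g]])
  have hg: "\<forall>\<^sub>F z in near_origin p. g z = h (cmap p \<psi> z)"
    using eventually_cmap[OF \<psi> gh] i1 by eventually_elim simp
  show ?thesis
  proof (rule milnor_transfer[OF g h, of "cmap p \<phi>" "cmap p \<psi>"])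
    fix f :: "cvec \<Rightarrow> complex"
    show "(\<lambda>z. f z - f (cmap p \<psi> (cmap p \<phi> z))) \<in> jac p h"
      by (rule jac_near_zero) (use i2 in eventually_elim, simp)
    show "(\<lambda>z. f z - f (cmap p \<phi> (cmap p \<psi> z))) \<in> jac p g"
      by (rule jac_near_zero) (use i1 in eventually_elim, simp)
  qed (auto intro: hg_cmap[OF \<phi>] hg_cmap[OF \<psi>] jac_cmap[OF \<phi> \<psi> i1 i2 g h gh] jac_cmap[OF \<psi> \<phi> i2 i1 h g hg])
qed

lemma milnor_cong:
  assumes "\<forall>\<^sub>F z in near_origin p. h z = g z" "holomorphic_germ p g"
  shows "milnor_number p g = milnor_number p h"
proof (rule milnor_cmap[OF cgerm_coord cgerm_coord _ _ assms(2)])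
  have "\<forall>\<^sub>F z in near_origin p. cmap p (\<lambda>k z. z k) z = z"
    by (rule eventually_mono[OF near_origin_Cn]) (simp add: cmap_coord)
  thus "\<forall>\<^sub>F z in near_origin p. h z = g (cmap p (\<lambda>k z. z k) z)"
    using assms(1) by eventually_elim simp
qed (auto intro!: eventually_mono[OF near_origin_Cn] simp: cmap_coord)

subsection \<open>Eliminating a nondegenerate variable\<close>

lemma hg_subst_last:
  assumes g: "holomorphic_germ (Suc n) g" and \<zeta>: "holomorphic_germ n \<zeta>" "\<zeta> origin = 0"
  shows "holomorphic_germ n (\<lambda>z. g (z(n := \<zeta> z)))"
    and "\<And>P. eventually P (near_origin (Suc n)) \<Longrightarrow> \<forall>\<^sub>F z in near_origin n. P (z(n := \<zeta> z))"
    and "\<And>i. i < n \<Longrightarrow> \<forall>\<^sub>F z in near_origin n. partial_deriv i (\<lambda>z. g (z(n := \<zeta> z))) z =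
        partial_deriv i g (z(n := \<zeta> z)) + partial_deriv n g (z(n := \<zeta> z)) * partial_deriv i \<zeta> z"
proof -
  define \<phi> where "\<phi> k = (if k = n then \<zeta> else (\<lambda>z. z k))" for k
  have \<phi>: "cgerm n (Suc n) \<phi>" using \<zeta> by (auto simp: cgerm_def \<phi>_def hg_coord)
  have eq: "cmap (Suc n) \<phi> z = z(n := \<zeta> z)" if "z \<in> Cn n" for z
    using that by (auto simp: \<phi>_def cmap_def Cn_def)
  have ev: "\<forall>\<^sub>F z in near_origin n. cmap (Suc n) \<phi> z = z(n := \<zeta> z)"
    by (rule eventually_mono[OF near_origin_Cn eq])
  hence ev2: "\<forall>\<^sub>F z in near_origin n. g (cmap (Suc n) \<phi> z) = g (z(n := \<zeta> z))"
    by eventually_elim simp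
  show "holomorphic_germ n (\<lambda>z. g (z(n := \<zeta> z)))"
    by (rule hg_cong[OF ev2 hg_cmap[OF \<phi> g]])
  show "\<forall>\<^sub>F z in near_origin n. P (z(n := \<zeta> z))" if "eventually P (near_origin (Suc n))" for P
    using eventually_cmap[OF \<phi> that] ev by eventually_elim simp
  obtain R where R: "0 < R" "hol (Suc n) R g" using g by (auto simp: holomorphic_germ_iff)
  obtain s where s: "0 < s" "hol n s \<zeta>" using \<zeta> by (auto simp: holomorphic_germ_iff)
  obtain r where r: "0 < r" "r \<le> s" "\<And>z. z \<in> polydisc n r \<Longrightarrow> cmod (\<zeta> z) < R"
    using hol_small_near_origin[OF s(2,1) \<zeta>(2) R(1)] by blast
  show "\<forall>\<^sub>F z in near_origin n. partial_deriv i (\<lambda>z. g (z(n := \<zeta> z))) z =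
        partial_deriv i g (z(n := \<zeta> z)) + partial_deriv n g (z(n := \<zeta> z)) * partial_deriv i \<zeta> z" if i: "i < n" for i
  proof -
    have "partial_deriv i (\<lambda>z. g (z(n := \<zeta> z))) z =
        partial_deriv i g (z(n := \<zeta> z)) + partial_deriv n g (z(n := \<zeta> z)) * partial_deriv i \<zeta> z"
      if "z \<in> polydisc n (min r R)" for z
      by (rule partial_deriv_subst_last[OF R(2)])
         (use that i r R s polydisc_mono[of "min r R" r n] hol_mono[OF s(2)] in auto)
    thus ?thesis unfolding eventually_near_origin using r(1) R(1) by (intro exI[of _ "min r R"]) auto
  qed
qed

lemma near_origin_drop_last:
  assumes "eventually P (near_origin n)"
  shows "\<forall>\<^sub>F z in near_origin (Suc n). P (z(n := 0))"
proof -
  have "\<forall>\<^sub>F z in near_origin (Suc n). P (cmap n (\<lambda>k z. z k) z)"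
    by (rule eventually_cmap[OF cgerm_coord assms])
  thus ?thesis using near_origin_Cn
  proof eventually_elim
    case (elim z)
    have "cmap n (\<lambda>k z. z k) z = z(n := 0)" using elim(2) by (auto simp: cmap_def Cn_def fun_eq_iff)
    thus ?case using elim(1) by simp
  qed
qed

lemma hg_drop_last:
  assumes "holomorphic_germ n f"
  shows "holomorphic_germ (Suc n) (\<lambda>z. f (z(n := 0)))"
proof (rule hg_cong[OF _ hg_cmap[OF cgerm_coord assms]])
  show "\<forall>\<^sub>F z in near_origin (Suc n). f (cmap n (\<lambda>k z. z k) z) = f (z(n := 0))"
  proof (rule eventually_mono[OF near_origin_Cn])
    fix z assume "z \<in> Cn (Suc n)"
    hence "cmap n (\<lambda>k z. z k) z = z(n := 0)" by (auto simp: cmap_def Cn_def fun_eq_iff)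
    thus "f (cmap n (\<lambda>k z. z k) z) = f (z(n := 0))" by simp
  qed
qed

lemma hg_divide_coord:
  assumes f: "holomorphic_germ n f" and i: "i < n"
  obtains Q where "holomorphic_germ n Q" "\<forall>\<^sub>F z in near_origin n. f z = f (z(i := 0)) + z i * Q z"
proof -
  obtain r where r: "0 < r" "hol n r f" using f by (auto simp: holomorphic_germ_iff)
  obtain Q where "hol n r Q" "\<forall>z\<in>polydisc n r. f z = f (z(i := 0)) + z i * Q z"
    using hol_divide_coord[OF r(2) i] by (metis (no_types, lifting))
  thus ?thesis using r(1) by (intro that[of Q]) (auto simp: eventually_near_origin intro: hg_I)
qed

text \<open>A shear in the last coordinate turns the graph of \<open>\<zeta>\<close> into a
  coordinate hyperplane, where division by a coordinate applies; the opposite shear brings the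
  quotient back. The two shears are \<open>\<phi> 1\<close> and \<open>\<phi> (-1)\<close>.\<close>

lemma hg_divide_graph:
  assumes f: "holomorphic_germ (Suc n) f" and \<zeta>: "holomorphic_germ n \<zeta>" "\<zeta> origin = 0"
  obtains Q where "holomorphic_germ (Suc n) Q"
    "\<forall>\<^sub>F z in near_origin (Suc n). f z = f (z(n := \<zeta> (z(n := 0)))) + (z n - \<zeta> (z(n := 0))) * Q z"
proof -
  define \<phi> where "\<phi> e k = (if k = n then (\<lambda>z. z n + e * \<zeta> (z(n := 0))) else (\<lambda>z. z k))" for e k
  have \<phi>: "cgerm (Suc n) (Suc n) (\<phi> e)" for e
    using hg_add[OF hg_coord hg_mult[OF hg_const hg_drop_last[OF \<zeta>(1)]]] \<zeta>(2)
    by (auto simp: cgerm_def \<phi>_def fun_upd_idem hg_coord)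
  have eq: "cmap (Suc n) (\<phi> e) z = z(n := z n + e * \<zeta> (z(n := 0)))" if "z \<in> Cn (Suc n)" for z e
    using that by (auto simp: \<phi>_def cmap_def Cn_def fun_eq_iff)
  define F where "F z = f (cmap (Suc n) (\<phi> 1) z)" for z
  have F: "holomorphic_germ (Suc n) F" unfolding F_def by (rule hg_cmap[OF \<phi> f])
  obtain Q where Q: "holomorphic_germ (Suc n) Q" "\<forall>\<^sub>F z in near_origin (Suc n). F z = F (z(n := 0)) + z n * Q z"
    using hg_divide_coord[OF F, of n] by auto
  show ?thesis
  proof (rule that[of "\<lambda>z. Q (cmap (Suc n) (\<phi> (-1)) z)"])
    show "holomorphic_germ (Suc n) (\<lambda>z. Q (cmap (Suc n) (\<phi> (- 1)) z))" by (rule hg_cmap[OF \<phi> Q(1)])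
    show "\<forall>\<^sub>F z in near_origin (Suc n). f z = f (z(n := \<zeta> (z(n := 0)))) + (z n - \<zeta> (z(n := 0))) * Q (cmap (Suc n) (\<phi> (- 1)) z)"
      using eventually_cmap[OF \<phi>[of "-1"] Q(2)] near_origin_Cn
    proof eventually_elim
      case (elim z)
      define w where "w = z(n := z n - \<zeta> (z(n := 0)))"
      have w: "cmap (Suc n) (\<phi> (- 1)) z = w" using eq[OF elim(2), of "-1"] by (simp add: w_def)
      have wC: "w \<in> Cn (Suc n)" "w(n := 0) \<in> Cn (Suc n)" using elim(2) by (auto simp: w_def Cn_def)
      have "F w = f z" using eq[OF wC(1), of 1] by (simp add: F_def w_def)
      moreover have "F (w(n := 0)) = f (z(n := \<zeta> (z(n := 0))))" using eq[OF wC(2), of 1] by (simp add: F_def w_def)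
      moreover have "w n = z n - \<zeta> (z(n := 0))" by (simp add: w_def)
      ultimately show ?case using elim(1) unfolding w by simp
    qed
  qed
qed

text \<open>Because the second derivative in the last variable is nonzero,
  \<open>partial_deriv n g\<close> is a unit times the equation \<open>d\<close> of the graph. So
  \<open>d\<close> belongs to the Jacobian ideal, and restricting to the graph and forgetting the
  last variable are inverse to each other modulo the Jacobian ideals.\<close>

lemma milnor_eliminate:
  assumes g: "holomorphic_germ (Suc n) g" and \<zeta>: "holomorphic_germ n \<zeta>" "\<zeta> origin = 0"
    and crit: "\<forall>\<^sub>F z in near_origin n. partial_deriv n g (z(n := \<zeta> z)) = 0"
    and nd: "partial_deriv n (partial_deriv n g) origin \<noteq> 0"
  shows "milnor_number (Suc n) g = milnor_number n (\<lambda>z. g (z(n := \<zeta> z)))"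
proof -
  define h where "h z = g (z(n := \<zeta> z))" for z
  have h: "holomorphic_germ n h" unfolding h_def by (rule hg_subst_last(1)[OF g \<zeta>])
  define d where "d z = z n - \<zeta> (z(n := 0))" for z
  have dhg: "holomorphic_germ (Suc n) d" unfolding d_def using hg_drop_last[OF \<zeta>(1)] by (intro hg_intros)
  \<comment> \<open>On the graph the derivative in the last variable vanishes, so the chain rule
    leaves only the direct term.\<close>
  have dh: "\<forall>\<^sub>F z in near_origin n. partial_deriv i h z = partial_deriv i g (z(n := \<zeta> z))" if "i < n" for i
    using hg_subst_last(3)[OF g \<zeta> that] crit unfolding h_def by eventually_elim simp
  have dn: "holomorphic_germ (Suc n) (partial_deriv n g)" using g by (rule hg_partial) simp
  have dj: "d \<in> jac (Suc n) g"
  proof -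
    obtain U where U: "holomorphic_germ (Suc n) U"
      "\<forall>\<^sub>F z in near_origin (Suc n). partial_deriv n g z = partial_deriv n g (z(n := \<zeta> (z(n := 0)))) + d z * U z"
      using hg_divide_graph[OF dn \<zeta>] unfolding d_def by blast
    have U2: "\<forall>\<^sub>F z in near_origin (Suc n). partial_deriv n g z = d z * U z"
      using U(2) near_origin_drop_last[OF crit] by eventually_elim simp
    \<comment> \<open>Differentiating \<open>d z * U z\<close> at the origin, where \<open>d\<close>
      vanishes with derivative 1, isolates the value of \<open>U\<close>.\<close>
    have "partial_deriv n (partial_deriv n g) origin = partial_deriv n (\<lambda>z. d z * U z) origin"
      by (rule eventually_near_origin_at[OF partial_deriv_cong_germ[OF U2]]) simp
    also have "\<dots> = deriv (\<lambda>w. w * U (origin(n := w))) 0"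
      unfolding partial_deriv_def d_def using \<zeta>(2) by (simp add: fun_upd_idem)
    also have "\<dots> = U origin"
    proof -
      obtain r where r: "0 < r" "hol (Suc n) r U" using U(1) by (auto simp: holomorphic_germ_iff)
      have "((\<lambda>w. U (origin(n := w))) has_field_derivative partial_deriv n U (origin(n := 0))) (at 0)"
        by (rule hol_has_partial[OF r(2)]) (use r in auto)
      from DERIV_mult[OF DERIV_ident this]
      have "((\<lambda>w. w * U (origin(n := w))) has_field_derivative U origin) (at 0)" by (simp add: fun_upd_idem)
      thus ?thesis by (rule DERIV_imp_deriv)
    qed
    finally have "U origin \<noteq> 0" using nd by simp
    then obtain V where V: "holomorphic_germ (Suc n) V" "\<forall>\<^sub>F z in near_origin (Suc n). U z \<noteq> 0 \<and> V z = inverse (U z)"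
      using hg_inverse[OF U(1)] by blast
    have "(\<lambda>z. V z * partial_deriv n g z) \<in> jac (Suc n) g" by (rule jac_mult[OF jac_partial[OF g] V(1)]) simp
    moreover have "\<forall>\<^sub>F z in near_origin (Suc n). V z * partial_deriv n g z = d z"
      using U2 V(2) by eventually_elim simp
    ultimately show ?thesis by (rule jac_cong)
  qed
  \<comment> \<open>Replacing the last variable by \<open>\<zeta>\<close> of the others changes a
    function by a multiple of \<open>d\<close>, hence by an element of the Jacobian ideal.\<close>
  have ts: "(\<lambda>z. f z - f (z(n := 0, n := \<zeta> (z(n := 0))))) \<in> jac (Suc n) g" if f: "holomorphic_germ (Suc n) f" for f
  proof -
    obtain Q where Q: "holomorphic_germ (Suc n) Q"
      "\<forall>\<^sub>F z in near_origin (Suc n). f z = f (z(n := \<zeta> (z(n := 0)))) + d z * Q z"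
      using hg_divide_graph[OF f \<zeta>] unfolding d_def by blast
    have "\<forall>\<^sub>F z in near_origin (Suc n). Q z * d z = f z - f (z(n := 0, n := \<zeta> (z(n := 0))))"
      using Q(2) by eventually_elim simp
    from jac_cong[OF jac_mult[OF dj Q(1)] this] show ?thesis .
  qed
  show ?thesis unfolding h_def[symmetric, abs_def]
  proof (rule milnor_transfer[OF g h, of "\<lambda>z. z(n := \<zeta> z)" "\<lambda>z. z(n := 0)"])
    fix f assume f: "holomorphic_germ n f"
    have "f z - f (z(n := \<zeta> z, n := 0)) = 0" if "z \<in> Cn n" for z
    proof -
      have "z(n := \<zeta> z, n := 0) = z" using that by (auto simp: Cn_def)
      thus ?thesis by (metis cancel_comm_monoid_add_class.diff_cancel)
    qed
    thus "(\<lambda>z. f z - f (z(n := \<zeta> z, n := 0))) \<in> jac n h"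
      by (intro jac_near_zero eventually_mono[OF near_origin_Cn])
  next
    fix f assume "f \<in> jac (Suc n) g"
    then obtain a where a: "\<forall>i<Suc n. holomorphic_germ (Suc n) (a i)"
        "\<forall>\<^sub>F z in near_origin (Suc n). f z = (\<Sum>i<Suc n. a i z * partial_deriv i g z)"
      by (auto simp: jac_def)
    have "(\<lambda>z. \<Sum>i<n. a i (z(n := \<zeta> z)) * partial_deriv i h z) \<in> jac n h"
    proof (intro jac_sum)
      fix i assume i: "i \<in> {..<n}"
      from jac_mult[OF jac_partial[OF h] hg_subst_last(1)[OF _ \<zeta>]] i a(1)
      show "(\<lambda>z. a i (z(n := \<zeta> z)) * partial_deriv i h z) \<in> jac n h" by simp
    qed
    moreover have "\<forall>\<^sub>F z in near_origin n. \<forall>i\<in>{..<n}. partial_deriv i h z = partial_deriv i g (z(n := \<zeta> z))"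
      using dh by (intro eventually_ball_finite) auto
    hence "\<forall>\<^sub>F z in near_origin n. (\<Sum>i<n. a i (z(n := \<zeta> z)) * partial_deriv i h z) = f (z(n := \<zeta> z))"
      using hg_subst_last(2)[OF g \<zeta> a(2)] crit by eventually_elim simp
    ultimately show "(\<lambda>z. f (z(n := \<zeta> z))) \<in> jac n h" by (rule jac_cong)
  next
    fix f assume "f \<in> jac n h"
    then obtain a where a: "\<forall>i<n. holomorphic_germ n (a i)"
        "\<forall>\<^sub>F z in near_origin n. f z = (\<Sum>i<n. a i z * partial_deriv i h z)"
      by (auto simp: jac_def)
    have "\<forall>\<^sub>F z in near_origin n. \<forall>i\<in>{..<n}. partial_deriv i h z = partial_deriv i g (z(n := \<zeta> z))"
      using dh by (intro eventually_ball_finite) auto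
    from near_origin_drop_last[OF this] near_origin_drop_last[OF a(2)]
    have "\<forall>\<^sub>F z in near_origin (Suc n). (\<Sum>i<n. a i (z(n := 0)) * partial_deriv i g (z(n := 0, n := \<zeta> (z(n := 0))))) = f (z(n := 0))"
      by eventually_elim simp
    moreover have "(\<lambda>z. \<Sum>i<n. a i (z(n := 0)) * partial_deriv i g (z(n := 0, n := \<zeta> (z(n := 0))))) \<in> jac (Suc n) g"
    proof (intro jac_sum)
      fix i assume i: "i \<in> {..<n}"
      have "partial_deriv i g \<in> jac (Suc n) g" using i by (intro jac_partial g) auto
      from jac_diff[OF this ts[OF jac_hg[OF this]]]
      have "(\<lambda>z. partial_deriv i g (z(n := 0, n := \<zeta> (z(n := 0))))) \<in> jac (Suc n) g" by simp
      from jac_mult[OF this hg_drop_last] a(1) i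
      show "(\<lambda>z. a i (z(n := 0)) * partial_deriv i g (z(n := 0, n := \<zeta> (z(n := 0))))) \<in> jac (Suc n) g" by simp
    qed
    ultimately show "(\<lambda>z. f (z(n := 0))) \<in> jac (Suc n) g" by (rule jac_cong[rotated])
  next
    show "(\<lambda>z. f z - f (z(n := 0, n := \<zeta> (z(n := 0))))) \<in> jac (Suc n) g" if "holomorphic_germ (Suc n) f" for f
      by (rule ts[OF that])
  qed (auto intro: hg_subst_last(1)[OF _ \<zeta>] hg_drop_last)
qed

section \<open>Rules for partial derivatives of germs, and consequences of a finite Milnor
  number\<close>

lemma hg_has_partial:
  assumes "holomorphic_germ n f" "i < n"
  shows "\<forall>\<^sub>F z in near_origin n. ((\<lambda>w. f (z(i := w))) has_field_derivative partial_deriv i f z) (at (z i))"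
proof -
  obtain r where r: "0 < r" "hol n r f" using assms by (auto simp: holomorphic_germ_iff)
  have "((\<lambda>w. f (z(i := w))) has_field_derivative partial_deriv i f z) (at (z i))" if "z \<in> polydisc n r" for z
    using hol_has_partial[OF r(2) that assms(2), of "z i"] polydisc_cmod[OF that r(1), of i] by simp
  thus ?thesis using r(1) by (auto simp: eventually_near_origin)
qed

lemma partial_deriv_add:
  assumes "holomorphic_germ n f" "holomorphic_germ n g" "i < n"
  shows "\<forall>\<^sub>F z in near_origin n. partial_deriv i (\<lambda>z. f z + g z) z = partial_deriv i f z + partial_deriv i g z"
  using hg_has_partial[OF assms(1,3)] hg_has_partial[OF assms(2,3)]
  by eventually_elim (simp add: partial_deriv_def[of i "\<lambda>z. f z + g z"] DERIV_imp_deriv[OF DERIV_add])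

lemma partial_deriv_mult:
  assumes "holomorphic_germ n f" "holomorphic_germ n g" "i < n"
  shows "\<forall>\<^sub>F z in near_origin n. partial_deriv i (\<lambda>z. f z * g z) z = partial_deriv i f z * g z + f z * partial_deriv i g z"
  using hg_has_partial[OF assms(1,3)] hg_has_partial[OF assms(2,3)]
proof eventually_elim
  case (elim z)
  from DERIV_imp_deriv[OF DERIV_mult[OF elim]] show ?case
    by (simp add: partial_deriv_def[of i "\<lambda>z. f z * g z"] mult.commute)
qed

lemma partial_deriv_const [simp]: "partial_deriv i (\<lambda>_. c) = (\<lambda>_. 0)"
  by (simp add: partial_deriv_def fun_eq_iff)

lemma partial_deriv_coord: "partial_deriv i (\<lambda>z. z j) = (\<lambda>_. if i = j then 1 else 0)"
  by (auto simp: partial_deriv_def fun_eq_iff)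

lemma partial_deriv_cmult:
  assumes "holomorphic_germ n f" "i < n"
  shows "\<forall>\<^sub>F z in near_origin n. partial_deriv i (\<lambda>z. c * f z) z = c * partial_deriv i f z"
  using partial_deriv_mult[OF hg_const assms] by eventually_elim simp

text \<open>The \<open>k + 1\<close> powers of a coordinate up to the \<open>k\<close>-th are
  dependent in an algebra of dimension \<open>k\<close>, and a relation between them is its lowest
  power times a unit.\<close>

lemma power_coord_in_jac:
  assumes g: "holomorphic_germ n g" and m: "milnor_number n g = enat k"
  shows "(\<lambda>z. z i ^ k) \<in> jac n g"
proof -
  have "\<not> indep_mod n g {..k} (\<lambda>j z. z i ^ j)"
    using indep_mod_card_le[OF g m] by fastforce
  then obtain c l where c: "(\<lambda>z. \<Sum>j\<le>k. c j * z i ^ j) \<in> jac n g" and l: "l \<le> k" "c l \<noteq> 0"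
    by (auto simp: indep_mod_def intro: hg_power hg_coord)
  \<comment> \<open>The lowest power in the relation; what remains after factoring it out has a
    nonzero constant term.\<close>
  define j0 where "j0 = (LEAST j. c j \<noteq> 0)"
  have j0: "c j0 \<noteq> 0" "j0 \<le> k" "\<And>j. j < j0 \<Longrightarrow> c j = 0"
    unfolding j0_def using l LeastI[of "\<lambda>j. c j \<noteq> 0" l] Least_le[of "\<lambda>j. c j \<noteq> 0" l] not_less_Least by force+
  define u where "u z = (\<Sum>j\<in>{j0..k}. c j * z i ^ (j - j0))" for z :: cvec
  have eq: "(\<Sum>j\<le>k. c j * z i ^ j) = u z * z i ^ j0" for z :: cvec
  proof -
    have "(\<Sum>j\<le>k. c j * z i ^ j) = (\<Sum>j\<in>{j0..k}. c j * z i ^ j)"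
      using j0 by (intro sum.mono_neutral_right) (auto simp: not_le)
    also have "\<dots> = u z * z i ^ j0" unfolding u_def sum_distrib_right
      by (intro sum.cong refl) (auto simp flip: power_add)
    finally show ?thesis .
  qed
  have u: "holomorphic_germ n u" unfolding u_def by (intro hg_sum hg_mult hg_const hg_power hg_coord)
  have "u origin = (\<Sum>j\<in>{j0..k}. if j = j0 then c j0 else 0)"
    unfolding u_def by (intro sum.cong refl) auto
  hence "u origin \<noteq> 0" using j0 by simp
  then obtain v where v: "holomorphic_germ n v" "\<forall>\<^sub>F z in near_origin n. u z \<noteq> 0 \<and> v z = inverse (u z)"
    using hg_inverse[OF u] by blast
  have "(\<lambda>z. (v z * z i ^ (k - j0)) * (\<Sum>j\<le>k. c j * z i ^ j)) \<in> jac n g"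
    by (rule jac_mult[OF c]) (intro hg_mult v hg_power hg_coord)
  moreover have "\<forall>\<^sub>F z in near_origin n. (v z * z i ^ (k - j0)) * (\<Sum>j\<le>k. c j * z i ^ j) = z i ^ k"
    using v(2)
  proof eventually_elim
    case (elim z)
    have "z i ^ (k - j0) * z i ^ j0 = z i ^ k" using j0 by (simp flip: power_add)
    thus ?case using elim by (simp add: eq field_simps)
  qed
  ultimately show ?thesis by (rule jac_cong)
qed

text \<open>Elements of the Jacobian ideal vanish at critical points near the origin, and a power of
  every coordinate is such an element.\<close>

lemma finite_milnor_isolated:
  assumes g: "holomorphic_germ n g" and m: "milnor_number n g = enat k"
  shows "\<forall>\<^sub>F z in near_origin n. z \<noteq> origin \<longrightarrow> \<not> grad_zero n g z"
proof -
  have "\<forall>\<^sub>F z in near_origin n. grad_zero n g z \<longrightarrow> z i ^ k = 0" for i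
  proof -
    obtain a where "\<forall>\<^sub>F z in near_origin n. z i ^ k = (\<Sum>j<n. a j z * partial_deriv j g z)"
      using power_coord_in_jac[OF g m, of i] by (auto simp: jac_def)
    thus ?thesis by eventually_elim (auto simp: grad_zero_def)
  qed
  hence "\<forall>\<^sub>F z in near_origin n. \<forall>i\<in>{..<n}. grad_zero n g z \<longrightarrow> z i ^ k = 0"
    by (intro eventually_ball_finite) auto
  thus ?thesis using near_origin_Cn
  proof eventually_elim
    case (elim z)
    have "z i = 0" if "grad_zero n g z" for i
      using elim that by (cases "i < n") (auto simp: Cn_def not_less)
    thus ?case by auto
  qed
qed

subsection \<open>Taylor coefficients in two variables\<close>

lemma hg_iter: "holomorphic_germ n f \<Longrightarrow> i < n \<Longrightarrow> holomorphic_germ n ((partial_deriv i ^^ a) f)"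
  by (induction a) (auto intro: hg_partial)

lemma iter_cong:
  assumes "\<forall>\<^sub>F z in near_origin n. f z = g z" "i < n"
  shows "\<forall>\<^sub>F z in near_origin n. (partial_deriv i ^^ a) f z = (partial_deriv i ^^ a) g z"
  by (induction a) (use assms in \<open>auto intro: partial_deriv_cong_germ\<close>)

lemma iter_add:
  assumes "holomorphic_germ n f" "holomorphic_germ n g" "i < n"
  shows "\<forall>\<^sub>F z in near_origin n. (partial_deriv i ^^ a) (\<lambda>z. f z + g z) z =
    (partial_deriv i ^^ a) f z + (partial_deriv i ^^ a) g z"
proof (induction a)
  case (Suc a)
  from partial_deriv_cong_germ[OF Suc assms(3)]
    partial_deriv_add[OF hg_iter[OF assms(1,3)] hg_iter[OF assms(2,3)] assms(3)]
  show ?case by eventually_elim simp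
qed simp

lemma iter_cmult:
  assumes "holomorphic_germ n f" "i < n"
  shows "\<forall>\<^sub>F z in near_origin n. (partial_deriv i ^^ a) (\<lambda>z. c * f z) z = c * (partial_deriv i ^^ a) f z"
proof (induction a)
  case (Suc a)
  from partial_deriv_cong_germ[OF Suc assms(2)] partial_deriv_cmult[OF hg_iter[OF assms] assms(2)]
  show ?case by eventually_elim simp
qed simp

text \<open>Of the Leibniz rule only two terms remain, since the factor is linear. For
  \<open>a = 0\<close> the truncated index \<open>a - 1\<close> is harmless because its factor is
  0.\<close>

lemma iter_coord_same:
  assumes "holomorphic_germ n f" "i < n"
  shows "\<forall>\<^sub>F z in near_origin n. (partial_deriv i ^^ a) (\<lambda>z. z i * f z) z =
     z i * (partial_deriv i ^^ a) f z + of_nat a * (partial_deriv i ^^ (a - 1)) f z"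
proof (induction a)
  case (Suc a)
  have 1: "\<forall>\<^sub>F z in near_origin n. partial_deriv i (\<lambda>z. z i * (partial_deriv i ^^ a) f z + of_nat a * (partial_deriv i ^^ (a - 1)) f z) z
     = partial_deriv i (\<lambda>z. z i * (partial_deriv i ^^ a) f z) z + partial_deriv i (\<lambda>z. of_nat a * (partial_deriv i ^^ (a - 1)) f z) z"
    by (intro partial_deriv_add assms hg_mult hg_coord hg_const hg_iter)
  from partial_deriv_cong_germ[OF Suc assms(2)] 1
    partial_deriv_mult[OF hg_coord hg_iter[OF assms] assms(2), of i a]
    partial_deriv_cmult[OF hg_iter[OF assms] assms(2), of "of_nat a" "a - 1"]
  show ?case
  proof eventually_elim
    case (elim z)
    have "of_nat a * (partial_deriv i ((partial_deriv i ^^ (a - 1)) f) z) = of_nat a * (partial_deriv i ^^ a) f z"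
      by (cases a) auto
    with elim show ?case by (simp add: partial_deriv_coord algebra_simps)
  qed
qed simp

lemma iter_coord_other:
  assumes "holomorphic_germ n f" "i < n" "i \<noteq> j"
  shows "\<forall>\<^sub>F z in near_origin n. (partial_deriv i ^^ a) (\<lambda>z. z j * f z) z = z j * (partial_deriv i ^^ a) f z"
proof (induction a)
  case (Suc a)
  from partial_deriv_cong_germ[OF Suc assms(2)] partial_deriv_mult[OF hg_coord hg_iter[OF assms(1,2)] assms(2), of j a]
  show ?case by eventually_elim (use assms(3) in \<open>simp add: partial_deriv_coord\<close>)
qed simp

lemma iter_commute:
  assumes "holomorphic_germ n f" "i < n" "j < n"
  shows "\<forall>\<^sub>F z in near_origin n. (partial_deriv i ^^ a) (partial_deriv j f) z = partial_deriv j ((partial_deriv i ^^ a) f) z"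
proof (induction a)
  case (Suc a)
  from partial_deriv_cong_germ[OF Suc assms(2)] partial_deriv_commute_germ[OF hg_iter[OF assms(1,2)] assms(3,2), of a]
  show ?case by eventually_elim simp
qed simp

text \<open>The Taylor coefficient of x^a y^b at the origin. Written as an iterated derivative, it
  inherits continuity in a parameter from the derivatives.\<close>

definition coef :: "nat \<Rightarrow> nat \<Rightarrow> (cvec \<Rightarrow> complex) \<Rightarrow> complex" where
  "coef a b h = (partial_deriv 0 ^^ a) ((partial_deriv (Suc 0) ^^ b) h) origin / (fact a * fact b)"

lemma iter2_cong:
  assumes "\<forall>\<^sub>F z in near_origin 2. f z = g z"
  shows "(partial_deriv 0 ^^ a) f origin = (partial_deriv 0 ^^ a) g origin"
  by (rule eventually_near_origin_at[OF iter_cong[OF assms]]) simp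

lemma coef_cong:
  assumes "\<forall>\<^sub>F z in near_origin 2. f z = g z"
  shows "coef a b f = coef a b g"
  unfolding coef_def by (subst iter2_cong[OF iter_cong[OF assms]]) auto

lemma coef_00: "coef 0 0 h = h origin"
  by (simp add: coef_def)

lemma coef_add:
  assumes "holomorphic_germ 2 f" "holomorphic_germ 2 g"
  shows "coef a b (\<lambda>z. f z + g z) = coef a b f + coef a b g"
proof -
  have "(partial_deriv 0 ^^ a) ((partial_deriv (Suc 0) ^^ b) (\<lambda>z. f z + g z)) origin =
     (partial_deriv 0 ^^ a) (\<lambda>z. (partial_deriv (Suc 0) ^^ b) f z + (partial_deriv (Suc 0) ^^ b) g z) origin"
    by (rule iter2_cong[OF iter_add]) (use assms in auto)
  also have "\<dots> = (partial_deriv 0 ^^ a) ((partial_deriv (Suc 0) ^^ b) f) origin + (partial_deriv 0 ^^ a) ((partial_deriv (Suc 0) ^^ b) g) origin"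
    by (rule eventually_near_origin_at[OF iter_add]) (auto intro!: hg_iter assms)
  finally show ?thesis by (simp add: coef_def add_divide_distrib)
qed

lemma coef_cmult:
  assumes "holomorphic_germ 2 f"
  shows "coef a b (\<lambda>z. c * f z) = c * coef a b f"
proof -
  have "(partial_deriv 0 ^^ a) ((partial_deriv (Suc 0) ^^ b) (\<lambda>z. c * f z)) origin =
     (partial_deriv 0 ^^ a) (\<lambda>z. c * (partial_deriv (Suc 0) ^^ b) f z) origin"
    by (rule iter2_cong[OF iter_cmult]) (use assms in auto)
  also have "\<dots> = c * (partial_deriv 0 ^^ a) ((partial_deriv (Suc 0) ^^ b) f) origin"
    by (rule eventually_near_origin_at[OF iter_cmult]) (auto intro!: hg_iter assms)
  finally show ?thesis by (simp add: coef_def)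
qed

lemma coef_zero: "coef a b (\<lambda>_. 0) = 0"
  using coef_cmult[of "\<lambda>_. 0" a b 0] by (simp add: hg_const)

lemma coef_sum:
  "(\<And>i. i \<in> I \<Longrightarrow> holomorphic_germ 2 (f i)) \<Longrightarrow> coef a b (\<lambda>z. \<Sum>i\<in>I. f i z) = (\<Sum>i\<in>I. coef a b (f i))"
  by (induction I rule: infinite_finite_induct) (simp_all add: coef_zero coef_add hg_sum)

lemma coef_X:
  assumes "holomorphic_germ 2 h"
  shows "coef a b (\<lambda>z. z 0 * h z) = (if a = 0 then 0 else coef (a - 1) b h)"
proof -
  have "(partial_deriv 0 ^^ a) ((partial_deriv (Suc 0) ^^ b) (\<lambda>z. z 0 * h z)) origin =
     (partial_deriv 0 ^^ a) (\<lambda>z. z 0 * (partial_deriv (Suc 0) ^^ b) h z) origin"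
    by (rule iter2_cong[OF iter_coord_other]) (use assms in auto)
  also have "\<dots> = origin 0 * (partial_deriv 0 ^^ a) ((partial_deriv (Suc 0) ^^ b) h) origin +
      of_nat a * (partial_deriv 0 ^^ (a - 1)) ((partial_deriv (Suc 0) ^^ b) h) origin"
    by (rule eventually_near_origin_at[OF iter_coord_same]) (auto intro!: hg_iter assms)
  finally show ?thesis by (cases a) (simp_all add: coef_def field_simps del: of_nat_Suc funpow.simps)
qed

lemma coef_Y:
  assumes "holomorphic_germ 2 h"
  shows "coef a b (\<lambda>z. z (Suc 0) * h z) = (if b = 0 then 0 else coef a (b - 1) h)"
proof -
  let ?k = "\<lambda>z. of_nat b * (partial_deriv (Suc 0) ^^ (b - 1)) h z"
  have k: "holomorphic_germ 2 ((partial_deriv (Suc 0) ^^ m) h)" for m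
    by (rule hg_iter[OF assms]) simp
  have "(partial_deriv 0 ^^ a) ((partial_deriv (Suc 0) ^^ b) (\<lambda>z. z (Suc 0) * h z)) origin =
     (partial_deriv 0 ^^ a) (\<lambda>z. z (Suc 0) * (partial_deriv (Suc 0) ^^ b) h z + ?k z) origin"
    by (rule iter2_cong[OF iter_coord_same]) (use assms in auto)
  also have "\<dots> = (partial_deriv 0 ^^ a) (\<lambda>z. z (Suc 0) * (partial_deriv (Suc 0) ^^ b) h z) origin + (partial_deriv 0 ^^ a) ?k origin"
    by (rule eventually_near_origin_at[OF iter_add]) (auto intro!: hg_mult hg_coord hg_const k)
  also have "(partial_deriv 0 ^^ a) (\<lambda>z. z (Suc 0) * (partial_deriv (Suc 0) ^^ b) h z) origin =
     origin (Suc 0) * (partial_deriv 0 ^^ a) ((partial_deriv (Suc 0) ^^ b) h) origin"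
    by (rule eventually_near_origin_at[OF iter_coord_other[OF k]]) auto
  also have "(partial_deriv 0 ^^ a) ?k origin = of_nat b * (partial_deriv 0 ^^ a) ((partial_deriv (Suc 0) ^^ (b - 1)) h) origin"
    by (rule eventually_near_origin_at[OF iter_cmult[OF k]]) auto
  finally show ?thesis by (cases b) (simp_all add: coef_def field_simps del: of_nat_Suc funpow.simps)
qed

lemma coef_X_power:
  "holomorphic_germ 2 h \<Longrightarrow> coef a b (\<lambda>z. z 0 ^ k * h z) = (if a < k then 0 else coef (a - k) b h)"
proof (induction k arbitrary: a)
  case (Suc k)
  have "(\<lambda>z. z 0 ^ Suc k * h z) = (\<lambda>z. z 0 * (z 0 ^ k * h z))" by (simp add: mult.assoc)
  thus ?case using Suc by (cases a) (auto simp: coef_X hg_mult hg_power hg_coord)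
qed simp

lemma coef_Y_power:
  "holomorphic_germ 2 h \<Longrightarrow> coef a b (\<lambda>z. z (Suc 0) ^ k * h z) = (if b < k then 0 else coef a (b - k) h)"
proof (induction k arbitrary: b)
  case (Suc k)
  have "(\<lambda>z. z (Suc 0) ^ Suc k * h z) = (\<lambda>z. z (Suc 0) * (z (Suc 0) ^ k * h z))" by (simp add: mult.assoc)
  thus ?case using Suc by (cases b) (auto simp: coef_Y hg_mult hg_power hg_coord)
qed simp

lemma coef_const: "coef a b (\<lambda>_. c) = (if a = 0 \<and> b = 0 then c else 0)"
proof -
  have *: "(partial_deriv i ^^ a) (\<lambda>_. c) = (\<lambda>_. if a = 0 then c else 0)" for i a c by (induction a) auto
  show ?thesis unfolding coef_def * by (auto simp: fact_0)
qed

definition mono :: "nat \<Rightarrow> nat \<Rightarrow> cvec \<Rightarrow> complex" where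
  "mono a b z = z 0 ^ a * z (Suc 0) ^ b"

lemma hg_mono: "holomorphic_germ n (mono a b)"
  unfolding mono_def[abs_def] by (intro hg_mult hg_power hg_coord)

lemma coef_mono_mult:
  assumes "holomorphic_germ 2 h"
  shows "coef i j (\<lambda>z. mono a b z * h z) = (if i < a \<or> j < b then 0 else coef (i - a) (j - b) h)"
proof -
  have "coef i j (\<lambda>z. mono a b z * h z) = coef i j (\<lambda>z. z 0 ^ a * (z (Suc 0) ^ b * h z))"
    by (simp add: mono_def mult.assoc)
  thus ?thesis using assms by (simp add: coef_X_power coef_Y_power hg_mult hg_power hg_coord)
qed

lemma coef_mono: "coef i j (mono a b) = (if i = a \<and> j = b then 1 else 0)"
  using coef_mono_mult[OF hg_const, of i j a b 1] by (auto simp: coef_const)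

lemma coef_partial_Y:
  "coef a b (partial_deriv (Suc 0) h) = of_nat (Suc b) * coef a (Suc b) h"
proof -
  have "(partial_deriv (Suc 0) ^^ b) (partial_deriv (Suc 0) h) = (partial_deriv (Suc 0) ^^ Suc b) h"
    by (simp add: funpow_swap1)
  thus ?thesis by (simp add: coef_def field_simps del: funpow.simps of_nat_Suc)
qed

lemma coef_partial_X:
  assumes "holomorphic_germ 2 h"
  shows "coef a b (partial_deriv 0 h) = of_nat (Suc a) * coef (Suc a) b h"
proof -
  have "(partial_deriv 0 ^^ a) ((partial_deriv (Suc 0) ^^ b) (partial_deriv 0 h)) origin =
     (partial_deriv 0 ^^ a) (partial_deriv 0 ((partial_deriv (Suc 0) ^^ b) h)) origin"
    by (rule iter2_cong[OF iter_commute]) (use assms in auto)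
  also have "\<dots> = (partial_deriv 0 ^^ Suc a) ((partial_deriv (Suc 0) ^^ b) h) origin"
    by (simp add: funpow_swap1)
  finally show ?thesis by (simp add: coef_def field_simps del: funpow.simps of_nat_Suc)
qed

lemma hg_split2:
  assumes "holomorphic_germ 2 h"
  obtains u v where "holomorphic_germ 2 u" "holomorphic_germ 2 v"
    "\<forall>\<^sub>F z in near_origin 2. h z = h origin + z 0 * u z + z (Suc 0) * v z"
proof -
  obtain u where u: "holomorphic_germ 2 u" "\<forall>\<^sub>F z in near_origin 2. h z = h (z(0 := 0)) + z 0 * u z"
    using hg_divide_coord[OF assms, of 0] by auto
  obtain w where w: "holomorphic_germ 2 w" "\<forall>\<^sub>F z in near_origin 2. h z = h (z(Suc 0 := 0)) + z (Suc 0) * w z"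
    using hg_divide_coord[OF assms, of "Suc 0"] by auto
  define \<phi> where "\<phi> k = (if k = 0 then (\<lambda>_. 0) else (\<lambda>z::cvec. z k))" for k :: nat
  have \<phi>: "cgerm 2 2 \<phi>" by (auto simp: cgerm_def \<phi>_def hg_coord hg_const)
  have c: "cmap 2 \<phi> z = z(0 := 0)" "z(0 := 0, Suc 0 := 0) = origin" if "z \<in> Cn 2" for z
    using that by (auto simp: cmap_def \<phi>_def Cn_def fun_eq_iff numeral_2_eq_2 less_Suc_eq not_less_eq Suc_le_eq)
  show ?thesis
  proof (rule that[of u "\<lambda>z. w (cmap 2 \<phi> z)"])
    show "\<forall>\<^sub>F z in near_origin 2. h z = h origin + z 0 * u z + z (Suc 0) * w (cmap 2 \<phi> z)"
      using u(2) eventually_cmap[OF \<phi> w(2)] near_origin_Cn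
    proof eventually_elim
      case (elim z)
      have "h (z(0 := 0)) = h origin + z (Suc 0) * w (z(0 := 0))"
        using elim(2) unfolding c(1)[OF elim(3)] by (simp add: c(2)[OF elim(3)] del: fun_upd_apply) simp
      thus ?case using elim(1) c(1)[OF elim(3)] by simp
    qed
  qed (use u hg_cmap[OF \<phi> w(1)] in auto)
qed

text \<open>The remainder is measured by pure powers of the two variables and not by total degree,
  because these powers are what is known to lie in the Jacobian ideal. Splitting h into h(0) + x u +
  y v lowers \<open>N\<close> for u and \<open>M\<close> for v.\<close>

lemma taylor2_aux:
  assumes "holomorphic_germ 2 h"
  shows "\<exists>c h1 h2. holomorphic_germ 2 h1 \<and> holomorphic_germ 2 h2 \<and> (\<forall>\<^sub>F z in near_origin 2.
     h z = (\<Sum>a<N. \<Sum>b<M. c a b * mono a b z) + z 0 ^ N * h1 z + z (Suc 0) ^ M * h2 z)"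
  using assms
proof (induction "N + M" arbitrary: N M h)
  case (0 N M h) thus ?case
    by (intro exI[of _ "\<lambda>_ _. 0"] exI[of _ h] exI[of _ "\<lambda>_. 0"]) (auto simp: hg_const)
next
  case (Suc k N M h)
  show ?case
  proof (cases "N = 0 \<or> M = 0")
    case True
    thus ?thesis
    proof
      assume "N = 0" thus ?thesis using Suc(3)
        by (intro exI[of _ "\<lambda>_ _. 0"] exI[of _ h] exI[of _ "\<lambda>_. 0"]) (auto simp: hg_const)
    next
      assume "M = 0" thus ?thesis using Suc(3)
        by (intro exI[of _ "\<lambda>_ _. 0"] exI[of _ "\<lambda>_. 0"] exI[of _ h]) (auto simp: hg_const)
    qed
  next
    case False
    then obtain N' M' where NM: "N = Suc N'" "M = Suc M'" by (meson not0_implies_Suc)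
    obtain u v where u: "holomorphic_germ 2 u" "holomorphic_germ 2 v"
      "\<forall>\<^sub>F z in near_origin 2. h z = h origin + z 0 * u z + z (Suc 0) * v z"
      using hg_split2[OF Suc(3)] by blast
    have "k = N' + M" "k = N + M'" using Suc(2) NM by auto
    from Suc(1)[OF this(1) u(1)] Suc(1)[OF this(2) u(2)]
    obtain c1 h1 h2 c2 k1 k2 where c:
      "holomorphic_germ 2 h1" "holomorphic_germ 2 h2" "holomorphic_germ 2 k1" "holomorphic_germ 2 k2"
      "\<forall>\<^sub>F z in near_origin 2. u z = (\<Sum>a<N'. \<Sum>b<M. c1 a b * mono a b z) + z 0 ^ N' * h1 z + z (Suc 0) ^ M * h2 z"
      "\<forall>\<^sub>F z in near_origin 2. v z = (\<Sum>a<N. \<Sum>b<M'. c2 a b * mono a b z) + z 0 ^ N * k1 z + z (Suc 0) ^ M' * k2 z"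
      by blast
    define d where "d a b = (if a = 0 \<and> b = 0 then h origin else 0) + (if a = 0 then 0 else c1 (a - 1) b) +
       (if b = 0 then 0 else c2 a (b - 1))" for a b
    have s: "(\<Sum>a<N. \<Sum>b<M. d a b * mono a b z) = h origin + z 0 * (\<Sum>a<N'. \<Sum>b<M. c1 a b * mono a b z) +
        z (Suc 0) * (\<Sum>a<N. \<Sum>b<M'. c2 a b * mono a b z)" for z
    proof -
      have 1: "(\<Sum>a<N. \<Sum>b<M. (if a = 0 \<and> b = 0 then h origin else 0) * mono a b z) = h origin"
        unfolding NM sum.lessThan_Suc_shift by (simp add: mono_def)
      have 2: "(\<Sum>a<N. \<Sum>b<M. (if a = 0 then 0 else c1 (a - 1) b) * mono a b z) = z 0 * (\<Sum>a<N'. \<Sum>b<M. c1 a b * mono a b z)"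
        unfolding NM(1) sum.lessThan_Suc_shift[of _ N'] by (simp add: mono_def sum_distrib_left mult_ac)
      have 3: "(\<Sum>a<N. \<Sum>b<M. (if b = 0 then 0 else c2 a (b - 1)) * mono a b z) = z (Suc 0) * (\<Sum>a<N. \<Sum>b<M'. c2 a b * mono a b z)"
        unfolding NM(2) sum.lessThan_Suc_shift[of _ M'] by (simp add: mono_def sum_distrib_left mult_ac)
      show ?thesis by (simp only: d_def distrib_right sum.distrib 1 2 3)
    qed
    have "\<forall>\<^sub>F z in near_origin 2. h z = (\<Sum>a<N. \<Sum>b<M. d a b * mono a b z) + z 0 ^ N * (h1 z + z (Suc 0) * k1 z)
       + z (Suc 0) ^ M * (z 0 * h2 z + k2 z)"
      using u(3) c(5,6)
    proof eventually_elim
      case (elim z)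
      have p: "z 0 ^ N = z 0 * z 0 ^ N'" "z (Suc 0) ^ M = z (Suc 0) * z (Suc 0) ^ M'" by (simp_all add: NM)
      show ?case unfolding elim(1) elim(2) elim(3) s unfolding p by (simp only: algebra_simps)
    qed
    thus ?thesis using c(1-4)
      by (intro exI[of _ d] exI[of _ "\<lambda>z. h1 z + z (Suc 0) * k1 z"] exI[of _ "\<lambda>z. z 0 * h2 z + k2 z"])
         (auto intro!: hg_add hg_mult hg_coord)
  qed
qed

text \<open>Applying \<open>coef\<close> to the expansion identifies its coefficients: the two
  remainders contribute nothing at exponents below \<open>N\<close> and \<open>M\<close>.\<close>

lemma taylor2:
  assumes h: "holomorphic_germ 2 h"
  obtains h1 h2 where "holomorphic_germ 2 h1" "holomorphic_germ 2 h2"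
    "\<forall>\<^sub>F z in near_origin 2. h z = (\<Sum>a<N. \<Sum>b<M. coef a b h * mono a b z) + z 0 ^ N * h1 z + z (Suc 0) ^ M * h2 z"
proof -
  obtain c h1 h2 where c: "holomorphic_germ 2 h1" "holomorphic_germ 2 h2" "\<forall>\<^sub>F z in near_origin 2.
     h z = (\<Sum>a<N. \<Sum>b<M. c a b * mono a b z) + z 0 ^ N * h1 z + z (Suc 0) ^ M * h2 z"
    using taylor2_aux[OF h] by blast
  have "coef i j h = c i j" if ij: "i < N" "j < M" for i j
  proof -
    have "coef i j h = coef i j (\<lambda>z. (\<Sum>a<N. \<Sum>b<M. c a b * mono a b z) + z 0 ^ N * h1 z + z (Suc 0) ^ M * h2 z)"
      by (rule coef_cong[OF c(3)])
    also have "\<dots> = (\<Sum>a<N. \<Sum>b<M. c a b * (if i = a \<and> j = b then 1 else 0))"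
      using ij c(1,2) by (simp add: coef_add coef_sum coef_cmult coef_mono coef_X_power coef_Y_power
          hg_add hg_sum hg_mult hg_const hg_mono hg_power hg_coord)
    also have "\<dots> = (\<Sum>a<N. if i = a then c i j else 0)"
      using ij by (intro sum.cong refl) (auto simp: if_distrib cong: if_cong)
    finally show ?thesis using ij by simp
  qed
  hence "\<forall>\<^sub>F z in near_origin 2. h z = (\<Sum>a<N. \<Sum>b<M. coef a b h * mono a b z) + z 0 ^ N * h1 z + z (Suc 0) ^ M * h2 z"
    using c(3) by simp
  with c(1,2) show ?thesis by (rule that)
qed

text \<open>Only the Taylor polynomial of \<open>A\<close> with exponents up to \<open>i\<close> and
  \<open>j\<close> matters; the remainder is a sum of a multiple of x^(i+1) and a multiple of
  y^(j+1).\<close>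

lemma coef_mult:
  assumes A: "holomorphic_germ 2 A" and g: "holomorphic_germ 2 g"
  shows "coef i j (\<lambda>z. A z * g z) = (\<Sum>a\<le>i. \<Sum>b\<le>j. coef a b A * coef (i - a) (j - b) g)"
proof -
  obtain h1 h2 where h: "holomorphic_germ 2 h1" "holomorphic_germ 2 h2"
    "\<forall>\<^sub>F z in near_origin 2. A z = (\<Sum>a<Suc i. \<Sum>b<Suc j. coef a b A * mono a b z) + z 0 ^ Suc i * h1 z + z (Suc 0) ^ Suc j * h2 z"
    using taylor2[OF A] by blast
  have "coef i j (\<lambda>z. A z * g z) = coef i j (\<lambda>z. (\<Sum>a<Suc i. \<Sum>b<Suc j. coef a b A * (mono a b z * g z)) +
      z 0 ^ Suc i * (h1 z * g z) + z (Suc 0) ^ Suc j * (h2 z * g z))"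
    by (rule coef_cong) (use h(3) in eventually_elim, simp add: ring_distribs sum_distrib_right mult.assoc)
  also have "\<dots> = coef i j (\<lambda>z. \<Sum>a<Suc i. \<Sum>b<Suc j. coef a b A * (mono a b z * g z))"
    using h(1,2) g by (simp del: sum.lessThan_Suc power_Suc add: coef_add coef_X_power coef_Y_power
        hg_add hg_sum hg_mult hg_const hg_mono hg_power hg_coord)
  also have "\<dots> = (\<Sum>a<Suc i. \<Sum>b<Suc j. coef a b A * coef (i - a) (j - b) g)"
    using g by (simp del: sum.lessThan_Suc add: coef_sum coef_cmult coef_mono_mult
        hg_sum hg_mult hg_const hg_mono)
  finally show ?thesis by (simp only: lessThan_Suc_atMost)
qed

subsection \<open>Functionals vanishing on the Jacobian ideal\<close>

text \<open>
  \<open>L i j\<close> is the value of a functional at \<open>x\<^sup>i y\<^sup>j\<close>, and \<open>P\<close> is the coefficient array of a function. The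
  truncation at \<open>K\<close> loses nothing when the Milnor number is \<open>K\<close>, because then \<open>x\<^sup>K\<close> and \<open>y\<^sup>K\<close> lie in the
  Jacobian ideal.
\<close>

definition jrel :: "nat \<Rightarrow> (nat \<Rightarrow> nat \<Rightarrow> complex) \<Rightarrow> (nat \<Rightarrow> nat \<Rightarrow> complex) \<Rightarrow> bool" where
  "jrel K P L \<longleftrightarrow> (\<forall>i j.
     (\<Sum>a<K. \<Sum>b<K. of_nat (Suc a) * P (Suc a) b * L (i + a) (j + b)) = 0 \<and>
     (\<Sum>a<K. \<Sum>b<K. of_nat (Suc b) * P a (Suc b) * L (i + a) (j + b)) = 0)"

definition dual_for :: "nat \<Rightarrow> (nat \<times> nat) set \<Rightarrow> (nat \<Rightarrow> nat \<Rightarrow> complex) \<Rightarrow> (nat \<Rightarrow> nat \<Rightarrow> complex) \<Rightarrow> bool" where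
  "dual_for K E P L \<longleftrightarrow> (\<exists>i j. L i j \<noteq> 0) \<and> (\<forall>i j. K \<le> i \<or> K \<le> j \<longrightarrow> L i j = 0) \<and>
     (\<forall>(i, j)\<in>E. L i j = 0) \<and> jrel K P L"

text \<open>Fewer than \<open>K\<close> monomials cannot span an algebra of dimension
  \<open>K\<close>. They are completed by as few basis elements as possible; the coordinate along
  one of these kills \<open>E\<close>, the Jacobian ideal and the other added elements.\<close>

lemma dual_exists:
  assumes g: "holomorphic_germ 2 g" and m: "milnor_number 2 g = enat K" and E: "finite E" "card E < K"
  shows "\<exists>L. dual_for K E (\<lambda>a b. coef a b g) L"
proof -
  obtain v :: "nat \<Rightarrow> _" where v: "spans_mod 2 g {..<K} v" using m milnor_number_iff[OF g] by blast
  have vh: "holomorphic_germ 2 (v r)" if "r < K" for r using v that by (auto simp: spans_mod_def)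
  define Q where "Q R f c d \<longleftrightarrow> (\<lambda>z. f z - (\<Sum>p\<in>E. c p * mono (fst p) (snd p) z) - (\<Sum>r\<in>R. d r * v r z)) \<in> jac 2 g" for R f c d
  \<comment> \<open>\<open>W R\<close> is the span of the Jacobian ideal, the monomials in
    \<open>E\<close> and the basis elements with index in \<open>R\<close>; \<open>Q\<close> records
    the coefficients.\<close>
  define W where "W R = {f. holomorphic_germ 2 f \<and> (\<exists>c d. Q R f c d)}" for R
  have "W {..<K} = Collect (holomorphic_germ 2)"
  proof -
    have "f \<in> W {..<K}" if f: "holomorphic_germ 2 f" for f
    proof -
      obtain d where "(\<lambda>z. f z - (\<Sum>i<K. d i * v i z)) \<in> jac 2 g" using v f unfolding spans_mod_def by blast
      hence "Q {..<K} f (\<lambda>_. 0) d" by (simp add: Q_def)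
      thus ?thesis using f unfolding W_def by blast
    qed
    thus ?thesis by (auto simp: W_def)
  qed
  hence "\<exists>R. (R \<subseteq> {..<K} \<and> W R = Collect (holomorphic_germ 2)) \<and>
     (\<forall>S. S \<subseteq> {..<K} \<and> W S = Collect (holomorphic_germ 2) \<longrightarrow> card R \<le> card S)"
    by (intro ex_has_least_nat[of _ "{..<K}"]) simp
  then obtain R where R: "R \<subseteq> {..<K}" "W R = Collect (holomorphic_germ 2)"
      "\<And>S. S \<subseteq> {..<K} \<Longrightarrow> W S = Collect (holomorphic_germ 2) \<Longrightarrow> card R \<le> card S"
    by metis
  have finR: "finite R" using R(1) finite_subset by blast
  \<comment> \<open>Otherwise the monomials in \<open>E\<close> alone would span, and the Milnor
    number would be at most \<open>card E\<close>.\<close>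
  have "R \<noteq> {}"
  proof
    assume "R = {}"
    have "spans_mod 2 g E (\<lambda>p. mono (fst p) (snd p))" unfolding spans_mod_def
    proof (intro conjI ballI allI impI E(1) hg_mono)
      fix f assume "holomorphic_germ 2 f"
      hence "f \<in> W R" using R(2) by simp
      thus "\<exists>c. (\<lambda>z. f z - (\<Sum>p\<in>E. c p * mono (fst p) (snd p) z)) \<in> jac 2 g"
        by (auto simp add: W_def Q_def \<open>R = {}\<close>)
    qed
    then obtain k where "k \<le> card E" "milnor_number 2 g = enat k" by (rule spans_mod_milnor_le[OF g])
    thus False using m E by simp
  qed
  then obtain r where r: "r \<in> R" by blast
  define W' where "W' = W (R - {r})"
  have W'h: "f \<in> W' \<Longrightarrow> holomorphic_germ 2 f" for f by (simp add: W'_def W_def)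
  have add: "(\<lambda>z. f z + h z) \<in> W'" if f': "f \<in> W'" and h': "h \<in> W'" for f h
  proof -
    obtain c d where "Q (R - {r}) f c d" using f' unfolding W'_def W_def by blast
    hence 1: "(\<lambda>z. f z - (\<Sum>p\<in>E. c p * mono (fst p) (snd p) z) - (\<Sum>r\<in>R-{r}. d r * v r z)) \<in> jac 2 g"
      unfolding Q_def .
    obtain c' d' where "Q (R - {r}) h c' d'" using h' unfolding W'_def W_def by blast
    hence 2: "(\<lambda>z. h z - (\<Sum>p\<in>E. c' p * mono (fst p) (snd p) z) - (\<Sum>r\<in>R-{r}. d' r * v r z)) \<in> jac 2 g"
      unfolding Q_def .
    have "Q (R - {r}) (\<lambda>z. f z + h z) (\<lambda>p. c p + c' p) (\<lambda>r. d r + d' r)"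
      unfolding Q_def by (rule jac_cong[OF jac_add[OF 1 2]]) (simp add: ring_distribs sum.distrib)
    moreover have "holomorphic_germ 2 (\<lambda>z. f z + h z)" using f' h' W'h by (intro hg_add) auto
    ultimately show ?thesis unfolding W'_def W_def by blast
  qed
  have cm: "(\<lambda>z. t * f z) \<in> W'" if f': "f \<in> W'" for f t
  proof -
    obtain c d where "Q (R - {r}) f c d" using f' unfolding W'_def W_def by blast
    hence 1: "(\<lambda>z. f z - (\<Sum>p\<in>E. c p * mono (fst p) (snd p) z) - (\<Sum>r\<in>R-{r}. d r * v r z)) \<in> jac 2 g"
      unfolding Q_def .
    have "Q (R - {r}) (\<lambda>z. t * f z) (\<lambda>p. t * c p) (\<lambda>r. t * d r)"
      unfolding Q_def by (rule jac_cong[OF jac_cmult[OF 1, of t]]) (simp add: right_diff_distrib sum_distrib_left mult.assoc)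
    moreover have "holomorphic_germ 2 (\<lambda>z. t * f z)" using f' W'h by (intro hg_mult hg_const) auto
    ultimately show ?thesis unfolding W'_def W_def by blast
  qed
  have jacW: "f \<in> W'" if "f \<in> jac 2 g" for f
  proof -
    have "Q (R - {r}) f (\<lambda>_. 0) (\<lambda>_. 0)" using that by (simp add: Q_def)
    thus ?thesis using jac_hg[OF that] unfolding W'_def W_def by blast
  qed
  have monoW: "mono i j \<in> W'" if "(i, j) \<in> E" for i j
  proof -
    have "(\<Sum>p\<in>E. (if p = (i, j) then 1 else 0) * mono (fst p) (snd p) z) = mono i j z" for z
      using that E(1) by (simp add: if_distrib[of "\<lambda>x. x * _"] sum.delta cong: if_cong)
    hence "Q (R - {r}) (mono i j) (\<lambda>p. if p = (i, j) then 1 else 0) (\<lambda>_. 0)"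
      by (simp add: Q_def jac_zero)
    thus ?thesis using hg_mono unfolding W'_def W_def by blast
  qed
  have ex: "\<exists>t. (\<lambda>z. f z - t * v r z) \<in> W'" if f: "holomorphic_germ 2 f" for f
  proof -
    have "f \<in> W R" using f R(2) by simp
    then obtain c d where 1: "Q R f c d" unfolding W_def by blast
    have "Q (R - {r}) (\<lambda>z. f z - d r * v r z) c d"
      unfolding Q_def by (rule jac_cong[OF 1[unfolded Q_def]]) (simp add: sum.remove[OF finR r])
    moreover have "holomorphic_germ 2 (\<lambda>z. f z - d r * v r z)" using f vh r R(1) by (intro hg_diff hg_mult hg_const) auto
    ultimately show ?thesis unfolding W'_def W_def by blast
  qed
  \<comment> \<open>This is the minimality of \<open>R\<close>; hence \<open>W'\<close> has
    codimension exactly one.\<close>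
  have vr: "v r \<notin> W'"
  proof
    assume vW: "v r \<in> W'"
    have "f \<in> W'" if f: "holomorphic_germ 2 f" for f
    proof -
      obtain t where "(\<lambda>z. f z - t * v r z) \<in> W'" using ex[OF f] by blast
      from add[OF this cm[OF vW, of t]] show ?thesis by simp
    qed
    hence "W (R - {r}) = Collect (holomorphic_germ 2)" using W'h by (auto simp: W'_def)
    from R(3)[OF _ this] have "card R \<le> card (R - {r})" using R(1) by blast
    thus False using card_Diff1_less[OF finR r] by simp
  qed
  \<comment> \<open>The coefficient of \<open>v r\<close> modulo \<open>W'\<close>, unique because
    \<open>v r\<close> is not in \<open>W'\<close>.\<close>
  define l where "l f = (SOME t. (\<lambda>z. f z - t * v r z) \<in> W')" for f
  have l: "(\<lambda>z. f z - l f * v r z) \<in> W'" if "holomorphic_germ 2 f" for f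
    unfolding l_def by (rule someI_ex[OF ex[OF that]])
  have l_eq: "l f = t" if "holomorphic_germ 2 f" "(\<lambda>z. f z - t * v r z) \<in> W'" for f t
  proof (rule ccontr)
    assume "l f \<noteq> t"
    have "(\<lambda>z. (1 / (t - l f)) * ((f z - l f * v r z) + (-1) * (f z - t * v r z))) \<in> W'"
      by (intro cm add l that)
    also have "(\<lambda>z. (1 / (t - l f)) * ((f z - l f * v r z) + (-1) * (f z - t * v r z))) = v r"
      using \<open>l f \<noteq> t\<close> by (simp add: fun_eq_iff field_simps)
    finally show False using vr by simp
  qed
  have l_add: "l (\<lambda>z. f z + h z) = l f + l h" if "holomorphic_germ 2 f" "holomorphic_germ 2 h" for f h
  proof (rule l_eq)
    show "(\<lambda>z. f z + h z - (l f + l h) * v r z) \<in> W'"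
      using add[OF l[OF that(1)] l[OF that(2)]] by (simp add: algebra_simps)
  qed (use that hg_add in auto)
  have l_cm: "l (\<lambda>z. t * f z) = t * l f" if "holomorphic_germ 2 f" for f t
  proof (rule l_eq)
    show "(\<lambda>z. t * f z - (t * l f) * v r z) \<in> W'"
      using cm[OF l[OF that(1)], of t] by (simp add: algebra_simps)
  qed (use that hg_mult hg_const in auto)
  have l_W: "l f = 0" if "f \<in> W'" for f by (rule l_eq[OF W'h[OF that]]) (use that in simp)
  have l_sum: "l (\<lambda>z. \<Sum>i\<in>I. f i z) = (\<Sum>i\<in>I. l (f i))" if "\<And>i. i \<in> I \<Longrightarrow> holomorphic_germ 2 (f i)"
    for f and I :: "nat set"
    using that
  proof (induction I rule: infinite_finite_induct)
    case (insert i I)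
    thus ?case by (simp add: l_add hg_sum)
  qed (simp_all add: l_W[OF jacW[OF jac_zero]])
  have l_cong: "l f = l h" if "holomorphic_germ 2 f" "holomorphic_germ 2 h" "\<forall>\<^sub>F z in near_origin 2. f z = h z" for f h
  proof -
    have d: "(\<lambda>z. f z - h z) \<in> jac 2 g" by (rule jac_near_zero) (use that(3) in eventually_elim, simp)
    have "l (\<lambda>z. h z + (f z - h z)) = l h + l (\<lambda>z. f z - h z)"
      by (rule l_add) (use that hg_diff in auto)
    thus ?thesis using l_W[OF jacW[OF d]] by simp
  qed
  define L where "L i j = l (mono i j)" for i j
  have big: "l (\<lambda>z. f z * (z 0 ^ K * h z)) = 0" "l (\<lambda>z. f z * (z (Suc 0) ^ K * h z)) = 0"
    if "holomorphic_germ 2 f" "holomorphic_germ 2 h" for f h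
  proof -
    have "l (\<lambda>z. (f z * h z) * z i ^ K) = 0" for i
      by (intro l_W jacW jac_mult power_coord_in_jac[OF g m] hg_mult that)
    from this[of 0] this[of "Suc 0"]
    show "l (\<lambda>z. f z * (z 0 ^ K * h z)) = 0" "l (\<lambda>z. f z * (z (Suc 0) ^ K * h z)) = 0"
      by (simp_all add: mult_ac)
  qed
  have expand: "l (\<lambda>z. mono i j z * F z) = (\<Sum>a<K. \<Sum>b<K. coef a b F * L (i + a) (j + b))"
    if F: "holomorphic_germ 2 F" for F i j
  proof -
    obtain h1 h2 where h: "holomorphic_germ 2 h1" "holomorphic_germ 2 h2"
      "\<forall>\<^sub>F z in near_origin 2. F z = (\<Sum>a<K. \<Sum>b<K. coef a b F * mono a b z) + z 0 ^ K * h1 z + z (Suc 0) ^ K * h2 z"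
      using taylor2[OF F] by blast
    have mm: "mono i j z * mono a b z = mono (i + a) (j + b) z" for a b z by (simp add: mono_def power_add mult_ac)
    have "l (\<lambda>z. mono i j z * F z) = l (\<lambda>z. (\<Sum>a<K. \<Sum>b<K. coef a b F * mono (i + a) (j + b) z) +
        mono i j z * (z 0 ^ K * h1 z) + mono i j z * (z (Suc 0) ^ K * h2 z))"
    proof (rule l_cong)
      show "\<forall>\<^sub>F z in near_origin 2. mono i j z * F z = (\<Sum>a<K. \<Sum>b<K. coef a b F * mono (i + a) (j + b) z) +
        mono i j z * (z 0 ^ K * h1 z) + mono i j z * (z (Suc 0) ^ K * h2 z)"
        using h(3) by eventually_elim (simp add: ring_distribs sum_distrib_left mult.left_commute mm)
    qed (intro hg_add hg_mult hg_sum hg_const hg_mono hg_power hg_coord F h(1,2))+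
    also have "\<dots> = l (\<lambda>z. \<Sum>a<K. \<Sum>b<K. coef a b F * mono (i + a) (j + b) z)"
      using h(1,2) big[OF hg_mono]
      by (subst l_add l_add; (intro hg_add hg_mult hg_sum hg_const hg_mono hg_power hg_coord h(1,2))?)+ simp
    also have "\<dots> = (\<Sum>a<K. \<Sum>b<K. coef a b F * L (i + a) (j + b))"
      by (simp add: l_sum l_cm hg_sum hg_mult hg_const hg_mono L_def)
    finally show ?thesis .
  qed
  \<comment> \<open>The functional has the value 1 at \<open>v r\<close>, whose expansion is finite
    modulo the \<open>K\<close>-th powers of the variables; so it cannot vanish on all
    monomials.\<close>
  have "(\<Sum>a<K. \<Sum>b<K. coef a b (v r) * L (0 + a) (0 + b)) = 1"
  proof -
    have "l (v r) = 1" using vh r R(1) l_W[OF jacW[OF jac_zero]] jacW[OF jac_zero] by (intro l_eq) auto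
    thus ?thesis using expand[OF vh, of r 0 0] r R(1) by (auto simp: mono_def)
  qed
  hence nz: "\<exists>i j. L i j \<noteq> 0"
    by (metis (no_types, lifting) mult_zero_right sum.neutral zero_neq_one)
  have supp: "L i j = 0" if "K \<le> i \<or> K \<le> j" for i j
  proof -
    have 1: "mono i j = (\<lambda>z. mono (i - K) j z * (z 0 ^ K * 1))" if "K \<le> i"
    proof
      fix z :: cvec
      have "z 0 ^ i = z 0 ^ (i - K) * z 0 ^ K" using that by (simp flip: power_add)
      thus "mono i j z = mono (i - K) j z * (z 0 ^ K * 1)" by (simp add: mono_def)
    qed
    have 2: "mono i j = (\<lambda>z. mono i (j - K) z * (z (Suc 0) ^ K * 1))" if "K \<le> j"
    proof
      fix z :: cvec
      have "z (Suc 0) ^ j = z (Suc 0) ^ (j - K) * z (Suc 0) ^ K" using that by (simp flip: power_add)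
      thus "mono i j z = mono i (j - K) z * (z (Suc 0) ^ K * 1)" by (simp add: mono_def)
    qed
    show ?thesis
    proof (cases "K \<le> i")
      case True
      show ?thesis unfolding L_def by (subst 1[OF True]) (rule big(1)[OF hg_mono hg_const])
    next
      case False
      hence "K \<le> j" using that by simp
      from 2[OF this] show ?thesis unfolding L_def by (simp only: big(2)[OF hg_mono hg_const])
    qed
  qed
  have "jrel K (\<lambda>a b. coef a b g) L" unfolding jrel_def
  proof (intro allI conjI)
    fix i j
    have z: "l (\<lambda>z. mono i j z * partial_deriv k g z) = 0" if "k < 2" for k
      by (intro l_W jacW jac_mult jac_partial g hg_mono that)
    from z[of 0] expand[of "partial_deriv 0 g" i j] g
    show "(\<Sum>a<K. \<Sum>b<K. of_nat (Suc a) * coef (Suc a) b g * L (i + a) (j + b)) = 0"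
      by (simp add: coef_partial_X hg_partial del: of_nat_Suc)
    from z[of "Suc 0"] expand[of "partial_deriv (Suc 0) g" i j] g
    show "(\<Sum>a<K. \<Sum>b<K. of_nat (Suc b) * coef a (Suc b) g * L (i + a) (j + b)) = 0"
      by (simp add: coef_partial_Y hg_partial del: of_nat_Suc)
  qed
  moreover have "\<forall>(i, j)\<in>E. L i j = 0" using monoW l_W by (auto simp: L_def)
  ultimately show ?thesis unfolding dual_for_def using nz supp by blast
qed

section \<open>Compactness of normalised functionals\<close>

lemma finite_subsequence_limit:
  fixes f :: "nat \<Rightarrow> 'i \<Rightarrow> complex"
  assumes "finite I" "\<And>n i. i \<in> I \<Longrightarrow> cmod (f n i) \<le> B"
  shows "\<exists>r l. strict_mono (r::nat \<Rightarrow> nat) \<and> (\<forall>i\<in>I. (\<lambda>n. f (r n) i) \<longlonglongrightarrow> l i)"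
  using assms
proof (induction I)
  case empty thus ?case by (intro exI[of _ id]) (auto simp: strict_mono_def)
next
  case (insert x I)
  then obtain r l where r0: "strict_mono r" "\<forall>i\<in>I. (\<lambda>n. f (r n) i) \<longlonglongrightarrow> l i" by auto
  hence r: "strict_mono r" "\<And>i. i \<in> I \<Longrightarrow> (\<lambda>n. f (r n) i) \<longlonglongrightarrow> l i" by auto
  have "bounded (range (\<lambda>n. f (r n) x))" using insert(4) by (auto simp: bounded_iff)
  then obtain m s where s: "strict_mono s" "((\<lambda>n. f (r n) x) \<circ> s) \<longlonglongrightarrow> m"
    using bounded_imp_convergent_subsequence by blast
  have "(\<lambda>n. f ((r \<circ> s) n) i) \<longlonglongrightarrow> (l(x := m)) i" if "i \<in> insert x I" for i
  proof (cases "i = x")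
    case False
    thus ?thesis using LIMSEQ_subseq_LIMSEQ[OF r(2)[of i] s(1)] that by (simp add: o_def)
  qed (use s in \<open>simp add: o_def\<close>)
  thus ?case using strict_mono_o[OF r(1) s(1)] by (intro exI[of _ "r \<circ> s"] exI[of _ "l(x := m)"]) blast
qed

text \<open>Scaling the variables by \<open>\<lambda>\<close> and dividing by \<open>\<lambda>\<^sup>4\<close> does not change the class of Jacobian functionals.\<close>

lemma dual_limit:
  fixes P :: "nat \<Rightarrow> nat \<Rightarrow> nat \<Rightarrow> complex" and lam :: "nat \<Rightarrow> real"
  assumes d: "\<And>n. \<exists>L. dual_for K E (P n) L" and lam: "\<And>n. 0 < lam n"
    and lim: "\<And>a b. (\<lambda>n. of_real (lam n ^ (a + b) / lam n ^ 4) * P n a b) \<longlonglongrightarrow> Q a b"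
  shows "\<exists>L. dual_for K E Q L"
proof -
  obtain L where L: "\<And>n. dual_for K E (P n) (L n)" using d by metis
  define I where "I = {..<K} \<times> {..<K}"
  \<comment> \<open>Values of the functional in the rescaled variables: in each relation the powers
    of \<open>lam\<close> then combine to a common factor.\<close>
  define M where "M n i j = L n i j / of_real (lam n ^ (i + j))" for n i j
  \<comment> \<open>Normalisation by the sum of the moduli; the norm 1 survives the limit, so the
    limit functional is not zero.\<close>
  define S where "S n = (\<Sum>p\<in>I. cmod (M n (fst p) (snd p)))" for n
  define N where "N n i j = M n i j / of_real (S n)" for n i j
  have S0: "S n > 0" for n
  proof -
    obtain i j where ij: "L n i j \<noteq> 0" using L[of n] by (auto simp: dual_for_def)
    hence "(i, j) \<in> I" using L[of n] by (auto simp: dual_for_def I_def not_le[symmetric])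
    moreover have "M n i j \<noteq> 0" using ij lam[of n] by (simp add: M_def)
    ultimately show ?thesis unfolding S_def
      by (intro sum_pos2[of I "(i, j)"]) (auto simp: I_def)
  qed
  have sumN: "(\<Sum>p\<in>I. cmod (N n (fst p) (snd p))) = 1" for n
    using S0[of n] by (simp add: N_def norm_divide S_def[symmetric] flip: sum_divide_distrib)
  have "cmod (N n (fst p) (snd p)) \<le> 1" if "p \<in> I" for n p
    using member_le_sum[of p I "\<lambda>p. cmod (N n (fst p) (snd p))"] that sumN[of n] by (auto simp: I_def)
  moreover have "finite I" by (simp add: I_def)
  ultimately obtain r l where r0: "strict_mono r" "\<forall>p\<in>I. (\<lambda>n. N (r n) (fst p) (snd p)) \<longlonglongrightarrow> l p"
    using finite_subsequence_limit[of I "\<lambda>n p. N n (fst p) (snd p)" 1] by blast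
  hence r: "strict_mono r" "\<And>p. p \<in> I \<Longrightarrow> (\<lambda>n. N (r n) (fst p) (snd p)) \<longlonglongrightarrow> l p" by auto
  define T where "T i j = (if (i, j) \<in> I then l (i, j) else 0)" for i j
  have N0: "N n i j = 0" if "(i, j) \<notin> I" for n i j
    using that L[of n] by (auto simp: N_def M_def I_def dual_for_def)
  have T: "(\<lambda>n. N (r n) i j) \<longlonglongrightarrow> T i j" for i j
    using r(2)[of "(i, j)"] N0 by (auto simp: T_def)
  have "(\<lambda>n. \<Sum>p\<in>I. cmod (N (r n) (fst p) (snd p))) \<longlonglongrightarrow> (\<Sum>p\<in>I. cmod (T (fst p) (snd p)))"
    by (intro tendsto_sum tendsto_norm T)
  hence sumT: "(\<Sum>p\<in>I. cmod (T (fst p) (snd p))) = 1" unfolding sumN by (simp add: LIMSEQ_const_iff)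
  have nz: "\<exists>i j. T i j \<noteq> 0"
  proof (rule ccontr)
    assume "\<nexists>i j. T i j \<noteq> 0"
    thus False using sumT by simp
  qed
  define Pn where "Pn n a b = of_real (lam n ^ (a + b) / lam n ^ 4) * P n a b" for n a b
  have limr: "(\<lambda>n. Pn (r n) a b) \<longlonglongrightarrow> Q a b" for a b
    using LIMSEQ_subseq_LIMSEQ[OF lim r(1)] by (simp add: o_def Pn_def)
  have Neq: "Pn n a b * N n i j = of_real (lam n ^ (a + b) / (lam n ^ 4 * lam n ^ (i + j) * S n)) * (P n a b * L n i j)" for n a b i j
    by (simp add: Pn_def N_def M_def mult.assoc)
  have rel1: "(\<Sum>a<K. \<Sum>b<K. of_nat (Suc a) * Pn n (Suc a) b * N n (i + a) (j + b)) = 0" for n i j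
  proof -
    have "of_nat (Suc a) * Pn n (Suc a) b * N n (i + a) (j + b) =
        of_real (lam n / (lam n ^ 4 * lam n ^ (i + j) * S n)) * (of_nat (Suc a) * P n (Suc a) b * L n (i + a) (j + b))" for a b
    proof -
      have "lam n ^ (Suc a + b) / (lam n ^ 4 * lam n ^ (i + a + (j + b)) * S n) = lam n / (lam n ^ 4 * lam n ^ (i + j) * S n)"
        using lam[of n] S0[of n] by (simp add: power_add field_simps)
      thus ?thesis using Neq[of n "Suc a" b "i + a" "j + b"] by (simp add: mult_ac)
    qed
    hence "(\<Sum>a<K. \<Sum>b<K. of_nat (Suc a) * Pn n (Suc a) b * N n (i + a) (j + b)) =
       of_real (lam n / (lam n ^ 4 * lam n ^ (i + j) * S n)) * (\<Sum>a<K. \<Sum>b<K. of_nat (Suc a) * P n (Suc a) b * L n (i + a) (j + b))"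
      by (simp add: sum_distrib_left del: of_nat_Suc)
    thus ?thesis using L[of n] by (simp add: dual_for_def jrel_def del: of_nat_Suc)
  qed
  have rel2: "(\<Sum>a<K. \<Sum>b<K. of_nat (Suc b) * Pn n a (Suc b) * N n (i + a) (j + b)) = 0" for n i j
  proof -
    have "of_nat (Suc b) * Pn n a (Suc b) * N n (i + a) (j + b) =
        of_real (lam n / (lam n ^ 4 * lam n ^ (i + j) * S n)) * (of_nat (Suc b) * P n a (Suc b) * L n (i + a) (j + b))" for a b
    proof -
      have "lam n ^ (a + Suc b) / (lam n ^ 4 * lam n ^ (i + a + (j + b)) * S n) = lam n / (lam n ^ 4 * lam n ^ (i + j) * S n)"
        using lam[of n] S0[of n] by (simp add: power_add field_simps)
      thus ?thesis using Neq[of n a "Suc b" "i + a" "j + b"] by (simp add: mult_ac)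
    qed
    hence "(\<Sum>a<K. \<Sum>b<K. of_nat (Suc b) * Pn n a (Suc b) * N n (i + a) (j + b)) =
       of_real (lam n / (lam n ^ 4 * lam n ^ (i + j) * S n)) * (\<Sum>a<K. \<Sum>b<K. of_nat (Suc b) * P n a (Suc b) * L n (i + a) (j + b))"
      by (simp add: sum_distrib_left del: of_nat_Suc)
    thus ?thesis using L[of n] by (simp add: dual_for_def jrel_def del: of_nat_Suc)
  qed
  have "jrel K Q T" unfolding jrel_def
  proof (intro allI conjI)
    fix i j
    have "(\<lambda>n. \<Sum>a<K. \<Sum>b<K. of_nat (Suc a) * Pn (r n) (Suc a) b * N (r n) (i + a) (j + b))
       \<longlonglongrightarrow> (\<Sum>a<K. \<Sum>b<K. of_nat (Suc a) * Q (Suc a) b * T (i + a) (j + b))"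
      by (intro tendsto_sum tendsto_mult tendsto_const limr T)
    thus "(\<Sum>a<K. \<Sum>b<K. of_nat (Suc a) * Q (Suc a) b * T (i + a) (j + b)) = 0"
      unfolding rel1 by (simp add: LIMSEQ_const_iff)
    have "(\<lambda>n. \<Sum>a<K. \<Sum>b<K. of_nat (Suc b) * Pn (r n) a (Suc b) * N (r n) (i + a) (j + b))
       \<longlonglongrightarrow> (\<Sum>a<K. \<Sum>b<K. of_nat (Suc b) * Q a (Suc b) * T (i + a) (j + b))"
      by (intro tendsto_sum tendsto_mult tendsto_const limr T)
    thus "(\<Sum>a<K. \<Sum>b<K. of_nat (Suc b) * Q a (Suc b) * T (i + a) (j + b)) = 0"
      unfolding rel2 by (simp add: LIMSEQ_const_iff)
  qed
  moreover have "T i j = 0" if "(i, j) \<in> E" for i j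
  proof -
    have "N n i j = 0" for n using L[of n] that by (auto simp: dual_for_def N_def M_def)
    thus ?thesis using T[of i j] by (simp add: LIMSEQ_const_iff)
  qed
  moreover have "T i j = 0" if "K \<le> i \<or> K \<le> j" for i j using that by (auto simp: T_def I_def)
  ultimately show ?thesis using nz unfolding dual_for_def by (intro exI[of _ T]) auto
qed

subsection \<open>Quartics with a critical point of multiplicity at least eight\<close>

definition quartic_array :: "(nat \<Rightarrow> nat \<Rightarrow> complex) \<Rightarrow> bool" where
  "quartic_array P \<longleftrightarrow> (\<forall>a b. a + b \<le> 1 \<or> 5 \<le> a + b \<longrightarrow> P a b = 0)"

text \<open>The partial derivatives of a quartic have degree at most 3, so the truncation at 8 loses
  nothing and each relation consists of nine terms.\<close>

lemma jrel_quartic: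
  assumes P: "quartic_array P" and J: "jrel 8 P L"
  shows "2 * P 2 0 * L (i + 1) j + P 1 1 * L i (j + 1) + 3 * P 3 0 * L (i + 2) j + 2 * P 2 1 * L (i + 1) (j + 1)
      + P 1 2 * L i (j + 2) + 4 * P 4 0 * L (i + 3) j + 3 * P 3 1 * L (i + 2) (j + 1)
      + 2 * P 2 2 * L (i + 1) (j + 2) + P 1 3 * L i (j + 3) = 0" (is ?X)
    and "2 * P 0 2 * L i (j + 1) + P 1 1 * L (i + 1) j + 3 * P 0 3 * L i (j + 2) + 2 * P 1 2 * L (i + 1) (j + 1)
      + P 2 1 * L (i + 2) j + 4 * P 0 4 * L i (j + 3) + 3 * P 1 3 * L (i + 1) (j + 2)
      + 2 * P 2 2 * L (i + 2) (j + 1) + P 3 1 * L (i + 3) j = 0" (is ?Y)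
proof -
  have z: "P a b = 0" if "a + b \<le> 1 \<or> 5 \<le> a + b" for a b using P that unfolding quartic_array_def by blast
  have s8: "(\<Sum>a<8. f a) = f 0 + f 1 + f 2 + f 3 + f 4 + f 5 + f 6 + f (7::nat)" for f :: "nat \<Rightarrow> complex"
    by (simp add: eval_nat_numeral)
  have X: "(\<Sum>a<8. \<Sum>b<8. of_nat (Suc a) * P (Suc a) b * L (i + a) (j + b)) = 0"
    and Y: "(\<Sum>a<8. \<Sum>b<8. of_nat (Suc b) * P a (Suc b) * L (i + a) (j + b)) = 0"
    using J unfolding jrel_def by blast+
  show ?X using X unfolding s8 by (simp add: z eval_nat_numeral algebra_simps)
  show ?Y using Y unfolding s8 by (simp add: z eval_nat_numeral algebra_simps)
qed

text \<open>An array supported in the 8 by 8 square vanishes in high degrees, so vanishing can be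
  proved by descending degree: once all higher degrees vanish, only the lowest-order terms of the
  partial derivatives contribute to a relation.\<close>

lemma descend_zero:
  fixes L :: "nat \<Rightarrow> nat \<Rightarrow> complex"
  assumes top: "\<And>i j. 8 \<le> i \<or> 8 \<le> j \<Longrightarrow> L i j = 0"
    and step: "\<And>d i j. \<lbrakk>d0 \<le> d; \<And>i j. d < i + j \<Longrightarrow> L i j = 0; i + j = d\<rbrakk> \<Longrightarrow> L i j = 0"
  shows "d0 \<le> i + j \<Longrightarrow> L i j = 0"
proof -
  have "\<forall>i j. d0 + (15 - k) \<le> i + j \<longrightarrow> L i j = 0" for k
  proof (induction k)
    case 0
    \<comment> \<open>Two indices below 8 have a sum of at most 14.\<close>
    have "8 \<le> i \<or> 8 \<le> j" if "d0 + 15 \<le> i + j" for i j using that by auto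
    thus ?case using top by auto
  next
    case (Suc k)
    show ?case
    proof (intro allI impI)
      fix i j assume ij: "d0 + (15 - Suc k) \<le> i + j"
      show "L i j = 0"
      proof (cases "d0 + (15 - k) \<le> i + j")
        case False
        show ?thesis
        proof (rule step[of "i + j"])
          show "L a b = 0" if "i + j < a + b" for a b
            using Suc ij that by (intro Suc[rule_format]) linarith
        qed (use ij in auto)
      qed (use Suc in auto)
    qed
  qed
  from this[of 15] show "d0 \<le> i + j \<Longrightarrow> L i j = 0" by auto
qed

section \<open>Vanishing of functionals, by the type of the terms of degree 2 and 3\<close>

context
  fixes P L :: "nat \<Rightarrow> nat \<Rightarrow> complex"
  assumes P: "quartic_array P" and J: "jrel 8 P L" and top: "\<And>i j. 8 \<le> i \<or> 8 \<le> j \<Longrightarrow> L i j = 0"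
begin

lemmas relX = jrel_quartic(1)[OF P J]
lemmas relY = jrel_quartic(2)[OF P J]

text \<open>Type A1: the linear parts of the two partial derivatives are independent, so in each
  positive degree the leading relations kill all values by Cramer's rule.\<close>

lemma dual_zero_nondegenerate:
  assumes "4 * P 2 0 * P 0 2 \<noteq> P (Suc 0) (Suc 0) ^ 2" "L 0 0 = 0"
  shows "L i j = 0"
proof (cases "1 \<le> i + j")
  case True
  show ?thesis
  proof (rule descend_zero[OF top _ True])
    fix d i j assume d: "1 \<le> d" and hi: "\<And>i j. d < i + j \<Longrightarrow> L i j = 0" and ij: "i + j = d"
    have *: "L (a + 1) b = 0 \<and> L a (b + 1) = 0" if "a + b + 1 = d" for a b
    proof -
      have 1: "2 * P 2 0 * L (a + 1) b + P (Suc 0) (Suc 0) * L a (b + 1) = 0"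
        using relX[of a b] that by (simp add: hi)
      have 2: "2 * P 0 2 * L a (b + 1) + P (Suc 0) (Suc 0) * L (a + 1) b = 0"
        using relY[of a b] that by (simp add: hi)
      have "(4 * P 2 0 * P 0 2 - P (Suc 0) (Suc 0) ^ 2) * L (a + 1) b =
          2 * P 0 2 * (2 * P 2 0 * L (a + 1) b + P (Suc 0) (Suc 0) * L a (b + 1)) - P (Suc 0) (Suc 0) * (2 * P 0 2 * L a (b + 1) + P (Suc 0) (Suc 0) * L (a + 1) b)"
        "(4 * P 2 0 * P 0 2 - P (Suc 0) (Suc 0) ^ 2) * L a (b + 1) =
          2 * P 2 0 * (2 * P 0 2 * L a (b + 1) + P (Suc 0) (Suc 0) * L (a + 1) b) - P (Suc 0) (Suc 0) * (2 * P 2 0 * L (a + 1) b + P (Suc 0) (Suc 0) * L a (b + 1))"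
        by (simp_all add: algebra_simps power2_eq_square)
      hence "(4 * P 2 0 * P 0 2 - P (Suc 0) (Suc 0) ^ 2) * L (a + 1) b = 0" "(4 * P 2 0 * P 0 2 - P (Suc 0) (Suc 0) ^ 2) * L a (b + 1) = 0"
        unfolding 1 2 by simp_all
      thus ?thesis using assms(1) by simp
    qed
    show "L i j = 0"
      using *[of "i - 1" j] *[of i "j - 1"] d ij by (cases i; cases j) auto
  qed
next
  case False
  hence "i = 0 \<and> j = 0" by auto
  thus ?thesis using assms by simp
qed

text \<open>Type D4: the cubic part is x times a quadratic form that has two distinct roots and is
  not divisible by x. The leading relations then determine everything from degree 3 on, and the
  monomials of degree at most 2 are prescribed.\<close>

lemma dual_zero_D4:
  assumes P2: "P 2 0 = 0" "P (Suc 0) (Suc 0) = 0" "P 0 2 = 0" and P3: "P 0 3 = 0" "P (Suc 0) 2 \<noteq> 0" "P 2 (Suc 0) ^ 2 \<noteq> 4 * P (Suc 0) 2 * P 3 0"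
    and k: "\<And>i j. i + j \<le> 2 \<Longrightarrow> L i j = 0"
  shows "L i j = 0"
proof (cases "3 \<le> i + j")
  case True
  show ?thesis
  proof (rule descend_zero[OF top _ True])
    fix d i j assume d: "3 \<le> d" and hi: "\<And>i j. d < i + j \<Longrightarrow> L i j = 0" and ij: "i + j = d"
    have X: "3 * P 3 0 * L (a + 2) b + 2 * P 2 (Suc 0) * L (a + 1) (b + 1) + P (Suc 0) 2 * L a (b + 2) = 0"
      and Y: "2 * P (Suc 0) 2 * L (a + 1) (b + 1) + P 2 (Suc 0) * L (a + 2) b = 0" if "a + b + 2 = d" for a b
      using relX[of a b] relY[of a b] that by (simp_all add: hi P2 P3)
    have k3: "L (a + 3) b = 0" if "a + b + 3 = d" for a b
    proof -
      have z: "3 * P 3 0 * L (a + 3) b + 2 * P 2 (Suc 0) * L (a + 2) (b + 1) + P (Suc 0) 2 * L (a + 1) (b + 2) = 0"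
        "2 * P (Suc 0) 2 * L (a + 2) (b + 1) + P 2 (Suc 0) * L (a + 3) b = 0"
        "2 * P (Suc 0) 2 * L (a + 1) (b + 2) + P 2 (Suc 0) * L (a + 2) (b + 1) = 0"
        using X[of "a + 1" b] Y[of "a + 1" b] Y[of a "b + 1"] that by (simp_all add: eval_nat_numeral)
      \<comment> \<open>Elimination of \<open>L (a + 2) (b + 1)\<close> and
        \<open>L (a + 1) (b + 2)\<close>; the factor that remains is a multiple of the discriminant
        of the quadratic form.\<close>
      have "3 * (4 * P (Suc 0) 2 * P 3 0 - P 2 (Suc 0) ^ 2) * L (a + 3) b =
         4 * P (Suc 0) 2 * (3 * P 3 0 * L (a + 3) b + 2 * P 2 (Suc 0) * L (a + 2) (b + 1) + P (Suc 0) 2 * L (a + 1) (b + 2))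
         - 2 * P (Suc 0) 2 * (2 * P (Suc 0) 2 * L (a + 1) (b + 2) + P 2 (Suc 0) * L (a + 2) (b + 1))
         - 3 * P 2 (Suc 0) * (2 * P (Suc 0) 2 * L (a + 2) (b + 1) + P 2 (Suc 0) * L (a + 3) b)"
        by (simp add: algebra_simps power2_eq_square)
      hence "3 * (4 * P (Suc 0) 2 * P 3 0 - P 2 (Suc 0) ^ 2) * L (a + 3) b = 0" unfolding z by simp
      thus ?thesis using P3(3) by (auto simp: mult_ac)
    qed
    have k2: "L 2 (d - 2) = 0"
    proof -
      have "2 * P (Suc 0) 2 * L 2 (d - 2) + P 2 (Suc 0) * L 3 (d - 3) = 0" using Y[of 1 "d - 3"] d by (simp add: eval_nat_numeral Suc_diff_Suc)
      thus ?thesis using k3[of 0 "d - 3"] d P3 by simp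
    qed
    have k1: "L (Suc 0) (d - 1) = 0"
    proof -
      have "2 * P (Suc 0) 2 * L (Suc 0) (d - 1) + P 2 (Suc 0) * L 2 (d - 2) = 0" using Y[of 0 "d - 2"] d by (simp add: eval_nat_numeral Suc_diff_Suc)
      thus ?thesis using k2 P3 by simp
    qed
    have k0: "L 0 d = 0"
    proof -
      have "3 * P 3 0 * L 2 (d - 2) + 2 * P 2 (Suc 0) * L (Suc 0) (d - 1) + P (Suc 0) 2 * L 0 d = 0"
        using X[of 0 "d - 2"] d by (simp add: eval_nat_numeral Suc_diff_Suc)
      thus ?thesis using k1 k2 P3 by simp
    qed
    consider "i = 0" | "i = 1" | "i = 2" | "i \<ge> 3" by linarith
    thus "L i j = 0"
    proof cases
      case 4 thus ?thesis using k3[of "i - 3" j] ij by simp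
    qed (use k0 k1 k2 ij in auto)
  qed
qed (use k in auto)

text \<open>Types D5 and D6: the cubic part is x^2 times another linear form, and the type depends
  on whether y^4 is present. The leading relations kill every value with a factor x in degree at
  least 2. Pure powers of y do not occur in them and are reached through relations of lower leading
  degree.\<close>

lemma dual_zero_D:
  assumes P2: "P 2 0 = 0" "P (Suc 0) (Suc 0) = 0" "P 0 2 = 0" and P3: "P 0 3 = 0" "P (Suc 0) 2 = 0" "P 2 (Suc 0) \<noteq> 0"
    and P4: "P 0 4 \<noteq> 0 \<or> P (Suc 0) 3 \<noteq> 0"
    and k: "\<And>j. j \<le> 5 \<Longrightarrow> L 0 j = 0" "L (Suc 0) 0 = 0"
  shows "L i j = 0"
proof (cases "2 \<le> i + j")
  case True
  show ?thesis
  proof (rule descend_zero[OF top _ True])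
    fix d i j assume d: "2 \<le> d" and hi: "\<And>i j. d < i + j \<Longrightarrow> L i j = 0" and ij: "i + j = d"
    have k2: "L (a + 2) b = 0" if "a + b + 2 = d" for a b
      using relY[of a b] that by (simp add: hi P2 P3)
    have k1: "L (a + 1) (b + 1) = 0" if "a + b + 2 = d" for a b
      using relX[of a b] k2[OF that] that by (simp add: hi P2 P3)
    have pos: "L a b = 0" if "a + b = d" "0 < a" for a b
    proof (cases "a = 1")
      case True
      have "0 + (b - 1) + 2 = d" "b - 1 + 1 = b" using True that d by auto
      with k1[of 0 "b - 1"] show ?thesis using True by simp
    next
      case False
      hence "2 \<le> a" using that by simp
      then obtain a' where "a = a' + 2" by (metis add.commute le_Suc_ex)
      thus ?thesis using k2[of a' b] that by simp
    qed
    have k0: "L 0 d = 0" if d6: "6 \<le> d"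
    proof (cases "P 0 4 = 0")
      case False
      define b where "b = d - 4"
      have b: "d = b + 4" using d6 by (simp add: b_def)
      have 1: "P 2 (Suc 0) * L 3 b = 0"
        using relY[of 1 b] b P2 P3 by (simp add: hi pos eval_nat_numeral)
      have 2: "3 * P 3 0 * L 3 b + 2 * P 2 (Suc 0) * L 2 (b + 1) = 0"
        using relX[of 1 b] b P2 P3 by (simp add: hi pos eval_nat_numeral)
      have 3: "P 2 (Suc 0) * L 2 (b + 1) + 4 * P 0 4 * L 0 d = 0"
        using relY[of 0 "b + 1"] b P2 P3 by (simp add: hi pos eval_nat_numeral)
      show ?thesis using 1 2 3 P3 False by auto
    next
      case True
      hence P13: "P (Suc 0) 3 \<noteq> 0" using P4 by simp
      define b where "b = d - 5"
      have b: "d = b + 5" using d6 by (simp add: b_def)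
      have L3: "L 3 (b + 1) = 0" using relY[of 1 "b + 1"] b P3 P2 True by (simp add: hi pos eval_nat_numeral)
      have L4: "L 4 b = 0" using relY[of 2 b] b P3 P2 True by (simp add: hi pos eval_nat_numeral)
      have L2: "L 2 (b + 2) = 0" using relY[of 0 "b + 2"] b P3 P2 True by (simp add: hi pos eval_nat_numeral)
      have L3': "L 3 b = 0" using relY[of 1 b] b P3 L3 L4 L2 P2 True by (simp add: hi pos eval_nat_numeral)
      have 1: "2 * P 2 (Suc 0) * L 2 (b + 1) + P (Suc 0) 3 * L (Suc 0) (b + 3) = 0"
        using relX[of 1 b] L3' L4 L3 L2 b P2 P3 by (simp add: hi pos eval_nat_numeral)
      have 2: "P 2 (Suc 0) * L 2 (b + 1) + 3 * P (Suc 0) 3 * L (Suc 0) (b + 3) = 0"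
        using relY[of 0 "b + 1"] L3' L4 L3 L2 b P2 P3 True by (simp add: hi pos eval_nat_numeral)
      \<comment> \<open>The unknown \<open>L 2 (b + 1)\<close> has lower degree and is not yet
        known; twice the second equation minus the first eliminates it.\<close>
      have "5 * P (Suc 0) 3 * L (Suc 0) (b + 3) = 2 * (P 2 (Suc 0) * L 2 (b + 1) + 3 * P (Suc 0) 3 * L (Suc 0) (b + 3)) - (2 * P 2 (Suc 0) * L 2 (b + 1) + P (Suc 0) 3 * L (Suc 0) (b + 3))"
        by (simp add: algebra_simps)
      hence L1: "L (Suc 0) (b + 3) = 0" unfolding 1 2 using P13 by simp
      have "2 * P 2 (Suc 0) * L (Suc 0) (b + 3) + 3 * P 3 0 * L 2 (b + 2) + P (Suc 0) 3 * L 0 d = 0"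
        using relX[of 0 "b + 2"] b P2 P3 by (simp add: hi pos eval_nat_numeral algebra_simps)
      thus ?thesis using L1 L2 P13 by simp
    qed
    show "L i j = 0"
    proof (cases "i = 0")
      case True
      thus ?thesis using k0 k(1)[of d] ij by (cases "d \<le> 5") auto
    qed (use pos ij in auto)
  qed
next
  case False
  hence "(i = 0 \<and> j \<le> 5) \<or> (i = 1 \<and> j = 0)" by auto
  thus ?thesis using k by auto
qed

text \<open>Type E6: the cubic part is x^3 and y^4 is present; the six monomials form a basis of the
  local algebra of x^3 + y^4. The derivative in x kills values with a factor x^2, and the derivative
  in y, which has only terms of degree 3, kills the other high ones.\<close>

lemma dual_zero_E6:
  assumes P2: "P 2 0 = 0" "P (Suc 0) (Suc 0) = 0" "P 0 2 = 0" and P3: "P 0 3 = 0" "P (Suc 0) 2 = 0" "P 2 (Suc 0) = 0" "P 3 0 \<noteq> 0"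
    and P4: "P 0 4 \<noteq> 0"
    and k: "L 0 0 = 0" "L (Suc 0) 0 = 0" "L 0 (Suc 0) = 0" "L (Suc 0) (Suc 0) = 0" "L 0 2 = 0" "L (Suc 0) 2 = 0"
  shows "L i j = 0"
proof (cases "2 \<le> i + j")
  case True
  show ?thesis
  proof (rule descend_zero[OF top _ True])
    fix d i j assume d: "2 \<le> d" and hi: "\<And>i j. d < i + j \<Longrightarrow> L i j = 0" and ij: "i + j = d"
    have k2: "L (a + 2) b = 0" if "a + b + 2 = d" for a b
      using relX[of a b] that P3 by (simp add: hi P2)
    have k2': "L a b = 0" if "a + b = d" "2 \<le> a" for a b
    proof -
      obtain a' where "a = a' + 2" using \<open>2 \<le> a\<close> by (metis add.commute le_Suc_ex)
      thus ?thesis using k2[of a' b] that by simp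
    qed
    have k1: "L (Suc 0) (d - 1) = 0"
    proof (cases "4 \<le> d")
      case True
      then obtain b where b: "d = b + 4" by (metis add.commute le_Suc_ex)
      show ?thesis using relY[of 1 b] b P4 P2 P3 by (simp add: hi k2' eval_nat_numeral)
    next
      case False
      hence "d = 2 \<or> d = 3" using d by auto
      thus ?thesis using k by auto
    qed
    have k0: "L 0 d = 0"
    proof (cases "3 \<le> d")
      case True
      then obtain b where b: "d = b + 3" by (metis add.commute le_Suc_ex)
      show ?thesis using relY[of 0 b] b P4 k1 P2 P3 by (simp add: hi k2' eval_nat_numeral)
    next
      case False
      thus ?thesis using k d by (cases "d = 2") auto
    qed
    consider "i = 0" | "i = 1" | "2 \<le> i" by linarith
    thus "L i j = 0" using k0 k1 k2' ij by cases auto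
  qed
next
  case False
  hence "(i = 0 \<and> j = 0) \<or> (i = 1 \<and> j = 0) \<or> (i = 0 \<and> j = 1)" by auto
  thus ?thesis using k by auto
qed

text \<open>Type E7: the cubic part is x^3, and x y^3 takes the place of y^4; the seven monomials
  form a basis of the local algebra of x^3 + x y^3. For the powers of y from the fifth on, relations
  of lower leading degree are needed.\<close>

lemma dual_zero_E7:
  assumes P2: "P 2 0 = 0" "P (Suc 0) (Suc 0) = 0" "P 0 2 = 0" and P3: "P 0 3 = 0" "P (Suc 0) 2 = 0" "P 2 (Suc 0) = 0" "P 3 0 \<noteq> 0"
    and P4: "P 0 4 = 0" "P (Suc 0) 3 \<noteq> 0"
    and k: "L 0 0 = 0" "L (Suc 0) 0 = 0" "L 0 (Suc 0) = 0" "L (Suc 0) (Suc 0) = 0" "L 0 2 = 0" "L 0 3 = 0" "L 0 4 = 0"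
  shows "L i j = 0"
proof (cases "2 \<le> i + j")
  case True
  show ?thesis
  proof (rule descend_zero[OF top _ True])
    fix d i j assume d: "2 \<le> d" and hi: "\<And>i j. d < i + j \<Longrightarrow> L i j = 0" and ij: "i + j = d"
    have k2: "L (a + 2) b = 0" if "a + b + 2 = d" for a b
      using relX[of a b] that P3 by (simp add: hi P2)
    have k2': "L a b = 0" if "a + b = d" "2 \<le> a" for a b
    proof -
      obtain a' where "a = a' + 2" using \<open>2 \<le> a\<close> by (metis add.commute le_Suc_ex)
      thus ?thesis using k2[of a' b] that by simp
    qed
    have k1: "L (Suc 0) (d - 1) = 0"
    proof (cases "3 \<le> d")
      case True
      then obtain b where b: "d = b + 3" by (metis add.commute le_Suc_ex)
      show ?thesis using relY[of 0 b] b P4 P2 P3 by (simp add: hi k2' eval_nat_numeral)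
    next
      case False
      thus ?thesis using k d by (cases "d = 2") auto
    qed
    have k0: "L 0 d = 0"
    proof (cases "5 \<le> d")
      case True
      then obtain b where b: "d = b + 5" by (metis add.commute le_Suc_ex)
      have L4: "L 4 b = 0" using relX[of 2 b] b P3 P2 by (simp add: hi k2' eval_nat_numeral)
      have L3: "L 3 (b + 1) = 0" using relX[of 1 "b + 1"] b P3 k1 P2 by (simp add: hi k2' eval_nat_numeral)
      have L2: "L 2 (b + 2) = 0" using relY[of 1 b] b P4 L3 L4 P2 P3 by (simp add: hi k2' eval_nat_numeral)
      show ?thesis using relX[of 0 "b + 2"] b P4 L2 k1 P2 P3 by (simp add: hi k2' eval_nat_numeral)
    next
      case False
      hence "d = 2 \<or> d = 3 \<or> d = 4" using d by auto
      thus ?thesis using k by auto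
    qed
    consider "i = 0" | "i = 1" | "2 \<le> i" by linarith
    thus "L i j = 0" using k0 k1 k2' ij by cases auto
  qed
next
  case False
  hence "(i = 0 \<and> j = 0) \<or> (i = 1 \<and> j = 0) \<or> (i = 0 \<and> j = 1)" by auto
  thus ?thesis using k by auto
qed

text \<open>With quadratic part x^2 the derivative in x starts with 2 x, so every value with a
  factor x is expressed by values of higher degree. Only the powers of y below the eighth are
  free.\<close>

lemma dual_zero_A_aux:
  assumes P2: "P 2 0 = 1" "P (Suc 0) (Suc 0) = 0" "P 0 2 = 0"
    and k: "\<And>j. j \<le> 6 \<Longrightarrow> L 0 j = 0" and m: "L 0 7 = 0"
  shows "L i j = 0"
proof (rule descend_zero[where ?d0.0 = 0, OF top])
  fix d i j assume hi: "\<And>i j. d < i + j \<Longrightarrow> L i j = 0" and ij: "i + j = d"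
  show "L i j = 0"
  proof (cases i)
    case 0
    show ?thesis
    proof (cases "j \<le> 6")
      case False
      hence "j = 7 \<or> 8 \<le> j" by auto
      thus ?thesis using m top 0 by auto
    qed (use k 0 in auto)
  next
    case (Suc a)
    thus ?thesis using relX[of a j] ij by (simp add: hi P2)
  qed
qed auto

end

text \<open>The \<open>l\<close> are values of the functional, the \<open>p\<close> coefficients of
  the quartic part. The equations \<open>E\<close> come from the derivative in x and determine the
  \<open>l\<close>. Inserted into the equations \<open>F\<close>, which come from the derivative in
  y, they give in turn 5, 6, 7 and 8 times a power of \<open>c\<close> times the deviation of
  \<open>p13\<close>, \<open>p22\<close>, \<open>p31\<close> and \<open>p40\<close> from the square
  of c y^2 + e x y + g x^2.\<close>

lemma square_coefficients:
  fixes c e g :: complex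
  assumes E: "2 * l14 - 4 * e * c + p13 = 0" "l23 = c * c"
    "2 * l13 - 4 * e * l14 - 6 * g * l23 + 2 * p22 * c = 0"
    "2 * l22 - 2 * c * l14 - 4 * e * l23 + p13 * c = 0" "l31 = c * l23"
    "2 * l12 - 4 * e * l13 - 6 * g * l22 + 2 * p22 * l14 + 3 * p31 * l23 = 0"
    "2 * l21 - 2 * c * l13 - 4 * e * l22 - 6 * g * l31 + p13 * l14 + 2 * p22 * l23 = 0"
    "2 * l30 - 2 * c * l22 - 4 * e * l31 + p13 * l23 = 0"
    "2 * l11 - 4 * e * l12 - 6 * g * l21 + 2 * p22 * l13 + 3 * p31 * l22 + 4 * p40 * l31 = 0"
    "2 * l20 - 2 * c * l12 - 4 * e * l21 - 6 * g * l30 + p13 * l13 + 2 * p22 * l22 + 3 * p31 * l31 = 0"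
    and F: "p04 = c * c" "3 * p13 * c - 4 * c * l14 - 2 * e * l23 = 0"
    "3 * p13 * l14 + 2 * p22 * l23 - 4 * c * l13 - 2 * e * l22 = 0"
    "3 * p13 * l13 + 2 * p22 * l22 + p31 * l31 - 4 * c * l12 - 2 * e * l21 = 0"
    "3 * p13 * l12 + 2 * p22 * l21 + p31 * l30 - 4 * c * l11 - 2 * e * l20 = 0"
    and n: "p04 \<noteq> 0 \<or> p13 \<noteq> 0"
  shows "p04 = c\<^sup>2 \<and> p13 = 2 * c * e \<and> p22 = e\<^sup>2 + 2 * g * c \<and> p31 = 2 * e * g \<and> p40 = g\<^sup>2"
proof -
  \<comment> \<open>If \<open>c\<close> were 0, both \<open>p04\<close> and \<open>p13\<close> would
    vanish, against \<open>n\<close>.\<close>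
  have c: "c \<noteq> 0"
  proof
    assume c0: "c = 0"
    have "l22 = 0" "l23 = 0" "2 * l14 = - p13" "p04 = 0" using E(1,2,4) F(1) c0 by (simp_all add: eq_neg_iff_add_eq_0)
    hence "p13 * l14 = 0" "p04 = 0" using F(3) c0 by simp_all
    thus False using n \<open>2 * l14 = - p13\<close> by auto
  qed
  have "5 * c * (p13 - 2 * e * c) = 2 * c * (2 * l14 - 4 * e * c + p13) +
      (3 * p13 * c - 4 * c * l14 - 2 * e * l23) + 2 * e * (l23 - c * c)"
    by (simp add: algebra_simps)
  hence "5 * c * (p13 - 2 * e * c) = 0" using E(1,2) F(2) by simp
  hence p13: "p13 = 2 * e * c" using c by simp
  have l14: "l14 = e * c" using E(1) p13 by Groebner_Basis.algebra
  have l22: "l22 = 2 * e * c * c" using E(2,4) p13 l14 by Groebner_Basis.algebra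
  have l13: "l13 = 2 * e * e * c + 3 * g * c * c - p22 * c" using E(2,3) l14 by Groebner_Basis.algebra
  have "6 * c * c * (p22 - e * e - 2 * g * c) = 0" using E(2) F(3) p13 l14 l22 l13 by Groebner_Basis.algebra
  hence "p22 - e * e - 2 * g * c = 0" using c by simp
  hence p22: "p22 = e * e + 2 * g * c" by Groebner_Basis.algebra
  have l13': "l13 = e * e * c + g * c * c" using l13 p22 by Groebner_Basis.algebra
  have l31: "l31 = c * c * c" using E(2,5) by Groebner_Basis.algebra
  have l12: "2 * l12 = 2 * e * e * e * c + 12 * e * g * c * c - 3 * p31 * c * c"
    using E(6) E(2) l13' l22 l14 p22 by Groebner_Basis.algebra
  have l21: "l21 = 3 * e * e * c * c + 2 * g * c * c * c" using E(7) E(2) l13' l22 l14 p22 l31 p13 by Groebner_Basis.algebra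
  have "7 * c * c * c * (p31 - 2 * e * g) = 0"
    using F(4) l12 l21 l13' l22 p22 p13 l31 by Groebner_Basis.algebra
  hence p31: "p31 = 2 * e * g" using c by simp
  have l12': "l12 = e * e * e * c + 3 * e * g * c * c" using l12 p31 by Groebner_Basis.algebra
  have l30: "l30 = 3 * e * c * c * c" using E(8) E(2) l22 l31 p13 by Groebner_Basis.algebra
  have l11: "2 * l11 = 4 * e * l12 + 6 * g * l21 - 2 * p22 * l13 - 3 * p31 * l22 - 4 * p40 * l31"
    using E(9) by Groebner_Basis.algebra
  have l20: "2 * l20 = 2 * c * l12 + 4 * e * l21 + 6 * g * l30 - p13 * l13 - 2 * p22 * l22 - 3 * p31 * l31"
    using E(10) by Groebner_Basis.algebra
  have "3 * p13 * l12 + 2 * p22 * l21 + p31 * l30 - 2 * c * (2 * l11) - e * (2 * l20) = 0"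
    using F(5) by (simp add: algebra_simps)
  hence "8 * c * c * c * c * (p40 - g * g) = 0"
    unfolding l11 l20 unfolding l12' l21 l13' l22 l30 l31 p13 p22 p31 by (simp add: algebra_simps)
  hence "p40 = g * g" using c by simp
  thus ?thesis using F(1) p13 p22 p31 by (simp add: power2_eq_square)
qed

text \<open>
  If the functional is nonzero, then \<open>L i j\<close> is the coefficient of \<open>y\<^sup>7\<close> in \<open>\<phi>(y)\<^sup>i y\<^sup>j\<close>, where \<open>x = \<phi>(y)\<close>
  solves \<open>\<partial>P/\<partial>x = 0\<close> and \<open>P(\<phi>(y), y)\<close> vanishes to order nine. The conic osculating this curve
  meets the quartic with multiplicity greater than eight, so the quartic is the double conic.
\<close>

lemma dual_A_square:
  assumes P: "quartic_array P" and J: "jrel 8 P L" and top: "\<And>i j. 8 \<le> i \<or> 8 \<le> j \<Longrightarrow> L i j = 0"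
    and P2: "P 2 0 = 1" "P (Suc 0) (Suc 0) = 0" "P 0 2 = 0"
    and k: "\<And>j. j \<le> 6 \<Longrightarrow> L 0 j = 0" and m: "L 0 7 = 1"
    and P4: "P 0 4 \<noteq> 0 \<or> P (Suc 0) 3 \<noteq> 0"
  shows "\<exists>c e g. P 0 4 = c\<^sup>2 \<and> P (Suc 0) 3 = 2 * c * e \<and> P 2 2 = e\<^sup>2 + 2 * g * c \<and> P 3 (Suc 0) = 2 * e * g \<and> P 4 0 = g\<^sup>2"
proof -
  note relX = jrel_quartic(1)[OF P J] and relY = jrel_quartic(2)[OF P J]
  have k': "L 0 0 = 0" "L 0 (Suc 0) = 0" "L 0 2 = 0" "L 0 3 = 0" "L 0 4 = 0" "L 0 5 = 0" "L 0 6 = 0" by (auto intro: k)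
  \<comment> \<open>In these degrees \<open>L 0 j\<close> vanishes by the support, and the leading
    term 2 x of the derivative in x pushes all other values to higher degree.\<close>
  have t8: "L i j = 0" if "8 \<le> i + j" for i j
  proof (rule descend_zero[OF top _ that])
    fix d i j assume d: "8 \<le> d" and hi: "\<And>i j. d < i + j \<Longrightarrow> L i j = 0" and ij: "i + j = d"
    show "L i j = 0"
    proof (cases i)
      case 0 thus ?thesis using top d ij by auto
    next
      case (Suc a) thus ?thesis using relX[of a j] ij by (simp add: hi P2)
    qed
  qed
  have t7: "L (Suc i) j = 0" if "i + j = 6" for i j
    using relX[of i j] that by (simp add: t8 P2)
  have t6: "L (Suc (Suc i)) j = 0" if "i + j = 4" for i j
    using relX[of "Suc i" j] that t7[of i "j + 2"] t7[of "i + 1" "j + 1"] t7[of "i + 2" j] P2 by (simp add: t8 eval_nat_numeral)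
  have t5: "L (Suc (Suc (Suc i))) j = 0" if "i + j = 2" for i j
    using relX[of "i + 2" j] that t6[of "i + 1" "j + 1"] t6[of "i + 2" j] t6[of i "j + 2"]
      t7[of "i + 2" "j + 2"] t7[of "i + 3" "j + 1"] t7[of "i + 4" j] t7[of "i + 1" "j + 3"] P2
    by (simp add: t8 eval_nat_numeral)
  \<comment> \<open>As x = \<phi>(y) starts with a multiple of y^2, the monomial x^i y^j has order
    at least 2 i + j on the curve. The values collected here and in \<open>z40\<close> all have 2 i
    + j > 7.\<close>
  have z: "L (Suc 0) 6 = 0" "L 2 5 = 0" "L 3 4 = 0" "L 4 3 = 0" "L 5 2 = 0" "L 2 4 = 0" "L 3 3 = 0" "L 4 2 = 0" "L 5 (Suc 0) = 0"
    "L 3 2 = 0" "L 4 (Suc 0) = 0" "L 5 0 = 0" "L 6 0 = 0"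
    using t7[of 0 6] t7[of 1 5] t7[of 2 4] t7[of 3 3] t7[of 4 2] t6[of 0 4] t6[of 1 3] t6[of 2 2] t6[of 3 1] t6[of 4 0]
      t5[of 0 2] t5[of 1 1] t5[of 2 0] by (simp_all add: eval_nat_numeral)
  have z40: "L 4 0 = 0" using relX[of 3 0] by (simp add: z[folded One_nat_def] P2[folded One_nat_def] t8 One_nat_def[symmetric] del: One_nat_def)
  note zz = z[folded One_nat_def] z40 k'[folded One_nat_def] m P2[folded One_nat_def]
  \<comment> \<open>Signs and factors are those of the square of x - c y^2 - e x y - g x^2, whose
    cubic terms are - 2 c x y^2 - 2 e x^2 y - 2 g x^3.\<close>
  define c e g where "c = L (Suc 0) 5" and "e = - P 2 (Suc 0) / 2" and "g = - P 3 0 / 2"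
  have P21: "P 2 (Suc 0) = - 2 * e" and P30: "P 3 0 = - 2 * g" by (simp_all add: e_def g_def)
  have P12: "P (Suc 0) 2 = - 2 * c"
    using relX[of 0 5] unfolding c_def by (simp add: zz t8 One_nat_def[symmetric] eq_neg_iff_add_eq_0 add.commute del: One_nat_def)
  have P03: "P 0 3 = 0"
    using relY[of 0 5] by (simp add: zz t8 One_nat_def[symmetric] del: One_nat_def)
  have c: "L (Suc 0) 5 = c" by (simp add: c_def)
  show ?thesis
  proof (intro exI, rule square_coefficients)
    have "2 * L (Suc 0) 4 + 2 * P 2 (Suc 0) * L (Suc 0) 5 + P (Suc 0) 3 = 0"
      using relX[of 0 4] by (simp add: zz t8 One_nat_def[symmetric] del: One_nat_def)
    thus "2 * L (Suc 0) 4 - 4 * e * c + P (Suc 0) 3 = 0"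
      unfolding P21 P30 P12 c by (simp add: algebra_simps)
    have "2 * L 2 3 + P (Suc 0) 2 * L (Suc 0) 5 = 0"
      using relX[of "Suc 0" 3] by (simp add: zz t8 One_nat_def[symmetric] del: One_nat_def)
    thus "L 2 3 = c * c"
      unfolding P21 P30 P12 c by (simp add: algebra_simps)
    have "2 * L (Suc 0) 3 + 3 * P 3 0 * L 2 3 + 2 * P 2 (Suc 0) * L (Suc 0) 4 + 2 * P 2 2 * L (Suc 0) 5 = 0"
      using relX[of 0 3] by (simp add: zz t8 One_nat_def[symmetric] del: One_nat_def)
    thus "2 * L (Suc 0) 3 - 4 * e * L (Suc 0) 4 - 6 * g * L 2 3 + 2 * P 2 2 * c = 0"
      unfolding P21 P30 P12 c by (simp add: algebra_simps)
    have "2 * L 2 2 + 2 * P 2 (Suc 0) * L 2 3 + P (Suc 0) 2 * L (Suc 0) 4 + P (Suc 0) 3 * L (Suc 0) 5 = 0"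
      using relX[of "Suc 0" 2] by (simp add: zz t8 One_nat_def[symmetric] del: One_nat_def)
    thus "2 * L 2 2 - 2 * c * L (Suc 0) 4 - 4 * e * L 2 3 + P (Suc 0) 3 * c = 0"
      unfolding P21 P30 P12 c by (simp add: algebra_simps)
    have "2 * L 3 (Suc 0) + P (Suc 0) 2 * L 2 3 = 0"
      using relX[of 2 "Suc 0"] by (simp add: zz t8 One_nat_def[symmetric] del: One_nat_def)
    thus "L 3 (Suc 0) = c * L 2 3"
      unfolding P21 P30 P12 c by (simp add: algebra_simps)
    have "2 * L (Suc 0) 2 + 3 * P 3 0 * L 2 2 + 2 * P 2 (Suc 0) * L (Suc 0) 3 + 3 * P 3 (Suc 0) * L 2 3 + 2 * P 2 2 * L (Suc 0) 4 = 0"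
      using relX[of 0 2] by (simp add: zz t8 One_nat_def[symmetric] del: One_nat_def)
    thus "2 * L (Suc 0) 2 - 4 * e * L (Suc 0) 3 - 6 * g * L 2 2 + 2 * P 2 2 * L (Suc 0) 4 + 3 * P 3 (Suc 0) * L 2 3 = 0"
      unfolding P21 P30 P12 c by (simp add: algebra_simps)
    have "2 * L 2 (Suc 0) + 3 * P 3 0 * L 3 (Suc 0) + 2 * P 2 (Suc 0) * L 2 2 + P (Suc 0) 2 * L (Suc 0) 3 + 2 * P 2 2 * L 2 3 + P (Suc 0) 3 * L (Suc 0) 4 = 0"
      using relX[of "Suc 0" "Suc 0"] by (simp add: zz t8 One_nat_def[symmetric] del: One_nat_def)
    thus "2 * L 2 (Suc 0) - 2 * c * L (Suc 0) 3 - 4 * e * L 2 2 - 6 * g * L 3 (Suc 0) + P (Suc 0) 3 * L (Suc 0) 4 + 2 * P 2 2 * L 2 3 = 0"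
      unfolding P21 P30 P12 c by (simp add: algebra_simps)
    have "2 * L 3 0 + 2 * P 2 (Suc 0) * L 3 (Suc 0) + P (Suc 0) 2 * L 2 2 + P (Suc 0) 3 * L 2 3 = 0"
      using relX[of 2 0] by (simp add: zz t8 One_nat_def[symmetric] del: One_nat_def)
    thus "2 * L 3 0 - 2 * c * L 2 2 - 4 * e * L 3 (Suc 0) + P (Suc 0) 3 * L 2 3 = 0"
      unfolding P21 P30 P12 c by (simp add: algebra_simps)
    have "2 * L (Suc 0) (Suc 0) + 3 * P 3 0 * L 2 (Suc 0) + 2 * P 2 (Suc 0) * L (Suc 0) 2 + 4 * P 4 0 * L 3 (Suc 0) + 3 * P 3 (Suc 0) * L 2 2 + 2 * P 2 2 * L (Suc 0) 3 = 0"
      using relX[of 0 "Suc 0"] by (simp add: zz t8 One_nat_def[symmetric] del: One_nat_def)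
    thus "2 * L (Suc 0) (Suc 0) - 4 * e * L (Suc 0) 2 - 6 * g * L 2 (Suc 0) + 2 * P 2 2 * L (Suc 0) 3 + 3 * P 3 (Suc 0) * L 2 2 + 4 * P 4 0 * L 3 (Suc 0) = 0"
      unfolding P21 P30 P12 c by (simp add: algebra_simps)
    have "2 * L 2 0 + 3 * P 3 0 * L 3 0 + 2 * P 2 (Suc 0) * L 2 (Suc 0) + P (Suc 0) 2 * L (Suc 0) 2 + 3 * P 3 (Suc 0) * L 3 (Suc 0) + 2 * P 2 2 * L 2 2 + P (Suc 0) 3 * L (Suc 0) 3 = 0"
      using relX[of "Suc 0" 0] by (simp add: zz t8 One_nat_def[symmetric] del: One_nat_def)
    thus "2 * L 2 0 - 2 * c * L (Suc 0) 2 - 4 * e * L 2 (Suc 0) - 6 * g * L 3 0 + P (Suc 0) 3 * L (Suc 0) 3 + 2 * P 2 2 * L 2 2 + 3 * P 3 (Suc 0) * L 3 (Suc 0) = 0"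
      unfolding P21 P30 P12 c by (simp add: algebra_simps)
    have "2 * P (Suc 0) 2 * L (Suc 0) 5 + 4 * P 0 4 = 0"
      using relY[of 0 4] by (simp add: zz t8 P03 One_nat_def[symmetric] del: One_nat_def)
    thus "P 0 4 = c * c"
      unfolding P21 P30 P12 c by (simp add: algebra_simps)
    have "2 * P (Suc 0) 2 * L (Suc 0) 4 + P 2 (Suc 0) * L 2 3 + 3 * P (Suc 0) 3 * L (Suc 0) 5 = 0"
      using relY[of 0 3] by (simp add: zz t8 P03 One_nat_def[symmetric] del: One_nat_def)
    thus "3 * P (Suc 0) 3 * c - 4 * c * L (Suc 0) 4 - 2 * e * L 2 3 = 0"
      unfolding P21 P30 P12 c by (simp add: algebra_simps)
    have "2 * P (Suc 0) 2 * L (Suc 0) 3 + P 2 (Suc 0) * L 2 2 + 3 * P (Suc 0) 3 * L (Suc 0) 4 + 2 * P 2 2 * L 2 3 = 0"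
      using relY[of 0 2] by (simp add: zz t8 P03 One_nat_def[symmetric] del: One_nat_def)
    thus "3 * P (Suc 0) 3 * L (Suc 0) 4 + 2 * P 2 2 * L 2 3 - 4 * c * L (Suc 0) 3 - 2 * e * L 2 2 = 0"
      unfolding P21 P30 P12 c by (simp add: algebra_simps)
    have "2 * P (Suc 0) 2 * L (Suc 0) 2 + P 2 (Suc 0) * L 2 (Suc 0) + 3 * P (Suc 0) 3 * L (Suc 0) 3 + 2 * P 2 2 * L 2 2 + P 3 (Suc 0) * L 3 (Suc 0) = 0"
      using relY[of 0 "Suc 0"] by (simp add: zz t8 P03 One_nat_def[symmetric] del: One_nat_def)
    thus "3 * P (Suc 0) 3 * L (Suc 0) 3 + 2 * P 2 2 * L 2 2 + P 3 (Suc 0) * L 3 (Suc 0) - 4 * c * L (Suc 0) 2 - 2 * e * L 2 (Suc 0) = 0"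
      unfolding P21 P30 P12 c by (simp add: algebra_simps)
    have "2 * P (Suc 0) 2 * L (Suc 0) (Suc 0) + P 2 (Suc 0) * L 2 0 + 3 * P (Suc 0) 3 * L (Suc 0) 2 + 2 * P 2 2 * L 2 (Suc 0) + P 3 (Suc 0) * L 3 0 = 0"
      using relY[of 0 0] by (simp add: zz t8 P03 One_nat_def[symmetric] del: One_nat_def)
    thus "3 * P (Suc 0) 3 * L (Suc 0) 2 + 2 * P 2 2 * L 2 (Suc 0) + P 3 (Suc 0) * L 3 0 - 4 * c * L (Suc 0) (Suc 0) - 2 * e * L 2 0 = 0"
      unfolding P21 P30 P12 c by (simp add: algebra_simps)
    show "P 0 4 \<noteq> 0 \<or> P (Suc 0) 3 \<noteq> 0" by (rule P4)
  qed
qed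

section \<open>Lower bound for the Milnor number of a germ of order four\<close>

lemma sum_fun_apply: "(\<Sum>x\<in>A. h x) p = (\<Sum>x\<in>A. h x p)" for h :: "'a \<Rightarrow> 'b \<Rightarrow> complex"
  by (induction A rule: infinite_finite_induct) auto

interpretation fv: vector_space "\<lambda>(c::complex) (f::nat \<times> nat \<Rightarrow> complex) p. c * f p"
  by standard (auto simp: fun_eq_iff algebra_simps)

definition order_ge :: "nat \<Rightarrow> (cvec \<Rightarrow> complex) \<Rightarrow> bool" where
  "order_ge n h \<longleftrightarrow> holomorphic_germ 2 h \<and> (\<forall>a b. a + b < n \<longrightarrow> coef a b h = 0)"

lemma order_ge_mult: "order_ge n h \<Longrightarrow> holomorphic_germ 2 A \<Longrightarrow> order_ge n (\<lambda>z. A z * h z)"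
  unfolding order_ge_def by (auto simp: coef_mult hg_mult intro!: sum.neutral)

lemma order_ge_X: "order_ge n h \<Longrightarrow> order_ge (Suc n) (\<lambda>z. z 0 * h z)"
  unfolding order_ge_def by (auto simp: coef_X hg_mult hg_coord)

lemma order_ge_Y: "order_ge n h \<Longrightarrow> order_ge (Suc n) (\<lambda>z. z (Suc 0) * h z)"
  unfolding order_ge_def by (auto simp: coef_Y hg_mult hg_coord)

lemma order_ge_add: "order_ge n h \<Longrightarrow> order_ge n k \<Longrightarrow> order_ge n (\<lambda>z. h z + k z)"
  unfolding order_ge_def by (auto simp: coef_add hg_add)

text \<open>Modulo degree 5 there are 15 monomials, while the gradient has order 3: up to degree 4
  the Jacobian ideal is spanned by the two partial derivatives and their four products with x and y.
  This leaves a dimension of at least 15 - 6 = 9.\<close>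

lemma order4_milnor:
  assumes g: "order_ge 4 g" and m: "milnor_number 2 g = enat k"
  shows "9 \<le> k"
proof -
  have gh: "holomorphic_germ 2 g" using g by (simp add: order_ge_def)
  define D where "D i = partial_deriv i g" for i
  have D: "order_ge 3 (D i)" if "i < 2" for i
  proof -
    have "i = 0 \<or> i = Suc 0" using that by auto
    thus ?thesis using g gh by (auto simp: order_ge_def D_def coef_partial_X coef_partial_Y hg_partial)
  qed
  obtain e :: "nat \<Rightarrow> _" where e: "spans_mod 2 g {..<k} e" using m milnor_number_iff[OF gh] by blast
  define M where "M = {p :: nat \<times> nat. fst p + snd p \<le> 4}"
  have Mfin: "M \<subseteq> {..4} \<times> {..4}" by (auto simp: M_def)
  hence finM: "finite M" by (rule finite_subset) simp
  have cardM: "card M = 15"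
  proof -
    have "M = (SIGMA a:{..4}. {..4 - a})" by (auto simp: M_def)
    hence "card M = (\<Sum>a\<le>4. card {..4 - a :: nat})" by (simp add: card_SigmaI)
    also have "\<dots> = 15" by (simp add: eval_nat_numeral)
    finally show ?thesis .
  qed
  \<comment> \<open>Truncation to degree at most 4; spans are compared in this space of dimension
    15.\<close>
  define T where "T h p = (if p \<in> M then coef (fst p) (snd p) h else 0)" for h p
  define S where "S = (\<lambda>i. T (e i)) ` {..<k} \<union>
    set [T (D 0), T (D 1), T (\<lambda>z. z 0 * D 0 z), T (\<lambda>z. z 0 * D 1 z), T (\<lambda>z. z (Suc 0) * D 0 z), T (\<lambda>z. z (Suc 0) * D 1 z)]"
  have finS: "finite S" by (simp add: S_def)
  have cardS: "card S \<le> k + 6"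
    unfolding S_def
    by (rule order.trans[OF card_Un_le add_mono[OF order.trans[OF card_image_le] order.trans[OF card_length]]]) auto
  have add: "T (\<lambda>z. f z + h z) \<in> fv.span S" if "holomorphic_germ 2 f" "holomorphic_germ 2 h" "T f \<in> fv.span S" "T h \<in> fv.span S" for f h
  proof -
    have "T (\<lambda>z. f z + h z) = T f + T h" using that by (auto simp: T_def fun_eq_iff coef_add)
    thus ?thesis using fv.span_add that by simp
  qed
  have cm: "T (\<lambda>z. c * f z) \<in> fv.span S" if "holomorphic_germ 2 f" "T f \<in> fv.span S" for f c
  proof -
    have "T (\<lambda>z. c * f z) = (\<lambda>p. c * T f p)" using that by (auto simp: T_def fun_eq_iff coef_cmult)
    thus ?thesis using fv.span_scale[OF that(2), of c] by simp
  qed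
  have zero: "T f \<in> fv.span S" if "order_ge 5 f" for f
  proof -
    have "T f = 0" using that by (auto simp: T_def M_def order_ge_def fun_eq_iff)
    thus ?thesis using fv.span_zero by simp
  qed
  have cong: "T f = T h" if "\<forall>\<^sub>F z in near_origin 2. f z = h z" for f h
    using coef_cong[OF that] by (auto simp: T_def fun_eq_iff)
  have prod: "T (\<lambda>z. A z * D i z) \<in> fv.span S" if A: "holomorphic_germ 2 A" and i: "i < 2" for A i
  proof -
    have i': "i = 0 \<or> i = 1" using i by auto
    have Dh: "holomorphic_germ 2 (D i)" using D[OF i] by (simp add: order_ge_def)
    obtain u v where u: "holomorphic_germ 2 u" "holomorphic_germ 2 v"
      "\<forall>\<^sub>F z in near_origin 2. A z = A origin + z 0 * u z + z (Suc 0) * v z"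
      using hg_split2[OF A] by blast
    obtain u1 u2 where u1: "holomorphic_germ 2 u1" "holomorphic_germ 2 u2"
      "\<forall>\<^sub>F z in near_origin 2. u z = u origin + z 0 * u1 z + z (Suc 0) * u2 z"
      using hg_split2[OF u(1)] by blast
    obtain v1 v2 where v1: "holomorphic_germ 2 v1" "holomorphic_germ 2 v2"
      "\<forall>\<^sub>F z in near_origin 2. v z = v origin + z 0 * v1 z + z (Suc 0) * v2 z"
      using hg_split2[OF u(2)] by blast
    \<comment> \<open>A partial derivative has order 3, so two further factors x or y lift it to
      order 5, which \<open>T\<close> does not see.\<close>
    define R where "R z = z 0 * (z 0 * (u1 z * D i z)) + z 0 * (z (Suc 0) * (u2 z * D i z)) +
       (z (Suc 0) * (z 0 * (v1 z * D i z)) + z (Suc 0) * (z (Suc 0) * (v2 z * D i z)))" for z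
    have R: "order_ge 5 R"
    proof -
      have "order_ge (Suc (Suc 3)) R" unfolding R_def
        by (intro order_ge_add order_ge_X order_ge_Y order_ge_mult[OF D[OF i]] u1 v1)
      thus ?thesis by (simp add: eval_nat_numeral)
    qed
    have "\<forall>\<^sub>F z in near_origin 2. A z * D i z = A origin * D i z + (u origin * (z 0 * D i z) + (v origin * (z (Suc 0) * D i z) + R z))"
      using u(3) u1(3) v1(3)
    proof eventually_elim
      case (elim z)
      show ?case unfolding elim(1) elim(2) elim(3) R_def by (simp only: algebra_simps)
    qed
    from cong[OF this]
    have "T (\<lambda>z. A z * D i z) = T (\<lambda>z. A origin * D i z + (u origin * (z 0 * D i z) + (v origin * (z (Suc 0) * D i z) + R z)))" .
    also have "\<dots> \<in> fv.span S"
    proof -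
      have m: "T (D i) \<in> fv.span S" "T (\<lambda>z. z 0 * D i z) \<in> fv.span S" "T (\<lambda>z. z (Suc 0) * D i z) \<in> fv.span S"
        using i' by (auto intro!: fv.span_base simp: S_def)
      have h: "holomorphic_germ 2 (\<lambda>z. z 0 * D i z)" "holomorphic_germ 2 (\<lambda>z. z (Suc 0) * D i z)" "holomorphic_germ 2 R"
        using Dh R by (auto intro: hg_mult hg_coord simp: order_ge_def)
      show ?thesis
        by (intro add cm hg_add hg_mult[OF hg_const] h Dh m zero R)
    qed
    finally show ?thesis .
  qed
  have delta: "T (mono a b) \<in> fv.span S" for a b
  proof -
    obtain c where c: "(\<lambda>z. mono a b z - (\<Sum>i<k. c i * e i z)) \<in> jac 2 g"
      using e hg_mono unfolding spans_mod_def by blast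
    then obtain A where A: "\<forall>i<2. holomorphic_germ 2 (A i)"
      "\<forall>\<^sub>F z in near_origin 2. mono a b z - (\<Sum>i<k. c i * e i z) = (\<Sum>i<2. A i z * partial_deriv i g z)"
      by (auto simp: jac_def)
    have eh: "holomorphic_germ 2 (e i)" if "i < k" for i using e that by (auto simp: spans_mod_def)
    have Dh: "holomorphic_germ 2 (D i)" if "i < 2" for i using D[OF that] by (simp add: order_ge_def)
    have s: "T (\<lambda>z. \<Sum>i<l. c i * e i z) \<in> fv.span S" if "l \<le> k" for l
      using that
    proof (induction l)
      case 0 thus ?case using zero[of "\<lambda>_. 0"] by (simp add: order_ge_def hg_const coef_zero)
    next
      case (Suc l)
      have "T (e l) \<in> fv.span S" using Suc by (intro fv.span_base) (auto simp: S_def)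
      thus ?case using Suc eh unfolding sum.lessThan_Suc
        by (intro add cm hg_sum hg_mult hg_const) auto
    qed
    have "\<forall>\<^sub>F z in near_origin 2. mono a b z = (\<Sum>i<k. c i * e i z) + (A 0 z * D 0 z + A 1 z * D 1 z)"
      using A(2)
    proof eventually_elim
      case (elim z)
      have "(\<Sum>i<2. A i z * partial_deriv i g z) = A 0 z * D 0 z + A 1 z * D 1 z"
        by (simp add: D_def numeral_2_eq_2)
      thus ?case using elim by (simp add: algebra_simps)
    qed
    from cong[OF this]
    have "T (mono a b) = T (\<lambda>z. (\<Sum>i<k. c i * e i z) + (A 0 z * D 0 z + A 1 z * D 1 z))" .
    also have "\<dots> \<in> fv.span S"
      using A(1) Dh eh by (intro add s prod hg_sum hg_mult hg_add hg_const) auto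
    finally show ?thesis .
  qed
  define B where "B = (\<lambda>p. T (mono (fst p) (snd p))) ` M"
  have Tm: "T (mono (fst p) (snd p)) q = (if p = q then 1 else 0)" if "p \<in> M" for p q
    using that by (cases p; cases q) (auto simp: T_def coef_mono)
  have inj: "inj_on (\<lambda>p. T (mono (fst p) (snd p))) M"
  proof (rule inj_onI)
    fix p q assume "p \<in> M" "q \<in> M" "T (mono (fst p) (snd p)) = T (mono (fst q) (snd q))"
    hence "T (mono (fst p) (snd p)) q = T (mono (fst q) (snd q)) q" by simp
    thus "p = q" using Tm[of p q] Tm[of q q] \<open>p \<in> M\<close> \<open>q \<in> M\<close> by (auto split: if_splits)
  qed
  have "fv.independent B"
  proof (rule fv.independent_if_scalars_zero)
    show "finite B" using finM by (simp add: B_def)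
    fix f x assume z: "(\<Sum>x\<in>B. (\<lambda>p. f x * x p)) = 0" and x: "x \<in> B"
    obtain q where q: "q \<in> M" "x = T (mono (fst q) (snd q))" using x by (auto simp: B_def)
    have "0 = (\<Sum>x\<in>B. (\<lambda>p. f x * x p)) q" using z by simp
    also have "\<dots> = (\<Sum>x\<in>B. f x * x q)" by (rule sum_fun_apply)
    also have "\<dots> = (\<Sum>p\<in>M. f (T (mono (fst p) (snd p))) * T (mono (fst p) (snd p)) q)"
      unfolding B_def by (subst sum.reindex[OF inj]) simp
    also have "\<dots> = (\<Sum>p\<in>M. if p = q then f x else 0)"
      by (intro sum.cong refl) (auto simp: Tm q(2))
    also have "\<dots> = f x" using q finM by simp
    finally show "f x = 0" by simp
  qed
  moreover have "B \<subseteq> fv.span S" using delta by (auto simp: B_def)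
  ultimately have "card B \<le> card S" using fv.independent_span_bound[OF finS] by blast
  moreover have "card B = 15" unfolding B_def by (subst card_image[OF inj]) (rule cardM)
  ultimately show ?thesis using cardS by simp
qed

subsection \<open>Linear changes of coordinates\<close>

definition lin :: "complex \<Rightarrow> complex \<Rightarrow> cvec \<Rightarrow> complex" where
  "lin p q z = p * z 0 + q * z (Suc 0)"

lemma hg_lin: "holomorphic_germ n (lin p q)"
  unfolding lin_def[abs_def] by (intro hg_add hg_mult hg_const hg_coord)

lemma coef_lin_mult:
  assumes "holomorphic_germ 2 h"
  shows "coef i j (\<lambda>z. lin p q z * h z) = p * (if i = 0 then 0 else coef (i - 1) j h) + q * (if j = 0 then 0 else coef i (j - 1) h)"
proof -
  have "coef i j (\<lambda>z. lin p q z * h z) = coef i j (\<lambda>z. p * (z 0 * h z) + q * (z (Suc 0) * h z))"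
    by (simp add: lin_def algebra_simps)
  thus ?thesis using assms by (simp add: coef_add coef_cmult coef_X coef_Y hg_mult hg_const hg_coord)
qed

definition lmono :: "complex \<Rightarrow> complex \<Rightarrow> complex \<Rightarrow> complex \<Rightarrow> nat \<Rightarrow> nat \<Rightarrow> cvec \<Rightarrow> complex" where
  "lmono w0 w1 v0 v1 a b z = lin w0 v0 z ^ a * lin w1 v1 z ^ b"

lemma hg_lmono: "holomorphic_germ n (lmono w0 w1 v0 v1 a b)"
  unfolding lmono_def[abs_def] by (intro hg_mult hg_power hg_lin)

lemma lmono_Suc:
  "lmono w0 w1 v0 v1 (Suc a) b = (\<lambda>z. lin w0 v0 z * lmono w0 w1 v0 v1 a b z)"
  "lmono w0 w1 v0 v1 a (Suc b) = (\<lambda>z. lin w1 v1 z * lmono w0 w1 v0 v1 a b z)"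
  by (auto simp: lmono_def mult_ac)

text \<open>The coefficient of x^i y^j in (w0 x + v0 y)^a (w1 x + v1 y)^b, found by splitting off
  one linear factor at a time.\<close>

fun kap :: "complex \<Rightarrow> complex \<Rightarrow> complex \<Rightarrow> complex \<Rightarrow> nat \<Rightarrow> nat \<Rightarrow> nat \<Rightarrow> nat \<Rightarrow> complex" where
  "kap w0 w1 v0 v1 0 0 i j = (if i = 0 \<and> j = 0 then 1 else 0)"
| "kap w0 w1 v0 v1 (Suc a) b i j = w0 * (if i = 0 then 0 else kap w0 w1 v0 v1 a b (i - 1) j) + v0 * (if j = 0 then 0 else kap w0 w1 v0 v1 a b i (j - 1))"
| "kap w0 w1 v0 v1 0 (Suc b) i j = w1 * (if i = 0 then 0 else kap w0 w1 v0 v1 0 b (i - 1) j) + v1 * (if j = 0 then 0 else kap w0 w1 v0 v1 0 b i (j - 1))"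

lemma coef_lmono: "coef i j (lmono w0 w1 v0 v1 a b) = kap w0 w1 v0 v1 a b i j"
proof (induction w0 w1 v0 v1 a b i j rule: kap.induct)
  case (1 w0 w1 v0 v1 i j)
  have "lmono w0 w1 v0 v1 0 0 = (\<lambda>_. 1)" by (simp add: lmono_def fun_eq_iff)
  thus ?case by (simp add: coef_const)
qed (auto simp: lmono_Suc coef_lin_mult hg_lmono)

lemma kap_homogeneous: "i + j \<noteq> a + b \<Longrightarrow> kap w0 w1 v0 v1 a b i j = 0"
proof (induction w0 w1 v0 v1 a b i j rule: kap.induct)
  case (2 w0 w1 v0 v1 a b i j) thus ?case by (cases i; cases j) auto
next
  case (3 w0 w1 v0 v1 b i j) thus ?case by (cases i; cases j) auto
qed auto

text \<open>The coefficient array after substituting w0 x + v0 y for x and w1 x + v1 y for y; only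
  exponents of equal total degree interact. The entry at (0, d) is the value of the form of degree d
  at (v0, v1), so conditions on v become vanishing coefficients.\<close>

definition tr :: "complex \<Rightarrow> complex \<Rightarrow> complex \<Rightarrow> complex \<Rightarrow> (nat \<Rightarrow> nat \<Rightarrow> complex) \<Rightarrow> nat \<Rightarrow> nat \<Rightarrow> complex" where
  "tr w0 w1 v0 v1 P i j = (\<Sum>a\<le>i + j. P a (i + j - a) * kap w0 w1 v0 v1 a (i + j - a) i j)"

definition lmap :: "complex \<Rightarrow> complex \<Rightarrow> complex \<Rightarrow> complex \<Rightarrow> nat \<Rightarrow> cvec \<Rightarrow> complex" where
  "lmap w0 w1 v0 v1 k = (if k = 0 then lin w0 v0 else lin w1 v1)"

lemma cgerm_lmap: "cgerm n p (lmap w0 w1 v0 v1)"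
  by (auto simp: cgerm_def lmap_def hg_lin) (auto simp: lin_def)

lemma mono_lmap: "mono a b (cmap 2 (lmap w0 w1 v0 v1) z) = lmono w0 w1 v0 v1 a b z"
  by (simp add: mono_def cmap_def lmap_def lmono_def)

text \<open>Under the substitution, the remainder of the Taylor expansion acquires a product of more
  than i + j linear forms and cannot reach the coefficient at (i, j).\<close>

lemma coef_lmap:
  assumes g: "holomorphic_germ 2 g"
  shows "coef i j (\<lambda>z. g (cmap 2 (lmap w0 w1 v0 v1) z)) = tr w0 w1 v0 v1 (\<lambda>a b. coef a b g) i j"
proof -
  define d where "d = i + j"
  let ?\<phi> = "cmap 2 (lmap w0 w1 v0 v1)"
  let ?k = "kap w0 w1 v0 v1"
  obtain h1 h2 where h: "holomorphic_germ 2 h1" "holomorphic_germ 2 h2"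
    "\<forall>\<^sub>F z in near_origin 2. g z = (\<Sum>a<Suc d. \<Sum>b<Suc d. coef a b g * mono a b z) + z 0 ^ Suc d * h1 z + z (Suc 0) ^ Suc d * h2 z"
    using taylor2[OF g] by blast
  have high: "coef i j (\<lambda>z. lmono w0 w1 v0 v1 a b z * H z) = 0" if "d < a + b" "holomorphic_germ 2 H" for a b H
    unfolding coef_mult[OF hg_lmono that(2)] coef_lmono
    using that by (intro sum.neutral ballI) (auto simp: kap_homogeneous d_def)
  have hc: "holomorphic_germ 2 (\<lambda>z. h1 (?\<phi> z))" "holomorphic_germ 2 (\<lambda>z. h2 (?\<phi> z))"
    by (auto intro: hg_cmap[OF cgerm_lmap] h)
  have "coef i j (\<lambda>z. g (?\<phi> z)) = coef i j (\<lambda>z. (\<Sum>a<Suc d. \<Sum>b<Suc d. coef a b g * lmono w0 w1 v0 v1 a b z)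
     + lmono w0 w1 v0 v1 (Suc d) 0 z * h1 (?\<phi> z) + lmono w0 w1 v0 v1 0 (Suc d) z * h2 (?\<phi> z))"
    by (rule coef_cong)
       (use eventually_cmap[OF cgerm_lmap h(3)] in \<open>eventually_elim, simp add: mono_lmap del: sum.lessThan_Suc, simp add: lmono_def cmap_def lmap_def\<close>)
  also have "\<dots> = (\<Sum>a<Suc d. \<Sum>b<Suc d. coef a b g * ?k a b i j)"
    using hc by (simp del: sum.lessThan_Suc add: coef_add coef_sum coef_cmult coef_lmono high
        hg_add hg_sum hg_mult hg_const hg_lmono)
  also have "\<dots> = (\<Sum>a<Suc d. coef a (d - a) g * ?k a (d - a) i j)"
  proof (rule sum.cong[OF refl])
    fix a assume a: "a \<in> {..<Suc d}"
    have "(\<Sum>b<Suc d. coef a b g * ?k a b i j) = (\<Sum>b<Suc d. if b = d - a then coef a b g * ?k a b i j else 0)"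
      using a by (intro sum.cong refl) (auto simp: kap_homogeneous d_def)
    also have "\<dots> = coef a (d - a) g * ?k a (d - a) i j" using a by (subst sum.delta) auto
    finally show "(\<Sum>b<Suc d. coef a b g * ?k a b i j) = coef a (d - a) g * ?k a (d - a) i j" .
  qed
  finally show ?thesis by (simp add: tr_def d_def lessThan_Suc_atMost del: sum.lessThan_Suc)
qed

lemma cmap_lmap:
  "cmap 2 (lmap w0 w1 v0 v1) z = (\<lambda>k. if k = 0 then w0 * z 0 + v0 * z (Suc 0) else if k = Suc 0 then w1 * z 0 + v1 * z (Suc 0) else 0)"
  by (auto simp: cmap_def lmap_def lin_def fun_eq_iff)

lemma lmap_inverse:
  assumes D: "w0 * v1 - w1 * v0 \<noteq> 0" and z: "z \<in> Cn 2"
  defines "D \<equiv> w0 * v1 - w1 * v0"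
  shows "cmap 2 (lmap w0 w1 v0 v1) (cmap 2 (lmap (v1 / D) (- w1 / D) (- v0 / D) (w0 / D)) z) = z"
    and "cmap 2 (lmap (v1 / D) (- w1 / D) (- v0 / D) (w0 / D)) (cmap 2 (lmap w0 w1 v0 v1) z) = z"
proof -
  have z2: "z k = 0" if "2 \<le> k" for k using z that by (simp add: Cn_def)
  have D0: "D \<noteq> 0" using D by (simp add: D_def)
  have a: "w0 * (v1 / D * x + - v0 / D * y) + v0 * (- w1 / D * x + w0 / D * y) = x"
    "w1 * (v1 / D * x + - v0 / D * y) + v1 * (- w1 / D * x + w0 / D * y) = y"
    "v1 / D * (w0 * x + v0 * y) + - v0 / D * (w1 * x + v1 * y) = x"
    "- w1 / D * (w0 * x + v0 * y) + w0 / D * (w1 * x + v1 * y) = y" for x y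
    using D0 unfolding D_def by (simp_all add: divide_simps) (simp_all add: algebra_simps)
  show "cmap 2 (lmap w0 w1 v0 v1) (cmap 2 (lmap (v1 / D) (- w1 / D) (- v0 / D) (w0 / D)) z) = z"
  proof (rule ext)
    fix k
    consider "k = 0" | "k = Suc 0" | "2 \<le> k" by linarith
    thus "cmap 2 (lmap w0 w1 v0 v1) (cmap 2 (lmap (v1 / D) (- w1 / D) (- v0 / D) (w0 / D)) z) k = z k"
    proof cases
      case 1
      show ?thesis unfolding cmap_lmap 1 by (simp only: simp_thms if_True if_False nat.distinct a)
    next
      case 2
      show ?thesis unfolding cmap_lmap 2 by (simp only: simp_thms if_True if_False nat.distinct a)
    next
      case 3
      hence "k \<noteq> 0" "k \<noteq> Suc 0" by auto
      thus ?thesis unfolding cmap_lmap using z2[OF 3] by simp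
    qed
  qed
  show "cmap 2 (lmap (v1 / D) (- w1 / D) (- v0 / D) (w0 / D)) (cmap 2 (lmap w0 w1 v0 v1) z) = z"
  proof (rule ext)
    fix k
    consider "k = 0" | "k = Suc 0" | "2 \<le> k" by linarith
    thus "cmap 2 (lmap (v1 / D) (- w1 / D) (- v0 / D) (w0 / D)) (cmap 2 (lmap w0 w1 v0 v1) z) k = z k"
    proof cases
      case 1
      show ?thesis unfolding cmap_lmap 1 by (simp only: simp_thms if_True if_False nat.distinct a)
    next
      case 2
      show ?thesis unfolding cmap_lmap 2 by (simp only: simp_thms if_True if_False nat.distinct a)
    next
      case 3
      hence "k \<noteq> 0" "k \<noteq> Suc 0" by auto
      thus ?thesis unfolding cmap_lmap using z2[OF 3] by simp
    qed
  qed
qed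

lemma milnor_lmap:
  assumes D: "w0 * v1 - w1 * v0 \<noteq> 0" and g: "holomorphic_germ 2 g"
  shows "milnor_number 2 (\<lambda>z. g (cmap 2 (lmap w0 w1 v0 v1) z)) = milnor_number 2 g"
proof -
  let ?D = "w0 * v1 - w1 * v0"
  note c = cgerm_lmap[of 2 2 "v1 / ?D" "- w1 / ?D" "- v0 / ?D" "w0 / ?D"]
  show ?thesis
  proof (rule milnor_cmap[OF cgerm_lmap c _ _ g, symmetric])
    show "\<forall>\<^sub>F z in near_origin 2. cmap 2 (lmap w0 w1 v0 v1) (cmap 2 (lmap (v1 / ?D) (- w1 / ?D) (- v0 / ?D) (w0 / ?D)) z) = z"
      by (rule eventually_mono[OF near_origin_Cn lmap_inverse(1)[OF D]])
    show "\<forall>\<^sub>F z in near_origin 2. cmap 2 (lmap (v1 / ?D) (- w1 / ?D) (- v0 / ?D) (w0 / ?D)) (cmap 2 (lmap w0 w1 v0 v1) z) = z"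
      by (rule eventually_mono[OF near_origin_Cn lmap_inverse(2)[OF D]])
  qed simp
qed

subsection \<open>Normal forms of quartics with nondegenerate leading form\<close>

lemma kap_sums:
  "tr w0 w1 v0 v1 P 0 2 = P 2 0 * v0\<^sup>2 + P 1 1 * v0 * v1 + P 0 2 * v1\<^sup>2"
  "tr w0 w1 v0 v1 P 1 1 = 2 * P 2 0 * w0 * v0 + P 1 1 * (w0 * v1 + w1 * v0) + 2 * P 0 2 * w1 * v1"
  "tr w0 w1 v0 v1 P 2 0 = P 2 0 * w0\<^sup>2 + P 1 1 * w0 * w1 + P 0 2 * w1\<^sup>2"
  "tr w0 w1 v0 v1 P 0 3 = P 3 0 * v0 ^ 3 + P 2 1 * v0\<^sup>2 * v1 + P 1 2 * v0 * v1\<^sup>2 + P 0 3 * v1 ^ 3"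
  "tr w0 w1 v0 v1 P 1 2 = 3 * P 3 0 * w0 * v0\<^sup>2 + P 2 1 * (2 * w0 * v0 * v1 + w1 * v0\<^sup>2) + P 1 2 * (w0 * v1\<^sup>2 + 2 * w1 * v0 * v1) + 3 * P 0 3 * w1 * v1\<^sup>2"
  "tr w0 w1 v0 v1 P 2 1 = 3 * P 3 0 * v0 * w0\<^sup>2 + P 2 1 * (2 * v0 * w0 * w1 + v1 * w0\<^sup>2) + P 1 2 * (v0 * w1\<^sup>2 + 2 * v1 * w0 * w1) + 3 * P 0 3 * v1 * w1\<^sup>2"
  "tr w0 w1 v0 v1 P 3 0 = P 3 0 * w0 ^ 3 + P 2 1 * w0\<^sup>2 * w1 + P 1 2 * w0 * w1\<^sup>2 + P 0 3 * w1 ^ 3"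
  unfolding tr_def
  by (simp_all add: eval_nat_numeral algebra_simps)

lemma kap_sums4:
  assumes "P 4 0 = 1" "P 0 4 = 1" "P 2 2 = a" "P 3 1 = 0" "P 1 3 = 0"
  shows
  "tr w0 w1 v0 v1 P 0 4 = v0 ^ 4 + v1 ^ 4 + a * v0\<^sup>2 * v1\<^sup>2"
  "tr w0 w1 v0 v1 P 1 3 = 4 * w0 * v0 ^ 3 + 4 * w1 * v1 ^ 3 + 2 * a * (w0 * v0 * v1\<^sup>2 + w1 * v0\<^sup>2 * v1)"
  "tr w0 w1 v0 v1 P 2 2 = 6 * w0\<^sup>2 * v0\<^sup>2 + 6 * w1\<^sup>2 * v1\<^sup>2 + a * (w0\<^sup>2 * v1\<^sup>2 + 4 * w0 * w1 * v0 * v1 + w1\<^sup>2 * v0\<^sup>2)"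
  "tr w0 w1 v0 v1 P 3 1 = 4 * v0 * w0 ^ 3 + 4 * v1 * w1 ^ 3 + 2 * a * (v0 * w0 * w1\<^sup>2 + v1 * w0\<^sup>2 * w1)"
  "tr w0 w1 v0 v1 P 4 0 = w0 ^ 4 + w1 ^ 4 + a * w0\<^sup>2 * w1\<^sup>2"
  unfolding tr_def using assms
  by (simp_all add: eval_nat_numeral algebra_simps)

lemma quartic_array_tr: "quartic_array P \<Longrightarrow> quartic_array (tr w0 w1 v0 v1 P)"
  unfolding quartic_array_def tr_def by (auto intro!: sum.neutral)

text \<open>The two equations say that the form vanishes at v together with its derivative in the
  direction w. With Euler's relation both partial derivatives vanish at v, which would make v a
  multiple root; the roots are simple because \<open>a\<^sup>2 \<noteq> 4\<close>.\<close>

lemma X9_no_double_direction: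
  fixes a :: complex
  assumes a: "a\<^sup>2 \<noteq> 4" and D: "w0 * v1 - w1 * v0 \<noteq> 0"
    and z: "v0 ^ 4 + v1 ^ 4 + a * v0\<^sup>2 * v1\<^sup>2 = 0"
      "4 * w0 * v0 ^ 3 + 4 * w1 * v1 ^ 3 + 2 * a * (w0 * v0 * v1\<^sup>2 + w1 * v0\<^sup>2 * v1) = 0"
  shows False
proof -
  have "(w0 * v1 - w1 * v0) * (2 * v0 * (2 * v0\<^sup>2 + a * v1\<^sup>2)) = 0"
    "(w0 * v1 - w1 * v0) * (2 * v1 * (2 * v1\<^sup>2 + a * v0\<^sup>2)) = 0"
    using z by Groebner_Basis.algebra+
  hence g: "v0 * (2 * v0\<^sup>2 + a * v1\<^sup>2) = 0" "v1 * (2 * v1\<^sup>2 + a * v0\<^sup>2) = 0"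
    using D by auto
  have "v0 \<noteq> 0" using g D by auto
  moreover have "v1 \<noteq> 0" using g D by auto
  ultimately have h: "2 * v0\<^sup>2 + a * v1\<^sup>2 = 0" "2 * v1\<^sup>2 + a * v0\<^sup>2 = 0" using g by auto
  hence "(a\<^sup>2 - 4) * v0\<^sup>2 = 0" by Groebner_Basis.algebra
  thus False using a \<open>v0 \<noteq> 0\<close> by simp
qed

text \<open>A root of c y^2 + e x y + g x^2 is a double root of its square. For \<open>c = 0\<close>
  the direction v is such a root, otherwise w + \<beta> v with \<beta> from the quadratic formula;
  \<open>X9_no_double_direction\<close> excludes both.\<close>

lemma X9_not_square:
  fixes a :: complex
  assumes a: "a\<^sup>2 \<noteq> 4" and D: "w0 * v1 - w1 * v0 \<noteq> 0" and P: "P 4 0 = 1" "P 0 4 = 1" "P 2 2 = a" "P 3 1 = 0" "P 1 3 = 0"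
    and sq: "tr w0 w1 v0 v1 P 0 4 = t * c\<^sup>2" "tr w0 w1 v0 v1 P 1 3 = t * (2 * c * e)"
      "tr w0 w1 v0 v1 P 2 2 = t * (e\<^sup>2 + 2 * g * c)" "tr w0 w1 v0 v1 P 3 1 = t * (2 * e * g)" "tr w0 w1 v0 v1 P 4 0 = t * g\<^sup>2"
  shows False
proof (cases "c = 0")
  case True
  thus False using X9_no_double_direction[OF a D] sq(1,2)[unfolded kap_sums4[OF P]] by auto
next
  case False
  define \<beta> where "\<beta> = (csqrt (e\<^sup>2 - 4 * c * g) - e) / (2 * c)"
  have "(2 * c * \<beta> + e)\<^sup>2 = e\<^sup>2 - 4 * c * g" using False by (simp add: \<beta>_def)
  hence "4 * c * (c * \<beta>\<^sup>2 + e * \<beta> + g) = 0" by Groebner_Basis.algebra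
  hence r: "c * \<beta>\<^sup>2 + e * \<beta> + g = 0" using False by simp
  define u0 u1 where "u0 = w0 + \<beta> * v0" and "u1 = w1 + \<beta> * v1"
  have D': "v0 * u1 - v1 * u0 \<noteq> 0" using D by (auto simp: u0_def u1_def algebra_simps)
  have "u0 ^ 4 + u1 ^ 4 + a * u0\<^sup>2 * u1\<^sup>2 = (w0 ^ 4 + w1 ^ 4 + a * w0\<^sup>2 * w1\<^sup>2)
    + \<beta> * (4 * v0 * w0 ^ 3 + 4 * v1 * w1 ^ 3 + 2 * a * (v0 * w0 * w1\<^sup>2 + v1 * w0\<^sup>2 * w1))
    + \<beta>\<^sup>2 * (6 * w0\<^sup>2 * v0\<^sup>2 + 6 * w1\<^sup>2 * v1\<^sup>2 + a * (w0\<^sup>2 * v1\<^sup>2 + 4 * w0 * w1 * v0 * v1 + w1\<^sup>2 * v0\<^sup>2))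
    + \<beta> ^ 3 * (4 * w0 * v0 ^ 3 + 4 * w1 * v1 ^ 3 + 2 * a * (w0 * v0 * v1\<^sup>2 + w1 * v0\<^sup>2 * v1))
    + \<beta> ^ 4 * (v0 ^ 4 + v1 ^ 4 + a * v0\<^sup>2 * v1\<^sup>2)"
    unfolding u0_def u1_def by Groebner_Basis.algebra
  also have "\<dots> = t * (c * \<beta>\<^sup>2 + e * \<beta> + g)\<^sup>2"
    using sq unfolding kap_sums4[OF P] by Groebner_Basis.algebra
  finally have 1: "u0 ^ 4 + u1 ^ 4 + a * u0\<^sup>2 * u1\<^sup>2 = 0" using r by simp
  have "4 * v0 * u0 ^ 3 + 4 * v1 * u1 ^ 3 + 2 * a * (v0 * u0 * u1\<^sup>2 + v1 * u0\<^sup>2 * u1) =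
      (4 * v0 * w0 ^ 3 + 4 * v1 * w1 ^ 3 + 2 * a * (v0 * w0 * w1\<^sup>2 + v1 * w0\<^sup>2 * w1))
    + 2 * \<beta> * (6 * w0\<^sup>2 * v0\<^sup>2 + 6 * w1\<^sup>2 * v1\<^sup>2 + a * (w0\<^sup>2 * v1\<^sup>2 + 4 * w0 * w1 * v0 * v1 + w1\<^sup>2 * v0\<^sup>2))
    + 3 * \<beta> ^ 2 * (4 * w0 * v0 ^ 3 + 4 * w1 * v1 ^ 3 + 2 * a * (w0 * v0 * v1\<^sup>2 + w1 * v0\<^sup>2 * v1))
    + 4 * \<beta> ^ 3 * (v0 ^ 4 + v1 ^ 4 + a * v0\<^sup>2 * v1\<^sup>2)"
    unfolding u0_def u1_def by Groebner_Basis.algebra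
  also have "\<dots> = 2 * t * (c * \<beta>\<^sup>2 + e * \<beta> + g) * (2 * c * \<beta> + e)"
    using sq unfolding kap_sums4[OF P] by Groebner_Basis.algebra
  finally have 2: "4 * v0 * u0 ^ 3 + 4 * v1 * u1 ^ 3 + 2 * a * (v0 * u0 * u1\<^sup>2 + v1 * u0\<^sup>2 * u1) = 0" using r by simp
  show False by (rule X9_no_double_direction[OF a D' 1 2])
qed

lemma jrel_scale: "jrel K P L \<Longrightarrow> jrel K (\<lambda>a b. s * P a b) (\<lambda>i j. t * L i j)"
proof -
  assume J: "jrel K P L"
  have "(\<Sum>a<K. \<Sum>b<K. of_nat (Suc a) * (s * P (Suc a) b) * (t * L (i + a) (j + b))) =
      s * t * (\<Sum>a<K. \<Sum>b<K. of_nat (Suc a) * P (Suc a) b * L (i + a) (j + b))"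
    "(\<Sum>a<K. \<Sum>b<K. of_nat (Suc b) * (s * P a (Suc b)) * (t * L (i + a) (j + b))) =
      s * t * (\<Sum>a<K. \<Sum>b<K. of_nat (Suc b) * P a (Suc b) * L (i + a) (j + b))" for i j
    by (simp_all add: sum_distrib_left mult_ac del: of_nat_Suc)
  thus ?thesis using J unfolding jrel_def by simp
qed

lemma cubic_root:
  fixes p q r s :: complex
  assumes "p \<noteq> 0"
  shows "\<exists>t. p * t ^ 3 + q * t\<^sup>2 + r * t + s = 0"
proof -
  have "0 < degree [:s, r, q, p:]" using assms by simp
  from alg_closed_imp_poly_has_root[OF this]
  obtain t where "poly [:s, r, q, p:] t = 0" by blast
  thus ?thesis by (intro exI[of _ t]) (simp add: algebra_simps eval_nat_numeral)
qed

text \<open>The terms of degree 2 and 3 fall into the types A, D and E according to the rank of the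
  quadratic part and, if it is zero, the multiplicities of the roots of the cubic part. Coordinates
  are chosen to bring the type into the position that the vanishing lemmas assume, and
  \<open>E\<close> is the set of monomials they prescribe.\<close>

lemma quartic_normal_form:
  fixes a :: complex
  assumes a: "a\<^sup>2 \<noteq> 4" and Q: "quartic_array Q"
    and Q4: "Q 4 0 = 1" "Q 0 4 = 1" "Q 2 2 = a" "Q 3 1 = 0" "Q 1 3 = 0"
    and nz: "\<not> (Q 2 0 = 0 \<and> Q 1 1 = 0 \<and> Q 0 2 = 0 \<and> Q 3 0 = 0 \<and> Q 2 1 = 0 \<and> Q 1 2 = 0 \<and> Q 0 3 = 0)"
  shows "\<exists>w0 w1 v0 v1 E. w0 * v1 - w1 * v0 \<noteq> 0 \<and> finite E \<and> card E \<le> 7 \<and>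
     (\<forall>L. \<not> dual_for 8 E (tr w0 w1 v0 v1 Q) L)"
proof -
  \<comment> \<open>No direction is a double root of the quartic part, so y^4 or x y^3 is present in
    all coordinates. This keeps the types D and E from degenerating further.\<close>
  have tr4: "tr w0 w1 v0 v1 Q 0 4 \<noteq> 0 \<or> tr w0 w1 v0 v1 Q (Suc 0) 3 \<noteq> 0" if "w0 * v1 - w1 * v0 \<noteq> 0" for w0 w1 v0 v1
    using X9_no_double_direction[OF a that] kap_sums4[OF Q4] by auto
  have goal: ?thesis
    if "w0 * v1 - w1 * v0 \<noteq> 0" "finite E" "card E \<le> 7"
      "\<And>L. jrel 8 (tr w0 w1 v0 v1 Q) L \<Longrightarrow> (\<And>i j. 8 \<le> i \<or> 8 \<le> j \<Longrightarrow> L i j = 0) \<Longrightarrow> (\<And>i j. (i, j) \<in> E \<Longrightarrow> L i j = 0)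
        \<Longrightarrow> (\<And>i j. L i j = 0)" for w0 w1 v0 v1 E
  proof -
    have "\<not> dual_for 8 E (tr w0 w1 v0 v1 Q) L" for L
      using that(4)[of L] unfolding dual_for_def by blast
    thus ?thesis using that(1-3) by blast
  qed
  note s = kap_sums[where P = Q]
  consider (nd) "4 * Q 2 0 * Q 0 2 \<noteq> Q 1 1 ^ 2" | (A) "4 * Q 2 0 * Q 0 2 = Q 1 1 ^ 2" "\<not> (Q 2 0 = 0 \<and> Q 1 1 = 0 \<and> Q 0 2 = 0)"
    | (c) "Q 2 0 = 0" "Q 1 1 = 0" "Q 0 2 = 0" by blast
  thus ?thesis
  proof cases
    case nd
    let ?P = "tr 1 0 0 1 Q"
    have P: "?P 2 0 = Q 2 0" "?P (Suc 0) (Suc 0) = Q 1 1" "?P 0 2 = Q 0 2" using s[of 1 0 0 1] by simp_all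
    show ?thesis
    proof (rule goal[of 1 1 0 0 "{(0,0)}"])
      fix L i j assume L: "jrel 8 ?P L" "\<And>i j. 8 \<le> i \<or> 8 \<le> j \<Longrightarrow> L i j = 0" "\<And>i j. (i, j) \<in> {(0,0)} \<Longrightarrow> L i j = 0"
      show "L i j = 0"
        by (rule dual_zero_nondegenerate[OF quartic_array_tr[OF Q] L(1,2)]) (use nd P L(3) in auto)
    qed auto
  next
    case A
    \<comment> \<open>A quadratic form of rank one is a multiple of x^2 once v spans its
      kernel.\<close>
    obtain w0 w1 v0 v1 where w: "w0 * v1 - w1 * v0 \<noteq> 0" "tr w0 w1 v0 v1 Q 0 2 = 0" "tr w0 w1 v0 v1 Q 1 1 = 0" "tr w0 w1 v0 v1 Q 2 0 \<noteq> 0"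
    proof (cases "Q 2 0 = 0")
      case True
      hence "Q 1 1 = 0" "Q 0 2 \<noteq> 0" using A by auto
      thus ?thesis using True s[of 0 1 1 0] by (intro that[of 0 0 1 1]) simp_all
    next
      case False
      show ?thesis
      proof (rule that[of 1 "2 * Q 2 0" 0 "- Q 1 1"])
        have "Q 2 0 * (4 * Q 2 0 * Q 0 2 - Q 1 1 ^ 2) = 0" using A by simp
        thus "tr 1 0 (- Q 1 1) (2 * Q 2 0) Q 0 2 = 0"
          unfolding s by (simp add: algebra_simps power2_eq_square)
      qed (use False s[of 1 0 "- Q 1 1" "2 * Q 2 0"] in simp_all)
    qed
    define \<alpha> where "\<alpha> = tr w0 w1 v0 v1 Q 2 0"
    define P where "P a b = (1 / \<alpha>) * tr w0 w1 v0 v1 Q a b" for a b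
    have \<alpha>: "\<alpha> \<noteq> 0" using w by (simp add: \<alpha>_def)
    have trP: "tr w0 w1 v0 v1 Q a b = \<alpha> * P a b" for a b using \<alpha> by (simp add: P_def)
    have qP: "quartic_array P" using quartic_array_tr[OF Q] unfolding quartic_array_def P_def by simp
    have P2: "P 2 0 = 1" "P (Suc 0) (Suc 0) = 0" "P 0 2 = 0" using w \<alpha> by (simp_all add: P_def \<alpha>_def)
    \<comment> \<open>The powers of y up to the sixth. The value at y^7 is then the only free one;
      if it were nonzero it could be scaled to 1, and the quartic part would be a square.\<close>
    define E where "E = (\<lambda>j. (0::nat, j::nat)) ` {..6}"
    show ?thesis
    proof (rule goal[OF w(1)])
      show "finite E" "card E \<le> 7" unfolding E_def using card_image_le[of "{..6}" "\<lambda>j. (0::nat, j::nat)"] by auto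
      fix L i j assume L: "jrel 8 (tr w0 w1 v0 v1 Q) L" "\<And>i j. 8 \<le> i \<or> 8 \<le> j \<Longrightarrow> L i j = 0" "\<And>i j. (i, j) \<in> E \<Longrightarrow> L i j = 0"
      have L0: "L 0 j = 0" if "j \<le> 6" for j using L(3)[of 0 j] that by (auto simp: E_def)
      have J: "jrel 8 P L" using jrel_scale[OF L(1), of "1 / \<alpha>" 1] by (simp add: P_def[abs_def])
      have "L 0 7 = 0"
      proof (rule ccontr)
        assume L7: "L 0 7 \<noteq> 0"
        have J': "jrel 8 P (\<lambda>i j. (1 / L 0 7) * L i j)" using jrel_scale[OF J, of 1 "1 / L 0 7"] by simp
        obtain c e g where "P 0 4 = c\<^sup>2" "P (Suc 0) 3 = 2 * c * e" "P 2 2 = e\<^sup>2 + 2 * g * c" "P 3 (Suc 0) = 2 * e * g" "P 4 0 = g\<^sup>2"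
          using dual_A_square[OF qP J' _ P2] L(2) L0 L7 tr4[OF w(1)] trP by auto
        thus False
          using X9_not_square[OF a w(1) Q4, of \<alpha> c e g] trP by simp
      qed
      note L7 = this
      show "L i j = 0" by (rule dual_zero_A_aux[OF qP J L(2) P2 L0 L7])
    qed
  next
    case c
    have t2: "tr w0 w1 v0 v1 Q 2 0 = 0" "tr w0 w1 v0 v1 Q (Suc 0) (Suc 0) = 0" "tr w0 w1 v0 v1 Q 0 2 = 0" for w0 w1 v0 v1
      using s[of w0 w1 v0 v1] c by simp_all
    \<comment> \<open>The two coefficients in the case distinction vanish exactly when v is a
      multiple root of the cubic part. If there is such a direction, the types are D5, D6, E6 and
      E7, otherwise D4.\<close>
    show ?thesis
    proof (cases "\<exists>w0 w1 v0 v1. w0 * v1 - w1 * v0 \<noteq> 0 \<and> tr w0 w1 v0 v1 Q 0 3 = 0 \<and> tr w0 w1 v0 v1 Q 1 2 = 0")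
      case True
      then obtain w0 w1 v0 v1 where w: "w0 * v1 - w1 * v0 \<noteq> 0" "tr w0 w1 v0 v1 Q 0 3 = 0" "tr w0 w1 v0 v1 Q 1 2 = 0" by blast
      let ?P = "tr w0 w1 v0 v1 Q"
      have w': "?P 0 3 = 0" "?P (Suc 0) 2 = 0" using w by simp_all
      note q = quartic_array_tr[OF Q, of w0 w1 v0 v1]
      consider (D) "?P 2 (Suc 0) \<noteq> 0" | (E6) "?P 2 (Suc 0) = 0" "?P 3 0 \<noteq> 0" "?P 0 4 \<noteq> 0"
        | (E7) "?P 2 (Suc 0) = 0" "?P 3 0 \<noteq> 0" "?P 0 4 = 0" "?P (Suc 0) 3 \<noteq> 0" | (z) "?P 2 (Suc 0) = 0" "?P 3 0 = 0"
        using tr4[OF w(1)] by blast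
      thus ?thesis
      proof cases
        case D
        show ?thesis
        proof (rule goal[OF w(1), of "{(0,0),(0,1),(0,2),(0,3),(0,4),(0,5),(1,0)}"])
          fix L i j assume L: "jrel 8 ?P L" "\<And>i j. 8 \<le> i \<or> 8 \<le> j \<Longrightarrow> L i j = 0"
            "\<And>i j. (i, j) \<in> {(0,0),(0,1),(0,2),(0,3),(0,4),(0,5),(1,0)} \<Longrightarrow> L i j = 0"
          have 0: "L 0 j = 0" if "j \<le> 5" for j
          proof -
            have "j = 0 \<or> j = 1 \<or> j = 2 \<or> j = 3 \<or> j = 4 \<or> j = 5" using that by auto
            thus ?thesis using L(3) by auto
          qed
          show "L i j = 0"
            by (rule dual_zero_D[OF q L(1,2) t2 w' D tr4[OF w(1)] 0]) (use L(3) in auto)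
        qed auto
      next
        case E6
        show ?thesis
        proof (rule goal[OF w(1), of "{(0,0),(1,0),(0,1),(1,1),(0,2),(1,2)}"])
          fix L i j assume L: "jrel 8 ?P L" "\<And>i j. 8 \<le> i \<or> 8 \<le> j \<Longrightarrow> L i j = 0"
            "\<And>i j. (i, j) \<in> {(0,0),(1,0),(0,1),(1,1),(0,2),(1,2)} \<Longrightarrow> L i j = 0"
          show "L i j = 0"
            by (rule dual_zero_E6[OF q L(1,2) t2 w' E6]) (use L(3) in auto)
        qed auto
      next
        case E7
        show ?thesis
        proof (rule goal[OF w(1), of "{(0,0),(1,0),(0,1),(1,1),(0,2),(0,3),(0,4)}"])
          fix L i j assume L: "jrel 8 ?P L" "\<And>i j. 8 \<le> i \<or> 8 \<le> j \<Longrightarrow> L i j = 0"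
            "\<And>i j. (i, j) \<in> {(0,0),(1,0),(0,1),(1,1),(0,2),(0,3),(0,4)} \<Longrightarrow> L i j = 0"
          show "L i j = 0"
            by (rule dual_zero_E7[OF q L(1,2) t2 w' E7]) (use L(3) in auto)
        qed auto
      next
        case z
        \<comment> \<open>The cubic part is zero in the new coordinates, hence as a function. Its
          values at four points give zero coefficients, against \<open>nz\<close>.\<close>
        define X where "X x y = Q 3 0 * x ^ 3 + Q 2 1 * x\<^sup>2 * y + Q 1 2 * x * y\<^sup>2 + Q 0 3 * y ^ 3" for x y
        have zero: "Q 3 0 * (w0 * x + v0 * y) ^ 3 + Q 2 1 * (w0 * x + v0 * y)\<^sup>2 * (w1 * x + v1 * y) +
           Q 1 2 * (w0 * x + v0 * y) * (w1 * x + v1 * y)\<^sup>2 + Q 0 3 * (w1 * x + v1 * y) ^ 3 = 0" for x y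
        proof -
          have "Q 3 0 * (w0 * x + v0 * y) ^ 3 + Q 2 1 * (w0 * x + v0 * y)\<^sup>2 * (w1 * x + v1 * y) +
           Q 1 2 * (w0 * x + v0 * y) * (w1 * x + v1 * y)\<^sup>2 + Q 0 3 * (w1 * x + v1 * y) ^ 3 =
           x ^ 3 * ?P 3 0 + x\<^sup>2 * y * ?P 2 1 + x * y\<^sup>2 * ?P 1 2 + y ^ 3 * ?P 0 3"
            unfolding s by Groebner_Basis.algebra
          thus ?thesis using w z by simp
        qed
        let ?D = "w0 * v1 - w1 * v0"
        have X0: "X x y = 0" for x y
        proof -
          have "w0 * ((v1 * x - v0 * y) / ?D) + v0 * ((w0 * y - w1 * x) / ?D) = x"
            "w1 * ((v1 * x - v0 * y) / ?D) + v1 * ((w0 * y - w1 * x) / ?D) = y"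
            using w(1) by (simp_all add: divide_simps) (simp_all add: algebra_simps)
          with zero[of "(v1 * x - v0 * y) / ?D" "(w0 * y - w1 * x) / ?D"] show ?thesis by (simp add: X_def)
        qed
        have "Q 3 0 = 0" "Q 0 3 = 0" using X0[of 1 0] X0[of 0 1] by (simp_all add: X_def)
        moreover have "Q 2 1 = 0 \<and> Q 1 2 = 0"
          using X0[of 1 1] X0[of 1 "-1"] calculation by (simp add: X_def)
        ultimately show ?thesis using c nz by auto
      qed
    next
      case False
      obtain w0 w1 v0 v1 where w: "w0 * v1 - w1 * v0 \<noteq> 0" "tr w0 w1 v0 v1 Q 0 3 = 0"
      proof (cases "Q 3 0 = 0")
        case True
        thus ?thesis using s[of 0 1 1 0] by (intro that[of 0 0 1 1]) simp_all
      next
        case F: False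
        obtain t where "Q 3 0 * t ^ 3 + Q 2 1 * t\<^sup>2 + Q 1 2 * t + Q 0 3 = 0" using cubic_root[OF F] by blast
        thus ?thesis using s[of 1 0 t 1] by (intro that[of 1 1 0 t]) simp_all
      qed
      let ?P = "tr w0 w1 v0 v1 Q"
      have P12: "?P 1 2 \<noteq> 0" using False w by blast
      have disc: "?P 2 1 ^ 2 \<noteq> 4 * ?P 1 2 * ?P 3 0"
      proof
        assume d: "?P 2 1 ^ 2 = 4 * ?P 1 2 * ?P 3 0"
        \<comment> \<open>If its discriminant is zero, the quadratic factor has this double root,
          which is then a multiple root of the cubic, against the assumption of the case.\<close>
        define x y where "x = 2 * ?P 1 2" and "y = - ?P 2 1"
        have "v0 * (w1 * x + v1 * y) - v1 * (w0 * x + v0 * y) = - x * (w0 * v1 - w1 * v0)"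
          by (simp add: algebra_simps)
        hence 1: "v0 * (w1 * x + v1 * y) - v1 * (w0 * x + v0 * y) \<noteq> 0" using w P12 by (simp add: x_def)
        have "tr v0 v1 (w0 * x + v0 * y) (w1 * x + v1 * y) Q 0 3 =
           x ^ 3 * ?P 3 0 + x\<^sup>2 * y * ?P 2 1 + x * y\<^sup>2 * ?P 1 2 + y ^ 3 * ?P 0 3"
          unfolding s by Groebner_Basis.algebra
        also have "\<dots> = 0" using d w(2) unfolding x_def y_def by Groebner_Basis.algebra
        finally have 2: "tr v0 v1 (w0 * x + v0 * y) (w1 * x + v1 * y) Q 0 3 = 0" .
        have "tr v0 v1 (w0 * x + v0 * y) (w1 * x + v1 * y) Q 1 2 =
           x\<^sup>2 * ?P 2 1 + 2 * x * y * ?P 1 2 + 3 * y ^ 2 * ?P 0 3"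
          unfolding s by Groebner_Basis.algebra
        also have "\<dots> = 0" using d w(2) unfolding x_def y_def by Groebner_Basis.algebra
        finally have 3: "tr v0 v1 (w0 * x + v0 * y) (w1 * x + v1 * y) Q 1 2 = 0" .
        show False using False 1 2 3 by blast
      qed
      note q = quartic_array_tr[OF Q, of w0 w1 v0 v1]
      show ?thesis
      proof (rule goal[OF w(1), of "{(0,0),(1,0),(0,1),(2,0),(1,1),(0,2)}"])
        fix L i j assume L: "jrel 8 ?P L" "\<And>i j. 8 \<le> i \<or> 8 \<le> j \<Longrightarrow> L i j = 0"
          "\<And>i j. (i, j) \<in> {(0,0),(1,0),(0,1),(2,0),(1,1),(0,2)} \<Longrightarrow> L i j = 0"
        have 2: "L i j = 0" if "i + j \<le> 2" for i j
        proof -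
          have "(i, j) \<in> {(0,0),(1,0),(0,1),(2,0),(1,1),(0,2)}" using that by auto
          thus ?thesis by (rule L(3))
        qed
        show "L i j = 0"
          by (rule dual_zero_D4[OF q L(1,2) t2 _ _ _ 2]) (use P12 disc w(2) in simp_all)
      qed auto
    qed
  qed
qed

section \<open>Rescaling a family with Milnor number 8\<close>

lemma coef_X9: "coef i j (X9_poly a) = (if (i, j) = (4, 0) \<or> (i, j) = (0, 4) then 1 else if (i, j) = (2, 2) then a else 0)"
proof -
  have "X9_poly a = (\<lambda>z. mono 4 0 z + mono 0 4 z + a * mono 2 2 z)"
    by (simp add: X9_poly_def mono_def fun_eq_iff mult.assoc)
  thus ?thesis by (auto simp: coef_add coef_cmult coef_mono hg_add hg_mult hg_const hg_mono)
qed

definition low_degrees :: "(nat \<times> nat) set" where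
  "low_degrees = {(2,0),(1,1),(0,2),(3,0),(2,1),(1,2),(0,3)}"

lemma low_degrees_iff: "(a, b) \<in> low_degrees \<longleftrightarrow> a + b = 2 \<or> a + b = 3"
proof
  assume ab: "a + b = 2 \<or> a + b = 3"
  consider "a = 0" | "a = 1" | "a = 2" | "a = 3" using ab by linarith
  thus "(a, b) \<in> low_degrees"
  proof cases
    case 1
    hence "b = 2 \<or> b = 3" using ab by simp
    thus ?thesis using 1 by (auto simp: low_degrees_def)
  next
    case 2
    hence "b = 1 \<or> b = 2" using ab by simp
    thus ?thesis using 2 by (auto simp: low_degrees_def)
  next
    case 3
    hence "b = 0 \<or> b = 1" using ab by simp
    thus ?thesis using 3 by (auto simp: low_degrees_def)
  next
    case 4
    hence "b = 0" using ab by simp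
    thus ?thesis using 4 by (simp add: low_degrees_def)
  qed
qed (auto simp: low_degrees_def)

text \<open>The monomials and coordinates are chosen for the limit \<open>Q\<close>, after passing
  to a subsequence. Functionals for them exist at every index, because the Milnor number is 8 there
  and linear coordinate changes preserve it.\<close>

lemma X9_family_no_milnor_8:
  fixes g :: "nat \<Rightarrow> cvec \<Rightarrow> complex" and A :: complex
  assumes A: "A\<^sup>2 \<noteq> 4" and g: "\<And>n. holomorphic_germ 2 (g n)" and m: "\<And>n. milnor_number 2 (g n) = 8"
    and lim: "\<And>a b. (\<lambda>n. coef a b (g n)) \<longlonglongrightarrow> coef a b (X9_poly A)"
    and low: "\<And>n a b. a + b \<le> 1 \<Longrightarrow> coef a b (g n) = 0"
  shows False
proof -
  have m8: "milnor_number 2 (g n) = enat 8" for n using m[of n] by (simp add: numeral_eq_enat)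
  define c where "c n p = coef (fst p) (snd p) (g n)" for n p
  define \<phi> where "\<phi> p x = (if fst p + snd p = 2 then sqrt (cmod x) else cmod x)" for p :: "nat \<times> nat" and x :: complex
  define \<mu> where "\<mu> n = (\<Sum>p\<in>low_degrees. \<phi> p (c n p))" for n
  \<comment> \<open>the square root makes the terms of degree 2 and 3 scale alike under \<open>g(\<mu> x, \<mu> y) / \<mu>\<^sup>4\<close>\<close>
  have fin: "finite low_degrees" by (simp add: low_degrees_def)
  have \<phi>0: "0 \<le> \<phi> p x" for p x by (simp add: \<phi>_def)
  have \<phi>z: "\<phi> p x = 0 \<longleftrightarrow> x = 0" for p x by (simp add: \<phi>_def)
  have \<phi>lim: "((\<lambda>n. \<phi> p (x n)) \<longlongrightarrow> \<phi> p y) F" if "(x \<longlongrightarrow> y) F" for p x y and F :: "nat filter"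
    unfolding \<phi>_def by (auto intro!: tendsto_real_sqrt tendsto_norm that)
  \<comment> \<open>If all terms of degree 2 and 3 were zero, the order would be at least 4 and the
    Milnor number at least 9.\<close>
  have \<mu>pos: "0 < \<mu> n" for n
  proof -
    have "\<exists>p\<in>low_degrees. c n p \<noteq> 0"
    proof (rule ccontr)
      assume *: "\<not> (\<exists>p\<in>low_degrees. c n p \<noteq> 0)"
      have "coef a b (g n) = 0" if "a + b < 4" for a b
      proof (cases "a + b \<le> 1")
        case False
        hence "(a, b) \<in> low_degrees" using that by (auto simp: low_degrees_iff)
        thus ?thesis using * by (auto simp: c_def)
      qed (use low in simp)
      hence "order_ge 4 (g n)" using g by (simp add: order_ge_def)
      from order4_milnor[OF this m8] show False by simp
    qed
    then obtain p where p: "p \<in> low_degrees" "c n p \<noteq> 0" by blast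
    hence "0 < \<phi> p (c n p)" using \<phi>0[of p "c n p"] \<phi>z[of p "c n p"] by linarith
    thus ?thesis unfolding \<mu>_def by (intro sum_pos2[OF fin p(1)] \<phi>0)
  qed
  have clim: "(\<lambda>n. c n p) \<longlonglongrightarrow> 0" if "p \<in> low_degrees" for p
  proof -
    have "coef (fst p) (snd p) (X9_poly A) = 0" using that by (auto simp: low_degrees_def coef_X9)
    thus ?thesis using lim[of "fst p" "snd p"] by (simp add: c_def)
  qed
  have \<mu>lim: "\<mu> \<longlonglongrightarrow> 0"
  proof -
    have "\<mu> \<longlonglongrightarrow> (\<Sum>p\<in>low_degrees. \<phi> p 0)" unfolding \<mu>_def[abs_def] by (intro tendsto_sum \<phi>lim clim)
    moreover have "(\<Sum>p\<in>low_degrees. \<phi> p 0) = 0" by (intro sum.neutral ballI) (simp add: \<phi>_def)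
    ultimately show ?thesis by simp
  qed
  \<comment> \<open>The coefficients of the rescaled germ.\<close>
  define S where "S n a b = of_real (\<mu> n ^ (a + b) / \<mu> n ^ 4) * coef a b (g n)" for n a b
  have \<phi>S: "\<phi> p (S n (fst p) (snd p)) = \<phi> p (c n p) / \<mu> n" if "p \<in> low_degrees" for n p
  proof -
    obtain a b where p: "p = (a, b)" by (cases p)
    have "a + b = 2 \<or> a + b = 3" using that p low_degrees_iff by blast
    thus ?thesis
    proof
      assume ab: "a + b = 2"
      have "\<mu> n ^ 2 / \<mu> n ^ 4 = 1 / (\<mu> n)\<^sup>2" using \<mu>pos[of n] by (simp add: field_simps flip: power_add)
      thus ?thesis using ab \<mu>pos[of n]
        by (simp add: p \<phi>_def S_def c_def norm_mult norm_divide norm_power real_sqrt_divide del: of_real_divide)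
    next
      assume ab: "a + b = 3"
      have "\<mu> n ^ 3 / \<mu> n ^ 4 = 1 / \<mu> n" using \<mu>pos[of n] by (simp add: eval_nat_numeral)
      thus ?thesis using ab \<mu>pos[of n]
        by (simp add: p \<phi>_def S_def c_def norm_mult norm_divide norm_power del: of_real_divide)
    qed
  qed
  have sumS: "(\<Sum>p\<in>low_degrees. \<phi> p (S n (fst p) (snd p))) = 1" for n
  proof -
    have "(\<Sum>p\<in>low_degrees. \<phi> p (S n (fst p) (snd p))) = (\<Sum>p\<in>low_degrees. \<phi> p (c n p) / \<mu> n)"
      by (intro sum.cong refl \<phi>S)
    also have "\<dots> = 1" using \<mu>pos[of n] by (simp add: \<mu>_def[symmetric] flip: sum_divide_distrib)
    finally show ?thesis .
  qed
  have bound: "cmod (S n (fst p) (snd p)) \<le> 1" if "p \<in> low_degrees" for n p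
  proof -
    have "\<phi> p (S n (fst p) (snd p)) \<le> 1"
      using member_le_sum[of p low_degrees "\<lambda>p. \<phi> p (S n (fst p) (snd p))"] sumS[of n] that fin \<phi>0 by simp
    thus ?thesis by (auto simp: \<phi>_def split: if_splits)
  qed
  obtain r l where rl: "strict_mono r" "\<forall>p\<in>low_degrees. (\<lambda>n. S (r n) (fst p) (snd p)) \<longlonglongrightarrow> l p"
    using finite_subsequence_limit[where f = "\<lambda>n p. S n (fst p) (snd p)" and B = 1, OF fin bound] by auto
  define Q where "Q a b = (if (a, b) \<in> low_degrees then l (a, b) else if a + b = 4 then coef a b (X9_poly A) else 0)" for a b
  have Slim: "(\<lambda>n. S (r n) a b) \<longlonglongrightarrow> Q a b" for a b
  proof -
    have gl: "(\<lambda>n. coef a b (g (r n))) \<longlonglongrightarrow> coef a b (X9_poly A)"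
      using LIMSEQ_subseq_LIMSEQ[OF lim rl(1)] by (simp add: o_def)
    have ml: "(\<lambda>n. \<mu> (r n)) \<longlonglongrightarrow> 0" using LIMSEQ_subseq_LIMSEQ[OF \<mu>lim rl(1)] by (simp add: o_def)
    consider "a + b \<le> 1" | "(a, b) \<in> low_degrees" | "a + b = 4" | "5 \<le> a + b"
      using low_degrees_iff[of a b] by linarith
    thus ?thesis
    proof cases
      case 1
      hence "Q a b = 0" by (auto simp: Q_def low_degrees_iff)
      thus ?thesis using low[OF 1] by (simp add: S_def)
    next
      case 2
      thus ?thesis using rl(2) by (auto simp: Q_def)
    next
      case 3
      hence "Q a b = coef a b (X9_poly A)" by (auto simp: Q_def low_degrees_iff)
      moreover have "S (r n) a b = coef a b (g (r n))" for n using 3 \<mu>pos[of "r n"] by (simp add: S_def)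
      ultimately show ?thesis using gl by simp
    next
      \<comment> \<open>In degree 5 and above a positive power of \<open>\<mu>\<close> is left over,
        so these terms disappear in the limit.\<close>
      case 4
      hence Q0: "Q a b = 0" by (auto simp: Q_def low_degrees_iff)
      define k where "k = a + b - 5"
      have k: "a + b = 4 + Suc k" using 4 by (simp add: k_def)
      have "S (r n) a b = of_real (\<mu> (r n) ^ Suc k) * coef a b (g (r n))" for n
        using \<mu>pos[of "r n"] by (simp add: S_def k power_add eval_nat_numeral)
      moreover have "(\<lambda>n. of_real (\<mu> (r n) ^ Suc k) * coef a b (g (r n))) \<longlonglongrightarrow> of_real (0 ^ Suc k) * coef a b (X9_poly A)"
        by (intro tendsto_mult tendsto_of_real tendsto_power ml gl)
      ultimately show ?thesis using Q0 by simp
    qed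
  qed
  \<comment> \<open>The normalising sum is continuous in the coefficients and keeps its value 1, so
    some term of degree 2 or 3 is left in \<open>Q\<close>.\<close>
  have "(\<lambda>n. \<Sum>p\<in>low_degrees. \<phi> p (S (r n) (fst p) (snd p))) \<longlonglongrightarrow> (\<Sum>p\<in>low_degrees. \<phi> p (Q (fst p) (snd p)))"
    by (intro tendsto_sum \<phi>lim Slim)
  hence sumQ: "(\<Sum>p\<in>low_degrees. \<phi> p (Q (fst p) (snd p))) = 1" unfolding sumS by (simp add: LIMSEQ_const_iff)
  have nz: "\<not> (Q 2 0 = 0 \<and> Q 1 1 = 0 \<and> Q 0 2 = 0 \<and> Q 3 0 = 0 \<and> Q 2 1 = 0 \<and> Q 1 2 = 0 \<and> Q 0 3 = 0)"
  proof
    assume *: "Q 2 0 = 0 \<and> Q 1 1 = 0 \<and> Q 0 2 = 0 \<and> Q 3 0 = 0 \<and> Q 2 1 = 0 \<and> Q 1 2 = 0 \<and> Q 0 3 = 0"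
    have "(\<Sum>p\<in>low_degrees. \<phi> p (Q (fst p) (snd p))) = 0"
      by (intro sum.neutral ballI) (use * in \<open>auto simp: low_degrees_def \<phi>_def\<close>)
    thus False using sumQ by simp
  qed
  have qQ: "quartic_array Q" by (auto simp: quartic_array_def Q_def low_degrees_iff)
  have Q4: "Q 4 0 = 1" "Q 0 4 = 1" "Q 2 2 = A" "Q 3 1 = 0" "Q 1 3 = 0"
    by (simp_all add: Q_def low_degrees_iff coef_X9)
  obtain w0 w1 v0 v1 E where w: "w0 * v1 - w1 * v0 \<noteq> 0" and E: "finite E" "card E \<le> 7"
    and nd: "\<And>L. \<not> dual_for 8 E (tr w0 w1 v0 v1 Q) L"
    using quartic_normal_form[OF A qQ Q4 nz] by blast
  \<comment> \<open>A linear substitution commutes with scaling the variables and can be made before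
    the limit; its effect \<open>tr\<close> on coefficients is continuous.\<close>
  define G where "G n z = g (r n) (cmap 2 (lmap w0 w1 v0 v1) z)" for n z
  have Gh: "holomorphic_germ 2 (G n)" for n unfolding G_def[abs_def] by (rule hg_cmap[OF cgerm_lmap g])
  have Gm: "milnor_number 2 (G n) = enat 8" for n
    unfolding G_def[abs_def] by (subst milnor_lmap[OF w g]) (rule m8)
  have "\<exists>L. dual_for 8 E (tr w0 w1 v0 v1 Q) L"
  proof (rule dual_limit[where P = "\<lambda>n a b. coef a b (G n)" and lam = "\<lambda>n. \<mu> (r n)"])
    show "\<exists>L. dual_for 8 E (\<lambda>a b. coef a b (G n)) L" for n
      by (rule dual_exists[OF Gh Gm E(1)]) (use E(2) in simp)
    show "0 < \<mu> (r n)" for n by (rule \<mu>pos)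
    fix i j
    have "of_real (\<mu> (r n) ^ (i + j) / \<mu> (r n) ^ 4) * coef i j (G n) = tr w0 w1 v0 v1 (S (r n)) i j" for n
      unfolding G_def[abs_def] coef_lmap[OF g] tr_def sum_distrib_left
      by (intro sum.cong refl) (simp add: S_def mult_ac)
    moreover have "(\<lambda>n. tr w0 w1 v0 v1 (S (r n)) i j) \<longlonglongrightarrow> tr w0 w1 v0 v1 Q i j"
      unfolding tr_def by (intro tendsto_sum tendsto_mult tendsto_const Slim)
    ultimately show "(\<lambda>n. of_real (\<mu> (r n) ^ (i + j) / \<mu> (r n) ^ 4) * coef i j (G n)) \<longlonglongrightarrow> tr w0 w1 v0 v1 Q i j"
      by simp
  qed
  thus False using nd by blast
qed

subsection \<open>Singularities of type \<open>E\<^sub>7\<close>\<close>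

lemma jac_comb:
  assumes "f1 \<in> jac n g" "f2 \<in> jac n g" "holomorphic_germ n a1" "holomorphic_germ n a2"
    and "\<forall>\<^sub>F z in near_origin n. h z = a1 z * f1 z + a2 z * f2 z"
  shows "h \<in> jac n g"
proof (rule jac_cong[OF jac_add[OF jac_mult[OF assms(1,3)] jac_mult[OF assms(2,4)]]])
  show "\<forall>\<^sub>F z in near_origin n. a1 z * f1 z + a2 z * f2 z = h z"
    using assms(5) by eventually_elim simp
qed

text \<open>A quartic form divisible by x; \<open>q1 \<noteq> 0\<close> says that x^2 does not
  divide it. The forms \<open>qX\<close> and \<open>qY\<close> are its partial derivatives.\<close>

definition qform :: "complex \<Rightarrow> complex \<Rightarrow> complex \<Rightarrow> complex \<Rightarrow> cvec \<Rightarrow> complex" where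
  "qform q4 q3 q2 q1 z = q4 * z 0 ^ 4 + q3 * z 0 ^ 3 * z (Suc 0) + q2 * (z 0)\<^sup>2 * (z (Suc 0))\<^sup>2 + q1 * z 0 * z (Suc 0) ^ 3"

definition qX :: "complex \<Rightarrow> complex \<Rightarrow> complex \<Rightarrow> complex \<Rightarrow> cvec \<Rightarrow> complex" where
  "qX q4 q3 q2 q1 z = 4 * q4 * z 0 ^ 3 + 3 * q3 * (z 0)\<^sup>2 * z (Suc 0) + 2 * q2 * z 0 * (z (Suc 0))\<^sup>2 + q1 * z (Suc 0) ^ 3"

definition qY :: "complex \<Rightarrow> complex \<Rightarrow> complex \<Rightarrow> complex \<Rightarrow> cvec \<Rightarrow> complex" where
  "qY q4 q3 q2 q1 z = q3 * z 0 ^ 3 + 2 * q2 * (z 0)\<^sup>2 * z (Suc 0) + 3 * q1 * z 0 * (z (Suc 0))\<^sup>2"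

lemma partial_qform:
  "partial_deriv 0 (qform q4 q3 q2 q1) = qX q4 q3 q2 q1"
  "partial_deriv (Suc 0) (qform q4 q3 q2 q1) = qY q4 q3 q2 q1"
  "2 \<le> i \<Longrightarrow> partial_deriv i (qform q4 q3 q2 q1) = (\<lambda>_. 0)"
  unfolding partial_deriv_def fun_eq_iff qform_def qX_def qY_def
  by (auto intro!: DERIV_imp_deriv derivative_eq_intros simp: algebra_simps eval_nat_numeral)

lemma hg_qform: "holomorphic_germ n (qform q4 q3 q2 q1)"
  unfolding qform_def[abs_def] by (intro hg_intros)

lemma hg_qX: "holomorphic_germ n (qX q4 q3 q2 q1)"
  unfolding qX_def[abs_def] by (intro hg_intros)

lemma hg_qY: "holomorphic_germ n (qY q4 q3 q2 q1)"
  unfolding qY_def[abs_def] by (intro hg_intros)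

lemma qform_mono: "qform q4 q3 q2 q1 = (\<lambda>z. q4 * mono 4 0 z + q3 * mono 3 1 z + q2 * mono 2 2 z + q1 * mono 1 3 z)"
  by (simp add: fun_eq_iff qform_def mono_def mult.assoc)

lemma coef_qform: "coef i j (qform q4 q3 q2 q1) =
   (if (i, j) = (4, 0) then q4 else if (i, j) = (3, 1) then q3 else if (i, j) = (2, 2) then q2 else if (i, j) = (1, 3) then q1 else 0)"
  unfolding qform_mono
  by (auto simp: coef_add coef_cmult coef_mono hg_add hg_mult hg_const hg_mono)

lemma order_qXY: "order_ge 3 (qX q4 q3 q2 q1)" "order_ge 3 (qY q4 q3 q2 q1)"
proof -
  have "coef i j (qX q4 q3 q2 q1) = 0 \<and> coef i j (qY q4 q3 q2 q1) = 0" if "i + j < 3" for i j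
    unfolding partial_qform[symmetric] coef_partial_X[OF hg_qform] coef_partial_Y coef_qform
    using that by auto
  thus "order_ge 3 (qX q4 q3 q2 q1)" "order_ge 3 (qY q4 q3 q2 q1)"
    by (simp_all add: order_ge_def hg_qX hg_qY)
qed

lemma partial_deriv_cube_mult:
  assumes u: "holomorphic_germ n u" and T: "holomorphic_germ n T" and i: "i < n"
  shows "\<forall>\<^sub>F z in near_origin n. partial_deriv i (\<lambda>z. u z * T z ^ 3) z =
    T z ^ 2 * (partial_deriv i u z * T z + 3 * u z * partial_deriv i T z)"
proof -
  have e: "(\<lambda>z. u z * T z ^ 3) = (\<lambda>z. u z * (T z * (T z * T z)))" by (simp add: fun_eq_iff eval_nat_numeral)
  from partial_deriv_mult[OF u hg_mult[OF T hg_mult[OF T T]] i] partial_deriv_mult[OF T hg_mult[OF T T] i]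
    partial_deriv_mult[OF T T i]
  show ?thesis unfolding e by eventually_elim (simp add: algebra_simps eval_nat_numeral)
qed

text \<open>
  \<open>\<Theta>\<close> agrees with \<open>x\<close> only modulo the partial derivatives of the quartic form: along a stable equivalence
  a linear form is determined only modulo the Jacobian ideal.
\<close>

context
  fixes q4 q3 q2 q1 :: complex and g u b c \<Theta> :: "cvec \<Rightarrow> complex"
  assumes q1: "q1 \<noteq> 0" and g: "holomorphic_germ 2 g" and u: "holomorphic_germ 2 u" "u origin \<noteq> 0"
    and b: "holomorphic_germ 2 b" and c: "holomorphic_germ 2 c"
    and \<Theta>: "\<And>z. \<Theta> z = z 0 + b z * qX q4 q3 q2 q1 z + c z * qY q4 q3 q2 q1 z"
    and gform: "\<forall>\<^sub>F z in near_origin 2. g z = qform q4 q3 q2 q1 z + u z * \<Theta> z ^ 3"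
begin

abbreviation "qx \<equiv> qX q4 q3 q2 q1"
abbreviation "qy \<equiv> qY q4 q3 q2 q1"

lemma \<Theta>_rem: obtains R where "order_ge 3 R" "\<Theta> = (\<lambda>z. z 0 + R z)"
proof (rule that[of "\<lambda>z. b z * qx z + c z * qy z"])
  show "order_ge 3 (\<lambda>z. b z * qx z + c z * qy z)"
    by (intro order_ge_add order_ge_mult order_qXY b c)
  show "\<Theta> = (\<lambda>z. z 0 + (b z * qx z + c z * qy z))" by (simp add: fun_eq_iff \<Theta>)
qed

lemma hg_\<Theta>: "holomorphic_germ 2 \<Theta>"
  using \<Theta>_rem by (metis hg_add hg_coord order_ge_def)

lemma coef_\<Theta>: "i + j < 3 \<Longrightarrow> coef i j \<Theta> = (if i = 1 \<and> j = 0 then 1 else 0)"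
proof -
  obtain R where R: "order_ge 3 R" "\<Theta> = (\<lambda>z. z 0 + R z)" by (rule \<Theta>_rem)
  have "(\<lambda>z::cvec. z 0) = mono 1 0" by (simp add: mono_def fun_eq_iff)
  hence "coef i j (\<lambda>z. z 0) = (if i = 1 \<and> j = 0 then 1 else 0)" by (simp only: coef_mono)
  thus "i + j < 3 \<Longrightarrow> coef i j \<Theta> = (if i = 1 \<and> j = 0 then 1 else 0)"
    using R by (simp add: coef_add hg_coord order_ge_def)
qed

lemma coef_g:
  assumes "i + j \<le> 4"
  shows "i < 3 \<Longrightarrow> coef i j g = coef i j (qform q4 q3 q2 q1)" and "i = 3 \<Longrightarrow> j = 0 \<Longrightarrow> coef i j g = u origin"
proof -
  obtain R where R: "order_ge 3 R" "\<Theta> = (\<lambda>z. z 0 + R z)" by (rule \<Theta>_rem)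
  have Rh: "holomorphic_germ 2 R" using R by (simp add: order_ge_def)
  \<comment> \<open>With \<open>R\<close> of order 3, all terms of the cube of x + R other than x^3
    have order at least 5 and leave coefficients up to degree 4 alone.\<close>
  define S where "S z = z 0 * (z 0 * ((3 * u z) * R z)) + (z 0 * (z 0 * ((0 * u z) * R z)) + ((3 * z 0 * u z + u z * R z) * (R z * R z)))" for z
  have R2: "order_ge 5 (\<lambda>z. R z * R z)"
    unfolding order_ge_def
  proof (intro conjI allI impI)
    fix i j :: nat assume ij: "i + j < 5"
    have "coef a b R * coef (i - a) (j - b) R = 0" if "a \<le> i" "b \<le> j" for a b
    proof (cases "a + b < 3")
      case False
      hence "(i - a) + (j - b) < 3" using ij that by linarith
      thus ?thesis using R(1) by (simp add: order_ge_def)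
    qed (use R(1) in \<open>simp add: order_ge_def\<close>)
    thus "coef i j (\<lambda>z. R z * R z) = 0" unfolding coef_mult[OF Rh Rh] by (intro sum.neutral ballI) auto
  qed (intro hg_mult Rh)
  have S: "order_ge 5 S"
  proof -
    have "order_ge (Suc (Suc 3)) (\<lambda>z. z 0 * (z 0 * (k z * R z)))" if "holomorphic_germ 2 k" for k
      by (intro order_ge_X order_ge_mult R that)
    hence *: "order_ge 5 (\<lambda>z. z 0 * (z 0 * (k z * R z)))" if "holomorphic_germ 2 k" for k
      using that by (simp add: eval_nat_numeral)
    show ?thesis unfolding S_def
      by (intro order_ge_add * order_ge_mult[OF R2] hg_intros u Rh)
  qed
  have "coef i j g = coef i j (\<lambda>z. qform q4 q3 q2 q1 z + (z 0 ^ 3 * u z + S z))"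
  proof (rule coef_cong)
    show "\<forall>\<^sub>F z in near_origin 2. g z = qform q4 q3 q2 q1 z + (z 0 ^ 3 * u z + S z)"
      using gform by eventually_elim (simp add: R(2) S_def eval_nat_numeral algebra_simps)
  qed
  also have "\<dots> = coef i j (qform q4 q3 q2 q1) + (if i < 3 then 0 else coef (i - 3) j u)"
    using S assms by (simp add: coef_add coef_X_power hg_qform hg_add hg_mult hg_power hg_coord u order_ge_def)
  finally have *: "coef i j g = coef i j (qform q4 q3 q2 q1) + (if i < 3 then 0 else coef (i - 3) j u)" .
  show "i < 3 \<Longrightarrow> coef i j g = coef i j (qform q4 q3 q2 q1)" using * by simp
  show "i = 3 \<Longrightarrow> j = 0 \<Longrightarrow> coef i j g = u origin" using * by (simp add: coef_qform coef_00)
qed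

text \<open>Exponents of a monomial basis of the local algebra of x^3 + x y^3, the normal form of
  E7.\<close>

definition E7set :: "(nat \<times> nat) set" where
  "E7set = {(0,0),(0,1),(0,2),(0,3),(0,4),(1,0),(1,1)}"

text \<open>In the low exponents that matter, the derivatives of \<open>g\<close> have only the
  terms 3 u(0) x^2 + q1 y^3 and 3 q1 x y^2. A supposed relation is tested against them coefficient
  by coefficient.\<close>

lemma E7_indep: "indep_mod 2 g E7set (\<lambda>p. mono (fst p) (snd p))"
  unfolding indep_mod_def
proof (intro conjI ballI allI impI hg_mono)
  show "finite E7set" by (simp add: E7set_def)
  fix d p assume J: "(\<lambda>z. \<Sum>p\<in>E7set. d p * mono (fst p) (snd p) z) \<in> jac 2 g" and p: "p \<in> E7set"
  then obtain A where A: "\<forall>i<2. holomorphic_germ 2 (A i)"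
    "\<forall>\<^sub>F z in near_origin 2. (\<Sum>p\<in>E7set. d p * mono (fst p) (snd p) z) = (\<Sum>i<2. A i z * partial_deriv i g z)"
    by (auto simp: jac_def)
  have Ah: "holomorphic_germ 2 (A 0)" "holomorphic_germ 2 (A (Suc 0))" using A by auto
  have Dh: "holomorphic_germ 2 (partial_deriv 0 g)" "holomorphic_germ 2 (partial_deriv (Suc 0) g)"
    using g by (auto intro: hg_partial)
  have E: "coef i j (\<lambda>z. \<Sum>p\<in>E7set. d p * mono (fst p) (snd p) z) = (if (i, j) \<in> E7set then d (i, j) else 0)" for i j
  proof -
    have "coef i j (\<lambda>z. \<Sum>p\<in>E7set. d p * mono (fst p) (snd p) z) = (\<Sum>p\<in>E7set. if p = (i, j) then d p else 0)"
      by (simp add: coef_sum coef_cmult coef_mono hg_mult hg_const hg_mono) (intro sum.cong refl, auto)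
    thus ?thesis by (simp add: E7set_def)
  qed
  have eq: "(if (i, j) \<in> E7set then d (i, j) else 0) =
      (\<Sum>a\<le>i. \<Sum>b\<le>j. coef a b (A 0) * coef (i - a) (j - b) (partial_deriv 0 g)) +
      (\<Sum>a\<le>i. \<Sum>b\<le>j. coef a b (A (Suc 0)) * coef (i - a) (j - b) (partial_deriv (Suc 0) g))" for i j
  proof -
    have "(if (i, j) \<in> E7set then d (i, j) else 0) = coef i j (\<lambda>z. A 0 z * partial_deriv 0 g z + A (Suc 0) z * partial_deriv (Suc 0) g z)"
      unfolding E[symmetric]
      by (rule coef_cong) (use A(2) in eventually_elim, simp add: numeral_2_eq_2)
    thus ?thesis by (simp add: coef_add coef_mult hg_mult Ah Dh)
  qed
  have lowX: "coef i j (partial_deriv 0 g) = (if (i, j) = (2, 0) then 3 * u origin else if (i, j) = (0, 3) then q1 else 0)"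
    if "(i, j) \<in> {(0,0),(0,1),(0,2),(0,3),(1,0),(1,1),(2,0)}" for i j
    using that coef_g[of "Suc i" j] by (auto simp: coef_partial_X[OF g] coef_qform)
  have lowY: "coef i j (partial_deriv (Suc 0) g) = (if (i, j) = (1, 2) then 3 * q1 else 0)"
    if "(i, j) \<in> {(0,0),(0,1),(0,2),(0,3),(1,0),(1,1),(2,0),(1,2)}" for i j
    using that coef_g[of i "Suc j"] by (auto simp: coef_partial_Y coef_qform)
  note lows = lowX[of 0 0] lowX[of 0 1] lowX[of 0 2] lowX[of 0 3] lowX[of 1 0] lowX[of 1 1] lowX[of 2 0]
     lowY[of 0 0] lowY[of 0 1] lowY[of 0 2] lowY[of 0 3] lowY[of 1 0] lowY[of 1 1] lowY[of 2 0] lowY[of 1 2]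
  have z1: "d (0,0) = 0" "d (0,1) = 0" "d (1,0) = 0" "d (1,1) = 0" "d (0,2) = 0"
    using eq[of 0 0] eq[of 0 1] eq[of 1 0] eq[of 1 1] eq[of 0 2] lows by (simp_all add: E7set_def eval_nat_numeral)
  \<comment> \<open>Exponents outside \<open>E7set\<close> do not occur on the left. Those at (2,0),
    (1,2) and (2,1) force the low terms of the multipliers to vanish, after which (0,3) and (0,4)
    can be read off.\<close>
  have A00: "coef 0 0 (A 0) = 0" using eq[of 2 0] lows u(2) by (simp add: E7set_def eval_nat_numeral)
  have z2: "d (0,3) = 0" using eq[of 0 3] lows A00 by (simp add: E7set_def eval_nat_numeral)
  have B00: "coef 0 0 (A (Suc 0)) = 0" using eq[of 1 2] lows A00 q1 by (simp add: E7set_def eval_nat_numeral)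
  have A01: "coef 0 (Suc 0) (A 0) = 0" using eq[of 2 1] lows A00 B00 u(2) by (simp add: E7set_def eval_nat_numeral)
  have z3: "d (0,4) = 0" using eq[of 0 4] lows A00 A01 B00 by (simp add: E7set_def eval_nat_numeral)
  show "d p = 0" using p z1 z2 z3 by (auto simp: E7set_def)
qed

text \<open>Modulo the Jacobian ideal the rules x^2 = V y^3, x y^2 = W y^4, x y^3 = 0 and y^5 = 0
  are derived, with a unit V; they reduce every germ to the seven monomials. Beforehand \<Theta> has
  to be replaced by a unit times x.\<close>

lemma E7_spans: "spans_mod 2 g E7set (\<lambda>p. mono (fst p) (snd p))"
proof -
  define U where "U i z = partial_deriv i u z * \<Theta> z + 3 * u z * partial_deriv i \<Theta> z" for i z
  have Uh: "holomorphic_germ 2 (U i)" if "i < 2" for i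
    unfolding U_def using that by (intro hg_intros hg_partial u hg_\<Theta>)
  have dg: "\<forall>\<^sub>F z in near_origin 2. partial_deriv 0 g z = qx z + \<Theta> z ^ 2 * U 0 z"
    "\<forall>\<^sub>F z in near_origin 2. partial_deriv (Suc 0) g z = qy z + \<Theta> z ^ 2 * U (Suc 0) z"
  proof -
    have "\<forall>\<^sub>F z in near_origin 2. partial_deriv i g z = partial_deriv i (qform q4 q3 q2 q1) z + \<Theta> z ^ 2 * U i z" if i: "i < 2" for i
      using partial_deriv_cong_germ[OF gform i] partial_deriv_cube_mult[OF u(1) hg_\<Theta> i]
        partial_deriv_add[OF hg_qform[of 2 q4 q3 q2 q1] hg_mult[OF u(1) hg_power[OF hg_\<Theta>, of 3]] i]
      by eventually_elim (simp add: U_def)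
    from this[of 0] this[of "Suc 0"]
    show "\<forall>\<^sub>F z in near_origin 2. partial_deriv 0 g z = qx z + \<Theta> z ^ 2 * U 0 z"
      "\<forall>\<^sub>F z in near_origin 2. partial_deriv (Suc 0) g z = qy z + \<Theta> z ^ 2 * U (Suc 0) z"
      by (simp_all add: partial_qform)
  qed
  have pJ: "partial_deriv 0 g \<in> jac 2 g" "partial_deriv (Suc 0) g \<in> jac 2 g"
    by (auto intro: jac_partial[OF g])
  have \<Theta>0: "\<Theta> origin = 0" using coef_\<Theta>[of 0 0] by (simp add: coef_00)
  have d\<Theta>: "partial_deriv 0 \<Theta> origin = 1" "partial_deriv (Suc 0) \<Theta> origin = 0"
    using coef_\<Theta>[of 1 0] coef_\<Theta>[of 0 1] by (simp_all add: coef_def)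
  \<comment> \<open>Expressing \<open>qx\<close> and \<open>qy\<close> in the formula for \<Theta>
    by the derivatives of \<open>g\<close> and the square of \<Theta> gives k \<Theta> = x modulo
    the Jacobian ideal, with the unit \<open>k\<close>.\<close>
  define k where "k z = 1 + \<Theta> z * (b z * U 0 z + c z * U (Suc 0) z)" for z
  have kh: "holomorphic_germ 2 k" unfolding k_def by (intro hg_intros hg_\<Theta> b c Uh) auto
  have "k origin \<noteq> 0" by (simp add: k_def \<Theta>0)
  then obtain v where v: "holomorphic_germ 2 v" "v origin = inverse (k origin)" "\<forall>\<^sub>F z in near_origin 2. k z \<noteq> 0 \<and> v z = inverse (k z)"
    using hg_inverse[OF kh] by blast
  have v0: "v origin = 1" using v(2) by (simp add: k_def \<Theta>0)
  define j1 where "j1 z = \<Theta> z - v z * z 0" for z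
  have j1: "j1 \<in> jac 2 g"
  proof (rule jac_comb[OF pJ, of "\<lambda>z. v z * b z" "\<lambda>z. v z * c z"])
    show "\<forall>\<^sub>F z in near_origin 2. j1 z = v z * b z * partial_deriv 0 g z + v z * c z * partial_deriv (Suc 0) g z"
      using dg v(3)
    proof eventually_elim
      case (elim z)
      have vk: "v z * k z = 1" using elim(3) by simp
      have "\<Theta> z = v z * k z * \<Theta> z" using vk by simp
      also have "\<dots> = v z * (\<Theta> z + \<Theta> z ^ 2 * (b z * U 0 z + c z * U (Suc 0) z))"
        by (simp add: k_def algebra_simps power2_eq_square)
      finally have "\<Theta> z = v z * (z 0 + b z * qx z + c z * qy z + \<Theta> z ^ 2 * (b z * U 0 z + c z * U (Suc 0) z))"
        using \<Theta>[of z] by simp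
      thus ?case unfolding j1_def elim(1) elim(2) by (simp add: algebra_simps)
    qed
  qed (intro hg_mult v b c)+
  define A where "A i z = v z ^ 2 * U i z" for i z
  have Ah: "holomorphic_germ 2 (A i)" if "i < 2" for i unfolding A_def using that by (intro hg_mult hg_power v Uh)
  have A0: "A 0 origin \<noteq> 0" "A (Suc 0) origin = 0"
    using u(2) by (simp_all add: A_def U_def v0 \<Theta>0 d\<Theta>)
  have QX: "(\<lambda>z. qx z + (z 0)\<^sup>2 * A 0 z) \<in> jac 2 g"
  proof (rule jac_comb[OF pJ(1) j1, of "\<lambda>_. 1" "\<lambda>z. - (\<Theta> z + v z * z 0) * U 0 z"])
    show "\<forall>\<^sub>F z in near_origin 2. qx z + (z 0)\<^sup>2 * A 0 z = 1 * partial_deriv 0 g z + - (\<Theta> z + v z * z 0) * U 0 z * j1 z"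
      using dg(1) by eventually_elim (simp add: j1_def A_def algebra_simps power2_eq_square)
  qed (intro hg_intros hg_\<Theta> v Uh; simp)+
  have QY: "(\<lambda>z. qy z + (z 0)\<^sup>2 * A (Suc 0) z) \<in> jac 2 g"
  proof (rule jac_comb[OF pJ(2) j1, of "\<lambda>_. 1" "\<lambda>z. - (\<Theta> z + v z * z 0) * U (Suc 0) z"])
    show "\<forall>\<^sub>F z in near_origin 2. qy z + (z 0)\<^sup>2 * A (Suc 0) z = 1 * partial_deriv (Suc 0) g z + - (\<Theta> z + v z * z 0) * U (Suc 0) z * j1 z"
      using dg(2) by eventually_elim (simp add: j1_def A_def algebra_simps power2_eq_square)
  qed (intro hg_intros hg_\<Theta> v Uh; simp)+
  \<comment> \<open>Division of the relation from the derivative in y by 3 q1 gives x y^2 = x^2 N,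
    where \<open>N\<close> vanishes at the origin because \<open>A (Suc 0)\<close> does.\<close>
  define N where "N z = - (1 / (3 * q1)) * (q3 * z 0 + 2 * q2 * z (Suc 0) + A (Suc 0) z)" for z
  have Nh: "holomorphic_germ 2 N" unfolding N_def by (intro hg_intros Ah) simp
  have N0: "N origin = 0" by (simp add: N_def A0)
  define F1 where "F1 z = z 0 * (z (Suc 0))\<^sup>2 - (z 0)\<^sup>2 * N z" for z
  have F1: "F1 \<in> jac 2 g"
  proof (rule jac_cong[OF jac_cmult[OF QY, of "1 / (3 * q1)"]])
    show "\<forall>\<^sub>F z in near_origin 2. 1 / (3 * q1) * (qy z + (z 0)\<^sup>2 * A (Suc 0) z) = F1 z"
      using q1 by (intro always_eventually allI) (simp add: qY_def F1_def N_def field_simps eval_nat_numeral)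
  qed
  \<comment> \<open>After x y^2 is replaced in the relation from the derivative in x, the
    coefficient of x^2 is the unit \<open>B\<close>; this gives x^2 = V y^3.\<close>
  define B where "B z = A 0 z + 4 * q4 * z 0 + 3 * q3 * z (Suc 0) + 2 * q2 * N z" for z
  have Bh: "holomorphic_germ 2 B" unfolding B_def by (intro hg_intros Ah Nh) simp
  have B0: "B origin \<noteq> 0" using A0 N0 by (simp add: B_def)
  obtain Bi where Bi: "holomorphic_germ 2 Bi" "Bi origin = inverse (B origin)" "\<forall>\<^sub>F z in near_origin 2. B z \<noteq> 0 \<and> Bi z = inverse (B z)"
    using hg_inverse[OF Bh B0] by blast
  define V where "V z = - q1 * Bi z" for z
  have Vh: "holomorphic_germ 2 V" unfolding V_def by (intro hg_mult hg_const Bi)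
  have V0: "V origin \<noteq> 0" using q1 B0 Bi(2) by (simp add: V_def)
  define F2 where "F2 z = (z 0)\<^sup>2 - V z * z (Suc 0) ^ 3" for z
  have F2: "F2 \<in> jac 2 g"
  proof (rule jac_comb[OF QX F1, of Bi "\<lambda>z. - 2 * q2 * Bi z"])
    show "\<forall>\<^sub>F z in near_origin 2. F2 z = Bi z * (qx z + (z 0)\<^sup>2 * A 0 z) + - 2 * q2 * Bi z * F1 z"
      using Bi(3)
    proof eventually_elim
      case (elim z)
      have "Bi z * B z = 1" using elim by simp
      hence "F2 z = Bi z * B z * (z 0)\<^sup>2 + q1 * Bi z * z (Suc 0) ^ 3" by (simp add: F2_def V_def)
      thus ?case by (simp add: B_def qX_def F1_def algebra_simps eval_nat_numeral)
    qed
  qed (intro hg_mult hg_const Bi)+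
  obtain n1 n2 where n: "holomorphic_germ 2 n1" "holomorphic_germ 2 n2"
    "\<forall>\<^sub>F z in near_origin 2. N z = N origin + z 0 * n1 z + z (Suc 0) * n2 z"
    using hg_split2[OF Nh] by blast
  \<comment> \<open>Replacing x^2 in x y^2 = x^2 N and splitting \<open>N\<close> into multiples of
    x and y leaves x y^2 with the unit \<open>C\<close> as factor.\<close>
  define C where "C z = 1 - V z * n1 z * z (Suc 0)" for z
  have Ch: "holomorphic_germ 2 C" unfolding C_def by (intro hg_intros Vh n)
  have C0: "C origin \<noteq> 0" by (simp add: C_def)
  obtain Ci where Ci: "holomorphic_germ 2 Ci" "\<forall>\<^sub>F z in near_origin 2. C z \<noteq> 0 \<and> Ci z = inverse (C z)"
    using hg_inverse[OF Ch C0] by blast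
  define W where "W z = Ci z * V z * n2 z" for z
  have Wh: "holomorphic_germ 2 W" unfolding W_def by (intro hg_mult Ci Vh n)
  define F3 where "F3 z = z 0 * (z (Suc 0))\<^sup>2 - W z * z (Suc 0) ^ 4" for z
  have F3: "F3 \<in> jac 2 g"
  proof (rule jac_comb[OF F1 F2, of Ci "\<lambda>z. Ci z * N z"])
    show "\<forall>\<^sub>F z in near_origin 2. F3 z = Ci z * F1 z + Ci z * N z * F2 z"
      using Ci(2) n(3)
    proof eventually_elim
      case (elim z)
      have "Ci z * C z = 1" using elim by simp
      hence "F3 z = Ci z * C z * (z 0 * (z (Suc 0))\<^sup>2) - W z * z (Suc 0) ^ 4" by (simp add: F3_def)
      also have "\<dots> = Ci z * (z 0 * (z (Suc 0))\<^sup>2 - (z 0 * n1 z + z (Suc 0) * n2 z) * (V z * z (Suc 0) ^ 3))"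
        by (simp add: C_def W_def algebra_simps eval_nat_numeral)
      also have "\<dots> = Ci z * (z 0 * (z (Suc 0))\<^sup>2 - N z * (V z * z (Suc 0) ^ 3))"
        using elim(2) N0 by simp
      finally show ?case by (simp add: F1_def F2_def algebra_simps)
    qed
  qed (intro hg_mult Ci Nh)+
  \<comment> \<open>Computing x^2 y^2 once from x y^2 = W y^4 and once from x^2 = V y^3 shows that
    y^5 times the unit \<open>D\<close> lies in the Jacobian ideal.\<close>
  define D where "D z = V z - W z ^ 2 * z (Suc 0)" for z
  have Dh: "holomorphic_germ 2 D" unfolding D_def by (intro hg_intros Vh Wh)
  have D0: "D origin \<noteq> 0" using V0 by (simp add: D_def)
  obtain Di where Di: "holomorphic_germ 2 Di" "\<forall>\<^sub>F z in near_origin 2. D z \<noteq> 0 \<and> Di z = inverse (D z)"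
    using hg_inverse[OF Dh D0] by blast
  have Y5: "(\<lambda>z. z (Suc 0) ^ 5) \<in> jac 2 g"
  proof (rule jac_comb[OF F3 F2, of "\<lambda>z. Di z * (z 0 + W z * (z (Suc 0))\<^sup>2)" "\<lambda>z. - Di z * (z (Suc 0))\<^sup>2"])
    show "\<forall>\<^sub>F z in near_origin 2. z (Suc 0) ^ 5 = Di z * (z 0 + W z * (z (Suc 0))\<^sup>2) * F3 z + - Di z * (z (Suc 0))\<^sup>2 * F2 z"
      using Di(2)
    proof eventually_elim
      case (elim z)
      have "Di z * D z = 1" using elim by simp
      hence "z (Suc 0) ^ 5 = Di z * D z * z (Suc 0) ^ 5" by simp
      thus ?case by (simp add: D_def F3_def F2_def algebra_simps eval_nat_numeral)
    qed
  qed (intro hg_intros Di Wh)+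
  have XY3: "(\<lambda>z. z 0 * z (Suc 0) ^ 3) \<in> jac 2 g"
    by (rule jac_comb[OF F3 Y5, of "\<lambda>z. z (Suc 0)" W])
       (rule hg_coord Wh always_eventually allI | simp add: F3_def algebra_simps eval_nat_numeral)+
  show ?thesis unfolding spans_mod_def
  proof (intro conjI ballI allI impI hg_mono)
    show "finite E7set" by (simp add: E7set_def)
    fix h assume h: "holomorphic_germ 2 h"
    obtain h1 h2 where h12: "holomorphic_germ 2 h1" "holomorphic_germ 2 h2"
      "\<forall>\<^sub>F z in near_origin 2. h z = (\<Sum>a<2. \<Sum>b<5. coef a b h * mono a b z) + z 0 ^ 2 * h1 z + z (Suc 0) ^ 5 * h2 z"
      using taylor2[OF h] by blast
    have Th: "holomorphic_germ 2 (\<lambda>z. V z * h1 z)" by (intro hg_mult Vh h12)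
    obtain t1 t2 where t: "holomorphic_germ 2 t1" "holomorphic_germ 2 t2"
      "\<forall>\<^sub>F z in near_origin 2. V z * h1 z = V origin * h1 origin + z 0 * t1 z + z (Suc 0) * t2 z"
      using hg_split2[OF Th] by blast
    obtain t3 t4 where t34: "holomorphic_germ 2 t3" "holomorphic_germ 2 t4"
      "\<forall>\<^sub>F z in near_origin 2. t2 z = t2 origin + z 0 * t3 z + z (Suc 0) * t4 z"
      using hg_split2[OF t(2)] by blast
    obtain w1 w2 where w: "holomorphic_germ 2 w1" "holomorphic_germ 2 w2"
      "\<forall>\<^sub>F z in near_origin 2. W z = W origin + z 0 * w1 z + z (Suc 0) * w2 z"
      using hg_split2[OF Wh] by blast
    \<comment> \<open>The remainder x^2 h1 contributes to y^3 and y^4 through \<open>V\<close>, the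
      term x y^2 to y^4 through \<open>W\<close>.\<close>
    define d where "d p = coef (fst p) (snd p) h + (if p = (0,3) then V origin * h1 origin else 0) +
      (if p = (0,4) then t2 origin + coef 1 2 h * W origin else 0)" for p
    define K where "K z = h1 z * F2 z + coef 1 2 h * F3 z + (coef 1 3 h + coef 1 4 h * z (Suc 0) + t1 z + z (Suc 0) * t3 z + coef 1 2 h * w1 z * z (Suc 0)) * (z 0 * z (Suc 0) ^ 3)
       + (h2 z + t4 z + coef 1 2 h * w2 z) * z (Suc 0) ^ 5" for z
    have K: "K \<in> jac 2 g" unfolding K_def
      by (intro jac_add jac_mult[OF F2] jac_cmult[OF F3] jac_mult[OF XY3] jac_mult[OF Y5] hg_intros h12 t t34 w)
    have "(\<lambda>z. h z - (\<Sum>p\<in>E7set. d p * mono (fst p) (snd p) z)) \<in> jac 2 g"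
    proof (rule jac_cong[OF K])
      show "\<forall>\<^sub>F z in near_origin 2. K z = h z - (\<Sum>p\<in>E7set. d p * mono (fst p) (snd p) z)"
        using h12(3) t(3) t34(3) w(3)
      proof eventually_elim
        case (elim z)
        define x y where "x = z 0" and "y = z (Suc 0)"
        have s: "(\<Sum>a<2. \<Sum>b<5. coef a b h * mono a b z) =
           coef 0 0 h + coef 0 1 h * y + coef 0 2 h * y\<^sup>2 + coef 0 3 h * y ^ 3 + coef 0 4 h * y ^ 4 +
           (coef 1 0 h + coef 1 1 h * y + coef 1 2 h * y\<^sup>2 + coef 1 3 h * y ^ 3 + coef 1 4 h * y ^ 4) * x"
          by (simp add: eval_nat_numeral mono_def x_def y_def algebra_simps)
        have d: "(\<Sum>p\<in>E7set. d p * mono (fst p) (snd p) z) =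
           coef 0 0 h + coef 0 1 h * y + coef 0 2 h * y\<^sup>2 + (coef 0 3 h + V origin * h1 origin) * y ^ 3 +
           (coef 0 4 h + (t2 origin + coef 1 2 h * W origin)) * y ^ 4 + coef 1 0 h * x + coef 1 1 h * x * y"
          by (simp add: E7set_def d_def mono_def x_def y_def)
        have 1: "x\<^sup>2 * h1 z = h1 z * F2 z + (V z * h1 z) * y ^ 3"
          by (simp add: F2_def x_def y_def algebra_simps)
        have 2: "coef 1 2 h * y\<^sup>2 * x = coef 1 2 h * F3 z + coef 1 2 h * W z * y ^ 4"
          by (simp add: F3_def x_def y_def algebra_simps)
        have "h z - (\<Sum>p\<in>E7set. d p * mono (fst p) (snd p) z) =
           h1 z * F2 z + coef 1 2 h * F3 z + (V z * h1 z - V origin * h1 origin) * y ^ 3 + coef 1 2 h * (W z - W origin) * y ^ 4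
           - t2 origin * y ^ 4 + (coef 1 3 h * y ^ 3 + coef 1 4 h * y ^ 4) * x + y ^ 5 * h2 z"
          unfolding elim(1) s d using 1 2 unfolding x_def[symmetric] y_def[symmetric] by (simp add: algebra_simps)
        also have "\<dots> = K z"
          unfolding elim(2) elim(3) elim(4) K_def x_def y_def by (simp add: algebra_simps eval_nat_numeral)
        finally show ?case by simp
      qed
    qed
    thus "\<exists>c. (\<lambda>z. h z - (\<Sum>p\<in>E7set. c p * mono (fst p) (snd p) z)) \<in> jac 2 g" by blast
  qed
qed

lemma E7_milnor: "milnor_number 2 g = 7"
proof -
  have card: "card E7set = 7" by (simp add: E7set_def)
  obtain k where k: "k \<le> card E7set" "milnor_number 2 g = enat k"
    by (rule spans_mod_milnor_le[OF g E7_spans])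
  have "card E7set \<le> k" by (rule indep_mod_card_le[OF g k(2) E7_indep])
  thus ?thesis using k card by (simp add: numeral_eq_enat)
qed

end

subsection \<open>Stabilisation\<close>

lemma implicit_germ:
  assumes f: "holomorphic_germ (Suc n) f" and f0: "f origin = 0" and d: "partial_deriv n f origin \<noteq> 0"
  obtains \<zeta> \<rho> where "holomorphic_germ n \<zeta>" "\<zeta> origin = 0" "0 < \<rho>"
    "\<forall>\<^sub>F z in near_origin n. f (z(n := \<zeta> z)) = 0"
    "\<forall>\<^sub>F z in near_origin n. \<forall>w. cmod w < \<rho> \<longrightarrow> f (z(n := w)) = 0 \<longrightarrow> w = \<zeta> z"
proof -
  obtain R where R: "0 < R" "hol (Suc n) R f" using f by (auto simp: holomorphic_germ_iff)
  show ?thesis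
  proof (rule implicit_function[OF R(2,1) f0 d])
    fix r \<rho> \<zeta>
    assume r: "0 < r" "r \<le> \<rho>" "\<rho> \<le> R" "hol n r \<zeta>"
    and b: "\<And>z. z \<in> polydisc n r \<Longrightarrow> cmod (\<zeta> z) < \<rho>"
    and u: "\<And>z w. z \<in> polydisc n r \<Longrightarrow> cmod w < \<rho> \<Longrightarrow> f (z(n := w)) = 0 \<longleftrightarrow> w = \<zeta> z"
    show thesis
    proof (rule that[of \<zeta> \<rho>])
    show "holomorphic_germ n \<zeta>" by (rule hg_I[OF r(1,4)])
    show "\<zeta> origin = 0" using u[of origin 0] r f0 by (simp add: fun_upd_idem)
    show "\<forall>\<^sub>F z in near_origin n. f (z(n := \<zeta> z)) = 0"
      unfolding eventually_near_origin using r(1) u b by blast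
    show "\<forall>\<^sub>F z in near_origin n. \<forall>w. cmod w < \<rho> \<longrightarrow> f (z(n := w)) = 0 \<longrightarrow> w = \<zeta> z"
      unfolding eventually_near_origin using r(1) u by blast
    qed (use r in simp)
  qed
qed

lemma partial_deriv_at_origin_cong:
  assumes "\<forall>\<^sub>F z in near_origin n. f z = g z" "i < n"
  shows "partial_deriv i f origin = partial_deriv i g origin"
  by (rule eventually_near_origin_at[OF partial_deriv_cong_germ[OF assms]])

text \<open>Squares are split off one at a time, and the shape of \<open>G\<close> is preserved. On
  the critical graph the last variable is a multiple of the square of \<Theta>, so its own square is
  absorbed into the unit before the cube, while removing the last variable from \<Theta> costs only
  a unit factor.\<close>

lemma E7_stable:
  fixes q4 q3 q2 q1 :: complex
  assumes "2 \<le> p" and q1: "q1 \<noteq> 0" and "holomorphic_germ p G" "holomorphic_germ p u" "u origin \<noteq> 0"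
    and "holomorphic_germ p b" "holomorphic_germ p c" "\<forall>i\<in>{2..<p}. holomorphic_germ p (a i)"
    and "\<forall>\<^sub>F z in near_origin p. G z = qform q4 q3 q2 q1 z + (\<Sum>i\<in>{2..<p}. (z i)\<^sup>2) +
      u z * (z 0 + (\<Sum>i\<in>{2..<p}. z i * a i z) + b z * qX q4 q3 q2 q1 z + c z * qY q4 q3 q2 q1 z) ^ 3"
  shows "milnor_number p G = 7"
  using assms(1,3-)
proof (induction p arbitrary: G u a b c rule: dec_induct)
  case base
  show ?case
    by (rule E7_milnor[OF q1 base(1-5), of "\<lambda>z. z 0 + b z * qX q4 q3 q2 q1 z + c z * qY q4 q3 q2 q1 z"])
       (use base(7) in simp_all)
next
  case (step k)
  let ?qx = "qX q4 q3 q2 q1" and ?qy = "qY q4 q3 q2 q1" and ?q = "qform q4 q3 q2 q1"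
  note G = step.prems(1) and u = step.prems(2) and u0 = step.prems(3) and b = step.prems(4) and c = step.prems(5)
  have a: "holomorphic_germ (Suc k) (a i)" if "i \<in> {2..<k} \<or> i = k" for i using step.prems(6) step.hyps that by auto
  define \<Theta> where "\<Theta> z = z 0 + (\<Sum>i\<in>{2..<k}. z i * a i z) + z k * a k z + b z * ?qx z + c z * ?qy z" for z
  have \<Theta>h: "holomorphic_germ (Suc k) \<Theta>" unfolding \<Theta>_def[abs_def] by (intro hg_intros a b c hg_qX hg_qY) auto
  have \<Theta>0: "\<Theta> origin = 0" by (simp add: \<Theta>_def qX_def qY_def)
  define Q where "Q z = ?q z + (\<Sum>i\<in>{2..<k}. (z i)\<^sup>2) + (z k)\<^sup>2" for z
  have Qh: "holomorphic_germ n Q" for n unfolding Q_def[abs_def] by (intro hg_intros hg_qform)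
  have k2: "2 \<le> k" by (rule step.hyps)
  have GQ: "\<forall>\<^sub>F z in near_origin (Suc k). G z = Q z + u z * \<Theta> z ^ 3"
    using step.prems(7) by eventually_elim (use k2 in \<open>simp add: Q_def \<Theta>_def atLeastLessThanSuc add.assoc\<close>, simp add: algebra_simps)
  have dQ: "partial_deriv k Q z = 2 * z k" for z
  proof -
    have "(\<lambda>w. Q (z(k := w))) = (\<lambda>w. ?q z + (\<Sum>i\<in>{2..<k}. (z i)\<^sup>2) + w\<^sup>2)"
      using k2 by (auto simp: Q_def qform_def fun_eq_iff)
    moreover have "((\<lambda>w. ?q z + (\<Sum>i\<in>{2..<k}. (z i)\<^sup>2) + w\<^sup>2) has_field_derivative 2 * z k) (at (z k))"
      by (auto intro!: derivative_eq_intros)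
    ultimately show ?thesis unfolding partial_deriv_def by (simp add: DERIV_imp_deriv)
  qed
  define K where "K z = partial_deriv k u z * \<Theta> z + 3 * u z * partial_deriv k \<Theta> z" for z
  have Kh: "holomorphic_germ (Suc k) K" unfolding K_def[abs_def] by (intro hg_intros hg_partial u \<Theta>h) auto
  define f where "f = partial_deriv k G"
  have fh: "holomorphic_germ (Suc k) f" unfolding f_def by (rule hg_partial[OF G]) simp
  have feq: "\<forall>\<^sub>F z in near_origin (Suc k). f z = 2 * z k + \<Theta> z * (\<Theta> z * K z)"
    using partial_deriv_cong_germ[OF GQ, of k, simplified] partial_deriv_add[OF Qh hg_mult[OF u hg_power[OF \<Theta>h, of 3]], of k, simplified]
      partial_deriv_cube_mult[OF u \<Theta>h, of k, simplified]
    unfolding f_def by eventually_elim (simp add: dQ K_def power2_eq_square)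
  have f0: "f origin = 0" using eventually_near_origin_at[OF feq] \<Theta>0 by simp
  have TK: "holomorphic_germ (Suc k) (\<lambda>z. \<Theta> z * K z)" by (intro hg_mult \<Theta>h Kh)
  have df: "partial_deriv k f origin = 2"
  proof -
    have "partial_deriv k f origin = partial_deriv k (\<lambda>z. 2 * z k + \<Theta> z * (\<Theta> z * K z)) origin"
      by (rule partial_deriv_at_origin_cong[OF feq]) simp
    also have "\<dots> = partial_deriv k (\<lambda>z. 2 * z k) origin + partial_deriv k (\<lambda>z. \<Theta> z * (\<Theta> z * K z)) origin"
      by (rule eventually_near_origin_at[OF partial_deriv_add[OF hg_mult[OF hg_const hg_coord] hg_mult[OF \<Theta>h TK]]]) simp
    also have "partial_deriv k (\<lambda>z. \<Theta> z * (\<Theta> z * K z)) origin = partial_deriv k \<Theta> origin * (\<Theta> origin * K origin) + \<Theta> origin * partial_deriv k (\<lambda>z. \<Theta> z * K z) origin"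
      by (rule eventually_near_origin_at[OF partial_deriv_mult[OF \<Theta>h TK]]) simp
    also have "partial_deriv k (\<lambda>z. 2 * z k) origin = 2"
      by (simp add: partial_deriv_def)
    finally show ?thesis by (simp add: \<Theta>0)
  qed
  have df0: "partial_deriv k f origin \<noteq> 0" using df by simp
  obtain \<zeta> \<rho> where \<zeta>: "holomorphic_germ k \<zeta>" "\<zeta> origin = 0" "0 < \<rho>" and z0: "\<forall>\<^sub>F z in near_origin k. f (z(k := \<zeta> z)) = 0"
    and "\<forall>\<^sub>F z in near_origin k. \<forall>w. cmod w < \<rho> \<longrightarrow> f (z(k := w)) = 0 \<longrightarrow> w = \<zeta> z"
    by (rule implicit_germ[OF fh f0 df0])
  have m: "milnor_number (Suc k) G = milnor_number k (\<lambda>z. G (z(k := \<zeta> z)))"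
    by (rule milnor_eliminate[OF G \<zeta>(1,2)]) (use z0 df in \<open>simp_all add: f_def\<close>)
  define r where "r h z = h (z(k := \<zeta> z))" for h :: "cvec \<Rightarrow> complex" and z
  have rh: "holomorphic_germ k (r h)" if "holomorphic_germ (Suc k) h" for h
    unfolding r_def[abs_def] by (rule hg_subst_last(1)[OF that \<zeta>(1,2)])
  have r0: "r h origin = h origin" for h by (simp add: r_def \<zeta>(2) fun_upd_idem)
  \<comment> \<open>On the graph, subtracting the term \<open>\<zeta> z * r (a k) z\<close> from
    \<Theta> amounts to multiplication by this unit.\<close>
  define v where "v z = 1 + r \<Theta> z * r K z * r (a k) z / 2" for z
  have vh: "holomorphic_germ k v" unfolding v_def[abs_def] divide_inverse by (intro hg_intros rh \<Theta>h Kh a) simp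
  have v0: "v origin = 1" by (simp add: v_def r0 \<Theta>0)
  obtain w where w: "holomorphic_germ k w" "w origin = inverse (v origin)" "\<forall>\<^sub>F z in near_origin k. v z \<noteq> 0 \<and> w z = inverse (v z)"
    by (rule hg_inverse[OF vh]) (use v0 in auto)
  define \<Theta>' where "\<Theta>' z = z 0 + (\<Sum>i\<in>{2..<k}. z i * r (a i) z) + r b z * ?qx z + r c z * ?qy z" for z
  have qr: "r ?qx z = ?qx z" "r ?qy z = ?qy z" "r ?q z = ?q z" for z
    using k2 by (simp_all add: r_def qX_def qY_def qform_def)
  have r\<Theta>: "r \<Theta> z = \<Theta>' z + \<zeta> z * r (a k) z" for z
    using k2 qr[of z] unfolding \<Theta>'_def \<Theta>_def r_def by simp
  \<comment> \<open>The old unit plus the contribution of the square of \<open>\<zeta>\<close>,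
    times the cube of the factor \<open>w\<close>, the inverse of \<open>v\<close>.\<close>
  define U where "U z = w z ^ 3 * (r u z + r \<Theta> z * (r K z)\<^sup>2 * (1 / 4))" for z
  have Uh: "holomorphic_germ k U" unfolding U_def[abs_def] by (intro hg_intros w rh u \<Theta>h Kh)
  have "milnor_number k (r G) = 7"
  proof (rule step.IH[OF rh[OF G] Uh _ rh[OF b] rh[OF c]])
    show "U origin \<noteq> 0" using w(2) v0 u0 by (simp add: U_def r0 \<Theta>0)
    show "\<forall>i\<in>{2..<k}. holomorphic_germ k (r (a i))" using rh a by blast
    show "\<forall>\<^sub>F z in near_origin k. r G z = ?q z + (\<Sum>i\<in>{2..<k}. (z i)\<^sup>2) +
        U z * (z 0 + (\<Sum>i\<in>{2..<k}. z i * r (a i) z) + r b z * ?qx z + r c z * ?qy z) ^ 3"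
      using hg_subst_last(2)[OF G \<zeta>(1,2) GQ] hg_subst_last(2)[OF G \<zeta>(1,2) feq] z0 w(3) unfolding \<Theta>'_def[symmetric]
    proof eventually_elim
      case (elim z)
      have \<zeta>2: "\<zeta> z = - (r \<Theta> z)\<^sup>2 * r K z / 2"
        using elim(2,3) by (simp add: r_def power2_eq_square field_simps add_eq_0_iff)
      have vw: "v z * w z = 1" using elim(4) by simp
      have "\<Theta>' z = r \<Theta> z * v z" using r\<Theta>[of z] unfolding \<zeta>2 v_def by (simp add: field_simps power2_eq_square)
      hence *: "r \<Theta> z = w z * \<Theta>' z" using vw by (simp add: mult_ac)
      have "r G z = r Q z + r u z * r \<Theta> z ^ 3" using elim(1) by (simp add: r_def)
      also have "r Q z = ?q z + (\<Sum>i\<in>{2..<k}. (z i)\<^sup>2) + (\<zeta> z)\<^sup>2"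
        using k2 qr(3)[of z] by (simp add: r_def Q_def)
      also have "(\<zeta> z)\<^sup>2 = r \<Theta> z ^ 3 * (r \<Theta> z * (r K z)\<^sup>2 * (1 / 4))"
        unfolding \<zeta>2 by (simp add: field_simps eval_nat_numeral)
      also have "?q z + (\<Sum>i\<in>{2..<k}. (z i)\<^sup>2) + r \<Theta> z ^ 3 * (r \<Theta> z * (r K z)\<^sup>2 * (1 / 4)) + r u z * r \<Theta> z ^ 3 =
          ?q z + (\<Sum>i\<in>{2..<k}. (z i)\<^sup>2) + (r u z + r \<Theta> z * (r K z)\<^sup>2 * (1 / 4)) * r \<Theta> z ^ 3"
        by (simp add: algebra_simps)
      also have "(r u z + r \<Theta> z * (r K z)\<^sup>2 * (1 / 4)) * r \<Theta> z ^ 3 = U z * \<Theta>' z ^ 3"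
        unfolding U_def by (subst (2) *) (simp add: power_mult_distrib mult_ac)
      finally show ?case .
    qed
  qed
  thus ?case unfolding m r_def[abs_def] .
qed

lemma hg_add_squares:
  assumes "holomorphic_germ n f"
  shows "holomorphic_germ p (add_squares n p f)"
proof -
  have "add_squares n p f = (\<lambda>z. f (cmap n (\<lambda>k z. z k) z) + (\<Sum>i\<in>{n..<p}. (z i)\<^sup>2))"
    by (simp add: add_squares_def fun_eq_iff cmap_def)
  thus ?thesis using hg_cmap[OF cgerm_coord assms, of p] by (auto intro!: hg_add hg_sum hg_power hg_coord)
qed

lemma partial_deriv_add_squares:
  assumes "n \<le> i" "i < p"
  shows "partial_deriv i (add_squares n p f) z = 2 * z i"
proof -
  have "(\<lambda>w. add_squares n p f (z(i := w))) = (\<lambda>w. f (\<lambda>i. if i < n then z i else 0) + (\<Sum>j\<in>{n..<p} - {i}. (z j)\<^sup>2) + w\<^sup>2)"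
  proof
    fix w
    have "(\<lambda>j. if j < n then (z(i := w)) j else 0) = (\<lambda>j. if j < n then z j else 0)" using assms by (auto simp: fun_eq_iff)
    moreover have "(\<Sum>j\<in>{n..<p}. ((z(i := w)) j)\<^sup>2) = w\<^sup>2 + (\<Sum>j\<in>{n..<p} - {i}. (z j)\<^sup>2)"
      using assms by (subst sum.remove[of _ i]) auto
    ultimately show "add_squares n p f (z(i := w)) = f (\<lambda>i. if i < n then z i else 0) + (\<Sum>j\<in>{n..<p} - {i}. (z j)\<^sup>2) + w\<^sup>2"
      unfolding add_squares_def by simp
  qed
  moreover have "((\<lambda>w. f (\<lambda>i. if i < n then z i else 0) + (\<Sum>j\<in>{n..<p} - {i}. (z j)\<^sup>2) + w\<^sup>2) has_field_derivative 2 * z i) (at (z i))"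
    by (auto intro!: derivative_eq_intros)
  ultimately show ?thesis unfolding partial_deriv_def by (simp add: DERIV_imp_deriv)
qed

lemma add_squares_same: "\<forall>\<^sub>F z in near_origin n. add_squares n n f z = f z"
proof (rule eventually_mono[OF near_origin_Cn])
  fix z assume "z \<in> Cn n"
  hence "(\<lambda>i. if i < n then z i else 0) = z" by (auto simp: Cn_def)
  thus "add_squares n n f z = f z" by (simp add: add_squares_def)
qed

lemma add_squares_drop: "n \<le> k \<Longrightarrow> add_squares n (Suc k) f (z(k := 0)) = add_squares n k f z"
proof -
  assume nk: "n \<le> k"
  hence "(\<lambda>j. if j < n then (z(k := 0)) j else 0) = (\<lambda>j. if j < n then z j else 0)" by (auto simp: fun_eq_iff)
  thus ?thesis using nk unfolding add_squares_def by (simp add: atLeastLessThanSuc)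
qed

text \<open>A new variable that enters only through its square has its critical graph at 0, so
  \<open>milnor_eliminate\<close> removes it.\<close>

lemma milnor_add_squares:
  assumes f: "holomorphic_germ n f" and "n \<le> p"
  shows "milnor_number p (add_squares n p f) = milnor_number n f"
  using assms(2)
proof (induction p rule: dec_induct)
  case base
  show ?case by (rule milnor_cong[OF add_squares_same f, symmetric])
next
  case (step k)
  have D: "partial_deriv k (add_squares n (Suc k) f) = (\<lambda>z. 2 * z k)"
    using step.hyps by (intro ext partial_deriv_add_squares) auto
  have "milnor_number (Suc k) (add_squares n (Suc k) f) = milnor_number k (\<lambda>z. add_squares n (Suc k) f (z(k := 0)))"
    by (rule milnor_eliminate[OF hg_add_squares[OF f] hg_const[of k 0]]) (simp_all add: D, simp add: partial_deriv_def)
  also have "(\<lambda>z. add_squares n (Suc k) f (z(k := 0))) = add_squares n k f"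
    using step.hyps by (simp add: add_squares_drop)
  finally show ?case using step.IH by simp
qed

subsection \<open>The Milnor number of \<open>X\<^sub>9\<close>\<close>

lemma hg_X9: "holomorphic_germ n (X9_poly a)"
  unfolding X9_poly_def[abs_def] by (intro hg_intros)

lemma partial_X9:
  "partial_deriv 0 (X9_poly a) = (\<lambda>z. 4 * z 0 ^ 3 + 2 * a * z 0 * (z (Suc 0))\<^sup>2)"
  "partial_deriv (Suc 0) (X9_poly a) = (\<lambda>z. 4 * z (Suc 0) ^ 3 + 2 * a * (z 0)\<^sup>2 * z (Suc 0))"
  unfolding partial_deriv_def fun_eq_iff X9_poly_def
  by (auto intro!: DERIV_imp_deriv derivative_eq_intros simp: algebra_simps eval_nat_numeral)

text \<open>The partial derivatives reduce x^3 and y^3 to multiples of x y^2 and x^2 y, and x^3 y, x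
  y^3 lie in the Jacobian ideal outright; so exponents below 3 suffice.\<close>

lemma X9_spans:
  assumes a: "a\<^sup>2 \<noteq> 4"
  shows "spans_mod 2 (X9_poly a) ({..<3} \<times> {..<3}) (\<lambda>p. mono (fst p) (snd p))"
proof -
  have P: "(\<lambda>z. 4 * z 0 ^ 3 + 2 * a * z 0 * (z (Suc 0))\<^sup>2) \<in> jac 2 (X9_poly a)"
    "(\<lambda>z. 4 * z (Suc 0) ^ 3 + 2 * a * (z 0)\<^sup>2 * z (Suc 0)) \<in> jac 2 (X9_poly a)"
    using jac_partial[OF hg_X9, of 0 2 a] jac_partial[OF hg_X9, of "Suc 0" 2 a] by (simp_all add: partial_X9)
  \<comment> \<open>Determinant of the linear system for x^3 y and x y^3 that arises from y times
    the first and x times the second derivative.\<close>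
  define D where "D = 16 - 4 * a\<^sup>2"
  have D: "D \<noteq> 0" using a by (auto simp: D_def)
  have comb: "T = 4 / D * u * P + - (2 * a / D) * v * Q" if "D * T = 4 * u * P - 2 * a * v * Q" for T u v P Q :: complex
    using that D by (simp add: field_simps)
  have X3Y: "(\<lambda>z. z 0 ^ 3 * z (Suc 0)) \<in> jac 2 (X9_poly a)"
  proof (rule jac_comb[OF P, of "\<lambda>z. 4 / D * z (Suc 0)" "\<lambda>z. - (2 * a / D) * z 0"])
    show "\<forall>\<^sub>F z in near_origin 2. z 0 ^ 3 * z (Suc 0) = 4 / D * z (Suc 0) * (4 * z 0 ^ 3 + 2 * a * z 0 * (z (Suc 0))\<^sup>2) +
        - (2 * a / D) * z 0 * (4 * z (Suc 0) ^ 3 + 2 * a * (z 0)\<^sup>2 * z (Suc 0))"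
    proof (intro always_eventually allI)
      fix z :: cvec
      show "z 0 ^ 3 * z (Suc 0) = 4 / D * z (Suc 0) * (4 * z 0 ^ 3 + 2 * a * z 0 * (z (Suc 0))\<^sup>2) +
        - (2 * a / D) * z 0 * (4 * z (Suc 0) ^ 3 + 2 * a * (z 0)\<^sup>2 * z (Suc 0))"
        by (rule comb) (simp add: D_def algebra_simps eval_nat_numeral)
    qed
  qed (intro hg_intros)+
  have XY3: "(\<lambda>z. z 0 * z (Suc 0) ^ 3) \<in> jac 2 (X9_poly a)"
  proof (rule jac_comb[OF P, of "\<lambda>z. - (2 * a / D) * z (Suc 0)" "\<lambda>z. 4 / D * z 0"])
    show "\<forall>\<^sub>F z in near_origin 2. z 0 * z (Suc 0) ^ 3 = - (2 * a / D) * z (Suc 0) * (4 * z 0 ^ 3 + 2 * a * z 0 * (z (Suc 0))\<^sup>2) +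
        4 / D * z 0 * (4 * z (Suc 0) ^ 3 + 2 * a * (z 0)\<^sup>2 * z (Suc 0))"
    proof (intro always_eventually allI)
      fix z :: cvec
      show "z 0 * z (Suc 0) ^ 3 = - (2 * a / D) * z (Suc 0) * (4 * z 0 ^ 3 + 2 * a * z 0 * (z (Suc 0))\<^sup>2) +
        4 / D * z 0 * (4 * z (Suc 0) ^ 3 + 2 * a * (z 0)\<^sup>2 * z (Suc 0))"
        by (subst add.commute, rule comb) (simp add: D_def algebra_simps eval_nat_numeral)
    qed
  qed (intro hg_intros)+
  show ?thesis unfolding spans_mod_def
  proof (intro conjI ballI allI impI hg_mono)
    fix h assume h: "holomorphic_germ 2 h"
    obtain h1 h2 where h12: "holomorphic_germ 2 h1" "holomorphic_germ 2 h2"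
      "\<forall>\<^sub>F z in near_origin 2. h z = (\<Sum>a<3. \<Sum>b<3. coef a b h * mono a b z) + z 0 ^ 3 * h1 z + z (Suc 0) ^ 3 * h2 z"
      using taylor2[OF h] by blast
    obtain t1 t2 where t: "holomorphic_germ 2 t1" "holomorphic_germ 2 t2"
      "\<forall>\<^sub>F z in near_origin 2. h1 z = h1 origin + z 0 * t1 z + z (Suc 0) * t2 z"
      using hg_split2[OF h12(1)] by blast
    obtain s1 s2 where s: "holomorphic_germ 2 s1" "holomorphic_germ 2 s2"
      "\<forall>\<^sub>F z in near_origin 2. h2 z = h2 origin + z 0 * s1 z + z (Suc 0) * s2 z"
      using hg_split2[OF h12(2)] by blast
    have ts: "holomorphic_germ 2 (\<lambda>z. t1 z + s2 z)" by (intro hg_add t s)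
    obtain w1 w2 where w: "holomorphic_germ 2 w1" "holomorphic_germ 2 w2"
      "\<forall>\<^sub>F z in near_origin 2. t1 z + s2 z = t1 origin + s2 origin + z 0 * w1 z + z (Suc 0) * w2 z"
      using hg_split2[OF ts] by blast
    \<comment> \<open>Modulo the ideal x^3 is - a/2 times x y^2 and y^3 is - a/2 times x^2 y; hence
      the remainders contribute at (1,2), (2,1) and (2,2).\<close>
    define d where "d p = coef (fst p) (snd p) h + (if p = (1,2) then - (a / 2) * h1 origin else 0) +
      (if p = (2,1) then - (a / 2) * h2 origin else 0) + (if p = (2,2) then - (a / 2) * (t1 origin + s2 origin) else 0)" for p :: "nat \<times> nat"
    define K where "K z = (1 / 4 * h1 z) * (4 * z 0 ^ 3 + 2 * a * z 0 * (z (Suc 0))\<^sup>2) + (1 / 4 * h2 z) * (4 * z (Suc 0) ^ 3 + 2 * a * (z 0)\<^sup>2 * z (Suc 0))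
       + (- (a / 2) * (s1 z + w1 z * z (Suc 0))) * (z 0 ^ 3 * z (Suc 0)) + (- (a / 2) * (t2 z + w2 z * z 0)) * (z 0 * z (Suc 0) ^ 3)" for z
    have K: "K \<in> jac 2 (X9_poly a)" unfolding K_def
      by (intro jac_add jac_mult[OF P(1)] jac_mult[OF P(2)] jac_mult[OF X3Y] jac_mult[OF XY3] hg_intros h12 t s w)
    have "(\<lambda>z. h z - (\<Sum>p\<in>{..<3} \<times> {..<3}. d p * mono (fst p) (snd p) z)) \<in> jac 2 (X9_poly a)"
    proof (rule jac_cong[OF K])
      show "\<forall>\<^sub>F z in near_origin 2. K z = h z - (\<Sum>p\<in>{..<3} \<times> {..<3}. d p * mono (fst p) (snd p) z)"
        using h12(3) t(3) s(3) w(3)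
      proof eventually_elim
        case (elim z)
        define x y where "x = z 0" and "y = z (Suc 0)"
        have sp: "(\<Sum>p\<in>{..<3} \<times> {..<3}. d p * mono (fst p) (snd p) z) = (\<Sum>i<3. \<Sum>j<3. d (i, j) * mono i j z)"
          by (simp add: sum.cartesian_product split_beta)
        have dd: "(\<Sum>i<3. \<Sum>j<3. d (i, j) * mono i j z) = (\<Sum>i<3. \<Sum>j<3. coef i j h * mono i j z)
          - (a / 2) * (h1 origin * (x * y\<^sup>2) + h2 origin * (x\<^sup>2 * y) + (t1 origin + s2 origin) * (x\<^sup>2 * y\<^sup>2))"
          by (simp add: d_def numeral_3_eq_3 numeral_2_eq_2 mono_def x_def y_def algebra_simps)
        have E: "t1 origin + s2 origin = t1 z + s2 z - x * w1 z - y * w2 z"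
          "h1 origin = h1 z - x * t1 z - y * t2 z" "h2 origin = h2 z - x * s1 z - y * s2 z"
          using elim(2-4) by (simp_all add: x_def y_def)
        show ?case unfolding sp dd elim(1) K_def E x_def[symmetric] y_def[symmetric]
          by (simp add: field_simps eval_nat_numeral)
      qed
    qed
    thus "\<exists>c. (\<lambda>z. h z - (\<Sum>p\<in>{..<3} \<times> {..<3}. c p * mono (fst p) (snd p) z)) \<in> jac 2 (X9_poly a)" by blast
  qed simp
qed

text \<open>The nine monomials bound the number from above, the order 4 of the germ from
  below.\<close>

lemma milnor_X9:
  assumes "a\<^sup>2 \<noteq> 4"
  shows "milnor_number 2 (X9_poly a) = 9"
proof -
  obtain k where k: "k \<le> card ({..<3::nat} \<times> {..<3::nat})" "milnor_number 2 (X9_poly a) = enat k"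
    by (rule spans_mod_milnor_le[OF hg_X9 X9_spans[OF assms]])
  have "order_ge 4 (X9_poly a)" by (auto simp: order_ge_def hg_X9 coef_X9)
  hence "9 \<le> k" by (rule order4_milnor[OF _ k(2)])
  thus ?thesis using k by (simp add: numeral_eq_enat)
qed

lemma isolated_singularity_X9:
  assumes "a\<^sup>2 \<noteq> 4"
  shows "isolated_singularity 2 (X9_poly a)"
  unfolding isolated_singularity_def
proof (intro conjI)
  have "milnor_number 2 (X9_poly a) = enat 9" using milnor_X9[OF assms] by (simp add: numeral_eq_enat)
  thus "\<forall>\<^sub>F z in near_origin 2. z \<noteq> origin \<longrightarrow> \<not> grad_zero 2 (X9_poly a) z"
    by (rule finite_milnor_isolated[OF hg_X9])
  show "grad_zero 2 (X9_poly a) origin"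
    by (auto simp: grad_zero_def partial_X9 numeral_2_eq_2 less_Suc_eq)
qed (simp_all add: hg_X9, simp add: X9_poly_def)

subsection \<open>Adapted coordinates for a singularity of type \<open>X\<^sub>9\<close>\<close>

definition coord_change :: "nat \<Rightarrow> (nat \<Rightarrow> cvec \<Rightarrow> complex) \<Rightarrow> (nat \<Rightarrow> cvec \<Rightarrow> complex) \<Rightarrow> bool" where
  "coord_change p \<phi> \<psi> \<longleftrightarrow> cgerm p p \<phi> \<and> cgerm p p \<psi> \<and>
     (\<forall>\<^sub>F z in near_origin p. cmap p \<phi> (cmap p \<psi> z) = z) \<and> (\<forall>\<^sub>F z in near_origin p. cmap p \<psi> (cmap p \<phi> z) = z)"

lemma biholomorphic_coord_change:
  assumes "biholomorphic_germ p \<Phi>"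
  obtains \<phi> \<psi> where "coord_change p \<phi> \<psi>" "\<forall>\<^sub>F z in near_origin p. \<Phi> z = cmap p \<phi> z"
proof -
  obtain \<Psi> where \<Phi>: "holomorphic_self_germ p \<Phi>" and \<Psi>: "holomorphic_self_germ p \<Psi>"
    and i: "\<forall>\<^sub>F z in near_origin p. \<Psi> (\<Phi> z) = z" "\<forall>\<^sub>F z in near_origin p. \<Phi> (\<Psi> z) = z"
    using assms unfolding biholomorphic_germ_def by blast
  have c: "cgerm p p (\<lambda>k z. H z k)" "\<forall>\<^sub>F z in near_origin p. H z = cmap p (\<lambda>k z. H z k) z" if "holomorphic_self_germ p H" for H
  proof -
    show "cgerm p p (\<lambda>k z. H z k)" using that by (simp add: cgerm_def holomorphic_self_germ_def)
    have "\<forall>\<^sub>F z in near_origin p. H z \<in> Cn p" using that by (simp add: holomorphic_self_germ_def)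
    thus "\<forall>\<^sub>F z in near_origin p. H z = cmap p (\<lambda>k z. H z k) z"
      by eventually_elim (auto simp: cmap_def Cn_def fun_eq_iff)
  qed
  show ?thesis
  proof (rule that[of "\<lambda>k z. \<Phi> z k" "\<lambda>k z. \<Psi> z k"])
    have "\<forall>\<^sub>F z in near_origin p. cmap p (\<lambda>k z. \<Phi> z k) (cmap p (\<lambda>k z. \<Psi> z k) z) = z"
      using eventually_cmap[OF c(1)[OF \<Psi>] c(2)[OF \<Phi>]] c(2)[OF \<Psi>] i(2) by eventually_elim metis
    moreover have "\<forall>\<^sub>F z in near_origin p. cmap p (\<lambda>k z. \<Psi> z k) (cmap p (\<lambda>k z. \<Phi> z k) z) = z"
      using eventually_cmap[OF c(1)[OF \<Phi>] c(2)[OF \<Psi>]] c(2)[OF \<Phi>] i(1) by eventually_elim metis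
    ultimately show "coord_change p (\<lambda>k z. \<Phi> z k) (\<lambda>k z. \<Psi> z k)"
      using c(1) \<Phi> \<Psi> by (simp add: coord_change_def)
  qed (rule c(2)[OF \<Phi>])
qed

lemma coord_change_compose:
  assumes "coord_change p \<phi> \<psi>" "coord_change p \<phi>' \<psi>'"
  shows "coord_change p (\<lambda>k z. \<phi> k (cmap p \<phi>' z)) (\<lambda>k z. \<psi>' k (cmap p \<psi> z))"
proof -
  note c = assms[unfolded coord_change_def]
  have g: "cgerm p p (\<lambda>k z. \<alpha> k (cmap p \<beta> z))" if "cgerm p p \<alpha>" "cgerm p p \<beta>" for \<alpha> \<beta>
    using that hg_cmap[OF that(2)] cmap_origin[OF that(2)] by (simp add: cgerm_def)
  have e: "cmap p (\<lambda>k z. \<alpha> k (cmap p \<beta> z)) z = cmap p \<alpha> (cmap p \<beta> z)" for \<alpha> \<beta> z by (simp add: cmap_def)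
  have inv: "\<forall>\<^sub>F z in near_origin p. cmap p \<alpha> (cmap p \<beta> (cmap p \<beta>' (cmap p \<alpha>' z))) = z"
    if "cgerm p p \<alpha>'" "\<forall>\<^sub>F z in near_origin p. cmap p \<beta> (cmap p \<beta>' z) = z" "\<forall>\<^sub>F z in near_origin p. cmap p \<alpha> (cmap p \<alpha>' z) = z"
    for \<alpha> \<beta> \<alpha>' \<beta>'
    using eventually_cmap[OF that(1,2)] that(3) by eventually_elim simp
  show ?thesis unfolding coord_change_def e using c by (auto intro!: g inv)
qed

lemma milnor_coord_change:
  assumes "coord_change p \<phi> \<psi>" "holomorphic_germ p g" "\<forall>\<^sub>F z in near_origin p. h z = g (cmap p \<phi> z)"
  shows "milnor_number p g = milnor_number p h"
  using assms milnor_cmap[of p \<phi> \<psi> g h] by (simp add: coord_change_def)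

lemma type_X9E:
  assumes "type_X9 n f"
  obtains a p \<phi> \<psi> where "a\<^sup>2 \<noteq> 4" "2 \<le> p" "n \<le> p" "coord_change p \<phi> \<psi>"
    "\<forall>\<^sub>F z in near_origin p. add_squares 2 p (X9_poly a) z = add_squares n p f (cmap p \<phi> z)"
proof -
  obtain a p \<Phi> where a: "a\<^sup>2 \<noteq> 4" "max 2 n \<le> p" "biholomorphic_germ p \<Phi>"
    and e: "\<forall>\<^sub>F z in near_origin p. add_squares n p f (\<Phi> z) = add_squares 2 p (X9_poly a) z"
    using assms unfolding type_X9_def stably_equivalent_def by blast
  obtain \<phi> \<psi> where c: "coord_change p \<phi> \<psi>" "\<forall>\<^sub>F z in near_origin p. \<Phi> z = cmap p \<phi> z"
    by (rule biholomorphic_coord_change[OF a(3)])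
  have "\<forall>\<^sub>F z in near_origin p. add_squares 2 p (X9_poly a) z = add_squares n p f (cmap p \<phi> z)"
    using e c(2) by eventually_elim simp
  thus ?thesis using a c(1) by (intro that[of a p \<phi> \<psi>]) auto
qed

lemma type_X9_milnor:
  assumes "type_X9 n f"
  shows "milnor_number n f = 9"
proof (rule type_X9E[OF assms])
  fix a p \<phi> \<psi>
  assume a: "a\<^sup>2 \<noteq> 4" "2 \<le> p" "n \<le> p" and c: "coord_change p \<phi> \<psi>"
    and e: "\<forall>\<^sub>F z in near_origin p. add_squares 2 p (X9_poly a) z = add_squares n p f (cmap p \<phi> z)"
  have f: "holomorphic_germ n f" using assms by (simp add: type_X9_def isolated_singularity_def)
  have "milnor_number n f = milnor_number p (add_squares n p f)" by (rule milnor_add_squares[OF f a(3), symmetric])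
  also have "\<dots> = milnor_number p (add_squares 2 p (X9_poly a))" by (rule milnor_coord_change[OF c hg_add_squares[OF f] e])
  also have "\<dots> = 9" using milnor_add_squares[OF hg_X9 a(2)] milnor_X9[OF a(1)] by simp
  finally show ?thesis .
qed

text \<open>A linear factor of the quartic form is moved to x; it is a simple factor, so the
  coefficient of x y^3 is nonzero.\<close>

lemma X9_shear:
  assumes a: "a\<^sup>2 \<noteq> (4::complex)"
  shows "\<exists>r q3 q2 q1. q1 \<noteq> 0 \<and> (\<forall>z. X9_poly a (z(0 := z 0 + r * z (Suc 0))) = qform 1 q3 q2 q1 z)"
proof -
  \<comment> \<open>\<open>s\<close> solves s^2 + a s + 1 = 0, so its square root \<open>r\<close>
    makes r^4 + a r^2 + 1 vanish, the coefficient of y^4 after the shear.\<close>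
  define s where "s = (csqrt (a\<^sup>2 - 4) - a) / 2"
  define r where "r = csqrt s"
  have r2: "r\<^sup>2 = s" by (simp add: r_def)
  have "2 * s + a = csqrt (a\<^sup>2 - 4)" unfolding s_def by (simp add: field_simps)
  hence "(2 * s + a)\<^sup>2 = a\<^sup>2 - 4" by simp
  hence "4 * (s\<^sup>2 + a * s + 1) = 0" by (simp add: power2_eq_square algebra_simps)
  hence s: "s\<^sup>2 + a * s + 1 = 0" by (simp only: mult_eq_0_iff) simp
  hence "s \<noteq> 0" by auto
  moreover have "2 * s + a \<noteq> 0" using \<open>(2 * s + a)\<^sup>2 = a\<^sup>2 - 4\<close> a by auto
  ultimately have q1: "2 * r * (2 * s + a) \<noteq> 0" using r2 by auto
  have "X9_poly a (z(0 := z 0 + r * z (Suc 0))) = qform 1 (4 * r) (6 * s + a) (2 * r * (2 * s + a)) z" for z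
  proof -
    define x y where "x = z 0" and "y = z (Suc 0)"
    have "(x + r * y) ^ 4 + y ^ 4 + a * (x + r * y)\<^sup>2 * y\<^sup>2 = x ^ 4 + 4 * r * x ^ 3 * y + (6 * r\<^sup>2 + a) * x\<^sup>2 * y\<^sup>2
       + 2 * r * (2 * r\<^sup>2 + a) * x * y ^ 3 + ((r\<^sup>2)\<^sup>2 + a * r\<^sup>2 + 1) * y ^ 4"
      by (simp add: algebra_simps eval_nat_numeral)
    also have "\<dots> = qform 1 (4 * r) (6 * s + a) (2 * r * (2 * s + a)) z"
      unfolding r2 s by (simp add: qform_def x_def y_def)
    finally show ?thesis by (simp add: X9_poly_def x_def y_def)
  qed
  thus ?thesis using q1 by blast
qed

lemma type_X9_coordinates:
  assumes "type_X9 n f"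
  obtains p \<phi> \<psi> q3 q2 q1 where "2 \<le> p" "n \<le> p" "q1 \<noteq> 0" "coord_change p \<phi> \<psi>"
    "\<forall>\<^sub>F z in near_origin p. qform 1 q3 q2 q1 z + (\<Sum>i\<in>{2..<p}. (z i)\<^sup>2) = add_squares n p f (cmap p \<phi> z)"
proof (rule type_X9E[OF assms])
  fix a p \<phi> \<psi>
  assume a: "a\<^sup>2 \<noteq> 4" "2 \<le> p" "n \<le> p" and c: "coord_change p \<phi> \<psi>"
    and e: "\<forall>\<^sub>F z in near_origin p. add_squares 2 p (X9_poly a) z = add_squares n p f (cmap p \<phi> z)"
  obtain r q3 q2 q1 where q: "q1 \<noteq> 0" "\<forall>z. X9_poly a (z(0 := z 0 + r * z (Suc 0))) = qform 1 q3 q2 q1 z"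
    using X9_shear[OF a(1)] by blast
  define \<sigma> where "\<sigma> t k z = (if k = 0 then z 0 + t * z (Suc 0) else z k)" for t :: complex and k :: nat and z :: cvec
  have \<sigma>c: "cgerm p p (\<sigma> t)" for t
    unfolding cgerm_def
  proof (intro allI impI conjI)
    fix k show "holomorphic_germ p (\<sigma> t k)"
      by (cases "k = 0") (simp_all add: \<sigma>_def[abs_def] hg_add hg_mult hg_const hg_coord)
  qed (simp add: \<sigma>_def)
  have \<sigma>e: "cmap p (\<sigma> t) z = z(0 := z 0 + t * z (Suc 0))" if "z \<in> Cn p" for t z
    using that a(2) by (auto simp: cmap_def \<sigma>_def Cn_def fun_eq_iff)
  have \<sigma>i: "\<forall>\<^sub>F z in near_origin p. cmap p (\<sigma> t) (cmap p (\<sigma> (- t)) z) = z" for t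
  proof (rule eventually_mono[OF near_origin_Cn])
    fix z assume z: "z \<in> Cn p"
    have "z(0 := z 0 - t * z (Suc 0)) \<in> Cn p" using z a(2) by (intro upd_Cn) auto
    from \<sigma>e[OF this, of t] show "cmap p (\<sigma> t) (cmap p (\<sigma> (- t)) z) = z"
      using \<sigma>e[OF z, of "- t"] by simp
  qed
  have \<sigma>cc: "coord_change p (\<sigma> r) (\<sigma> (- r))" using \<sigma>c \<sigma>i[of r] \<sigma>i[of "- r"] by (simp add: coord_change_def)
  show ?thesis
  proof (rule that[OF a(2,3) q(1) coord_change_compose[OF c \<sigma>cc]])
    show "\<forall>\<^sub>F z in near_origin p. qform 1 q3 q2 q1 z + (\<Sum>i\<in>{2..<p}. (z i)\<^sup>2) = add_squares n p f (cmap p (\<lambda>k z. \<phi> k (cmap p (\<sigma> r) z)) z)"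
      using eventually_cmap[OF \<sigma>c[of r] e] near_origin_Cn
    proof eventually_elim
      case (elim z)
      let ?z = "z(0 := z 0 + r * z (Suc 0))"
      have "(\<Sum>i\<in>{2..<p}. (?z i)\<^sup>2) = (\<Sum>i\<in>{2..<p}. (z i)\<^sup>2)" by (intro sum.cong) auto
      moreover have "X9_poly a (\<lambda>i. if i < 2 then ?z i else 0) = X9_poly a ?z" by (simp add: X9_poly_def)
      ultimately have "add_squares 2 p (X9_poly a) ?z = qform 1 q3 q2 q1 z + (\<Sum>i\<in>{2..<p}. (z i)\<^sup>2)"
        unfolding add_squares_def by (simp only: q(2)[rule_format])
      moreover have "cmap p (\<lambda>k z. \<phi> k (cmap p (\<sigma> r) z)) z = cmap p \<phi> (cmap p (\<sigma> r) z)" by (simp add: cmap_def)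
      ultimately show ?case using elim(1) \<sigma>e[OF elim(2), of r] by simp
    qed
  qed
qed

lemma type_X9_X9_poly:
  assumes "a\<^sup>2 \<noteq> 4"
  shows "type_X9 2 (X9_poly a)"
proof -
  have s: "holomorphic_self_germ 2 (\<lambda>z. z)"
    by (simp add: holomorphic_self_germ_def near_origin_Cn hg_coord)
  hence "biholomorphic_germ 2 (\<lambda>z. z)"
    unfolding biholomorphic_germ_def by (intro conjI exI[of _ "\<lambda>z. z"]) simp_all
  hence "stably_equivalent 2 (X9_poly a) 2 (X9_poly a)"
    unfolding stably_equivalent_def by (intro exI[of _ 2] exI[of _ "\<lambda>z. z"]) simp
  thus ?thesis using assms isolated_singularity_X9 by (auto simp: type_X9_def)
qed

subsection \<open>A deformation with jump 2\<close>

definition pr :: "nat \<Rightarrow> cvec \<Rightarrow> cvec" where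
  "pr m z = (\<lambda>i. if i < m then z i else 0)"

lemma add_squares_pr: "add_squares n p f z = f (pr n z) + (\<Sum>i\<in>{n..<p}. (z i)\<^sup>2)"
  by (simp add: add_squares_def pr_def)

text \<open>Setting the coordinates from \<open>n\<close> to \<open>m - 1\<close> to zero one after
  the other changes \<open>F\<close> each time by a multiple of that coordinate, which is a
  component of \<open>\<phi>\<close> in the Jacobian ideal.\<close>

lemma jac_projection:
  assumes \<phi>: "cgerm p p \<phi>" and F: "holomorphic_germ p F"
    and J: "\<And>k. n \<le> k \<Longrightarrow> k < p \<Longrightarrow> \<phi> k \<in> jac p h" and m: "n \<le> m" "m \<le> p"
  shows "(\<lambda>z. F (pr m (cmap p \<phi> z)) - F (pr n (cmap p \<phi> z))) \<in> jac p h"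
  using m
proof (induction m rule: dec_induct)
  case base
  show ?case using jac_zero by simp
next
  case (step m)
  have mp: "m < p" using step.prems by simp
  obtain Q where Q: "holomorphic_germ p Q" "\<forall>\<^sub>F z in near_origin p. F z = F (z(m := 0)) + z m * Q z"
    using hg_divide_coord[OF F mp] by blast
  define \<tau> where "\<tau> k = (if k < Suc m then \<phi> k else (\<lambda>_. 0))" for k
  have \<tau>: "cgerm p p \<tau>" using \<phi> by (auto simp: cgerm_def \<tau>_def hg_const)
  have \<tau>e: "cmap p \<tau> z = pr (Suc m) (cmap p \<phi> z)" for z
    using mp by (auto simp: cmap_def \<tau>_def pr_def fun_eq_iff)
  have IH: "(\<lambda>z. F (pr m (cmap p \<phi> z)) - F (pr n (cmap p \<phi> z))) \<in> jac p h" using step by simp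
  show ?case
  proof (rule jac_cong[OF jac_add[OF IH jac_mult[OF J[OF step.hyps(1) mp] hg_cmap[OF \<tau> Q(1)]]]])
    show "\<forall>\<^sub>F z in near_origin p. F (pr m (cmap p \<phi> z)) - F (pr n (cmap p \<phi> z)) + Q (cmap p \<tau> z) * \<phi> m z =
       F (pr (Suc m) (cmap p \<phi> z)) - F (pr n (cmap p \<phi> z))"
      using eventually_cmap[OF \<tau> Q(2)]
    proof eventually_elim
      case (elim z)
      have "(cmap p \<tau> z)(m := 0) = pr m (cmap p \<phi> z)" unfolding \<tau>e by (auto simp: pr_def fun_eq_iff)
      moreover have "cmap p \<tau> z m = \<phi> m z" using mp by (simp add: cmap_def \<tau>_def)
      ultimately show ?case using elim unfolding \<tau>e by simp
    qed
  qed
qed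

lemma partial_qform_squares:
  fixes q4 q3 q2 q1 :: complex
  assumes p: "2 \<le> p"
  defines "h \<equiv> \<lambda>z. qform q4 q3 q2 q1 z + (\<Sum>i\<in>{2..<p}. (z i)\<^sup>2)"
  shows "partial_deriv 0 h = qX q4 q3 q2 q1" "partial_deriv (Suc 0) h = qY q4 q3 q2 q1"
    "2 \<le> i \<Longrightarrow> i < p \<Longrightarrow> partial_deriv i h = (\<lambda>z. 2 * z i)"
proof -
  have s: "(\<Sum>i\<in>{2..<p}. ((z(j := w)) i)\<^sup>2) = (\<Sum>i\<in>{2..<p}. (z i)\<^sup>2)" if "j < 2" for z :: cvec and j w
    using that by (intro sum.cong) auto
  show "partial_deriv 0 h = qX q4 q3 q2 q1" "partial_deriv (Suc 0) h = qY q4 q3 q2 q1"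
    unfolding partial_deriv_def fun_eq_iff h_def qform_def qX_def qY_def
    by (auto intro!: DERIV_imp_deriv derivative_eq_intros simp: s algebra_simps eval_nat_numeral simp del: fun_upd_apply)
       (auto intro!: DERIV_imp_deriv derivative_eq_intros simp: algebra_simps eval_nat_numeral)
  have "h = add_squares 2 p (qform q4 q3 q2 q1)"
    by (simp add: fun_eq_iff h_def add_squares_def qform_def)
  thus "2 \<le> i \<Longrightarrow> i < p \<Longrightarrow> partial_deriv i h = (\<lambda>z. 2 * z i)"
    by (auto intro: partial_deriv_add_squares)
qed

lemma hg_shift:
  assumes "holomorphic_germ p f" "n \<le> p"
  shows "holomorphic_germ (Suc n) (\<lambda>w. f (\<lambda>i. w (Suc i)))"
proof (rule hg_cong)
  have c: "cgerm (Suc n) p (\<lambda>k w. w (Suc k))" by (simp add: cgerm_def hg_coord)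
  show "holomorphic_germ (Suc n) (\<lambda>w. f (cmap p (\<lambda>k w. w (Suc k)) w))" by (rule hg_cmap[OF c assms(1)])
  show "\<forall>\<^sub>F w in near_origin (Suc n). f (cmap p (\<lambda>k w. w (Suc k)) w) = f (\<lambda>i. w (Suc i))"
  proof (rule eventually_mono[OF near_origin_Cn])
    fix w assume "w \<in> Cn (Suc n)"
    hence "cmap p (\<lambda>k w. w (Suc k)) w = (\<lambda>i. w (Suc i))" using assms(2) by (auto simp: cmap_def Cn_def fun_eq_iff)
    thus "f (cmap p (\<lambda>k w. w (Suc k)) w) = f (\<lambda>i. w (Suc i))" by simp
  qed
qed

lemma hg_restrict:
  assumes "holomorphic_germ p f" "n \<le> p"
  shows "holomorphic_germ n f"
proof (rule hg_cong[OF _ hg_cmap[OF cgerm_coord assms(1)]])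
  show "\<forall>\<^sub>F z in near_origin n. f (cmap p (\<lambda>k z. z k) z) = f z"
    by (rule eventually_mono[OF near_origin_Cn]) (simp add: cmap_coord assms(2))
qed

text \<open>The deformation adds s times the cube of x, as far as x can be expressed in the
  variables of \<open>f\<close>. For nonzero s the stabilised germ has the shape treated by
  \<open>E7_stable\<close>, and the Milnor number drops to 7.\<close>

lemma type_X9_jump_2:
  assumes X9: "type_X9 n f"
  shows "\<exists>F. deformation n f F \<and> has_jump n f F 2"
proof (rule type_X9_coordinates[OF X9])
  fix p \<phi> \<psi> q3 q2 q1
  assume p: "2 \<le> p" "n \<le> p" and q1: "q1 \<noteq> 0" and cc: "coord_change p \<phi> \<psi>"
    and e: "\<forall>\<^sub>F z in near_origin p. qform 1 q3 q2 q1 z + (\<Sum>i\<in>{2..<p}. (z i)\<^sup>2) = add_squares n p f (cmap p \<phi> z)"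
  note c = cc[unfolded coord_change_def]
  have f: "holomorphic_germ n f" "f origin = 0" "\<forall>\<^sub>F z in near_origin n. z \<noteq> origin \<longrightarrow> \<not> grad_zero n f z"
    using X9 by (simp_all add: type_X9_def isolated_singularity_def)
  have \<psi>0: "holomorphic_germ p (\<psi> 0)" "\<psi> 0 origin = 0" using c p by (simp_all add: cgerm_def)
  define h where "h z = qform 1 q3 q2 q1 z + (\<Sum>i\<in>{2..<p}. (z i)\<^sup>2)" for z
  have hh: "holomorphic_germ p h" unfolding h_def[abs_def] by (intro hg_intros hg_qform)
  define g where "g = add_squares n p f"
  have gh: "holomorphic_germ p g" unfolding g_def by (rule hg_add_squares[OF f(1)])
  have e': "\<forall>\<^sub>F z in near_origin p. h z = g (cmap p \<phi> z)" using e unfolding h_def g_def .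
  \<comment> \<open>In a stabilising variable \<open>g\<close> is a pure square, so
    \<open>\<phi> k\<close> is half of the pulled-back derivative of \<open>g\<close>.\<close>
  have J: "\<phi> k \<in> jac p h" if k: "n \<le> k" "k < p" for k
  proof -
    have "(\<lambda>z. partial_deriv k g (cmap p \<phi> z)) \<in> jac p h"
      by (rule jac_cmap[where \<psi> = \<psi>, OF _ _ _ _ gh hh e' jac_partial[OF gh k(2)]]) (use c in simp_all)
    hence "(\<lambda>z. 1 / 2 * partial_deriv k g (cmap p \<phi> z)) \<in> jac p h" by (rule jac_cmult)
    thus ?thesis using k by (simp add: g_def partial_deriv_add_squares cmap_def)
  qed
  have "(\<lambda>z. \<psi> 0 (pr p (cmap p \<phi> z)) - \<psi> 0 (pr n (cmap p \<phi> z))) \<in> jac p h"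
    by (rule jac_projection[OF _ \<psi>0(1) J p(2)]) (use c in simp_all)
  then obtain A where A: "\<forall>i<p. holomorphic_germ p (A i)"
    "\<forall>\<^sub>F z in near_origin p. \<psi> 0 (pr p (cmap p \<phi> z)) - \<psi> 0 (pr n (cmap p \<phi> z)) = (\<Sum>i<p. A i z * partial_deriv i h z)"
    by (auto simp: jac_def)
  \<comment> \<open>\<open>\<psi> 0\<close> is the coordinate x of the normal form, written in the
    coordinates of the stabilised \<open>f\<close>. Here it is evaluated on points of
    \<open>Cn n\<close>, where the stabilising variables are 0.\<close>
  define F where "F s w = f w + s * \<psi> 0 w ^ 3" for s w
  have Fh: "holomorphic_germ n (F s)" for s
    unfolding F_def by (intro hg_intros f hg_restrict[OF \<psi>0(1) p(2)])
  have m7: "milnor_number n (F s) = 7" if s: "s \<noteq> 0" for s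
  proof -
    let ?G = "\<lambda>z. add_squares n p (F s) (cmap p \<phi> z)"
    have "milnor_number n (F s) = milnor_number p (add_squares n p (F s))"
      by (rule milnor_add_squares[OF Fh p(2), symmetric])
    also have "\<dots> = milnor_number p ?G" by (rule milnor_coord_change[OF cc hg_add_squares[OF Fh]]) simp
    also have "\<dots> = 7"
    \<comment> \<open>The restriction error is a combination of derivatives of \<open>h\<close>:
      those in x and y are \<open>qX\<close> and \<open>qY\<close>, the others are 2 z_i, whence the
      factor 2.\<close>
    proof (rule E7_stable[OF p(1) q1, where u = "\<lambda>_. s" and b = "\<lambda>z. - A 0 z" and c = "\<lambda>z. - A (Suc 0) z" and a = "\<lambda>i z. - 2 * A i z"])
      show "holomorphic_germ p ?G" by (rule hg_cmap[OF _ hg_add_squares[OF Fh]]) (use c in simp)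
      show "\<forall>\<^sub>F z in near_origin p. ?G z = qform 1 q3 q2 q1 z + (\<Sum>i\<in>{2..<p}. (z i)\<^sup>2) +
        s * (z 0 + (\<Sum>i\<in>{2..<p}. z i * (- 2 * A i z)) + - A 0 z * qX 1 q3 q2 q1 z + - A (Suc 0) z * qY 1 q3 q2 q1 z) ^ 3"
        using A(2) e c[THEN conjunct2, THEN conjunct2, THEN conjunct2]
      proof eventually_elim
        case (elim z)
        have "pr p (cmap p \<phi> z) = cmap p \<phi> z" by (auto simp: pr_def cmap_def)
        hence \<Lambda>: "\<psi> 0 (pr n (cmap p \<phi> z)) = \<psi> 0 (cmap p \<phi> z) - (\<Sum>i<p. A i z * partial_deriv i h z)"
          using elim(1) by (simp add: algebra_simps)
        have "\<psi> 0 (cmap p \<phi> z) = cmap p \<psi> (cmap p \<phi> z) 0" using p by (simp add: cmap_def)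
        hence z0: "\<psi> 0 (cmap p \<phi> z) = z 0" using elim(3) by simp
        have I: "{..<p} = insert 0 (insert (Suc 0) {2..<p})" using p(1) by auto
        have "(\<Sum>i<p. A i z * partial_deriv i h z) = A 0 z * partial_deriv 0 h z + A (Suc 0) z * partial_deriv (Suc 0) h z
           + (\<Sum>i\<in>{2..<p}. A i z * partial_deriv i h z)"
          unfolding I by simp
        also have "(\<Sum>i\<in>{2..<p}. A i z * partial_deriv i h z) = (\<Sum>i\<in>{2..<p}. A i z * (2 * z i))"
          by (intro sum.cong refl) (simp add: h_def[abs_def] partial_qform_squares(3)[OF p(1)])
        also have "\<dots> = - (\<Sum>i\<in>{2..<p}. z i * (- 2 * A i z))"
          unfolding sum_negf[symmetric] by (intro sum.cong refl) simp
        also have "partial_deriv 0 h = qX 1 q3 q2 q1" unfolding h_def[abs_def] by (rule partial_qform_squares(1)[OF p(1)])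
        also have "partial_deriv (Suc 0) h = qY 1 q3 q2 q1" unfolding h_def[abs_def] by (rule partial_qform_squares(2)[OF p(1)])
        finally have S: "(\<Sum>i<p. A i z * partial_deriv i h z) = A 0 z * qX 1 q3 q2 q1 z + A (Suc 0) z * qY 1 q3 q2 q1 z
           + - (\<Sum>i\<in>{2..<p}. z i * (- 2 * A i z))" .
        have "?G z = add_squares n p f (cmap p \<phi> z) + s * \<psi> 0 (pr n (cmap p \<phi> z)) ^ 3"
          by (simp add: add_squares_pr F_def)
        also have "\<psi> 0 (pr n (cmap p \<phi> z)) = z 0 + (\<Sum>i\<in>{2..<p}. z i * (- 2 * A i z)) + - A 0 z * qX 1 q3 q2 q1 z + - A (Suc 0) z * qY 1 q3 q2 q1 z"
          unfolding \<Lambda> z0 S by simp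
        finally show ?case using elim(2) by simp
      qed
    qed (use s p A(1) in \<open>auto intro!: hg_uminus hg_mult hg_const\<close>)
    finally show ?thesis .
  qed
  have "deformation n f F"
    unfolding deformation_def
  proof (intro conjI)
    show "holomorphic_germ (Suc n) (\<lambda>w. F (w 0) (\<lambda>i. w (Suc i)))"
      unfolding F_def by (intro hg_add hg_mult hg_coord hg_power hg_shift[OF f(1) order_refl] hg_shift[OF \<psi>0(1) p(2)])
    have "\<forall>\<^sub>F z in near_origin n. z \<noteq> origin \<longrightarrow> \<not> grad_zero n (F s) z" for s
    proof (cases "s = 0")
      case True
      hence "F s = f" by (simp add: F_def fun_eq_iff)
      thus ?thesis using f(3) by simp
    next
      case False
      thus ?thesis using finite_milnor_isolated[OF Fh, of s 7] m7 by (simp add: numeral_eq_enat)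
    qed
    thus "\<forall>\<^sub>F s in nhds 0. \<forall>\<^sub>F z in near_origin n. z \<noteq> origin \<longrightarrow> \<not> grad_zero n (F s) z" by simp
  qed (simp_all add: F_def f \<psi>0)
  moreover have "has_jump n f F 2"
    unfolding has_jump_def
  proof -
    have "\<forall>\<^sub>F s in at (0::complex). s \<noteq> 0" by (simp add: eventually_at_filter)
    thus "\<forall>\<^sub>F s in at 0. milnor_number n (F s) + enat 2 = milnor_number n f"
      by eventually_elim (simp add: m7 type_X9_milnor[OF X9] numeral_eq_enat)
  qed
  ultimately show ?thesis by blast
qed

subsection \<open>Families over the first coordinate\<close>

lemma case_nat_origin [simp]: "case_nat 0 origin = origin"
  by (auto simp: fun_eq_iff split: nat.split)

lemma case_nat_upd: "(case_nat s z)(Suc i := w) = case_nat s (z(i := w))"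
  by (auto simp: fun_eq_iff split: nat.split)

lemma case_nat_polydisc:
  "z \<in> polydisc n r \<Longrightarrow> cmod s < r \<Longrightarrow> case_nat s z \<in> polydisc (Suc n) r"
  by (auto simp: polydisc_def Cn_def less_Suc_eq_0_disj split: nat.split)

lemma near_slice:
  assumes "eventually P (near_origin (Suc n))"
  shows "\<forall>\<^sub>F s in nhds 0. \<forall>\<^sub>F z in near_origin n. P (case_nat s z)"
proof -
  obtain r where r: "0 < r" "\<And>z. z \<in> polydisc (Suc n) r \<Longrightarrow> P z" using assms by (auto simp: eventually_near_origin)
  have "\<forall>\<^sub>F s in nhds (0::complex). s \<in> ball 0 r" using r(1) by (intro eventually_nhds_in_open) auto
  thus ?thesis
  proof eventually_elim
    case (elim s)
    show ?case unfolding eventually_near_origin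
      by (intro exI[of _ r] conjI r(1) ballI r(2) case_nat_polydisc) (use elim in simp_all)
  qed
qed

lemma hg_slice:
  assumes "holomorphic_germ (Suc n) h"
  shows "\<forall>\<^sub>F s in nhds 0. holomorphic_germ n (\<lambda>z. h (case_nat s z))"
proof -
  obtain r where r: "0 < r" "hol (Suc n) r h" using assms by (auto simp: holomorphic_germ_iff)
  have "\<forall>\<^sub>F s in nhds (0::complex). s \<in> ball 0 r" using r(1) by (intro eventually_nhds_in_open) auto
  thus ?thesis
  proof eventually_elim
    case (elim s)
    hence s: "cmod s < r" by simp
    have c: "continuous_on (polydisc n r) (\<lambda>z. case_nat s z)"
    proof (rule continuous_on_coordinatewise_then_product)
      fix j show "continuous_on (polydisc n r) (\<lambda>z. case_nat s z j)"
        by (cases j) (auto intro: continuous_intros)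
    qed
    have "continuous_on (polydisc n r) (\<lambda>z. h (case_nat s z))"
      by (rule continuous_on_compose2[OF hol_continuous[OF r(2)] c]) (auto intro: case_nat_polydisc s)
    moreover have "(\<lambda>w. h (case_nat s (z(i := w)))) holomorphic_on ball 0 r" if "z \<in> polydisc n r" "i < n" for z i
      using hol_slice[OF r(2) case_nat_polydisc[OF that(1) s], of "Suc i"] that(2) unfolding case_nat_upd by simp
    ultimately have "hol n r (\<lambda>z. h (case_nat s z))" by (simp add: hol_iff)
    thus ?case by (rule hg_I[OF r(1)])
  qed
qed

lemma partial_slice: "partial_deriv i (\<lambda>z. h (case_nat s z)) = (\<lambda>z. partial_deriv (Suc i) h (case_nat s z))"
  by (simp add: fun_eq_iff partial_deriv_def case_nat_upd)

lemma iter_slice: "(partial_deriv i ^^ a) (\<lambda>z. h (case_nat s z)) = (\<lambda>z. (partial_deriv (Suc i) ^^ a) h (case_nat s z))"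
  by (induction a) (simp_all add: partial_slice)

text \<open>The coefficient is, up to a constant, a mixed derivative of \<open>h\<close> in its last
  two variables, restricted to the parameter axis, where it is holomorphic.\<close>

lemma coef_slice_isCont:
  assumes "holomorphic_germ 3 h"
  shows "isCont (\<lambda>s. coef a b (\<lambda>z. h (case_nat s z))) 0"
proof -
  define D where "D = (partial_deriv 1 ^^ a) ((partial_deriv 2 ^^ b) h)"
  have D: "holomorphic_germ 3 D" unfolding D_def by (intro hg_iter assms) auto
  obtain r where r: "0 < r" "hol 3 r D" using D by (auto simp: holomorphic_germ_iff)
  have "(\<lambda>w. D (origin(0 := w))) holomorphic_on ball 0 r" by (rule hol_slice[OF r(2)]) (use r in auto)
  hence "continuous_on (ball 0 r) (\<lambda>w. D (origin(0 := w)))" by (rule holomorphic_on_imp_continuous_on)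
  hence "isCont (\<lambda>w. D (origin(0 := w))) 0" using r(1) by (auto simp: continuous_on_eq_continuous_at)
  moreover have "(\<lambda>w. D (origin(0 := w))) = (\<lambda>s. D (case_nat s origin))"
  proof
    fix w :: complex
    have "origin(0 := w) = case_nat w origin" by (auto simp: fun_eq_iff split: nat.split)
    thus "D (origin(0 := w)) = D (case_nat w origin)" by simp
  qed
  ultimately have "isCont (\<lambda>s. D (case_nat s origin)) 0" by simp
  thus ?thesis unfolding coef_def iter_slice by (simp add: D_def numeral_2_eq_2)
qed

text \<open>The parameter is attached as coordinate 0 by \<open>case_nat\<close>, so joint
  holomorphy is holomorphy in \<open>k + 1\<close> variables and the implicit function theorem also
  yields holomorphic dependence on s.\<close>

definition X9_family :: "complex \<Rightarrow> nat \<Rightarrow> (cvec \<Rightarrow> complex) \<Rightarrow> bool" where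
  "X9_family a k H \<longleftrightarrow> holomorphic_germ (Suc k) H \<and>
     (\<forall>\<^sub>F s in nhds 0. H (case_nat s origin) = 0) \<and>
     (\<forall>\<^sub>F s in nhds 0. grad_zero k (\<lambda>z. H (case_nat s z)) origin) \<and>
     (\<forall>\<^sub>F s in at 0. milnor_number k (\<lambda>z. H (case_nat s z)) = 8) \<and>
     (\<forall>\<^sub>F z in near_origin k. H (case_nat 0 z) = add_squares 2 k (X9_poly a) z)"

lemma eventually_nhds_at: "eventually P (nhds a) \<Longrightarrow> eventually P (at a)"
  by (simp add: eventually_at_filter eventually_mono)

text \<open>Splitting lemma with parameter: the equation for the critical points in the last
  variable is solved with s and the other variables as parameters, and
  \<open>milnor_eliminate\<close> applies on each slice.\<close>

lemma X9_family_reduce: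
  assumes H: "X9_family a (Suc k) H" and k: "2 \<le> k"
  shows "\<exists>H'. X9_family a k H'"
proof -
  note Hh = H[unfolded X9_family_def, THEN conjunct1]
  note H0 = H[unfolded X9_family_def, THEN conjunct2, THEN conjunct1]
  note Hg = H[unfolded X9_family_def, THEN conjunct2, THEN conjunct2, THEN conjunct1]
  note Hm = H[unfolded X9_family_def, THEN conjunct2, THEN conjunct2, THEN conjunct2, THEN conjunct1]
  note HX = H[unfolded X9_family_def, THEN conjunct2, THEN conjunct2, THEN conjunct2, THEN conjunct2]
  define f where "f = partial_deriv (Suc k) H"
  have fh: "holomorphic_germ (Suc (Suc k)) f" unfolding f_def by (rule hg_partial[OF Hh]) simp
  have fs: "partial_deriv k (\<lambda>z. H (case_nat s z)) = (\<lambda>z. f (case_nat s z))" for s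
    by (simp add: f_def partial_slice)
  have f_0: "\<forall>\<^sub>F s in nhds 0. f (case_nat s origin) = 0"
    using Hg
  proof eventually_elim
    case (elim s)
    hence "partial_deriv k (\<lambda>z. H (case_nat s z)) origin = 0" by (simp add: grad_zero_def)
    thus ?case by (simp add: fs)
  qed
  have f0: "f origin = 0" using eventually_nhds_x_imp_x[OF f_0] by simp
  have fX: "\<forall>\<^sub>F z in near_origin (Suc k). f (case_nat 0 z) = 2 * z k"
    using partial_deriv_cong_germ[OF HX, of k, simplified]
    by eventually_elim (use k in \<open>simp add: fs partial_deriv_add_squares\<close>)
  have "partial_deriv (Suc k) f origin = partial_deriv k (\<lambda>z. f (case_nat 0 z)) origin"
    by (simp add: partial_slice)
  also have "\<dots> = partial_deriv k (\<lambda>z. 2 * z k) origin" by (rule partial_deriv_at_origin_cong[OF fX]) simp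
  also have "\<dots> = 2" by (simp add: partial_deriv_def)
  finally have df: "partial_deriv (Suc k) f origin \<noteq> 0" by simp
  obtain \<zeta> \<rho> where \<zeta>: "holomorphic_germ (Suc k) \<zeta>" "\<zeta> origin = 0" "0 < \<rho>"
    and z0: "\<forall>\<^sub>F z in near_origin (Suc k). f (z(Suc k := \<zeta> z)) = 0"
    and z1: "\<forall>\<^sub>F z in near_origin (Suc k). \<forall>w. cmod w < \<rho> \<longrightarrow> f (z(Suc k := w)) = 0 \<longrightarrow> w = \<zeta> z"
    by (rule implicit_germ[OF fh f0 df])
  have d2: "\<forall>\<^sub>F s in nhds 0. partial_deriv k (partial_deriv k (\<lambda>z. H (case_nat s z))) origin \<noteq> 0"
  proof -
    have dh: "holomorphic_germ (Suc (Suc k)) (partial_deriv (Suc k) f)" by (rule hg_partial[OF fh]) simp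
    obtain i where i: "holomorphic_germ (Suc (Suc k)) i" "i origin = inverse (partial_deriv (Suc k) f origin)"
      "\<forall>\<^sub>F z in near_origin (Suc (Suc k)). partial_deriv (Suc k) f z \<noteq> 0 \<and> i z = inverse (partial_deriv (Suc k) f z)"
      by (rule hg_inverse[where f = "partial_deriv (Suc k) f", OF dh df])
    from near_slice[OF i(3)] show ?thesis
    proof eventually_elim
      case (elim s)
      from eventually_near_origin_at[OF elim] show ?case by (simp add: f_def partial_slice)
    qed
  qed
  \<comment> \<open>The origin is a critical point for every small s, so uniqueness makes the graph
    pass through it.\<close>
  have \<zeta>0: "\<forall>\<^sub>F s in nhds 0. \<zeta> (case_nat s origin) = 0"
    using near_slice[OF z1] f_0
  proof eventually_elim
    case (elim s)
    have "(case_nat s origin)(Suc k := 0) = case_nat s origin" by (simp add: case_nat_upd fun_upd_idem)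
    thus ?case using eventually_near_origin_at[OF elim(1)] elim(2) \<zeta>(3) by (metis norm_zero)
  qed
  define H' where "H' z = H (z(Suc k := \<zeta> z))" for z
  have H's: "H' (case_nat s z) = H (case_nat s (z(k := \<zeta> (case_nat s z))))" for s z
    by (simp add: H'_def case_nat_upd)
  have good: "\<forall>\<^sub>F s in nhds 0. H' (case_nat s origin) = 0 \<and> grad_zero k (\<lambda>z. H' (case_nat s z)) origin \<and>
      milnor_number (Suc k) (\<lambda>z. H (case_nat s z)) = milnor_number k (\<lambda>z. H' (case_nat s z))"
    using hg_slice[OF Hh] hg_slice[OF \<zeta>(1)] \<zeta>0 near_slice[OF z0] d2 H0 Hg
  proof eventually_elim
    case (elim s)
    let ?H = "\<lambda>z. H (case_nat s z)" and ?\<zeta> = "\<lambda>z. \<zeta> (case_nat s z)"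
    have crit: "\<forall>\<^sub>F z in near_origin k. partial_deriv k ?H (z(k := ?\<zeta> z)) = 0"
      unfolding fs using elim(4) by (simp add: case_nat_upd)
    have "milnor_number (Suc k) ?H = milnor_number k (\<lambda>z. ?H (z(k := ?\<zeta> z)))"
      by (rule milnor_eliminate[OF elim(1,2) _ crit elim(5)]) (use elim(3) in simp)
    moreover have "H' (case_nat s origin) = 0" using elim(3,6) by (simp add: H's fun_upd_idem)
    moreover have "grad_zero k (\<lambda>z. H' (case_nat s z)) origin"
      unfolding grad_zero_def H's
    proof (intro allI impI)
      fix i assume i: "i < k"
      have "partial_deriv i (\<lambda>z. ?H (z(k := ?\<zeta> z))) origin =
          partial_deriv i ?H (origin(k := ?\<zeta> origin)) + partial_deriv k ?H (origin(k := ?\<zeta> origin)) * partial_deriv i ?\<zeta> origin"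
        by (rule eventually_near_origin_at[OF hg_subst_last(3)[OF elim(1,2) _ i]]) (use elim(3) in simp)
      thus "partial_deriv i (\<lambda>z. ?H (z(k := ?\<zeta> z))) origin = 0"
        using elim(3,7) i by (simp add: fun_upd_idem grad_zero_def)
    qed
    ultimately show ?case by (simp add: H's)
  qed
  \<comment> \<open>At s = 0 the last variable enters through its square alone. Uniqueness gives
    \<open>\<zeta> = 0\<close> there, and the form is kept with one square fewer.\<close>
  have HX': "\<forall>\<^sub>F z in near_origin k. H' (case_nat 0 z) = add_squares 2 k (X9_poly a) z"
    using eventually_nhds_x_imp_x[OF near_slice[OF z1]] hg_subst_last(2)[OF Hh[THEN eventually_nhds_x_imp_x[OF hg_slice]] hg_const[of k 0] refl fX]
      hg_subst_last(2)[OF Hh[THEN eventually_nhds_x_imp_x[OF hg_slice]] hg_const[of k 0] refl HX]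
  proof eventually_elim
    case (elim z)
    have "f ((case_nat 0 z)(Suc k := 0)) = 0" using elim(2) by (simp add: case_nat_upd)
    hence "\<zeta> (case_nat 0 z) = 0" using elim(1) \<zeta>(3) by (metis norm_zero)
    hence "H' (case_nat 0 z) = H (case_nat 0 (z(k := 0)))" by (simp only: H's)
    thus ?case using elim(3) k by (simp add: add_squares_drop)
  qed
  have "X9_family a k H'"
    unfolding X9_family_def
  proof (intro conjI HX')
    show "holomorphic_germ (Suc k) H'" unfolding H'_def[abs_def] by (rule hg_subst_last(1)[OF Hh \<zeta>(1,2)])
    show "\<forall>\<^sub>F s in nhds 0. H' (case_nat s origin) = 0" "\<forall>\<^sub>F s in nhds 0. grad_zero k (\<lambda>z. H' (case_nat s z)) origin"
      using good by (auto elim: eventually_mono)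
    show "\<forall>\<^sub>F s in at 0. milnor_number k (\<lambda>z. H' (case_nat s z)) = 8"
      using eventually_nhds_at[OF good] Hm by eventually_elim simp
  qed
  thus ?thesis by blast
qed

text \<open>A sequence of parameters tending to 0 suffices; along it the coefficients converge by
  continuity in s.\<close>

lemma no_X9_family_2:
  assumes a: "a\<^sup>2 \<noteq> 4" and H: "X9_family a 2 H"
  shows False
proof -
  note H' = H[unfolded X9_family_def]
  have Hh: "holomorphic_germ (Suc 2) H" using H' by blast
  have "\<forall>\<^sub>F s in at 0. holomorphic_germ 2 (\<lambda>z. H (case_nat s z)) \<and> H (case_nat s origin) = 0 \<and>
      grad_zero 2 (\<lambda>z. H (case_nat s z)) origin \<and> milnor_number 2 (\<lambda>z. H (case_nat s z)) = 8"
    using eventually_nhds_at[OF hg_slice[OF Hh]] eventually_nhds_at[OF H'[THEN conjunct2, THEN conjunct1]]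
      eventually_nhds_at[OF H'[THEN conjunct2, THEN conjunct2, THEN conjunct1]] H'[THEN conjunct2, THEN conjunct2, THEN conjunct2, THEN conjunct1]
    by eventually_elim simp
  then obtain d where d: "0 < d" "\<And>s. s \<noteq> 0 \<Longrightarrow> cmod s < d \<Longrightarrow> holomorphic_germ 2 (\<lambda>z. H (case_nat s z)) \<and> H (case_nat s origin) = 0 \<and>
      grad_zero 2 (\<lambda>z. H (case_nat s z)) origin \<and> milnor_number 2 (\<lambda>z. H (case_nat s z)) = 8"
    by (auto simp: eventually_at)
  \<comment> \<open>The shift by 2 keeps all parameters strictly inside the disc of radius
    \<open>d\<close>.\<close>
  define t where "t n = complex_of_real (d / real (n + 2))" for n
  have t: "t n \<noteq> 0" "cmod (t n) < d" for n
    using d(1) by (simp_all add: t_def norm_divide divide_less_eq del: of_real_divide) 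
  have dl: "(\<lambda>n. d / real (n + 2)) \<longlonglongrightarrow> 0" using LIMSEQ_ignore_initial_segment[OF lim_const_over_n[of d], of 2] by simp
  have "t \<longlonglongrightarrow> of_real 0" unfolding t_def[abs_def] by (rule tendsto_of_real[OF dl])
  hence tl: "t \<longlonglongrightarrow> 0" by simp
  have c: "coef i j (\<lambda>z. H (case_nat 0 z)) = coef i j (X9_poly a)" for i j
  proof (rule coef_cong)
    have "\<forall>\<^sub>F z in near_origin 2. H (case_nat 0 z) = add_squares 2 2 (X9_poly a) z" using H' by blast
    thus "\<forall>\<^sub>F z in near_origin 2. H (case_nat 0 z) = X9_poly a z"
      using add_squares_same[of 2 "X9_poly a"] by eventually_elim simp
  qed
  show False
  proof (rule X9_family_no_milnor_8[OF a, of "\<lambda>n z. H (case_nat (t n) z)"])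
    fix i j
    have "isCont (\<lambda>s. coef i j (\<lambda>z. H (case_nat s z))) 0" by (rule coef_slice_isCont) (use Hh in simp)
    from isCont_tendsto_compose[OF this tl]
    show "(\<lambda>n. coef i j (\<lambda>z. H (case_nat (t n) z))) \<longlonglongrightarrow> coef i j (X9_poly a)" by (simp add: c)
  next
    fix n i j :: nat
    assume ij: "i + j \<le> 1"
    note g = d(2)[OF t[of n]]
    have p: "partial_deriv 0 (\<lambda>z. H (case_nat (t n) z)) origin = 0" "partial_deriv (Suc 0) (\<lambda>z. H (case_nat (t n) z)) origin = 0"
      using g by (simp_all add: grad_zero_def)
    consider "i = 0" "j = 0" | "i = 1" "j = 0" | "i = 0" "j = 1" using ij by linarith
    thus "coef i j (\<lambda>z. H (case_nat (t n) z)) = 0"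
      by cases (use g p in \<open>simp_all add: coef_def\<close>)
  qed (use d(2) t in blast)+
qed

lemma no_X9_family:
  assumes a: "a\<^sup>2 \<noteq> 4" and "2 \<le> k" and "X9_family a k H"
  shows False
  using assms(2,3)
proof (induction k arbitrary: H rule: dec_induct)
  case base
  thus ?case using no_X9_family_2[OF a] by blast
next
  case (step k)
  thus ?case using X9_family_reduce by blast
qed

text \<open>A jump of 1 means Milnor number 8 for all small nonzero s. Stabilisation and a
  coordinate change that does not depend on s turn the deformation into an
  \<open>X9_family\<close>.\<close>

lemma type_X9_no_jump_1:
  assumes X9: "type_X9 n f" and D: "deformation n f F" and J: "has_jump n f F 1"
  shows False
proof (rule type_X9E[OF X9])
  fix a p \<phi> \<psi>
  assume a: "a\<^sup>2 \<noteq> 4" "2 \<le> p" "n \<le> p" and cc: "coord_change p \<phi> \<psi>"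
    and e: "\<forall>\<^sub>F z in near_origin p. add_squares 2 p (X9_poly a) z = add_squares n p f (cmap p \<phi> z)"
  have \<phi>: "cgerm p p \<phi>" using cc by (simp add: coord_change_def)
  hence \<phi>k: "holomorphic_germ p (\<phi> k)" "\<phi> k origin = 0" if "k < p" for k using that by (simp_all add: cgerm_def)
  define \<Phi> where "\<Phi> w = F (w 0) (\<lambda>i. w (Suc i))" for w
  have \<Phi>h: "holomorphic_germ (Suc n) \<Phi>" using D by (simp add: deformation_def \<Phi>_def[abs_def])
  have \<Phi>s: "(\<lambda>z. \<Phi> (case_nat s z)) = F s" for s by (simp add: \<Phi>_def)
  have Fh: "\<forall>\<^sub>F s in nhds 0. holomorphic_germ n (F s)" using hg_slice[OF \<Phi>h] by (simp add: \<Phi>s)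
  have F0: "\<forall>\<^sub>F z in near_origin n. F 0 z = f z" "\<forall>\<^sub>F s in nhds 0. F s origin = 0" using D by (simp_all add: deformation_def)
  have f: "holomorphic_germ n f" using X9 by (simp add: type_X9_def isolated_singularity_def)
  have m8: "\<forall>\<^sub>F s in at 0. milnor_number n (F s) = 8"
    using J unfolding has_jump_def type_X9_milnor[OF X9]
  proof eventually_elim
    case (elim s)
    thus ?case by (cases "milnor_number n (F s)") (simp_all add: numeral_eq_enat)
  qed
  have mn0: "\<forall>\<^sub>F s in nhds 0. milnor_number n (F s) \<noteq> 0"
    using m8[unfolded eventually_at_filter]
  proof eventually_elim
    case (elim s)
    have "milnor_number n (F 0) = 9" using milnor_cong[OF F0(1) f] type_X9_milnor[OF X9] by simp
    thus ?case using elim by (cases "s = 0") auto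
  qed
  \<comment> \<open>The coordinate change that brings the stabilised \<open>f\<close> into normal
    form, applied to every stabilised member of the family.\<close>
  define G where "G w = add_squares n p (F (w 0)) (cmap p \<phi> (\<lambda>i. w (Suc i)))" for w
  have Gs: "(\<lambda>z. G (case_nat s z)) = (\<lambda>z. add_squares n p (F s) (cmap p \<phi> z))" for s by (simp add: G_def)
  have Gh: "holomorphic_germ (Suc p) G"
  proof -
    define \<sigma> where "\<sigma> k = (case k of 0 \<Rightarrow> (\<lambda>w. w 0) | Suc j \<Rightarrow> (\<lambda>w. \<phi> j (\<lambda>i. w (Suc i))))" for k :: nat
    have \<sigma>: "cgerm (Suc p) (Suc n) \<sigma>"
      using a(3) hg_shift[OF \<phi>k(1) order_refl] \<phi>k(2)
      by (auto simp: cgerm_def \<sigma>_def hg_coord split: nat.split)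
    have e1: "G w = \<Phi> (cmap (Suc n) \<sigma> w) + (\<Sum>i\<in>{n..<p}. (\<phi> i (\<lambda>i. w (Suc i)))\<^sup>2)" for w
    proof -
      have "(\<lambda>i. cmap (Suc n) \<sigma> w (Suc i)) = pr n (cmap p \<phi> (\<lambda>i. w (Suc i)))"
        using a(3) by (auto simp: cmap_def pr_def \<sigma>_def fun_eq_iff)
      moreover have "cmap (Suc n) \<sigma> w 0 = w 0" by (simp add: cmap_def \<sigma>_def)
      moreover have "(\<Sum>i\<in>{n..<p}. (cmap p \<phi> (\<lambda>i. w (Suc i)) i)\<^sup>2) = (\<Sum>i\<in>{n..<p}. (\<phi> i (\<lambda>i. w (Suc i)))\<^sup>2)"
        by (intro sum.cong) (auto simp: cmap_def)
      ultimately show ?thesis by (simp add: G_def add_squares_pr \<Phi>_def)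
    qed
    show ?thesis unfolding e1[abs_def]
      by (intro hg_add hg_cmap[OF \<sigma> \<Phi>h] hg_sum hg_power hg_shift[OF \<phi>k(1) order_refl]) auto
  qed
  have Gm: "\<forall>\<^sub>F s in nhds 0. milnor_number p (\<lambda>z. G (case_nat s z)) = milnor_number n (F s)"
    using Fh
  proof eventually_elim
    case (elim s)
    have "milnor_number p (\<lambda>z. add_squares n p (F s) (cmap p \<phi> z)) = milnor_number p (add_squares n p (F s))"
      by (rule milnor_coord_change[OF cc hg_add_squares[OF elim], symmetric]) simp
    thus ?case using milnor_add_squares[OF elim a(3)] by (simp add: Gs)
  qed
  have "X9_family a p G"
    unfolding X9_family_def
  proof (intro conjI Gh)
    show "\<forall>\<^sub>F s in nhds 0. G (case_nat s origin) = 0"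
      using F0(2)
    proof eventually_elim
      case (elim s)
      have "pr n origin = origin" by (simp add: pr_def)
      thus ?case using elim fun_cong[OF Gs, of s origin] by (simp add: cmap_origin[OF \<phi>] add_squares_pr)
    qed
    show "\<forall>\<^sub>F s in nhds 0. grad_zero p (\<lambda>z. G (case_nat s z)) origin"
      using hg_slice[OF Gh] Gm mn0
    proof eventually_elim
      case (elim s)
      show ?case using milnor_number_zero[OF elim(1)] elim(2,3) by auto
    qed
    show "\<forall>\<^sub>F s in at 0. milnor_number p (\<lambda>z. G (case_nat s z)) = 8"
      using eventually_nhds_at[OF Gm] m8 by eventually_elim simp
    have c: "cgerm p n \<phi>" using \<phi> a(3) by (simp add: cgerm_def)
    show "\<forall>\<^sub>F z in near_origin p. G (case_nat 0 z) = add_squares 2 p (X9_poly a) z"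
      using eventually_cmap[OF c F0(1)] e
    proof eventually_elim
      case (elim z)
      have "cmap n \<phi> z = pr n (cmap p \<phi> z)" using a(3) by (auto simp: cmap_def pr_def fun_eq_iff)
      thus ?case using elim fun_cong[OF Gs, of 0 z] by (simp add: add_squares_pr)
    qed
  qed
  thus False by (rule no_X9_family[OF a(1,2)])
qed

text \<open>The value 2 is attained, 1 is impossible, and the definition admits only nonzero
  jumps.\<close>

theorem type_X9_milnor_jump:
  assumes "type_X9 n f"
  shows "milnor_jump n f = 2"
  unfolding milnor_jump_def
proof (rule antisym)
  show "Inf {enat k | k. k \<noteq> 0 \<and> (\<exists>F. deformation n f F \<and> has_jump n f F k)} \<le> 2"
    using type_X9_jump_2[OF assms] by (intro Inf_lower) (auto simp: numeral_eq_enat intro!: exI[of _ 2])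
  show "2 \<le> Inf {enat k | k. k \<noteq> 0 \<and> (\<exists>F. deformation n f F \<and> has_jump n f F k)}"
  proof (rule Inf_greatest)
    fix x assume "x \<in> {enat k | k. k \<noteq> 0 \<and> (\<exists>F. deformation n f F \<and> has_jump n f F k)}"
    then obtain k F where k: "x = enat k" "k \<noteq> 0" "deformation n f F" "has_jump n f F k" by blast
    have "k \<noteq> 1" using type_X9_no_jump_1[OF assms k(3)] k(4) by blast
    thus "2 \<le> x" using k by (simp add: numeral_eq_enat)
  qed
qed

theorem theorem5:
  shows "(\<forall>a::complex. a\<^sup>2 \<noteq> 4 \<longrightarrow>
            isolated_singularity 2 (X9_poly a) \<and> milnor_jump 2 (X9_poly a) = 2) \<and>
         (\<forall>(n::nat) (f :: (nat \<Rightarrow> complex) \<Rightarrow> complex). type_X9 n f \<longrightarrow> milnor_jump n f = 2)"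
  using type_X9_milnor_jump type_X9_X9_poly isolated_singularity_X9 by blast

end
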